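(* Let $K=K_vK^v\subset G(\mathbb{A}^\infty)$ be a fine open compact subgroup with $K_v=G(A_v)$. Suppose $a\in A$ with $v(a)=1$. (1) For any integer $1\le h\le r$, the closed subscheme $V(H^a_1,\dots,H^a_{h-1})$ of $\overline{\mathcal{M}}^r_K$ is independent of the choice of $a$ (satisfying $v(a)=1$). (2) For any point $x$ in $\overline{\mathcal{M}}^r_K$, the Drinfeld $A$-module $\overline\varphi_{K,x}$ over the point $x$ has height $\ge h$ if and only if $x\in V(H^a_1,\dots,H^a_{h-1})$.
   Context: **Base.** $F$ is a global function field with field of constants $\mathbb{F}_q$, the function field of a geometrically connected smooth projective curve $\mathcal{C}$ over $\mathbb{F}_q$; $\infty$ is a fixed closed point; $A=\Gamma(\mathcal{C}\setminus\{\infty\},\mathcal{O}_{\mathcal{C}})$; $\deg(a)=\dim_{\mathbb{F}_q}A/(a)$ for $0\ne a\in A$; $\widehat A$ is the profinite completion of $A$ and $\mathbb{A}^\infty=\widehat A\otimes_AF$; $r\ge1$, $G=\mathrm{GL}_r$. For an $A$-scheme $S$, $\gamma:A\to\Gamma(S,\mathcal{O}_S)$ denotes the structure map; an $A$-field is a field $L$ with a ring homomorphism $\gamma:A\to L$. **Drinfeld modules.** A Drinfeld $A$-module over an $A$-field $L$ is a ring homomorphism $\varphi:A\to L\{\tau\}$, $a\mapsto\varphi_a=\sum_i\varphi_{a,i}\tau^i$ (where $\tau c=c^q\tau$) with $\varphi_{a,0}=\gamma(a)$ and not factoring through $L$; its rank is the integer $r\ge1$ such that $\varphi_{a,i}=0$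 for $i>r\deg(a)$ and $\varphi_{a,r\deg(a)}\neq0$ for all $a\ne0$. A line bundle $E$ over $S$ is a commutative group scheme with $\mathbb{G}_m$-action, Zariski locally isomorphic to $\mathbb{G}_{a,S}$. A generalized Drinfeld $A$-module over $S$ is a pair $(E,\varphi)$ with a line bundle $E$ and a ring homomorphism $\varphi$ from $A$ to the endomorphism ring of the commutative group scheme $E$, $\varphi_a=\sum_{i\ge0}\varphi_{a,i}\tau^i$ (locally finite, $\varphi_{a,i}\in\Gamma(S,E^{\otimes(1-q^i)})$, $\tau^i:E\to E^{\otimes q^i}$, $x\mapsto x^{q^i}$), such that $\varphi_{a,0}=\gamma(a)$ and the fiber at every point $s\in S$ is a Drinfeld $A$-module of some rank $r_s\ge1$. It is of rank $\le r$ if $\varphi_{a,i}=0$ for all $i>r\deg(a)$; it is a Drinfeld $A$-module of rank $r$ if in addition $r_s=r$ for all $s$. It is weakly separating if for any Drinfeld $A$-module over any $A$-field $L$ at most finitely many fibers of $(E,\varphi)$ over $L$-valued points of $S$ are isomorphic to it. $v$ is a finite place of $F$ with prime ideal $\mathfrak{p}\subset A$, $\mathbb{F}_v=A/\mathfrak{p}$, $\deg(v)=[\mathbb{F}_v:\mathbb{F}_q]$. For a Drinfeld $A$-module $\varphi$ of rank $\rho$ over an $\mathbb{F}_v$-field $L$, the $v$-rank is the integer $j$ with $\varphi[\mathfrak{p}](\overline L)\simeq(\mathfrak{p}^{-1}/A)^j$, where $\varphi[\mathfrak{p}]=\bigcap_{a\in\mathfrak{p}}\ker\varphi_a$, and the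 height is $\rho-j$. **Moduli.** $A_{(v)}$ is the localization and $A_v$ the completion of $A$ at $v$; $\widehat A^{(v)}=\prod_{v'\ne v,\infty}A_{v'}$; $\mathbb{A}^{\infty v}$ is the ring of adeles away from $\infty,v$. An open compact subgroup of $G(\widehat A)$ is fine if for some prime ideal $\mathfrak{q}\subset A$ its image in $\mathrm{GL}_r(A/\mathfrak{q})$ is unipotent; an open compact subgroup of $G(\mathbb{A}^\infty)$ is fine if it is conjugate to a fine subgroup of $G(\widehat A)$. For a Drinfeld module $\varphi$ over an $A_{(v)}$-field $L$ put $T^{(v)}(\varphi)=\mathrm{Hom}_A(\mathbb{A}^{\infty v}/\widehat A^{(v)},\varphi(L^{\rm sep}))$, $V^{(v)}(\varphi)=\mathbb{A}^{\infty v}\otimes_{\widehat A^{(v)}}T^{(v)}(\varphi)$. A level-$K^v$ structure on a Drinfeld module $(E,\varphi)$ of rank $r$ over a connected locally Noetherian $A_{(v)}$-scheme $S$ is a $\pi_1(S,\bar s)$-invariant $K^v$-orbit $\bar\eta=\eta K^v$ of isomorphisms $\eta:(\mathbb{A}^{\infty v})^r\to V^{(v)}(\varphi_{\bar s})$. An isogeny $\alpha:(E_1,\varphi_1)\to(E_2,\varphi_2)$ is prime-to-$v$ if $\ker\alpha\subset\ker\varphi_{1,a}$ for some $a\in A\setminus\mathfrak{p}$. For fine $K=K_vK^v$, $\mathbf{M}^r_K$ is the affine smooth $A_{(v)}$-scheme representing triples $(E,\varphi,\bar\eta)$ modulo prime-to-$v$ isogenies respecting level structures; $(E_K,\varphi_K)$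 is its universal family. $\mathbf{M}^r_K\hookrightarrow\overline{\mathbf{M}}^r_K$ is the Satake compactification: the (unique) dominant open immersion over $A_{(v)}$ into a normal integral scheme, proper and flat over $A_{(v)}$, such that $(E_K,\varphi_K)$ extends to a weakly separating generalized Drinfeld $A$-module $(\overline E_K,\overline\varphi_K)$ (of rank $\le r$) over $\overline{\mathbf{M}}^r_K$. Put $\omega_K=\mathrm{Lie}(\overline E_K)^\vee$ and $\overline{\mathcal{M}}^r_K=\overline{\mathbf{M}}^r_K\otimes_{A_{(v)}}\mathbb{F}_v$. **Hasse invariants.** For $a\in\mathfrak{p}$ with $v(a)=1$ write $\overline\varphi_{K,a}=\sum_{i=0}^{r\deg a}\overline\varphi_{K,a,i}\tau^i$ and put $H^a_i=\overline\varphi_{K,a,\,i\deg(v)}\in H^0(\overline{\mathbf{M}}^r_K,\omega_K^{\otimes(q^{i\deg(v)}-1)})$ for $0\le i\le r-1$. $V(H^a_1,\dots,H^a_{h-1})$ is the closed subscheme of $\overline{\mathcal{M}}^r_K$ with ideal sheaf $\sum_{i=1}^{h-1}H^a_i\cdot\omega_K^{\otimes(1-q^{i\deg(v)})}$. *)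

theory Defs
  imports "HOL-Algebra.Algebra" "HOL-Analysis.Abstract_Topology"
begin

no_notation var (\<open>X\<index>\<close>)    \<comment> \<open>frees \<open>X\<close> for use as a variable\<close>

section \<open>The base: a global function field with two places\<close>

text \<open>The curve is given by its function field; its closed points are the places, i.e. the
  proper valuation rings of \<open>F\<close> containing the constant field.\<close>

record 'f base =
  ffield :: "'f ring"
  constf :: "'f set"
  inft :: "'f set"    \<comment> \<open>valuation ring of the place infinity\<close>
  vpl :: "'f set"     \<comment> \<open>valuation ring of the finite place v\<close>

definition global_function_field :: "'f ring \<Rightarrow> 'f set \<Rightarrow> bool" where
  "global_function_field F k \<longleftrightarrow>
     field F \<and> subfield k F \<and> finite k \<and>
     (\<exists>x\<in>carrier F. (ring.transcendental F over k) x \<and>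
        ring.finite_dimension F (generate_field F (insert x k)) (carrier F)) \<and>
     (\<forall>x\<in>carrier F. (ring.algebraic F over k) x \<longrightarrow> x \<in> k)"

definition place :: "'f ring \<Rightarrow> 'f set \<Rightarrow> 'f set \<Rightarrow> bool" where
  "place F k Ow \<longleftrightarrow> subring Ow F \<and> k \<subseteq> Ow \<and> Ow \<noteq> carrier F \<and>
     (\<forall>x\<in>carrier F - {\<zero>\<^bsub>F\<^esub>}. x \<in> Ow \<or> inv\<^bsub>F\<^esub> x \<in> Ow)"

definition place_ideal :: "'f ring \<Rightarrow> 'f set \<Rightarrow> 'f set" where
  "place_ideal F Ow = {x \<in> Ow. x = \<zero>\<^bsub>F\<^esub> \<or> inv\<^bsub>F\<^esub> x \<notin> Ow}"

definition uniformizer :: "'f ring \<Rightarrow> 'f set \<Rightarrow> 'f \<Rightarrow> bool" where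
  "uniformizer F Ow t \<longleftrightarrow> t \<in> Ow \<and> place_ideal F Ow = PIdl\<^bsub>F\<lparr>carrier := Ow\<rparr>\<^esub> t"

text \<open>\<open>has_valuation F Ow a n\<close>: the normalized valuation of \<open>a\<close> at the place \<open>Ow\<close> is \<open>n\<close>.\<close>

definition has_valuation :: "'f ring \<Rightarrow> 'f set \<Rightarrow> 'f \<Rightarrow> int \<Rightarrow> bool" where
  "has_valuation F Ow a n \<longleftrightarrow>
     (\<exists>t u. uniformizer F Ow t \<and> u \<in> Ow \<and> u \<noteq> \<zero>\<^bsub>F\<^esub> \<and> inv\<^bsub>F\<^esub> u \<in> Ow \<and>
        a = u \<otimes>\<^bsub>F\<^esub> (t [^]\<^bsub>F\<^esub> n))"

definition is_base :: "'f base \<Rightarrow> bool" where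
  "is_base B \<longleftrightarrow> global_function_field (ffield B) (constf B) \<and>
     place (ffield B) (constf B) (inft B) \<and> place (ffield B) (constf B) (vpl B) \<and>
     vpl B \<noteq> inft B"

definition qB :: "'f base \<Rightarrow> nat" where
  "qB B = card (constf B)"

definition regular_away :: "'f base \<Rightarrow> 'f set set \<Rightarrow> 'f set" where
  "regular_away B S =
     {x \<in> carrier (ffield B). \<forall>Ow. place (ffield B) (constf B) Ow \<and> Ow \<notin> S \<longrightarrow> x \<in> Ow}"

definition AA :: "'f base \<Rightarrow> 'f set" where
  "AA B = regular_away B {inft B}"

definition Aring :: "'f base \<Rightarrow> 'f ring" where
  "Aring B = (ffield B)\<lparr>carrier := AA B\<rparr>"

definition vprime :: "'f base \<Rightarrow> 'f set" where
  "vprime B = AA B \<inter> place_ideal (ffield B) (vpl B)"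

definition Fv :: "'f base \<Rightarrow> 'f set ring" where
  "Fv B = Aring B Quot vprime B"

definition Aloc :: "'f base \<Rightarrow> 'f ring" where
  "Aloc B = (ffield B)\<lparr>carrier :=
     {b \<otimes>\<^bsub>ffield B\<^esub> inv\<^bsub>ffield B\<^esub> c | b c. b \<in> AA B \<and> c \<in> AA B - vprime B}\<rparr>"

definition Aloc_residue :: "'f base \<Rightarrow> 'f \<Rightarrow> 'f set" where
  "Aloc_residue B x = (THE y. y \<in> carrier (Fv B) \<and>
     (\<exists>b\<in>AA B. \<exists>c\<in>AA B - vprime B. x = b \<otimes>\<^bsub>ffield B\<^esub> inv\<^bsub>ffield B\<^esub> c \<and>
        y \<otimes>\<^bsub>Fv B\<^esub> (vprime B +>\<^bsub>Aring B\<^esub> c) = vprime B +>\<^bsub>Aring B\<^esub> b))"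

text \<open>The dimension of \<open>A/I\<close> over the constant field.\<close>

definition ideal_deg :: "'f base \<Rightarrow> 'f set \<Rightarrow> nat" where
  "ideal_deg B I = ring.dim (Aring B Quot I)
     ((\<lambda>c. I +>\<^bsub>Aring B\<^esub> c) ` constf B) (carrier (Aring B Quot I))"

definition degA :: "'f base \<Rightarrow> 'f \<Rightarrow> nat" where
  "degA B a = ideal_deg B (PIdl\<^bsub>Aring B\<^esub> a)"

definition deg_v :: "'f base \<Rightarrow> nat" where
  "deg_v B = ideal_deg B (vprime B)"

section \<open>Modules\<close>

text \<open>The record \<open>module\<close> extends \<open>ring\<close>; its fields \<open>mult\<close> and \<open>one\<close> are irrelevant.\<close>

definition mod_hom :: "('r, 'x) ring_scheme \<Rightarrow> ('r, 'm) module \<Rightarrow> ('r, 'n) module \<Rightarrow> ('m \<Rightarrow> 'n) set"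
  where
  "mod_hom R M N = {u \<in> carrier M \<rightarrow>\<^sub>E carrier N.
     (\<forall>x\<in>carrier M. \<forall>y\<in>carrier M. u (x \<oplus>\<^bsub>M\<^esub> y) = u x \<oplus>\<^bsub>N\<^esub> u y) \<and>
     (\<forall>a\<in>carrier R. \<forall>x\<in>carrier M. u (a \<odot>\<^bsub>M\<^esub> x) = a \<odot>\<^bsub>N\<^esub> u x)}"

definition mod_iso :: "('r, 'x) ring_scheme \<Rightarrow> ('r, 'm) module \<Rightarrow> ('r, 'n) module \<Rightarrow> ('m \<Rightarrow> 'n) set"
  where "mod_iso R M N = {u \<in> mod_hom R M N. bij_betw u (carrier M) (carrier N)}"

definition mod_power :: "('r, 'm) module \<Rightarrow> nat \<Rightarrow> ('r, nat \<Rightarrow> 'm) module" where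
  "mod_power M n = \<lparr>carrier = {..<n} \<rightarrow>\<^sub>E carrier M, monoid.mult = undefined, one = undefined,
     ring.zero = (\<lambda>i\<in>{..<n}. \<zero>\<^bsub>M\<^esub>), ring.add = (\<lambda>x y. \<lambda>i\<in>{..<n}. x i \<oplus>\<^bsub>M\<^esub> y i),
     smult = (\<lambda>a x. \<lambda>i\<in>{..<n}. a \<odot>\<^bsub>M\<^esub> x i)\<rparr>"

definition ring_as_module :: "'r ring \<Rightarrow> ('r, 'r) module" where
  "ring_as_module R = \<lparr>carrier = carrier R, monoid.mult = undefined, one = undefined,
     ring.zero = \<zero>\<^bsub>R\<^esub>, ring.add = ring.add R, smult = monoid.mult R\<rparr>"

text \<open>Extension of scalars \<open>C \<otimes>\<^sub>R N\<close> along a subring \<open>R \<subseteq> C\<close>, as formal sums (lists) of pure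
  tensors modulo the congruence generated by bilinearity and balancedness.\<close>

inductive tensor_eq ::
  "'c ring \<Rightarrow> 'c set \<Rightarrow> ('c, 'n) module \<Rightarrow> ('c \<times> 'n) list \<Rightarrow> ('c \<times> 'n) list \<Rightarrow> bool"
  for C R N where
  refl: "set xs \<subseteq> carrier C \<times> carrier N \<Longrightarrow> tensor_eq C R N xs xs"
| sym: "tensor_eq C R N xs ys \<Longrightarrow> tensor_eq C R N ys xs"
| trans: "tensor_eq C R N xs ys \<Longrightarrow> tensor_eq C R N ys zs \<Longrightarrow> tensor_eq C R N xs zs"
| app: "tensor_eq C R N xs ys \<Longrightarrow> tensor_eq C R N xs' ys' \<Longrightarrow> tensor_eq C R N (xs @ xs') (ys @ ys')"
| comm: "set xs \<subseteq> carrier C \<times> carrier N \<Longrightarrow> set ys \<subseteq> carrier C \<times> carrier N \<Longrightarrow>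
    tensor_eq C R N (xs @ ys) (ys @ xs)"
| zero: "n \<in> carrier N \<Longrightarrow> tensor_eq C R N [(\<zero>\<^bsub>C\<^esub>, n)] []"
| add_l: "c \<in> carrier C \<Longrightarrow> c' \<in> carrier C \<Longrightarrow> n \<in> carrier N \<Longrightarrow>
    tensor_eq C R N [(c \<oplus>\<^bsub>C\<^esub> c', n)] [(c, n), (c', n)]"
| add_r: "c \<in> carrier C \<Longrightarrow> n \<in> carrier N \<Longrightarrow> n' \<in> carrier N \<Longrightarrow>
    tensor_eq C R N [(c, n \<oplus>\<^bsub>N\<^esub> n')] [(c, n), (c, n')]"
| bal: "c \<in> carrier C \<Longrightarrow> z \<in> R \<Longrightarrow> n \<in> carrier N \<Longrightarrow>
    tensor_eq C R N [(c \<otimes>\<^bsub>C\<^esub> z, n)] [(c, z \<odot>\<^bsub>N\<^esub> n)]"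

definition tensor_cls :: "'c ring \<Rightarrow> 'c set \<Rightarrow> ('c, 'n) module \<Rightarrow> ('c \<times> 'n) list \<Rightarrow> ('c \<times> 'n) list set"
  where "tensor_cls C R N xs = {ys. tensor_eq C R N xs ys}"

definition ext_scalars :: "'c ring \<Rightarrow> 'c set \<Rightarrow> ('c, 'n) module \<Rightarrow> ('c, ('c \<times> 'n) list set) module" where
  "ext_scalars C R N =
    \<lparr>carrier = {tensor_cls C R N xs | xs. set xs \<subseteq> carrier C \<times> carrier N},
     monoid.mult = undefined, one = undefined,
     ring.zero = tensor_cls C R N [],
     ring.add = (\<lambda>z w. \<Union>xs\<in>z. \<Union>ys\<in>w. tensor_cls C R N (xs @ ys)),
     smult = (\<lambda>c z. \<Union>xs\<in>z. tensor_cls C R N (map (\<lambda>(d, n). (c \<otimes>\<^bsub>C\<^esub> d, n)) xs))\<rparr>"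

definition ext_scalars_map ::
  "'c ring \<Rightarrow> 'c set \<Rightarrow> ('c, 'n) module \<Rightarrow> ('n0 \<Rightarrow> 'n) \<Rightarrow> ('c \<times> 'n0) list set \<Rightarrow> ('c \<times> 'n) list set"
  where
  "ext_scalars_map C R N u z = (\<Union>xs\<in>z. tensor_cls C R N (map (\<lambda>(d, n). (d, u n)) xs))"

section \<open>Completions, finite adeles and level subgroups\<close>

text \<open>For a ring \<open>R\<close> of functions regular away from a finite set of places,
  \<open>completion F R\<close> is the completion of \<open>F\<close> for the topology with the nonzero ideals \<open>I\<close> of \<open>R\<close> as
  neighbourhoods of zero: an element is a compatible system of cosets in \<open>F/I\<close>. It contains the
  profinite completion \<open>lim R/I\<close> as \<open>completion_int F R\<close>. One obtains the finite adeles for \<open>R = A\<close>, the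
  adeles away from infinity and \<open>v\<close> (with the product of the \<open>A\<^sub>w\<close>, \<open>w \<noteq> v, \<infinity>\<close>, as integral part)
  for \<open>R\<close> = the functions regular away from infinity and \<open>v\<close>, and the local field at
  \<open>v\<close> with its valuation ring \<open>A\<^sub>v\<close> for \<open>R\<close> = the valuation ring of \<open>v\<close>.\<close>

definition nz_ideals :: "'f ring \<Rightarrow> 'f set \<Rightarrow> 'f set set" where
  "nz_ideals F R = {I. ideal I (F\<lparr>carrier := R\<rparr>) \<and> I \<noteq> {\<zero>\<^bsub>F\<^esub>}}"

definition completion :: "'f ring \<Rightarrow> 'f set \<Rightarrow> ('f set \<Rightarrow> 'f set) ring" where
  "completion F R =
    \<lparr>carrier = {x \<in> (\<Pi>\<^sub>E I\<in>nz_ideals F R. a_rcosets\<^bsub>F\<^esub> I).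
        \<forall>I\<in>nz_ideals F R. \<forall>J\<in>nz_ideals F R. I \<subseteq> J \<longrightarrow> x I \<subseteq> x J},
     monoid.mult = (\<lambda>x y. \<lambda>I\<in>nz_ideals F R. THE c. c \<in> a_rcosets\<^bsub>F\<^esub> I \<and>
        (\<exists>J\<in>nz_ideals F R. \<forall>s\<in>x J. \<forall>t\<in>y J. s \<otimes>\<^bsub>F\<^esub> t \<in> c)),
     one = (\<lambda>I\<in>nz_ideals F R. I +>\<^bsub>F\<^esub> \<one>\<^bsub>F\<^esub>),
     ring.zero = (\<lambda>I\<in>nz_ideals F R. I),
     ring.add = (\<lambda>x y. \<lambda>I\<in>nz_ideals F R. x I <+>\<^bsub>F\<^esub> y I)\<rparr>"

definition completion_int :: "'f ring \<Rightarrow> 'f set \<Rightarrow> ('f set \<Rightarrow> 'f set) ring" where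
  "completion_int F R = (completion F R)\<lparr>carrier := {x \<in> carrier (completion F R). x R = R}\<rparr>"

definition completion_map :: "'f ring \<Rightarrow> 'f set \<Rightarrow> 'f set \<Rightarrow> ('f set \<Rightarrow> 'f set) \<Rightarrow> ('f set \<Rightarrow> 'f set)"
  where
  "completion_map F R R' x = (\<lambda>J\<in>nz_ideals F R'. THE c. c \<in> a_rcosets\<^bsub>F\<^esub> J \<and> x (J \<inter> R) \<subseteq> c)"

definition adeles :: "'f base \<Rightarrow> ('f set \<Rightarrow> 'f set) ring" where
  "adeles B = completion (ffield B) (AA B)"

definition Ahat :: "'f base \<Rightarrow> ('f set \<Rightarrow> 'f set) ring" where
  "Ahat B = completion_int (ffield B) (AA B)"

definition AAv :: "'f base \<Rightarrow> 'f set" where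
  "AAv B = regular_away B {inft B, vpl B}"

definition adeles_v :: "'f base \<Rightarrow> ('f set \<Rightarrow> 'f set) ring" where
  "adeles_v B = completion (ffield B) (AAv B)"

definition Ahat_v :: "'f base \<Rightarrow> ('f set \<Rightarrow> 'f set) ring" where
  "Ahat_v B = completion_int (ffield B) (AAv B)"

type_synonym 'c mat = "nat \<times> nat \<Rightarrow> 'c"

definition mats :: "nat \<Rightarrow> 'c ring \<Rightarrow> 'c mat monoid" where
  "mats r R = \<lparr>carrier = {..<r} \<times> {..<r} \<rightarrow>\<^sub>E carrier R,
     monoid.mult = (\<lambda>g h. \<lambda>(i, j)\<in>{..<r} \<times> {..<r}. finsum R (\<lambda>k. g (i, k) \<otimes>\<^bsub>R\<^esub> h (k, j)) {..<r}),
     one = (\<lambda>(i, j)\<in>{..<r} \<times> {..<r}. if i = j then \<one>\<^bsub>R\<^esub> else \<zero>\<^bsub>R\<^esub>)\<rparr>"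

definition GLr :: "nat \<Rightarrow> 'c ring \<Rightarrow> 'c mat monoid" where
  "GLr r R = units_of (mats r R)"

definition mat_map :: "nat \<Rightarrow> ('c \<Rightarrow> 'd) \<Rightarrow> 'c mat \<Rightarrow> 'd mat" where
  "mat_map r f g = (\<lambda>ij\<in>{..<r} \<times> {..<r}. f (g ij))"

definition mat_vec :: "nat \<Rightarrow> 'c ring \<Rightarrow> 'c mat \<Rightarrow> (nat \<Rightarrow> 'c) \<Rightarrow> (nat \<Rightarrow> 'c)" where
  "mat_vec r R g x = (\<lambda>i\<in>{..<r}. finsum R (\<lambda>j. g (i, j) \<otimes>\<^bsub>R\<^esub> x j) {..<r})"

definition unipotent_mat :: "nat \<Rightarrow> 'c ring \<Rightarrow> 'c mat \<Rightarrow> bool" where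
  "unipotent_mat r R g \<longleftrightarrow>
     (\<exists>n::nat. (\<lambda>ij\<in>{..<r} \<times> {..<r}. g ij \<ominus>\<^bsub>R\<^esub> \<one>\<^bsub>mats r R\<^esub> ij) [^]\<^bsub>mats r R\<^esub> n
         = (\<lambda>ij\<in>{..<r} \<times> {..<r}. \<zero>\<^bsub>R\<^esub>))"

text \<open>The adelic topology on \<open>GL\<^sub>r\<close>: the coarsest one making the entries of \<open>g\<close> and \<open>g\<^sup>-\<^sup>1\<close> continuous.\<close>

definition GL_adelic_topology :: "'f base \<Rightarrow> nat \<Rightarrow> ('f set \<Rightarrow> 'f set) mat topology" where
  "GL_adelic_topology B r = topology_generated_by
     ({{g \<in> carrier (GLr r (adeles B)). g (i, j) I = c} | i j I c.
         i < r \<and> j < r \<and> I \<in> nz_ideals (ffield B) (AA B)} \<union>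
      {{g \<in> carrier (GLr r (adeles B)). (inv\<^bsub>GLr r (adeles B)\<^esub> g) (i, j) I = c} | i j I c.
         i < r \<and> j < r \<and> I \<in> nz_ideals (ffield B) (AA B)})"

definition open_compact_subgroup :: "'f base \<Rightarrow> nat \<Rightarrow> ('f set \<Rightarrow> 'f set) mat set \<Rightarrow> bool" where
  "open_compact_subgroup B r K \<longleftrightarrow> subgroup K (GLr r (adeles B)) \<and>
     openin (GL_adelic_topology B r) K \<and> compactin (GL_adelic_topology B r) K"

definition fine_integral :: "'f base \<Rightarrow> nat \<Rightarrow> ('f set \<Rightarrow> 'f set) mat set \<Rightarrow> bool" where
  "fine_integral B r K \<longleftrightarrow> open_compact_subgroup B r K \<and> K \<subseteq> carrier (GLr r (Ahat B)) \<and>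
     (\<exists>Q. primeideal Q (Aring B) \<and> Q \<noteq> {\<zero>\<^bsub>Aring B\<^esub>} \<and>
        (\<forall>g\<in>K. unipotent_mat r (Aring B Quot Q) (mat_map r (\<lambda>x. x Q) g)))"

definition fine :: "'f base \<Rightarrow> nat \<Rightarrow> ('f set \<Rightarrow> 'f set) mat set \<Rightarrow> bool" where
  "fine B r K \<longleftrightarrow> open_compact_subgroup B r K \<and>
     (\<exists>h\<in>carrier (GLr r (adeles B)). fine_integral B r
        ((\<lambda>g. h \<otimes>\<^bsub>GLr r (adeles B)\<^esub> g \<otimes>\<^bsub>GLr r (adeles B)\<^esub> inv\<^bsub>GLr r (adeles B)\<^esub> h) ` K))"

text \<open>\<open>K = K\<^sub>v K\<^sup>v\<close> with \<open>K\<^sub>v = GL\<^sub>r(A\<^sub>v)\<close>.\<close>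

definition hyperspecial_decomp ::
  "'f base \<Rightarrow> nat \<Rightarrow> ('f set \<Rightarrow> 'f set) mat set \<Rightarrow> ('f set \<Rightarrow> 'f set) mat set \<Rightarrow> bool" where
  "hyperspecial_decomp B r K Kv \<longleftrightarrow> subgroup Kv (GLr r (adeles_v B)) \<and>
     K = {g \<in> carrier (GLr r (adeles B)).
        mat_map r (completion_map (ffield B) (AA B) (vpl B)) g
          \<in> carrier (GLr r (completion_int (ffield B) (vpl B))) \<and>
        mat_map r (completion_map (ffield B) (AA B) (AAv B)) g \<in> Kv}"

section \<open>Drinfeld modules over fields\<close>

definition skew_poly :: "nat \<Rightarrow> 'l ring \<Rightarrow> (nat \<Rightarrow> 'l) ring" where
  "skew_poly q L =
    \<lparr>carrier = {f. (\<forall>i. f i \<in> carrier L) \<and> finite {i. f i \<noteq> \<zero>\<^bsub>L\<^esub>}},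
     monoid.mult = (\<lambda>f g k. finsum L (\<lambda>i. f i \<otimes>\<^bsub>L\<^esub> (g (k - i) [^]\<^bsub>L\<^esub> (q ^ i))) {..k}),
     one = (\<lambda>i. if i = 0 then \<one>\<^bsub>L\<^esub> else \<zero>\<^bsub>L\<^esub>),
     ring.zero = (\<lambda>i. \<zero>\<^bsub>L\<^esub>),
     ring.add = (\<lambda>f g i. f i \<oplus>\<^bsub>L\<^esub> g i)\<rparr>"

definition is_A_field :: "'f base \<Rightarrow> 'l ring \<Rightarrow> ('f \<Rightarrow> 'l) \<Rightarrow> bool" where
  "is_A_field B L \<gamma> \<longleftrightarrow> field L \<and> \<gamma> \<in> ring_hom (Aring B) L"

definition drinfeld_module :: "'f base \<Rightarrow> 'l ring \<Rightarrow> ('f \<Rightarrow> 'l) \<Rightarrow> ('f \<Rightarrow> nat \<Rightarrow> 'l) \<Rightarrow> bool" where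
  "drinfeld_module B L \<gamma> \<psi> \<longleftrightarrow> is_A_field B L \<gamma> \<and>
     \<psi> \<in> ring_hom (Aring B) (skew_poly (qB B) L) \<and>
     (\<forall>a\<in>AA B. \<psi> a 0 = \<gamma> a) \<and> (\<exists>a\<in>AA B. \<exists>i>0. \<psi> a i \<noteq> \<zero>\<^bsub>L\<^esub>)"

definition has_rank :: "'f base \<Rightarrow> 'l ring \<Rightarrow> ('f \<Rightarrow> nat \<Rightarrow> 'l) \<Rightarrow> nat \<Rightarrow> bool" where
  "has_rank B L \<psi> r \<longleftrightarrow> r \<ge> 1 \<and>
     (\<forall>a\<in>AA B - {\<zero>\<^bsub>ffield B\<^esub>}. (\<forall>i>r * degA B a. \<psi> a i = \<zero>\<^bsub>L\<^esub>) \<and> \<psi> a (r * degA B a) \<noteq> \<zero>\<^bsub>L\<^esub>)"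

definition rank_of :: "'f base \<Rightarrow> 'l ring \<Rightarrow> ('f \<Rightarrow> nat \<Rightarrow> 'l) \<Rightarrow> nat" where
  "rank_of B L \<psi> = (THE r. has_rank B L \<psi> r)"

text \<open>An isomorphism is a unit \<open>u\<close> of \<open>L\<close> with \<open>u \<psi>\<^sub>a = \<psi>'\<^sub>a u\<close>.\<close>

definition drinfeld_isomorphic ::
  "'f base \<Rightarrow> 'l ring \<Rightarrow> ('f \<Rightarrow> nat \<Rightarrow> 'l) \<Rightarrow> ('f \<Rightarrow> nat \<Rightarrow> 'l) \<Rightarrow> bool" where
  "drinfeld_isomorphic B L \<psi> \<psi>' \<longleftrightarrow> (\<exists>u\<in>carrier L - {\<zero>\<^bsub>L\<^esub>}. \<forall>a\<in>AA B. \<forall>i.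
     u \<otimes>\<^bsub>L\<^esub> \<psi> a i = \<psi>' a i \<otimes>\<^bsub>L\<^esub> (u [^]\<^bsub>L\<^esub> (qB B ^ i)))"

definition closure_action :: "'f base \<Rightarrow> 'l ring \<Rightarrow> ('f \<Rightarrow> nat \<Rightarrow> 'l) \<Rightarrow> 'f \<Rightarrow>
    (('l list \<times> nat) multiset \<Rightarrow> 'l) \<Rightarrow> (('l list \<times> nat) multiset \<Rightarrow> 'l)" where
  "closure_action B L \<psi> a x = (let M = field.alg_closure L in
     finsum M (\<lambda>i. ring.indexed_const L (\<psi> a i) \<otimes>\<^bsub>M\<^esub> (x [^]\<^bsub>M\<^esub> (qB B ^ i))) {i. \<psi> a i \<noteq> \<zero>\<^bsub>L\<^esub>})"

definition v_torsion :: "'f base \<Rightarrow> 'l ring \<Rightarrow> ('f \<Rightarrow> nat \<Rightarrow> 'l) \<Rightarrow>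
    ('f, ('l list \<times> nat) multiset \<Rightarrow> 'l) module" where
  "v_torsion B L \<psi> = (let M = field.alg_closure L in
    \<lparr>carrier = {x \<in> carrier M. \<forall>a\<in>vprime B. closure_action B L \<psi> a x = \<zero>\<^bsub>M\<^esub>},
     monoid.mult = undefined, one = undefined, ring.zero = \<zero>\<^bsub>M\<^esub>, ring.add = ring.add M,
     smult = closure_action B L \<psi>\<rparr>)"

text \<open>The \<open>A\<close>-module \<open>\<pp>\<^sup>-\<^sup>1/A\<close>, with cosets of \<open>A\<close> as elements.\<close>

definition inv_prime_quot :: "'f base \<Rightarrow> ('f, 'f set) module" where
  "inv_prime_quot B = (let F = ffield B in
    \<lparr>carrier = {AA B +>\<^bsub>F\<^esub> x | x. x \<in> carrier F \<and> (\<forall>b\<in>vprime B. x \<otimes>\<^bsub>F\<^esub> b \<in> AA B)},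
     monoid.mult = undefined, one = undefined, ring.zero = AA B, ring.add = (\<lambda>c d. c <+>\<^bsub>F\<^esub> d),
     smult = (\<lambda>a c. \<Union>x\<in>c. AA B +>\<^bsub>F\<^esub> (a \<otimes>\<^bsub>F\<^esub> x))\<rparr>)"

definition v_rank :: "'f base \<Rightarrow> 'l ring \<Rightarrow> ('f \<Rightarrow> nat \<Rightarrow> 'l) \<Rightarrow> nat" where
  "v_rank B L \<psi> =
     (THE j. mod_iso (Aring B) (v_torsion B L \<psi>) (mod_power (inv_prime_quot B) j) \<noteq> {})"

definition height :: "'f base \<Rightarrow> 'l ring \<Rightarrow> ('f \<Rightarrow> nat \<Rightarrow> 'l) \<Rightarrow> int" where
  "height B L \<psi> = int (rank_of B L \<psi>) - int (v_rank B L \<psi>)"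

section \<open>Schemes\<close>

record ('p, 'a) rspace =
  spc :: "'p topology"
  shf :: "'p set \<Rightarrow> 'a ring"
  res :: "'p set \<Rightarrow> 'p set \<Rightarrow> 'a \<Rightarrow> 'a"    \<comment> \<open>\<open>res X U V\<close> restricts from \<open>U\<close> to \<open>V\<close>\<close>

definition is_sheaf :: "'p topology \<Rightarrow> ('p set \<Rightarrow> 'c set) \<Rightarrow> ('p set \<Rightarrow> 'p set \<Rightarrow> 'c \<Rightarrow> 'c) \<Rightarrow> bool" where
  "is_sheaf X C \<rho> \<longleftrightarrow>
    (\<forall>U V. openin X U \<and> openin X V \<and> V \<subseteq> U \<longrightarrow> \<rho> U V \<in> C U \<rightarrow> C V) \<and>
    (\<forall>U. openin X U \<longrightarrow> (\<forall>s\<in>C U. \<rho> U U s = s)) \<and>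
    (\<forall>U V W. openin X U \<and> openin X V \<and> openin X W \<and> W \<subseteq> V \<and> V \<subseteq> U \<longrightarrow>
       (\<forall>s\<in>C U. \<rho> V W (\<rho> U V s) = \<rho> U W s)) \<and>
    (\<forall>\<U> s. (\<forall>U\<in>\<U>. openin X U \<and> s U \<in> C U) \<and>
       (\<forall>U\<in>\<U>. \<forall>V\<in>\<U>. \<rho> U (U \<inter> V) (s U) = \<rho> V (U \<inter> V) (s V)) \<longrightarrow>
       (\<exists>!t. t \<in> C (\<Union>\<U>) \<and> (\<forall>U\<in>\<U>. \<rho> (\<Union>\<U>) U t = s U)))"

definition ringed_space :: "('p, 'a) rspace \<Rightarrow> bool" where
  "ringed_space X \<longleftrightarrow> is_sheaf (spc X) (\<lambda>U. carrier (shf X U)) (res X) \<and>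
    (\<forall>U. openin (spc X) U \<longrightarrow> cring (shf X U)) \<and>
    (\<forall>U V. openin (spc X) U \<and> openin (spc X) V \<and> V \<subseteq> U \<longrightarrow> res X U V \<in> ring_hom (shf X U) (shf X V))"

abbreviation pts :: "('p, 'a) rspace \<Rightarrow> 'p set" where
  "pts X \<equiv> topspace (spc X)"

abbreviation glob :: "('p, 'a) rspace \<Rightarrow> 'a ring" where
  "glob X \<equiv> shf X (pts X)"

definition germ :: "('p, 'a) rspace \<Rightarrow> 'p \<Rightarrow> 'p set \<Rightarrow> 'a \<Rightarrow> ('p set \<times> 'a) set" where
  "germ X x U s = {(V, t). openin (spc X) V \<and> x \<in> V \<and> t \<in> carrier (shf X V) \<and>
     (\<exists>W. openin (spc X) W \<and> x \<in> W \<and> W \<subseteq> U \<inter> V \<and> res X U W s = res X V W t)}"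

definition stalk :: "('p, 'a) rspace \<Rightarrow> 'p \<Rightarrow> ('p set \<times> 'a) set ring" where
  "stalk X x =
    \<lparr>carrier = {germ X x U s | U s. openin (spc X) U \<and> x \<in> U \<and> s \<in> carrier (shf X U)},
     monoid.mult = (\<lambda>g h. \<Union>(U, s)\<in>g. \<Union>(V, t)\<in>h.
        germ X x (U \<inter> V) (res X U (U \<inter> V) s \<otimes>\<^bsub>shf X (U \<inter> V)\<^esub> res X V (U \<inter> V) t)),
     one = germ X x (pts X) \<one>\<^bsub>glob X\<^esub>,
     ring.zero = germ X x (pts X) \<zero>\<^bsub>glob X\<^esub>,
     ring.add = (\<lambda>g h. \<Union>(U, s)\<in>g. \<Union>(V, t)\<in>h.
        germ X x (U \<inter> V) (res X U (U \<inter> V) s \<oplus>\<^bsub>shf X (U \<inter> V)\<^esub> res X V (U \<inter> V) t))\<rparr>"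

definition local_ring :: "('r, 'x) ring_scheme \<Rightarrow> bool" where
  "local_ring R \<longleftrightarrow> cring R \<and> (\<exists>!I. maximalideal I R)"

definition max_ideal :: "('r, 'x) ring_scheme \<Rightarrow> 'r set" where
  "max_ideal R = (THE I. maximalideal I R)"

definition locally_ringed_space :: "('p, 'a) rspace \<Rightarrow> bool" where
  "locally_ringed_space X \<longleftrightarrow> ringed_space X \<and> (\<forall>x\<in>pts X. local_ring (stalk X x))"

definition residue_field :: "('p, 'a) rspace \<Rightarrow> 'p \<Rightarrow> ('p set \<times> 'a) set set ring" where
  "residue_field X x = stalk X x Quot max_ideal (stalk X x)"

text \<open>A morphism \<open>X \<rightarrow> Y\<close> is a pair of a map of points and a comorphism
  \<open>smap f V : \<O>\<^sub>Y(V) \<rightarrow> \<O>\<^sub>X(f\<^sup>-\<^sup>1 V)\<close>, both made extensional so that equality of morphisms is equality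
  in HOL.\<close>

record ('p, 'a, 'q, 'b) rmor =
  pmap :: "'p \<Rightarrow> 'q"
  smap :: "'q set \<Rightarrow> 'b \<Rightarrow> 'a"

definition preim :: "('p, 'a) rspace \<Rightarrow> ('p, 'a, 'q, 'b) rmor \<Rightarrow> 'q set \<Rightarrow> 'p set" where
  "preim X f V = {x \<in> pts X. pmap f x \<in> V}"

definition mor :: "('p, 'a) rspace \<Rightarrow> ('q, 'b) rspace \<Rightarrow> ('p, 'a, 'q, 'b) rmor set" where
  "mor X Y = {f. pmap f \<in> extensional (pts X) \<and> continuous_map (spc X) (spc Y) (pmap f) \<and>
     smap f \<in> extensional {V. openin (spc Y) V} \<and>
     (\<forall>V. openin (spc Y) V \<longrightarrow> smap f V \<in> extensional (carrier (shf Y V)) \<and>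
        smap f V \<in> ring_hom (shf Y V) (shf X (preim X f V))) \<and>
     (\<forall>V W. openin (spc Y) V \<and> openin (spc Y) W \<and> W \<subseteq> V \<longrightarrow> (\<forall>t\<in>carrier (shf Y V).
        smap f W (res Y V W t) = res X (preim X f V) (preim X f W) (smap f V t))) \<and>
     (\<forall>x\<in>pts X. \<forall>V. openin (spc Y) V \<and> pmap f x \<in> V \<longrightarrow> (\<forall>t\<in>carrier (shf Y V).
        germ X x (preim X f V) (smap f V t) \<in> Units (stalk X x) \<longrightarrow>
        germ Y (pmap f x) V t \<in> Units (stalk Y (pmap f x))))}"

definition comp_mor :: "('p, 'a) rspace \<Rightarrow> ('q, 'b) rspace \<Rightarrow> ('s, 'c) rspace \<Rightarrow>
    ('q, 'b, 's, 'c) rmor \<Rightarrow> ('p, 'a, 'q, 'b) rmor \<Rightarrow> ('p, 'a, 's, 'c) rmor" where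
  "comp_mor X Y Z g f =
    \<lparr>pmap = (\<lambda>x\<in>pts X. pmap g (pmap f x)),
     smap = (\<lambda>W\<in>{W. openin (spc Z) W}. \<lambda>t\<in>carrier (shf Z W). smap f (preim Y g W) (smap g W t))\<rparr>"

definition id_mor :: "('p, 'a) rspace \<Rightarrow> ('p, 'a, 'p, 'a) rmor" where
  "id_mor X = \<lparr>pmap = (\<lambda>x\<in>pts X. x), smap = (\<lambda>V\<in>{V. openin (spc X) V}. \<lambda>t\<in>carrier (shf X V). t)\<rparr>"

definition open_immersion ::
  "('p, 'a) rspace \<Rightarrow> ('q, 'b) rspace \<Rightarrow> ('p, 'a, 'q, 'b) rmor \<Rightarrow> bool" where
  "open_immersion X Y f \<longleftrightarrow> f \<in> mor X Y \<and> openin (spc Y) (pmap f ` pts X) \<and>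
     homeomorphic_map (spc X) (subtopology (spc Y) (pmap f ` pts X)) (pmap f) \<and>
     (\<forall>V. openin (spc Y) V \<and> V \<subseteq> pmap f ` pts X \<longrightarrow>
        smap f V \<in> ring_iso (shf Y V) (shf X (preim X f V)))"

definition iso_mor :: "('p, 'a) rspace \<Rightarrow> ('q, 'b) rspace \<Rightarrow> ('p, 'a, 'q, 'b) rmor \<Rightarrow> bool" where
  "iso_mor X Y f \<longleftrightarrow> open_immersion X Y f \<and> pmap f ` pts X = pts Y"

definition open_sub :: "('p, 'a) rspace \<Rightarrow> 'p set \<Rightarrow> ('p, 'a) rspace" where
  "open_sub X U = X\<lparr>spc := subtopology (spc X) U\<rparr>"

subsection \<open>Spectra\<close>

definition frac :: "'a ring \<Rightarrow> 'a set \<Rightarrow> 'a \<Rightarrow> 'a \<Rightarrow> ('a \<times> 'a) set" where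
  "frac R P a s = {(b, t). b \<in> carrier R \<and> t \<in> carrier R - P \<and>
     (\<exists>u\<in>carrier R - P. u \<otimes>\<^bsub>R\<^esub> (a \<otimes>\<^bsub>R\<^esub> t) = u \<otimes>\<^bsub>R\<^esub> (b \<otimes>\<^bsub>R\<^esub> s))}"

definition loc_add :: "'a ring \<Rightarrow> 'a set \<Rightarrow> ('a \<times> 'a) set \<Rightarrow> ('a \<times> 'a) set \<Rightarrow> ('a \<times> 'a) set" where
  "loc_add R P x y = (\<Union>(a, s)\<in>x. \<Union>(b, t)\<in>y.
     frac R P ((a \<otimes>\<^bsub>R\<^esub> t) \<oplus>\<^bsub>R\<^esub> (b \<otimes>\<^bsub>R\<^esub> s)) (s \<otimes>\<^bsub>R\<^esub> t))"

definition loc_mult :: "'a ring \<Rightarrow> 'a set \<Rightarrow> ('a \<times> 'a) set \<Rightarrow> ('a \<times> 'a) set \<Rightarrow> ('a \<times> 'a) set" where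
  "loc_mult R P x y = (\<Union>(a, s)\<in>x. \<Union>(b, t)\<in>y. frac R P (a \<otimes>\<^bsub>R\<^esub> b) (s \<otimes>\<^bsub>R\<^esub> t))"

definition Spec :: "'a ring \<Rightarrow> ('a set, 'a set \<Rightarrow> ('a \<times> 'a) set) rspace" where
  "Spec R =
    \<lparr>spc = topology (\<lambda>U. \<exists>I\<subseteq>carrier R. U = {P. primeideal P R \<and> \<not> I \<subseteq> P}),
     shf = (\<lambda>U. \<lparr>
       carrier = {f \<in> extensional U. \<forall>P\<in>U. \<exists>V. (\<exists>I\<subseteq>carrier R. V = {P. primeideal P R \<and> \<not> I \<subseteq> P}) \<and>
          P \<in> V \<and> V \<subseteq> U \<and> (\<exists>a\<in>carrier R. \<exists>s\<in>carrier R. \<forall>Q\<in>V. s \<notin> Q \<and> f Q = frac R Q a s)},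
       monoid.mult = (\<lambda>f g. \<lambda>P\<in>U. loc_mult R P (f P) (g P)),
       one = (\<lambda>P\<in>U. frac R P \<one>\<^bsub>R\<^esub> \<one>\<^bsub>R\<^esub>),
       ring.zero = (\<lambda>P\<in>U. frac R P \<zero>\<^bsub>R\<^esub> \<one>\<^bsub>R\<^esub>),
       ring.add = (\<lambda>f g. \<lambda>P\<in>U. loc_add R P (f P) (g P))\<rparr>),
     res = (\<lambda>U V f. restrict f V)\<rparr>"

text \<open>The spectrum of a field, on the one-point space; \<open>L\<close>-valued points are morphisms out of it.\<close>

definition field_spec :: "'l ring \<Rightarrow> (unit, 'l) rspace" where
  "field_spec L =
    \<lparr>spc = discrete_topology UNIV,
     shf = (\<lambda>U. if U = UNIV then L else L\<lparr>carrier := {\<zero>\<^bsub>L\<^esub>}, one := \<zero>\<^bsub>L\<^esub>\<rparr>),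
     res = (\<lambda>U V s. if V = UNIV then s else \<zero>\<^bsub>L\<^esub>)\<rparr>"

definition residue_point :: "('p, 'a) rspace \<Rightarrow> 'p \<Rightarrow> (unit, ('p set \<times> 'a) set set, 'p, 'a) rmor" where
  "residue_point X x =
    \<lparr>pmap = (\<lambda>_. x),
     smap = (\<lambda>V\<in>{V. openin (spc X) V}. \<lambda>t\<in>carrier (shf X V).
       if x \<in> V then max_ideal (stalk X x) +>\<^bsub>stalk X x\<^esub> germ X x V t
       else \<zero>\<^bsub>residue_field X x\<^esub>)\<rparr>"

definition affine :: "('p, 'a) rspace \<Rightarrow> bool" where
  "affine X \<longleftrightarrow> locally_ringed_space X \<and> (\<exists>f. iso_mor X (Spec (glob X)) f)"

definition affine_open :: "('p, 'a) rspace \<Rightarrow> 'p set \<Rightarrow> bool" where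
  "affine_open X U \<longleftrightarrow> openin (spc X) U \<and> affine (open_sub X U)"

definition scheme :: "('p, 'a) rspace \<Rightarrow> bool" where
  "scheme X \<longleftrightarrow> locally_ringed_space X \<and> (\<forall>x\<in>pts X. \<exists>U. x \<in> U \<and> affine_open X U)"

subsection \<open>Schemes over a ring\<close>

text \<open>A scheme over \<open>R\<close> is a scheme \<open>X\<close> with a structure map \<open>g : R \<rightarrow> \<Gamma>(X, \<O>\<^sub>X)\<close>.

  The type variables \<open>'p\<close> and \<open>'a\<close> act as a universe: whenever a definition
  quantifies over all (test) schemes, these have the same types as the given scheme.\<close>

definition scheme_over :: "'r ring \<Rightarrow> ('p, 'a) rspace \<Rightarrow> ('r \<Rightarrow> 'a) \<Rightarrow> bool" where
  "scheme_over R X g \<longleftrightarrow> scheme X \<and> g \<in> ring_hom R (glob X)"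

definition mor_over :: "'r ring \<Rightarrow> ('p, 'a) rspace \<Rightarrow> ('r \<Rightarrow> 'a) \<Rightarrow> ('q, 'b) rspace \<Rightarrow> ('r \<Rightarrow> 'b) \<Rightarrow>
    ('p, 'a, 'q, 'b) rmor set" where
  "mor_over R X g Y h = {f \<in> mor X Y. \<forall>c\<in>carrier R. smap f (pts Y) (h c) = g c}"

definition fibre_product :: "'r ring \<Rightarrow> ('p, 'a) rspace \<Rightarrow> ('r \<Rightarrow> 'a) \<Rightarrow> ('p, 'a) rspace \<Rightarrow> ('r \<Rightarrow> 'a) \<Rightarrow>
    ('p, 'a) rspace \<Rightarrow> ('r \<Rightarrow> 'a) \<Rightarrow> ('p, 'a, 'p, 'a) rmor \<Rightarrow> ('p, 'a, 'p, 'a) rmor \<Rightarrow> bool" where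
  "fibre_product R X g Y h P k p1 p2 \<longleftrightarrow> scheme_over R P k \<and>
     p1 \<in> mor_over R P k X g \<and> p2 \<in> mor_over R P k Y h \<and>
     (\<forall>T t f1 f2. scheme_over R (T :: ('p, 'a) rspace) t \<and>
        f1 \<in> mor_over R T t X g \<and> f2 \<in> mor_over R T t Y h \<longrightarrow>
        (\<exists>!u. u \<in> mor_over R T t P k \<and> comp_mor T P X p1 u = f1 \<and> comp_mor T P Y p2 u = f2))"

text \<open>\<open>X' = X \<otimes>\<^sub>R R'\<close> for a ring homomorphism \<open>\<pi> : R \<rightarrow> R'\<close>.\<close>

definition base_change :: "'r ring \<Rightarrow> 's ring \<Rightarrow> ('r \<Rightarrow> 's) \<Rightarrow> ('p, 'a) rspace \<Rightarrow> ('r \<Rightarrow> 'a) \<Rightarrow>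
    ('p, 'a) rspace \<Rightarrow> ('s \<Rightarrow> 'a) \<Rightarrow> ('p, 'a, 'p, 'a) rmor \<Rightarrow> bool" where
  "base_change R R' \<pi> X g X' g' j \<longleftrightarrow> scheme_over R' X' g' \<and> j \<in> mor_over R X' (g' \<circ> \<pi>) X g \<and>
     (\<forall>T t f. scheme_over R' (T :: ('p, 'a) rspace) t \<and> f \<in> mor_over R T (t \<circ> \<pi>) X g \<longrightarrow>
        (\<exists>!u. u \<in> mor_over R' T t X' g' \<and> comp_mor T X' X j u = f))"

definition separated_over :: "'r ring \<Rightarrow> ('p, 'a) rspace \<Rightarrow> ('r \<Rightarrow> 'a) \<Rightarrow> bool" where
  "separated_over R X g \<longleftrightarrow> (\<forall>P k p1 p2 d. fibre_product R X g X g P k p1 p2 \<and>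
     d \<in> mor_over R X g P k \<and> comp_mor X P X p1 d = id_mor X \<and> comp_mor X P X p2 d = id_mor X \<longrightarrow>
     closedin (spc P) (pmap d ` pts X))"

definition locally_finite_type :: "'r ring \<Rightarrow> ('p, 'a) rspace \<Rightarrow> ('r \<Rightarrow> 'a) \<Rightarrow> bool" where
  "locally_finite_type R X g \<longleftrightarrow> (\<forall>x\<in>pts X. \<exists>U. x \<in> U \<and> affine_open X U \<and>
     (\<exists>G. finite G \<and> G \<subseteq> carrier (shf X U) \<and>
        carrier (shf X U) = generate_ring (shf X U) ((\<lambda>c. res X (pts X) U (g c)) ` carrier R \<union> G)))"

definition universally_closed :: "'r ring \<Rightarrow> ('p, 'a) rspace \<Rightarrow> ('r \<Rightarrow> 'a) \<Rightarrow> bool" where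
  "universally_closed R X g \<longleftrightarrow> (\<forall>T t P k p1 p2.
     scheme_over R T t \<and> fibre_product R X g T t P k p1 p2 \<longrightarrow>
     closed_map (spc P) (spc T) (pmap p2))"

definition proper_over :: "'r ring \<Rightarrow> ('p, 'a) rspace \<Rightarrow> ('r \<Rightarrow> 'a) \<Rightarrow> bool" where
  "proper_over R X g \<longleftrightarrow> separated_over R X g \<and> compact_space (spc X) \<and>
     locally_finite_type R X g \<and> universally_closed R X g"

text \<open>Flatness of the stalks through the equational criterion: every linear relation with
  coefficients in \<open>R\<close> is a consequence of relations in \<open>R\<close>.\<close>

definition flat_over :: "'r ring \<Rightarrow> ('p, 'a) rspace \<Rightarrow> ('r \<Rightarrow> 'a) \<Rightarrow> bool" where
  "flat_over R X g \<longleftrightarrow> (\<forall>x\<in>pts X. let S = stalk X x; h = (\<lambda>c. germ X x (pts X) (g c)) in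
     \<forall>(n::nat) c m. (\<forall>i<n. c i \<in> carrier R \<and> m i \<in> carrier S) \<and>
        finsum S (\<lambda>i. h (c i) \<otimes>\<^bsub>S\<^esub> m i) {..<n} = \<zero>\<^bsub>S\<^esub> \<longrightarrow>
        (\<exists>(l::nat) b y. (\<forall>j<l. y j \<in> carrier S \<and> (\<forall>i<n. b i j \<in> carrier R)) \<and>
           (\<forall>i<n. m i = finsum S (\<lambda>j. h (b i j) \<otimes>\<^bsub>S\<^esub> y j) {..<l}) \<and>
           (\<forall>j<l. finsum R (\<lambda>i. c i \<otimes>\<^bsub>R\<^esub> b i j) {..<n} = \<zero>\<^bsub>R\<^esub>)))"

definition integral_scheme :: "('p, 'a) rspace \<Rightarrow> bool" where
  "integral_scheme X \<longleftrightarrow> scheme X \<and> pts X \<noteq> {} \<and>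
     (\<forall>U. openin (spc X) U \<and> U \<noteq> {} \<longrightarrow> domain (shf X U))"

definition integrally_closed :: "'r ring \<Rightarrow> bool" where
  "integrally_closed R \<longleftrightarrow> domain R \<and>
     (\<forall>a\<in>carrier R. \<forall>b\<in>carrier R - {\<zero>\<^bsub>R\<^esub>}.
        (\<exists>(n::nat) c. (\<forall>i<n. c i \<in> carrier R) \<and>
           a [^]\<^bsub>R\<^esub> n = finsum R (\<lambda>i. c i \<otimes>\<^bsub>R\<^esub> (a [^]\<^bsub>R\<^esub> i) \<otimes>\<^bsub>R\<^esub> (b [^]\<^bsub>R\<^esub> (n - i))) {..<n}) \<longrightarrow>
        b divides\<^bsub>R\<^esub> a)"

definition normal_scheme :: "('p, 'a) rspace \<Rightarrow> bool" where
  "normal_scheme X \<longleftrightarrow> scheme X \<and> (\<forall>x\<in>pts X. integrally_closed (stalk X x))"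

definition locally_noetherian :: "('p, 'a) rspace \<Rightarrow> bool" where
  "locally_noetherian X \<longleftrightarrow> (\<forall>x\<in>pts X. \<exists>U. x \<in> U \<and> affine_open X U \<and> noetherian_ring (shf X U))"

definition square_zero_thickening ::
  "('p, 'a) rspace \<Rightarrow> ('p, 'a) rspace \<Rightarrow> ('p, 'a, 'p, 'a) rmor \<Rightarrow> bool" where
  "square_zero_thickening T0 T i \<longleftrightarrow> affine T0 \<and> affine T \<and> i \<in> mor T0 T \<and>
     smap i (pts T) ` carrier (glob T) = carrier (glob T0) \<and>
     (\<forall>x\<in>carrier (glob T). \<forall>y\<in>carrier (glob T).
        smap i (pts T) x = \<zero>\<^bsub>glob T0\<^esub> \<and> smap i (pts T) y = \<zero>\<^bsub>glob T0\<^esub> \<longrightarrow> x \<otimes>\<^bsub>glob T\<^esub> y = \<zero>\<^bsub>glob T\<^esub>)"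

text \<open>Smooth means formally smooth and locally of finite presentation; the latter is the same as
  locally of finite type since \<open>R\<close> will be noetherian.\<close>

definition smooth_over :: "'r ring \<Rightarrow> ('p, 'a) rspace \<Rightarrow> ('r \<Rightarrow> 'a) \<Rightarrow> bool" where
  "smooth_over R X g \<longleftrightarrow> locally_finite_type R X g \<and>
     (\<forall>(T :: ('p, 'a) rspace) t T0 i f0. square_zero_thickening T0 T i \<and> scheme_over R T t \<and>
        f0 \<in> mor_over R T0 (smap i (pts T) \<circ> t) X g \<longrightarrow>
        (\<exists>f\<in>mor_over R T t X g. comp_mor T0 T X f i = f0))"

text \<open>Finite etale (= finite, formally etale) morphisms to a locally noetherian scheme.\<close>

definition finite_etale :: "('p, 'a) rspace \<Rightarrow> ('p, 'a) rspace \<Rightarrow> ('p, 'a, 'p, 'a) rmor \<Rightarrow> bool" where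
  "finite_etale Y S h \<longleftrightarrow> scheme Y \<and> h \<in> mor Y S \<and>
     (\<forall>s\<in>pts S. \<exists>U. s \<in> U \<and> affine_open S U \<and> affine_open Y (preim Y h U) \<and>
        (\<exists>G. finite G \<and> G \<subseteq> carrier (shf Y (preim Y h U)) \<and>
           (\<forall>y\<in>carrier (shf Y (preim Y h U)). \<exists>c\<in>G \<rightarrow> carrier (shf S U).
              y = finsum (shf Y (preim Y h U)) (\<lambda>b. smap h U (c b) \<otimes>\<^bsub>shf Y (preim Y h U)\<^esub> b) G))) \<and>
     (\<forall>(T :: ('p, 'a) rspace) T0 i f g0. square_zero_thickening T0 T i \<and> f \<in> mor T S \<and> g0 \<in> mor T0 Y \<and>
        comp_mor T0 Y S h g0 = comp_mor T0 T S f i \<longrightarrow>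
        (\<exists>!g. g \<in> mor T Y \<and> comp_mor T Y S h g = f \<and> comp_mor T0 T Y g i = g0))"

subsection \<open>Closed subschemes\<close>

text \<open>The closed subscheme with ideal sheaf \<open>\<J>\<close>: sections are families in \<open>\<O>\<^sub>x/\<J>\<^sub>x\<close> that
  locally come from sections of \<open>\<O>\<^sub>X\<close>.\<close>

definition ideal_stalk :: "('p, 'a) rspace \<Rightarrow> ('p set \<Rightarrow> 'a set) \<Rightarrow> 'p \<Rightarrow> ('p set \<times> 'a) set set" where
  "ideal_stalk X \<J> x = {germ X x U s | U s. openin (spc X) U \<and> x \<in> U \<and> s \<in> \<J> U}"

definition closed_subscheme :: "('p, 'a) rspace \<Rightarrow> ('p set \<Rightarrow> 'a set) \<Rightarrow>
    ('p, 'p \<Rightarrow> ('p set \<times> 'a) set set) rspace" where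
  "closed_subscheme X \<J> = (let Z = {x \<in> pts X. ideal_stalk X \<J> x \<noteq> carrier (stalk X x)};
      Q = (\<lambda>x. stalk X x Quot ideal_stalk X \<J> x) in
    \<lparr>spc = subtopology (spc X) Z,
     shf = (\<lambda>W. \<lparr>
       carrier = {s \<in> extensional W. \<forall>x\<in>W. \<exists>U t. openin (spc X) U \<and> x \<in> U \<and> t \<in> carrier (shf X U) \<and>
          (\<forall>y\<in>U \<inter> W. s y = ideal_stalk X \<J> y +>\<^bsub>stalk X y\<^esub> germ X y U t)},
       monoid.mult = (\<lambda>s t. \<lambda>x\<in>W. s x \<otimes>\<^bsub>Q x\<^esub> t x),
       one = (\<lambda>x\<in>W. \<one>\<^bsub>Q x\<^esub>),
       ring.zero = (\<lambda>x\<in>W. \<zero>\<^bsub>Q x\<^esub>),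
       ring.add = (\<lambda>s t. \<lambda>x\<in>W. s x \<oplus>\<^bsub>Q x\<^esub> t x)\<rparr>),
     res = (\<lambda>U V s. restrict s V)\<rparr>)"

section \<open>Line bundles and generalized Drinfeld modules\<close>

text \<open>A line bundle is represented by its invertible sheaf of sections.\<close>

record ('p, 'a, 'm) lbundle =
  sec :: "'p set \<Rightarrow> ('a, 'm) module"
  mres :: "'p set \<Rightarrow> 'p set \<Rightarrow> 'm \<Rightarrow> 'm"

text \<open>The pairs of an open set and a generator of the bundle over it.\<close>

definition gens :: "('p, 'a) rspace \<Rightarrow> ('p, 'a, 'm) lbundle \<Rightarrow> ('p set \<times> 'm) set" where
  "gens X E = {(U, m). openin (spc X) U \<and> m \<in> carrier (sec E U) \<and>
     (\<forall>V. openin (spc X) V \<and> V \<subseteq> U \<longrightarrow>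
        bij_betw (\<lambda>c. c \<odot>\<^bsub>sec E V\<^esub> mres E U V m) (carrier (shf X V)) (carrier (sec E V)))}"

definition line_bundle :: "('p, 'a) rspace \<Rightarrow> ('p, 'a, 'm) lbundle \<Rightarrow> bool" where
  "line_bundle X E \<longleftrightarrow> is_sheaf (spc X) (\<lambda>U. carrier (sec E U)) (mres E) \<and>
     (\<forall>U. openin (spc X) U \<longrightarrow> module (shf X U) (sec E U)) \<and>
     (\<forall>U V. openin (spc X) U \<and> openin (spc X) V \<and> V \<subseteq> U \<longrightarrow>
        (\<forall>x\<in>carrier (sec E U). \<forall>y\<in>carrier (sec E U).
           mres E U V (x \<oplus>\<^bsub>sec E U\<^esub> y) = mres E U V x \<oplus>\<^bsub>sec E V\<^esub> mres E U V y) \<and>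
        (\<forall>c\<in>carrier (shf X U). \<forall>x\<in>carrier (sec E U).
           mres E U V (c \<odot>\<^bsub>sec E U\<^esub> x) = res X U V c \<odot>\<^bsub>sec E V\<^esub> mres E U V x)) \<and>
     (\<forall>x\<in>pts X. \<exists>(U, m)\<in>gens X E. x \<in> U)"

text \<open>A section \<open>c\<close> of \<open>E' \<otimes> E\<^sup>\<otimes>\<^sup>(\<^sup>-\<^sup>Q\<^sup>)\<close>, \<open>Q = q\<^sup>n\<close>, i.e. a homomorphism \<open>E\<^sup>\<otimes>\<^sup>Q \<rightarrow> E'\<close>, is the same as the
  \<open>Q\<close>-Frobenius-semilinear map \<open>x \<mapsto> c x\<^sup>Q\<close> from \<open>E\<close> to \<open>E'\<close>; it is represented by this map. So for
  \<open>E' = E\<close> the elements of \<open>twisted_maps\<close> are the global sections of \<open>E\<^sup>\<otimes>\<^sup>(\<^sup>1\<^sup>-\<^sup>Q\<^sup>)\<close>, composed with \<open>\<tau>\<^sup>n\<close>.\<close>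

definition twisted_maps :: "('p, 'a) rspace \<Rightarrow> nat \<Rightarrow> ('p, 'a, 'm) lbundle \<Rightarrow> ('p, 'a, 'm) lbundle \<Rightarrow>
    ('p set \<Rightarrow> 'm \<Rightarrow> 'm) set" where
  "twisted_maps X Q E E' = {f.
     (\<forall>U. openin (spc X) U \<longrightarrow> f U \<in> carrier (sec E U) \<rightarrow> carrier (sec E' U) \<and>
        (\<forall>x\<in>carrier (sec E U). \<forall>y\<in>carrier (sec E U).
           f U (x \<oplus>\<^bsub>sec E U\<^esub> y) = f U x \<oplus>\<^bsub>sec E' U\<^esub> f U y) \<and>
        (\<forall>c\<in>carrier (shf X U). \<forall>x\<in>carrier (sec E U).
           f U (c \<odot>\<^bsub>sec E U\<^esub> x) = (c [^]\<^bsub>shf X U\<^esub> Q) \<odot>\<^bsub>sec E' U\<^esub> f U x)) \<and>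
     (\<forall>U V. openin (spc X) U \<and> openin (spc X) V \<and> V \<subseteq> U \<longrightarrow>
        (\<forall>x\<in>carrier (sec E U). f V (mres E U V x) = mres E' U V (f U x)))}"

definition coef :: "('p, 'a) rspace \<Rightarrow> ('p, 'a, 'm) lbundle \<Rightarrow> 'p set \<Rightarrow> 'm \<Rightarrow> 'm \<Rightarrow> 'a" where
  "coef X E U m y = (THE c. c \<in> carrier (shf X U) \<and> y = c \<odot>\<^bsub>sec E U\<^esub> m)"

type_synonym ('f, 'p, 'm) action = "'f \<Rightarrow> nat \<Rightarrow> 'p set \<Rightarrow> 'm \<Rightarrow> 'm"

text \<open>The coordinate forms, with respect to the generators \<open>m\<close> near the image point, of the fibre of
  \<open>(E, \<phi>)\<close> over an \<open>L\<close>-valued point \<open>f\<close>.\<close>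

definition fibres :: "('p, 'a) rspace \<Rightarrow> ('p, 'a, 'm) lbundle \<Rightarrow> ('f, 'p, 'm) action \<Rightarrow>
    (unit, 'l, 'p, 'a) rmor \<Rightarrow> ('f \<Rightarrow> nat \<Rightarrow> 'l) set" where
  "fibres X E \<phi> f = {(\<lambda>a i. smap f U (coef X E U m (\<phi> a i U m))) | U m.
     (U, m) \<in> gens X E \<and> pmap f () \<in> U}"

definition locally_finite :: "('p, 'a) rspace \<Rightarrow> ('p, 'a, 'm) lbundle \<Rightarrow> ('p, 'a, 'm) lbundle \<Rightarrow>
    (nat \<Rightarrow> 'p set \<Rightarrow> 'm \<Rightarrow> 'm) \<Rightarrow> bool" where
  "locally_finite X E E' \<alpha> \<longleftrightarrow> (\<forall>x\<in>pts X. \<exists>U N. openin (spc X) U \<and> x \<in> U \<and>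
     (\<forall>i>N. \<forall>e\<in>carrier (sec E U). \<alpha> i U e = \<zero>\<^bsub>sec E' U\<^esub>))"

text \<open>In the following, \<open>\<gamma> : A \<rightarrow> \<Gamma>(X, \<O>\<^sub>X)\<close> is the structure map, and \<open>\<phi> a i\<close> is the semilinear map
  \<open>\<phi>\<^sub>a\<^sub>,\<^sub>i \<tau>\<^sup>i\<close>; composition of such maps is the multiplication in the endomorphism ring of the
  group scheme \<open>E\<close>.\<close>

definition gen_drinfeld :: "'f base \<Rightarrow> ('p, 'a) rspace \<Rightarrow> ('f \<Rightarrow> 'a) \<Rightarrow> ('p, 'a, 'm) lbundle \<Rightarrow> ('f, 'p, 'm) action \<Rightarrow> bool" where
  "gen_drinfeld B X \<gamma> E \<phi> \<longleftrightarrow> line_bundle X E \<and>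
     (\<forall>a\<in>AA B. (\<forall>i. \<phi> a i \<in> twisted_maps X (qB B ^ i) E E) \<and> locally_finite X E E (\<phi> a)) \<and>
     (\<forall>U. openin (spc X) U \<longrightarrow> (\<forall>e\<in>carrier (sec E U).
        (\<forall>a\<in>AA B. \<phi> a 0 U e = res X (pts X) U (\<gamma> a) \<odot>\<^bsub>sec E U\<^esub> e) \<and>
        (\<forall>i>0. \<phi> \<one>\<^bsub>Aring B\<^esub> i U e = \<zero>\<^bsub>sec E U\<^esub>) \<and>
        (\<forall>a\<in>AA B. \<forall>b\<in>AA B. \<forall>i.
           \<phi> (a \<oplus>\<^bsub>Aring B\<^esub> b) i U e = \<phi> a i U e \<oplus>\<^bsub>sec E U\<^esub> \<phi> b i U e) \<and>
        (\<forall>a\<in>AA B. \<forall>b\<in>AA B. \<forall>k.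
           \<phi> (a \<otimes>\<^bsub>Aring B\<^esub> b) k U e = finsum (sec E U) (\<lambda>i. \<phi> a i U (\<phi> b (k - i) U e)) {..k}))) \<and>
     (\<forall>x\<in>pts X. \<exists>\<rho>. \<forall>\<psi>\<in>fibres X E \<phi> (residue_point X x).
        drinfeld_module B (residue_field X x) (smap (residue_point X x) (pts X) \<circ> \<gamma>) \<psi> \<and>
        has_rank B (residue_field X x) \<psi> \<rho>)"

definition rank_le :: "'f base \<Rightarrow> nat \<Rightarrow> ('p, 'a) rspace \<Rightarrow> ('p, 'a, 'm) lbundle \<Rightarrow> ('f, 'p, 'm) action \<Rightarrow> bool" where
  "rank_le B r X E \<phi> \<longleftrightarrow> (\<forall>a\<in>AA B - {\<zero>\<^bsub>ffield B\<^esub>}. \<forall>i>r * degA B a. \<forall>U. openin (spc X) U \<longrightarrow>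
     (\<forall>e\<in>carrier (sec E U). \<phi> a i U e = \<zero>\<^bsub>sec E U\<^esub>))"

definition drinfeld_rank :: "'f base \<Rightarrow> nat \<Rightarrow> ('p, 'a) rspace \<Rightarrow> ('f \<Rightarrow> 'a) \<Rightarrow> ('p, 'a, 'm) lbundle \<Rightarrow> ('f, 'p, 'm) action \<Rightarrow> bool" where
  "drinfeld_rank B r X \<gamma> E \<phi> \<longleftrightarrow> gen_drinfeld B X \<gamma> E \<phi> \<and> rank_le B r X E \<phi> \<and>
     (\<forall>x\<in>pts X. \<forall>\<psi>\<in>fibres X E \<phi> (residue_point X x). has_rank B (residue_field X x) \<psi> r)"

definition weakly_separating :: "'f base \<Rightarrow> ('p, 'a) rspace \<Rightarrow> ('f \<Rightarrow> 'a) \<Rightarrow> ('p, 'a, 'm) lbundle \<Rightarrow> ('f, 'p, 'm) action \<Rightarrow> bool" where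
  "weakly_separating B X \<gamma> E \<phi> \<longleftrightarrow> (\<forall>(L :: 'a ring) \<gamma>L \<psi>0. drinfeld_module B L \<gamma>L \<psi>0 \<longrightarrow>
     finite {f \<in> mor_over (Aring B) (field_spec L) \<gamma>L X \<gamma>.
        \<exists>\<psi>\<in>fibres X E \<phi> f. drinfeld_isomorphic B L \<psi> \<psi>0})"

text \<open>\<open>u\<close> exhibits \<open>(E', \<phi>')\<close> as the pullback of \<open>(E, \<phi>)\<close> along \<open>f : X' \<rightarrow> X\<close>: it is an
  \<open>f\<close>-semilinear map \<open>E \<rightarrow> f\<^sub>* E'\<close> taking local generators to local generators.\<close>

definition pullback_via :: "'f base \<Rightarrow> ('p, 'a) rspace \<Rightarrow> ('p, 'a) rspace \<Rightarrow> ('p, 'a, 'p, 'a) rmor \<Rightarrow>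
    ('p, 'a, 'm) lbundle \<Rightarrow> ('f, 'p, 'm) action \<Rightarrow>
    ('p, 'a, 'm) lbundle \<Rightarrow> ('f, 'p, 'm) action \<Rightarrow> ('p set \<Rightarrow> 'm \<Rightarrow> 'm) \<Rightarrow> bool" where
  "pullback_via B X' X f E \<phi> E' \<phi>' u \<longleftrightarrow>
     (\<forall>U. openin (spc X) U \<longrightarrow> (let U' = preim X' f U in
        u U \<in> carrier (sec E U) \<rightarrow> carrier (sec E' U') \<and>
        (\<forall>x\<in>carrier (sec E U). \<forall>y\<in>carrier (sec E U).
           u U (x \<oplus>\<^bsub>sec E U\<^esub> y) = u U x \<oplus>\<^bsub>sec E' U'\<^esub> u U y) \<and>
        (\<forall>c\<in>carrier (shf X U). \<forall>x\<in>carrier (sec E U).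
           u U (c \<odot>\<^bsub>sec E U\<^esub> x) = smap f U c \<odot>\<^bsub>sec E' U'\<^esub> u U x) \<and>
        (\<forall>a\<in>AA B. \<forall>i. \<forall>x\<in>carrier (sec E U). u U (\<phi> a i U x) = \<phi>' a i U' (u U x)))) \<and>
     (\<forall>U V. openin (spc X) U \<and> openin (spc X) V \<and> V \<subseteq> U \<longrightarrow> (\<forall>x\<in>carrier (sec E U).
        u V (mres E U V x) = mres E' (preim X' f U) (preim X' f V) (u U x))) \<and>
     (\<forall>(U, m)\<in>gens X E. (preim X' f U, u U m) \<in> gens X' E')"

section \<open>Points of line bundles, Tate modules and level structures\<close>

text \<open>The set \<open>E(T)\<close> of \<open>T\<close>-valued points of \<open>E\<close> over \<open>f : T \<rightarrow> X\<close>, i.e. the global sections of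
  \<open>f\<^sup>* E\<close>: such a point is given by its coordinate with respect to every local generator of \<open>E\<close>.\<close>

definition bundle_points :: "('p, 'a) rspace \<Rightarrow> ('p, 'a, 'm) lbundle \<Rightarrow> ('s, 'b) rspace \<Rightarrow>
    ('s, 'b, 'p, 'a) rmor \<Rightarrow> ('p set \<times> 'm \<Rightarrow> 'b) set" where
  "bundle_points X E T f = {x \<in> (\<Pi>\<^sub>E (U, m)\<in>gens X E. carrier (shf T (preim T f U))).
     \<forall>(U, m)\<in>gens X E. \<forall>(U', m')\<in>gens X E. \<forall>V c.
       openin (spc X) V \<and> V \<subseteq> U \<inter> U' \<and> c \<in> carrier (shf X V) \<and>
       mres E U' V m' = c \<odot>\<^bsub>sec E V\<^esub> mres E U V m \<longrightarrow>
       res T (preim T f U) (preim T f V) (x (U, m)) =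
         smap f V c \<otimes>\<^bsub>shf T (preim T f V)\<^esub> res T (preim T f U') (preim T f V) (x (U', m'))}"

definition zero_point :: "('p, 'a) rspace \<Rightarrow> ('p, 'a, 'm) lbundle \<Rightarrow> ('s, 'b) rspace \<Rightarrow>
    ('s, 'b, 'p, 'a) rmor \<Rightarrow> ('p set \<times> 'm \<Rightarrow> 'b)" where
  "zero_point X E T f = (\<lambda>(U, m)\<in>gens X E. \<zero>\<^bsub>shf T (preim T f U)\<^esub>)"

text \<open>The map \<open>E\<^sub>1(T) \<rightarrow> E\<^sub>2(T)\<close> induced by \<open>\<alpha> = \<Sum> \<alpha>\<^sub>i\<close>, \<open>\<alpha>\<^sub>i\<close> being \<open>q\<^sup>i\<close>-semilinear: over open sets on which
  the sum is finite, it is \<open>x \<mapsto> \<Sum> c\<^sub>i x\<^sup>Q\<close> (\<open>Q = q\<^sup>i\<close>) in coordinates.\<close>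

definition apply_hom :: "nat \<Rightarrow> ('p, 'a) rspace \<Rightarrow> ('p, 'a, 'm) lbundle \<Rightarrow> ('p, 'a, 'm) lbundle \<Rightarrow>
    (nat \<Rightarrow> 'p set \<Rightarrow> 'm \<Rightarrow> 'm) \<Rightarrow> ('s, 'b) rspace \<Rightarrow> ('s, 'b, 'p, 'a) rmor \<Rightarrow>
    ('p set \<times> 'm \<Rightarrow> 'b) \<Rightarrow> ('p set \<times> 'm \<Rightarrow> 'b)" where
  "apply_hom q X E1 E2 \<alpha> T f x = (THE y. y \<in> bundle_points X E2 T f \<and>
     (\<forall>U m1 m2. (U, m1) \<in> gens X E1 \<and> (U, m2) \<in> gens X E2 \<longrightarrow>
       (let c = (\<lambda>i. coef X E2 U m2 (\<alpha> i U m1)); I = {i. c i \<noteq> \<zero>\<^bsub>shf X U\<^esub>};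
            R = shf T (preim T f U) in
         finite I \<longrightarrow>
         y (U, m2) = finsum R (\<lambda>i. smap f U (c i) \<otimes>\<^bsub>R\<^esub> (x (U, m1) [^]\<^bsub>R\<^esub> (q ^ i))) I)))"

definition point_module :: "'f base \<Rightarrow> ('p, 'a) rspace \<Rightarrow> ('p, 'a, 'm) lbundle \<Rightarrow> ('f, 'p, 'm) action \<Rightarrow> ('s, 'b) rspace \<Rightarrow> ('s, 'b, 'p, 'a) rmor \<Rightarrow>
    ('f, 'p set \<times> 'm \<Rightarrow> 'b) module" where
  "point_module B X E \<phi> T f =
    \<lparr>carrier = bundle_points X E T f, monoid.mult = undefined, one = undefined,
     ring.zero = zero_point X E T f,
     ring.add = (\<lambda>x y. \<lambda>(U, m)\<in>gens X E. x (U, m) \<oplus>\<^bsub>shf T (preim T f U)\<^esub> y (U, m)),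
     smult = (\<lambda>a. apply_hom (qB B) X E E (\<phi> a) T f)\<rparr>"

text \<open>\<open>adeles_v_mod\<close>: the adeles away from \<open>v\<close> and infinity as an \<open>A\<close>-module.\<close>

definition adeles_v_mod :: "'f base \<Rightarrow> ('f, 'f set \<Rightarrow> 'f set) module" where
  "adeles_v_mod B =
    \<lparr>carrier = carrier (adeles_v B), monoid.mult = undefined, one = undefined,
     ring.zero = \<zero>\<^bsub>adeles_v B\<^esub>, ring.add = ring.add (adeles_v B),
     smult = (\<lambda>a x. (\<lambda>I\<in>nz_ideals (ffield B) (AAv B). I +>\<^bsub>ffield B\<^esub> a) \<otimes>\<^bsub>adeles_v B\<^esub> x)\<rparr>"

text \<open>Homomorphisms from \<open>\<A>\<^sup>\<infinity>\<^sup>v\<close> modulo its integral elements are homomorphisms from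
  \<open>\<A>\<^sup>\<infinity>\<^sup>v\<close> vanishing on the integral elements.\<close>

definition tate :: "'f base \<Rightarrow> ('f, 'n) module \<Rightarrow> ('f set \<Rightarrow> 'f set, ('f set \<Rightarrow> 'f set) \<Rightarrow> 'n) module" where
  "tate B N =
    \<lparr>carrier = {t \<in> mod_hom (Aring B) (adeles_v_mod B) N. \<forall>x\<in>carrier (Ahat_v B). t x = \<zero>\<^bsub>N\<^esub>},
     monoid.mult = undefined, one = undefined,
     ring.zero = (\<lambda>x\<in>carrier (adeles_v B). \<zero>\<^bsub>N\<^esub>),
     ring.add = (\<lambda>t u. \<lambda>x\<in>carrier (adeles_v B). t x \<oplus>\<^bsub>N\<^esub> u x),
     smult = (\<lambda>z t. \<lambda>x\<in>carrier (adeles_v B). t (z \<otimes>\<^bsub>adeles_v B\<^esub> x))\<rparr>"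

definition rational_tate :: "'f base \<Rightarrow> ('f, 'n) module \<Rightarrow>
    ('f set \<Rightarrow> 'f set, (('f set \<Rightarrow> 'f set) \<times> (('f set \<Rightarrow> 'f set) \<Rightarrow> 'n)) list set) module" where
  "rational_tate B N = ext_scalars (adeles_v B) (carrier (Ahat_v B)) (tate B N)"

text \<open>The map on rational Tate modules induced by a map \<open>w : N0 \<rightarrow> N\<close> (defined on prime-to-\<open>v\<close> torsion).\<close>

definition rational_tate_map :: "'f base \<Rightarrow> ('f, 'n) module \<Rightarrow> ('n0 \<Rightarrow> 'n) \<Rightarrow>
    (('f set \<Rightarrow> 'f set) \<times> (('f set \<Rightarrow> 'f set) \<Rightarrow> 'n0)) list set \<Rightarrow>
    (('f set \<Rightarrow> 'f set) \<times> (('f set \<Rightarrow> 'f set) \<Rightarrow> 'n)) list set" where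
  "rational_tate_map B N w = ext_scalars_map (adeles_v B) (carrier (Ahat_v B)) (tate B N)
     (\<lambda>t. \<lambda>x\<in>carrier (adeles_v B). w (t x))"

definition adelic_space :: "'f base \<Rightarrow> nat \<Rightarrow> ('f set \<Rightarrow> 'f set, nat \<Rightarrow> 'f set \<Rightarrow> 'f set) module" where
  "adelic_space B r = mod_power (ring_as_module (adeles_v B)) r"

definition then_map :: "'f base \<Rightarrow> nat \<Rightarrow> ('y \<Rightarrow> 'z) \<Rightarrow> ((nat \<Rightarrow> 'f set \<Rightarrow> 'f set) \<Rightarrow> 'y) \<Rightarrow>
    ((nat \<Rightarrow> 'f set \<Rightarrow> 'f set) \<Rightarrow> 'z)" where
  "then_map B r w \<eta> = (\<lambda>x\<in>carrier (adelic_space B r). w (\<eta> x))"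

subsection \<open>The etale fundamental groupoid\<close>

definition geometric_point :: "('p, 'a) rspace \<Rightarrow> 'a ring \<Rightarrow> (unit, 'a, 'p, 'a) rmor \<Rightarrow> bool" where
  "geometric_point S \<Omega> s \<longleftrightarrow> algebraically_closed \<Omega> \<and> s \<in> mor (field_spec \<Omega>) S"

definition points_over :: "('p, 'a) rspace \<Rightarrow> 'a ring \<Rightarrow> (unit, 'a, 'p, 'a) rmor \<Rightarrow>
    ('p, 'a) rspace \<times> ('p, 'a, 'p, 'a) rmor \<Rightarrow> (unit, 'a, 'p, 'a) rmor set" where
  "points_over S \<Omega> s = (\<lambda>(Y, h). {y \<in> mor (field_spec \<Omega>) Y. comp_mor (field_spec \<Omega>) Y S h y = s})"

text \<open>The paths from \<open>s\<close> to \<open>s'\<close> are the isomorphisms between the two fibre functors on finite etale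
  covers; for \<open>s = s'\<close> they form the etale fundamental group.\<close>

definition paths :: "('p, 'a) rspace \<Rightarrow> 'a ring \<Rightarrow> (unit, 'a, 'p, 'a) rmor \<Rightarrow>
    'a ring \<Rightarrow> (unit, 'a, 'p, 'a) rmor \<Rightarrow>
    (('p, 'a) rspace \<times> ('p, 'a, 'p, 'a) rmor \<Rightarrow> (unit, 'a, 'p, 'a) rmor \<Rightarrow> (unit, 'a, 'p, 'a) rmor) set"
  where
  "paths S \<Omega> s \<Omega>' s' = {\<sigma>.
     (\<forall>Y h. finite_etale Y S h \<longrightarrow>
        bij_betw (\<sigma> (Y, h)) (points_over S \<Omega> s (Y, h)) (points_over S \<Omega>' s' (Y, h))) \<and>
     (\<forall>Y h Y' h' g. finite_etale Y S h \<and> finite_etale Y' S h' \<and> g \<in> mor Y Y' \<and> comp_mor Y Y' S h' g = h \<longrightarrow>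
        (\<forall>y\<in>points_over S \<Omega> s (Y, h).
           \<sigma> (Y', h') (comp_mor (field_spec \<Omega>) Y Y' g y) = comp_mor (field_spec \<Omega>') Y Y' g (\<sigma> (Y, h) y)))}"

definition eval_point :: "('p, 'a) rspace \<Rightarrow> ('p, 'a, 'm) lbundle \<Rightarrow> ('p, 'a) rspace \<Rightarrow> ('p, 'a, 'p, 'a) rmor \<Rightarrow>
    (unit, 'a, 'p, 'a) rmor \<Rightarrow> ('p set \<times> 'm \<Rightarrow> 'a) \<Rightarrow> ('p set \<times> 'm \<Rightarrow> 'a)" where
  "eval_point S E Y h y z = (\<lambda>(U, m)\<in>gens S E. smap y (preim Y h U) (z (U, m)))"

text \<open>Transport of prime-to-\<open>v\<close> torsion points along a path: \<open>\<phi>[b]\<close> is finite etale over \<open>S\<close> for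
  \<open>b \<in> A \<setminus> \<pp>\<close>, and a \<open>Y\<close>-valued point \<open>z\<close> of \<open>\<phi>[b]\<close> is a morphism \<open>Y \<rightarrow> \<phi>[b]\<close> over \<open>S\<close>, so that transport
  sends \<open>z(y)\<close> to \<open>z(\<sigma> y)\<close>.\<close>

definition transport :: "'f base \<Rightarrow> ('p, 'a) rspace \<Rightarrow> ('p, 'a, 'm) lbundle \<Rightarrow> ('f, 'p, 'm) action \<Rightarrow> 'a ring \<Rightarrow> (unit, 'a, 'p, 'a) rmor \<Rightarrow>
    'a ring \<Rightarrow> (unit, 'a, 'p, 'a) rmor \<Rightarrow>
    (('p, 'a) rspace \<times> ('p, 'a, 'p, 'a) rmor \<Rightarrow> (unit, 'a, 'p, 'a) rmor \<Rightarrow> (unit, 'a, 'p, 'a) rmor) \<Rightarrow>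
    ('p set \<times> 'm \<Rightarrow> 'a) \<Rightarrow> ('p set \<times> 'm \<Rightarrow> 'a)" where
  "transport B S E \<phi> \<Omega> s \<Omega>' s' \<sigma> x = (THE x'. x' \<in> bundle_points S E (field_spec \<Omega>') s' \<and>
     (\<forall>b\<in>AA B - vprime B. \<forall>Y h z y. finite_etale Y S h \<and>
        z \<in> carrier (point_module B S E \<phi> Y h) \<and>
        b \<odot>\<^bsub>point_module B S E \<phi> Y h\<^esub> z = \<zero>\<^bsub>point_module B S E \<phi> Y h\<^esub> \<and>
        y \<in> points_over S \<Omega> s (Y, h) \<and> eval_point S E Y h y z = x \<longrightarrow>
        eval_point S E Y h (\<sigma> (Y, h) y) z = x'))"

subsection \<open>Level structures and the moduli problem\<close>

type_synonym ('f, 'p, 'a, 'm) level_orbit =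
  "((nat \<Rightarrow> 'f set \<Rightarrow> 'f set) \<Rightarrow>
    (('f set \<Rightarrow> 'f set) \<times> (('f set \<Rightarrow> 'f set) \<Rightarrow> ('p set \<times> 'm \<Rightarrow> 'a))) list set) set"

type_synonym ('f, 'p, 'a, 'm) obj =
  "('p, 'a, 'm) lbundle \<times> ('f, 'p, 'm) action \<times> ('f, 'p, 'a, 'm) level_orbit"

definition level_structure :: "'f base \<Rightarrow> nat \<Rightarrow> ('f set \<Rightarrow> 'f set) mat set \<Rightarrow> ('p, 'a) rspace \<Rightarrow>
    ('p, 'a, 'm) lbundle \<Rightarrow> ('f, 'p, 'm) action \<Rightarrow> 'a ring \<Rightarrow> (unit, 'a, 'p, 'a) rmor \<Rightarrow>
    ('f, 'p, 'a, 'm) level_orbit \<Rightarrow> bool" where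
  "level_structure B r Kv S E \<phi> \<Omega> s orb \<longleftrightarrow> (let N = point_module B S E \<phi> (field_spec \<Omega>) s in
     (\<exists>\<eta>\<in>mod_iso (adeles_v B) (adelic_space B r) (rational_tate B N).
        orb = {(\<lambda>x\<in>carrier (adelic_space B r). \<eta> (mat_vec r (adeles_v B) k x)) | k. k \<in> Kv}) \<and>
     (\<forall>\<sigma>\<in>paths S \<Omega> s \<Omega> s.
        then_map B r (rational_tate_map B N (transport B S E \<phi> \<Omega> s \<Omega> s \<sigma>)) ` orb = orb))"

definition drinfeld_hom :: "'f base \<Rightarrow> ('p, 'a) rspace \<Rightarrow>
    ('p, 'a, 'm) lbundle \<Rightarrow> ('f, 'p, 'm) action \<Rightarrow>
    ('p, 'a, 'm) lbundle \<Rightarrow> ('f, 'p, 'm) action \<Rightarrow>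
    (nat \<Rightarrow> 'p set \<Rightarrow> 'm \<Rightarrow> 'm) \<Rightarrow> bool" where
  "drinfeld_hom B S E1 \<phi>1 E2 \<phi>2 \<alpha> \<longleftrightarrow>
     (\<forall>i. \<alpha> i \<in> twisted_maps S (qB B ^ i) E1 E2) \<and> locally_finite S E1 E2 \<alpha> \<and>
     (\<forall>a\<in>AA B. \<forall>k U. openin (spc S) U \<longrightarrow> (\<forall>e\<in>carrier (sec E1 U).
        finsum (sec E2 U) (\<lambda>i. \<alpha> i U (\<phi>1 a (k - i) U e)) {..k} =
        finsum (sec E2 U) (\<lambda>i. \<phi>2 a i U (\<alpha> (k - i) U e)) {..k}))"

text \<open>An isogeny is a homomorphism that is nonzero in all fibres.\<close>

definition isogeny :: "'f base \<Rightarrow> ('p, 'a) rspace \<Rightarrow>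
    ('p, 'a, 'm) lbundle \<Rightarrow> ('f, 'p, 'm) action \<Rightarrow>
    ('p, 'a, 'm) lbundle \<Rightarrow> ('f, 'p, 'm) action \<Rightarrow>
    (nat \<Rightarrow> 'p set \<Rightarrow> 'm \<Rightarrow> 'm) \<Rightarrow> bool" where
  "isogeny B S E1 \<phi>1 E2 \<phi>2 \<alpha> \<longleftrightarrow> drinfeld_hom B S E1 \<phi>1 E2 \<phi>2 \<alpha> \<and>
     (\<forall>x\<in>pts S. \<exists>U m1 m2 i. x \<in> U \<and> (U, m1) \<in> gens S E1 \<and> (U, m2) \<in> gens S E2 \<and>
        smap (residue_point S x) U (coef S E2 U m2 (\<alpha> i U m1)) \<noteq> \<zero>\<^bsub>residue_field S x\<^esub>)"

definition prime_to_v_isogeny :: "'f base \<Rightarrow> ('p, 'a) rspace \<Rightarrow>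
    ('p, 'a, 'm) lbundle \<Rightarrow> ('f, 'p, 'm) action \<Rightarrow>
    ('p, 'a, 'm) lbundle \<Rightarrow> ('f, 'p, 'm) action \<Rightarrow>
    (nat \<Rightarrow> 'p set \<Rightarrow> 'm \<Rightarrow> 'm) \<Rightarrow> bool" where
  "prime_to_v_isogeny B S E1 \<phi>1 E2 \<phi>2 \<alpha> \<longleftrightarrow> isogeny B S E1 \<phi>1 E2 \<phi>2 \<alpha> \<and>
     (\<exists>a\<in>AA B - vprime B. \<forall>(T :: ('p, 'a) rspace) f. scheme T \<and> f \<in> mor T S \<longrightarrow>
        (\<forall>x\<in>bundle_points S E1 T f.
           apply_hom (qB B) S E1 E2 \<alpha> T f x = zero_point S E2 T f \<longrightarrow>
           apply_hom (qB B) S E1 E1 (\<phi>1 a) T f x = zero_point S E1 T f))"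

definition triple :: "'f base \<Rightarrow> nat \<Rightarrow> ('f set \<Rightarrow> 'f set) mat set \<Rightarrow> ('p, 'a) rspace \<Rightarrow> ('f \<Rightarrow> 'a) \<Rightarrow>
    'a ring \<Rightarrow> (unit, 'a, 'p, 'a) rmor \<Rightarrow>
    ('f, 'p, 'a, 'm) obj \<Rightarrow> bool" where
  "triple B r Kv S \<gamma> \<Omega> s = (\<lambda>(E, \<phi>, orb).
     drinfeld_rank B r S \<gamma> E \<phi> \<and> level_structure B r Kv S E \<phi> \<Omega> s orb)"

definition isogenous :: "'f base \<Rightarrow> nat \<Rightarrow> ('f set \<Rightarrow> 'f set) mat set \<Rightarrow> ('p, 'a) rspace \<Rightarrow> ('f \<Rightarrow> 'a) \<Rightarrow>
    'a ring \<Rightarrow> (unit, 'a, 'p, 'a) rmor \<Rightarrow>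
    ('f, 'p, 'a, 'm) obj \<Rightarrow>
    ('f, 'p, 'a, 'm) obj \<Rightarrow> bool" where
  "isogenous B r Kv S \<gamma> \<Omega> s = (\<lambda>(E1, \<phi>1, orb1) (E2, \<phi>2, orb2).
     triple B r Kv S \<gamma> \<Omega> s (E1, \<phi>1, orb1) \<and> triple B r Kv S \<gamma> \<Omega> s (E2, \<phi>2, orb2) \<and>
     (\<exists>\<alpha>. prime_to_v_isogeny B S E1 \<phi>1 E2 \<phi>2 \<alpha> \<and>
        then_map B r (rational_tate_map B (point_module B S E2 \<phi>2 (field_spec \<Omega>) s)
          (apply_hom (qB B) S E1 E2 \<alpha> (field_spec \<Omega>) s)) ` orb1 = orb2))"

text \<open>\<open>(E', \<phi>', orb')\<close> over \<open>S'\<close>, with base point \<open>s'\<close>, is the pullback of \<open>(E, \<phi>, orb)\<close> over \<open>S\<close>,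
  with base point \<open>s\<close>, along \<open>f : S' \<rightarrow> S\<close>. The level structures are compared by moving the base
  point \<open>s\<close> of \<open>S\<close> to \<open>f(s')\<close> along a path; the choice of the path does not matter by invariance under the
  fundamental group.\<close>

definition pullback_triple :: "'f base \<Rightarrow> nat \<Rightarrow> ('p, 'a) rspace \<Rightarrow> ('p, 'a) rspace \<Rightarrow>
    ('p, 'a, 'p, 'a) rmor \<Rightarrow>
    'a ring \<Rightarrow> (unit, 'a, 'p, 'a) rmor \<Rightarrow>
    ('f, 'p, 'a, 'm) obj \<Rightarrow>
    'a ring \<Rightarrow> (unit, 'a, 'p, 'a) rmor \<Rightarrow>
    ('f, 'p, 'a, 'm) obj \<Rightarrow> bool" where
  "pullback_triple B r S' S f \<Omega> s = (\<lambda>(E, \<phi>, orb) \<Omega>' s' (E', \<phi>', orb').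
     let fs' = comp_mor (field_spec \<Omega>') S' S f s';
         N = point_module B S E \<phi> (field_spec \<Omega>') fs' in
     \<exists>u. pullback_via B S' S f E \<phi> E' \<phi>' u \<and>
       (\<exists>\<sigma>\<in>paths S \<Omega> s \<Omega>' fs'.
          then_map B r (rational_tate_map B N (transport B S E \<phi> \<Omega> s \<Omega>' fs' \<sigma>)) ` orb =
          then_map B r (rational_tate_map B N
            (\<lambda>x'. \<lambda>(U, m)\<in>gens S E. x' (preim S' f U, u U m))) ` orb'))"

text \<open>\<open>M\<close> represents the functor of triples modulo prime-to-\<open>v\<close> isogenies respecting the level structures on
  connected locally noetherian schemes over \<open>Aloc B\<close>, and \<open>(EK, \<phi>K, orbK)\<close> is a universal triple.\<close>

definition represents_moduli :: "'f base \<Rightarrow> nat \<Rightarrow> ('f set \<Rightarrow> 'f set) mat set \<Rightarrow>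
    ('p, 'a) rspace \<Rightarrow> ('f \<Rightarrow> 'a) \<Rightarrow> 'a ring \<Rightarrow> (unit, 'a, 'p, 'a) rmor \<Rightarrow>
    ('f, 'p, 'a, 'm) obj \<Rightarrow> bool" where
  "represents_moduli B r Kv M g \<Omega>0 s0 uobj \<longleftrightarrow>
     geometric_point M \<Omega>0 s0 \<and> triple B r Kv M g \<Omega>0 s0 uobj \<and>
     (\<forall>(S :: ('p, 'a) rspace) gS \<Omega> s obj.
        scheme_over (Aloc B) S gS \<and> connected_space (spc S) \<and> locally_noetherian S \<and>
        geometric_point S \<Omega> s \<and> triple B r Kv S gS \<Omega> s obj \<longrightarrow>
        (\<exists>!f. f \<in> mor_over (Aloc B) S gS M g \<and>
          (\<exists>obj'. triple B r Kv S gS \<Omega> s obj' \<and> pullback_triple B r S M f \<Omega>0 s0 uobj \<Omega> s obj' \<and>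
             equivclp (isogenous B r Kv S gS \<Omega> s) obj' obj)))"

definition moduli_scheme :: "'f base \<Rightarrow> nat \<Rightarrow> ('f set \<Rightarrow> 'f set) mat set \<Rightarrow>
    ('p, 'a) rspace \<Rightarrow> ('f \<Rightarrow> 'a) \<Rightarrow>
    ('p, 'a, 'm) lbundle \<Rightarrow> ('f, 'p, 'm) action \<Rightarrow> bool" where
  "moduli_scheme B r Kv M g EK \<phi>K \<longleftrightarrow> scheme_over (Aloc B) M g \<and> affine M \<and> smooth_over (Aloc B) M g \<and>
     (\<exists>\<Omega>0 s0 orbK. represents_moduli B r Kv M g \<Omega>0 s0 (EK, \<phi>K, orbK))"

definition satake_compactification :: "'f base \<Rightarrow> nat \<Rightarrow>
    ('p, 'a) rspace \<Rightarrow> ('f \<Rightarrow> 'a) \<Rightarrow> ('p, 'a, 'm) lbundle \<Rightarrow> ('f, 'p, 'm) action \<Rightarrow>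
    ('p, 'a) rspace \<Rightarrow> ('f \<Rightarrow> 'a) \<Rightarrow> ('p, 'a, 'p, 'a) rmor \<Rightarrow>
    ('p, 'a, 'm) lbundle \<Rightarrow> ('f, 'p, 'm) action \<Rightarrow> bool" where
  "satake_compactification B r M g EK \<phi>K Mbar gbar \<iota> Ebar \<phi>bar \<longleftrightarrow>
     scheme_over (Aloc B) Mbar gbar \<and> integral_scheme Mbar \<and> normal_scheme Mbar \<and>
     proper_over (Aloc B) Mbar gbar \<and> flat_over (Aloc B) Mbar gbar \<and>
     \<iota> \<in> mor_over (Aloc B) M g Mbar gbar \<and> open_immersion M Mbar \<iota> \<and>
     spc Mbar closure_of (pmap \<iota> ` pts M) = pts Mbar \<and>
     gen_drinfeld B Mbar gbar Ebar \<phi>bar \<and> rank_le B r Mbar Ebar \<phi>bar \<and>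
     weakly_separating B Mbar gbar Ebar \<phi>bar \<and>
     (\<exists>u. pullback_via B M Mbar \<iota> Ebar \<phi>bar EK \<phi>K u)"

section \<open>Hasse invariants\<close>

text \<open>\<open>H\<^sup>a\<^sub>i\<close> is a section of \<open>\<omega>\<^sup>\<otimes>\<^sup>(\<^sup>Q\<^sup>-\<^sup>1\<^sup>) = E\<^sup>\<otimes>\<^sup>(\<^sup>1\<^sup>-\<^sup>Q\<^sup>)\<close>, \<open>Q = q\<close> to the power \<open>i deg v\<close>, where
  \<open>\<omega> = Lie(E)\<^sup>\<or>\<close> and \<open>Lie(E) = E\<close> as invertible sheaves.\<close>

definition hasse :: "'f base \<Rightarrow> ('f, 'p, 'm) action \<Rightarrow> 'f \<Rightarrow> nat \<Rightarrow> 'p set \<Rightarrow> 'm \<Rightarrow> 'm" where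
  "hasse B \<phi> a i = \<phi> a (i * deg_v B)"

text \<open>The ideal sheaf \<open>\<Sum>\<^sub>i H\<^sub>i \<cdot> \<omega>\<^sup>\<otimes>\<^sup>(\<^sup>1\<^sup>-\<^sup>Q\<^sup>)\<close>, for a family of such sections \<open>H\<^sub>i\<close> on \<open>X\<close>, on a scheme
  \<open>X'\<close> over \<open>X\<close>. Where \<open>E\<close> has a generator \<open>m\<close>, the sheaf \<open>\<omega>\<^sup>\<otimes>\<^sup>(\<^sup>1\<^sup>-\<^sup>Q\<^sup>) = E\<^sup>\<otimes>\<^sup>(\<^sup>Q\<^sup>-\<^sup>1\<^sup>)\<close> is generated
  by \<open>m\<^sup>Q\<^sup>-\<^sup>1\<close>, whose product with \<open>H\<^sub>i\<close> is the \<open>c\<close> with \<open>H\<^sub>i(m) = c m\<close>.\<close>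

definition vanishing_ideal :: "('p, 'a) rspace \<Rightarrow> ('p, 'a) rspace \<Rightarrow> ('p, 'a, 'p, 'a) rmor \<Rightarrow>
    ('p, 'a, 'm) lbundle \<Rightarrow> (nat \<Rightarrow> 'p set \<Rightarrow> 'm \<Rightarrow> 'm) \<Rightarrow> nat set \<Rightarrow> 'p set \<Rightarrow> 'a set" where
  "vanishing_ideal X' X j E H I W = {s \<in> carrier (shf X' W). openin (spc X') W \<and>
     (\<forall>w\<in>W. \<exists>W' U m. openin (spc X') W' \<and> w \<in> W' \<and> W' \<subseteq> W \<and> (U, m) \<in> gens X E \<and> W' \<subseteq> preim X' j U \<and>
        res X' W W' s \<in> Idl\<^bsub>shf X' W'\<^esub>
          ((\<lambda>i. res X' (preim X' j U) W' (smap j U (coef X E U m (H i U m)))) ` I))}"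

text \<open>\<open>V(H\<^sup>a\<^sub>1, \<dots>, H\<^sup>a\<^sub>h\<^sub>-\<^sub>1)\<close> in the special fibre \<open>j : M0 \<rightarrow> Mbar\<close>.\<close>

definition hasse_locus :: "'f base \<Rightarrow> ('p, 'a) rspace \<Rightarrow> ('p, 'a) rspace \<Rightarrow> ('p, 'a, 'p, 'a) rmor \<Rightarrow>
    ('p, 'a, 'm) lbundle \<Rightarrow> ('f, 'p, 'm) action \<Rightarrow> 'f \<Rightarrow> nat \<Rightarrow>
    ('p, 'p \<Rightarrow> ('p set \<times> 'a) set set) rspace" where
  "hasse_locus B M0 Mbar j E \<phi> a h =
     closed_subscheme M0 (vanishing_ideal M0 Mbar j E (hasse B \<phi> a) {1..<h})"

end

theory Submission
  imports Defs
begin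

text \<open>Let \<open>x\<close> be a point of the special fibre and \<open>\<psi>\<close> the coordinate form of the Drinfeld module at \<open>x\<close>, over the residue
field \<open>\<kappa>\<close>. It has some rank \<open>\<rho>\<close>, and the constant coefficient of \<open>\<psi>\<^sub>c\<close> is the image of \<open>c\<close> under \<open>A/\<pp> \<rightarrow> \<kappa>\<close>. Put
\<open>d = deg v\<close>, and let \<open>l\<close> be the smallest index at which \<open>\<psi>\<^sub>a\<close> has a nonzero coefficient. Everything rests on two
facts.

The first is \<open>l = d \<cdot> height\<close> (\<open>rank_height\<close>, \<open>height_ge_iff\<close>). Since \<open>\<psi>[\<pp>]\<close> is a power of \<open>\<pp>\<^sup>-\<^sup>1/A\<close>, which is
isomorphic to \<open>A/\<pp>\<close>, it says that \<open>|\<psi>[\<pp>]| q\<^sup>l = |A/\<pp>|\<^sup>\<rho>\<close> (\<open>card_torsion_eq\<close>). This is proved by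
counting. The kernel of an additive polynomial on an algebraically closed field has \<open>q\<close> to the power (top index minus
lowest index) elements (\<open>card_ker_qpoly\<close>). The element \<open>a\<close> may have zeros other than \<open>v\<close>; an \<open>e\<close> with
\<open>e \<equiv> 1\<close> modulo \<open>\<pp>\<close> and \<open>e \<pp> \<subseteq> a A\<close> (\<open>exists_idempotent\<close>) is an idempotent of \<open>A/a\<close> that separates the part at \<open>v\<close>
from the rest. Because \<open>\<psi>\<^sub>a\<close> is surjective, \<open>\<psi>[\<pp>\<^sup>n]\<close> has at least as many elements as \<open>\<psi>[\<pp>]\<^sup>n\<close>. On the other hand
the pigeonhole principle gives a nonzero \<open>c \<in> \<pp>\<^sup>n\<close> whose degree is, up to a constant, the one that the index of
\<open>\<pp>\<^sup>n\<close> forces; \<open>\<psi>\<^sub>c\<close> has no coefficients below \<open>n l\<close>, and kills \<open>\<psi>[\<pp>\<^sup>n]\<close>. Comparing the two for \<open>n \<rightarrow> \<infinity>\<close> gives one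
inequality; the same inequality for the complementary idempotent, and the known size of \<open>\<psi>[a]\<close>, give the other.

The second fact concerns coefficients \<open>C\<^sub>c\<^sub>,\<^sub>i\<close> of the universal family in any \<open>A/\<pp>\<close>-algebra. Comparing \<open>c a\<close> with
\<open>a c\<close> in degree \<open>k\<close> shows that \<open>(\<gamma>(c)\<^sup>Q - \<gamma>(c)) C\<^sub>a\<^sub>,\<^sub>k\<close>, \<open>Q = q\<^sup>k\<close>, lies in the ideal generated by the lower coefficients of
\<open>a\<close>. If \<open>d\<close> does not divide \<open>k\<close> then some residue class is moved by the \<open>Q\<close>-Frobenius, so \<open>C\<^sub>a\<^sub>,\<^sub>k\<close> itself lies there.
Hence \<open>H\<^sub>1, \<dots>, H\<^sub>h\<^sub>-\<^sub>1\<close> generate the ideal of all coefficients of \<open>a\<close> below \<open>h d\<close>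
(\<open>low_coefficients_in_ideal\<close>). This ideal does not depend on \<open>a\<close>: with \<open>e\<close> as above, \<open>e a'\<close> is a multiple of
\<open>a\<close>, and \<open>e\<close> has constant coefficient \<open>1\<close> (\<open>hasse_ideal_le\<close>).

Part (1) is the second fact over small open sets. For part (2), \<open>x\<close> lies on the locus iff all \<open>H\<^sub>i\<close> with \<open>0 < i < h\<close>
vanish at \<open>x\<close> (\<open>ideal_stalk_proper_iff\<close>), by the second fact over \<open>\<kappa>\<close> iff \<open>\<psi>\<^sub>a\<close> vanishes below \<open>h d\<close>, and by the
first fact iff the height is at least \<open>h\<close>. The finiteness of \<open>A/\<pp>\<close> and the existence of \<open>e\<close> are themselves deduced
from the existence of one Drinfeld module of characteristic \<open>\<pp>\<close>, so they are available wherever the special fibre has a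
point.\<close>

section \<open>Counting fibres and roots\<close>

lemma card_le_fibres:
  assumes T: "finite T" and fS: "f ` S \<subseteq> T"
    and fib: "\<And>t. t \<in> T \<Longrightarrow> finite {s \<in> S. f s = t} \<and> card {s \<in> S. f s = t} \<le> b"
  shows "finite S \<and> card S \<le> card T * b"
proof -
  have S: "S = (\<Union>t\<in>T. {s \<in> S. f s = t})" using fS by auto
  have "finite (\<Union>t\<in>T. {s \<in> S. f s = t})" using T fib by blast
  moreover have "card (\<Union>t\<in>T. {s \<in> S. f s = t}) \<le> (\<Sum>t\<in>T. card {s \<in> S. f s = t})"
    by (rule card_UN_le[OF T])
  moreover have "(\<Sum>t\<in>T. card {s \<in> S. f s = t}) \<le> card T * b"
    using sum_bounded_above[of T "\<lambda>t. card {s \<in> S. f s = t}" b] fib by simp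
  ultimately show ?thesis using S by simp
qed

lemma card_eq_fibres:
  assumes T: "finite T" and fS: "f ` S \<subseteq> T"
    and fib: "\<And>t. t \<in> T \<Longrightarrow> finite {s \<in> S. f s = t} \<and> card {s \<in> S. f s = t} = b"
  shows "finite S \<and> card S = card T * b"
proof -
  have S: "S = (\<Union>t\<in>T. {s \<in> S. f s = t})" using fS by auto
  have "finite (\<Union>t\<in>T. {s \<in> S. f s = t})" using T fib by blast
  moreover have "card (\<Union>t\<in>T. {s \<in> S. f s = t}) = (\<Sum>t\<in>T. card {s \<in> S. f s = t})"
    by (rule card_UN_disjoint[OF T]) (use fib in auto)
  moreover have "(\<Sum>t\<in>T. card {s \<in> S. f s = t}) = card T * b"
    using fib by simp
  ultimately show ?thesis using S by simp
qed

lemma card_additive_preimage: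
  assumes G: "abelian_group G" and H: "abelian_group H"
    and t: "t \<in> carrier G \<rightarrow> carrier H"
    and add: "\<And>x y. x \<in> carrier G \<Longrightarrow> y \<in> carrier G \<Longrightarrow> t (x \<oplus>\<^bsub>G\<^esub> y) = t x \<oplus>\<^bsub>H\<^esub> t y"
    and S: "finite S" "S \<subseteq> t ` carrier G"
    and ker: "finite {x \<in> carrier G. t x = \<zero>\<^bsub>H\<^esub>}"
  shows "finite {x \<in> carrier G. t x \<in> S} \<and>
    card {x \<in> carrier G. t x \<in> S} = card S * card {x \<in> carrier G. t x = \<zero>\<^bsub>H\<^esub>}"
proof (rule card_eq_fibres[where f = t])
  interpret G: abelian_group G by fact
  interpret H: abelian_group H by fact
  let ?K = "{x \<in> carrier G. t x = \<zero>\<^bsub>H\<^esub>}"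
  show "finite S" by fact
  show "t ` {x \<in> carrier G. t x \<in> S} \<subseteq> S" by auto
  fix s assume s: "s \<in> S"
  then obtain x0 where x0: "x0 \<in> carrier G" "s = t x0" using S by auto
  have tm: "t (\<ominus>\<^bsub>G\<^esub> x) = \<ominus>\<^bsub>H\<^esub> t x" if "x \<in> carrier G" for x
  proof -
    have z: "t \<zero>\<^bsub>G\<^esub> = \<zero>\<^bsub>H\<^esub>"
      using add[of "\<zero>\<^bsub>G\<^esub>" "\<zero>\<^bsub>G\<^esub>"] t by (metis G.l_zero G.zero_closed H.add.l_cancel_one PiE)
    have "t (\<ominus>\<^bsub>G\<^esub> x) \<oplus>\<^bsub>H\<^esub> t x = \<zero>\<^bsub>H\<^esub>"
      using add[of "\<ominus>\<^bsub>G\<^esub> x" x] that z by (simp add: G.l_neg)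
    moreover have "t (\<ominus>\<^bsub>G\<^esub> x) \<in> carrier H" "t x \<in> carrier H" using that t by auto
    ultimately show ?thesis using H.minus_equality by simp
  qed
  have "bij_betw (\<lambda>x. x \<oplus>\<^bsub>G\<^esub> x0) ?K {x \<in> {x \<in> carrier G. t x \<in> S}. t x = s}"
  proof (rule bij_betwI[where g = "\<lambda>x. x \<oplus>\<^bsub>G\<^esub> (\<ominus>\<^bsub>G\<^esub> x0)"])
    have t0: "t x0 \<in> carrier H" using x0 t by auto
    show "(\<lambda>x. x \<oplus>\<^bsub>G\<^esub> x0) \<in> ?K \<rightarrow> {x \<in> {x \<in> carrier G. t x \<in> S}. t x = s}"
      using x0 s add t0 by auto
    show "(\<lambda>x. x \<oplus>\<^bsub>G\<^esub> (\<ominus>\<^bsub>G\<^esub> x0)) \<in> {x \<in> {x \<in> carrier G. t x \<in> S}. t x = s} \<rightarrow> ?K"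
      using x0 add t0 tm by (auto simp: H.r_neg)
  qed (use x0 in \<open>auto simp: G.a_assoc G.r_neg G.l_neg\<close>)
  from bij_betw_finite[OF this] bij_betw_same_card[OF this]
  show "finite {x \<in> {x \<in> carrier G. t x \<in> S}. t x = s} \<and>
      card {x \<in> {x \<in> carrier G. t x \<in> S}. t x = s} = card ?K"
    using ker by simp
qed

text \<open>Polynomials of the library are lists with the leading coefficient first; the sums used
below run upwards from the constant term.\<close>

lemma (in ring) eval_map_rev_upt:
  assumes "\<And>i. i \<le> N \<Longrightarrow> d i \<in> carrier R" "x \<in> carrier R"
  shows "eval (map d (rev [0..<Suc N])) x = (\<Oplus>i\<in>{..N}. d i \<otimes> x [^] i)"
  using assms(1)
proof (induction N)
  case 0 show ?case using 0 assms(2) by simp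
next
  case (Suc N)
  have "eval (map d (rev [0..<Suc (Suc N)])) x
      = d (Suc N) \<otimes> x [^] (Suc N) \<oplus> eval (map d (rev [0..<Suc N])) x"
    by simp
  also have "\<dots> = d (Suc N) \<otimes> x [^] (Suc N) \<oplus> (\<Oplus>i\<in>{..N}. d i \<otimes> x [^] i)"
    using Suc by simp
  also have "\<dots> = (\<Oplus>i\<in>{..Suc N}. d i \<otimes> x [^] i)"
    using Suc.prems assms(2) by (subst finsum_Suc) (auto simp: Pi_def)
  finally show ?case .
qed

lemma (in field) card_roots_le_aux:
  assumes d: "\<And>i. i \<le> N \<Longrightarrow> d i \<in> carrier R" and dN: "d N \<noteq> \<zero>"
  shows "finite {x \<in> carrier R. (\<Oplus>i\<in>{..N}. d i \<otimes> x [^] i) = \<zero>} \<and>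
    card {x \<in> carrier R. (\<Oplus>i\<in>{..N}. d i \<otimes> x [^] i) = \<zero>} \<le> N"
proof -
  let ?p = "map d (rev [0..<Suc N])"
  have p: "?p \<in> carrier (poly_ring R)" "?p \<noteq> []"
    unfolding univ_poly_carrier[symmetric] polynomial_def using d dN by (auto simp: less_Suc_eq_le)
  have "{x \<in> carrier R. (\<Oplus>i\<in>{..N}. d i \<otimes> x [^] i) = \<zero>} = set_mset (roots ?p)"
    using roots_mem_iff_is_root[OF p(1)] eval_map_rev_upt[of N d] d p(2) unfolding is_root_def by auto
  moreover have "card (set_mset (roots ?p)) \<le> size (roots ?p)"
    by (simp add: size_multiset_overloaded_eq) (metis card_eq_sum count_greater_eq_one_iff sum_mono)
  moreover have "size (roots ?p) \<le> N" using size_roots_le_degree[OF p(1)] by simp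
  ultimately show ?thesis by auto
qed

lemma (in field) card_roots_le:
  assumes d: "\<And>i. i \<le> N \<Longrightarrow> d i \<in> carrier R" and nz: "j \<le> N" "d j \<noteq> \<zero>"
  shows "finite {x \<in> carrier R. (\<Oplus>i\<in>{..N}. d i \<otimes> x [^] i) = \<zero>} \<and>
    card {x \<in> carrier R. (\<Oplus>i\<in>{..N}. d i \<otimes> x [^] i) = \<zero>} \<le> N"
proof -
  define M where "M = (GREATEST i. i \<le> N \<and> d i \<noteq> \<zero>)"
  have M: "M \<le> N" "d M \<noteq> \<zero>" using GreatestI_nat[of "\<lambda>i. i \<le> N \<and> d i \<noteq> \<zero>" j N] nz unfolding M_def by auto
  have M': "d i = \<zero>" if "i \<le> N" "i > M" for i
    using Greatest_le_nat[of "\<lambda>i. i \<le> N \<and> d i \<noteq> \<zero>" i N] that unfolding M_def by auto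
  have eq: "(\<Oplus>i\<in>{..N}. d i \<otimes> x [^] i) = (\<Oplus>i\<in>{..M}. d i \<otimes> x [^] i)" if "x \<in> carrier R" for x
    by (rule add.finprod_mono_neutral_cong_right) (use that d M M' in \<open>auto simp: Pi_def\<close>)
  have "{x \<in> carrier R. (\<Oplus>i\<in>{..N}. d i \<otimes> x [^] i) = \<zero>} = {x \<in> carrier R. (\<Oplus>i\<in>{..M}. d i \<otimes> x [^] i) = \<zero>}"
    using eq by auto
  thus ?thesis using card_roots_le_aux[of M d] d M by fastforce
qed

lemma (in algebraically_closed) exists_root_of_sum:
  fixes N :: nat
  assumes d: "\<And>i. i \<le> N \<Longrightarrow> d i \<in> carrier L" and dN: "d N \<noteq> \<zero>" and N: "N > 0"
  obtains x where "x \<in> carrier L" "(\<Oplus>i\<in>{..N}. d i \<otimes> x [^] i) = \<zero>"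
proof -
  let ?p = "map d (rev [0..<Suc N])"
  have p: "?p \<in> carrier (poly_ring L)" "?p \<noteq> []"
    unfolding univ_poly_carrier[symmetric] polynomial_def using d dN by (auto simp: less_Suc_eq_le)
  have "size (roots ?p) = N" using roots_over_carrier[OF p(1)] unfolding splitted_def by simp
  then obtain x where "x \<in># roots ?p" using N by (metis multiset_nonemptyE size_empty less_irrefl)
  hence "x \<in> carrier L" "eval ?p x = \<zero>" using roots_mem_iff_is_root[OF p(1)] unfolding is_root_def by auto
  thus ?thesis using that eval_map_rev_upt[of N d x] d by auto
qed

section \<open>Frobenius\<close>

lemma (in cring) binomial_theorem:
  assumes x: "x \<in> carrier R" and y: "y \<in> carrier R"
  shows "(x \<oplus> y) [^] (n::nat) = (\<Oplus>i\<in>{..n}. add_pow R (n choose i) (x [^] i \<otimes> y [^] (n - i)))"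
proof (induction n)
  case 0 show ?case using assms by simp
next
  case (Suc n)
  let ?T = "\<lambda>i. x [^] Suc i \<otimes> y [^] (n - i)"
  have T: "?T i \<in> carrier R" for i using x y by blast
  have "(x \<oplus> y) [^] (Suc n) = (\<Oplus>i\<in>{..n}. add_pow R (n choose i) (x [^] i \<otimes> y [^] (n - i))) \<otimes> x
      \<oplus> (\<Oplus>i\<in>{..n}. add_pow R (n choose i) (x [^] i \<otimes> y [^] (n - i))) \<otimes> y"
    using Suc x y by (simp add: r_distr)
  also have "(\<Oplus>i\<in>{..n}. add_pow R (n choose i) (x [^] i \<otimes> y [^] (n - i))) \<otimes> x
      = (\<Oplus>i\<in>{..n}. add_pow R (n choose i) (?T i))"
    using x y by (subst finsum_ldistr) (auto intro!: finsum_cong' simp: add_pow_ldistr add_pow_rdistr m_ac)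
  also have "(\<Oplus>i\<in>{..n}. add_pow R (n choose i) (x [^] i \<otimes> y [^] (n - i))) \<otimes> y
      = (\<Oplus>i\<in>{..n}. add_pow R (n choose i) (x [^] i \<otimes> y [^] (Suc n - i)))"
    using x y by (subst finsum_ldistr) (auto intro!: finsum_cong' simp: add_pow_ldistr add_pow_rdistr m_ac Suc_diff_le)
  also have "\<dots> = (\<Oplus>i\<in>{..Suc n}. add_pow R (n choose i) (x [^] i \<otimes> y [^] (Suc n - i)))"
    using x y by (subst finsum_Suc) (auto simp: Pi_def binomial_eq_0)
  also have "\<dots> = (\<Oplus>i\<in>{..n}. add_pow R (n choose Suc i) (?T i)) \<oplus> y [^] Suc n"
    using x y by (subst finsum_Suc2) (auto simp: Pi_def simp del: nat_pow_Suc)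
  finally have "(x \<oplus> y) [^] (Suc n) = (\<Oplus>i\<in>{..n}. add_pow R (n choose i) (?T i))
      \<oplus> ((\<Oplus>i\<in>{..n}. add_pow R (n choose Suc i) (?T i)) \<oplus> y [^] Suc n)" .
  also have "\<dots> = (\<Oplus>i\<in>{..n}. add_pow R (n choose i) (?T i) \<oplus> add_pow R (n choose Suc i) (?T i)) \<oplus> y [^] Suc n"
    using x y T by (subst finsum_addf) (auto simp: Pi_def a_assoc)
  also have "\<dots> = (\<Oplus>i\<in>{..n}. add_pow R (Suc n choose Suc i) (?T i)) \<oplus> y [^] Suc n"
    using x y T by (auto intro!: finsum_cong' arg_cong2[of _ _ _ _ "(\<oplus>)"] simp: add.nat_pow_mult simp del: nat_pow_Suc)
  also have "\<dots> = (\<Oplus>i\<in>{..Suc n}. add_pow R (Suc n choose i) (x [^] i \<otimes> y [^] (Suc n - i)))"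
    using x y by (subst finsum_Suc2) (auto simp: Pi_def simp del: nat_pow_Suc)
  finally show ?case .
qed

lemma (in field) finite_pow_card:
  assumes fin: "finite (carrier R)" and x: "x \<in> carrier R"
  shows "x [^] card (carrier R) = x"
proof (cases "x = \<zero>")
  case True
  have "card (carrier R) \<noteq> 0" using fin zero_closed by auto
  thus ?thesis using True by (simp add: nat_pow_zero)
next
  case False
  interpret G: group "Multiplicative_Group.mult_of R" by (rule field_mult_group)
  have pow: "x [^]\<^bsub>Multiplicative_Group.mult_of R\<^esub> n = x [^] n" for n :: nat
    by (induction n) auto
  have pos: "card (carrier R) > 0" using fin zero_closed card_gt_0_iff by blast
  have "x [^]\<^bsub>Multiplicative_Group.mult_of R\<^esub> (order (Multiplicative_Group.mult_of R)) = \<one>"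
    using G.pow_order_eq_1[of x] False x by simp
  hence "x [^] (order (Multiplicative_Group.mult_of R)) = \<one>" unfolding pow .
  hence "x [^] (card (carrier R) - 1) = \<one>" using order_mult_of[OF fin] by (simp add: order_def)
  hence "x [^] Suc (card (carrier R) - 1) = x" using x by simp
  thus ?thesis using pos by simp
qed

text \<open>The binomial expansion of \<open>(x + 1)\<^sup>q = x + 1\<close> is a polynomial identity of degree below \<open>q\<close> satisfied
by all \<open>q\<close> elements of the field, so its coefficients vanish.\<close>

lemma (in field) choose_card_eq_zero:
  assumes fin: "finite (carrier R)" and i: "0 < i" "i < card (carrier R)"
  shows "add_pow R (card (carrier R) choose i) \<one> = \<zero>"
proof (rule ccontr)
  assume nz: "add_pow R (card (carrier R) choose i) \<one> \<noteq> \<zero>"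
  let ?q = "card (carrier R)"
  define d where "d = (\<lambda>i. if 0 < i then add_pow R (?q choose i) \<one> else \<zero>)"
  have d: "d i \<in> carrier R" for i by (simp add: d_def)
  obtain N where N: "?q = Suc N" using i by (cases "?q") auto
  have "(\<Oplus>i\<in>{..N}. d i \<otimes> x [^] i) = \<zero>" if x: "x \<in> carrier R" for x
  proof -
    have "x \<oplus> \<one> = (x \<oplus> \<one>) [^] ?q" using finite_pow_card[OF fin] x by simp
    also have "\<dots> = (\<Oplus>i\<in>{..Suc N}. add_pow R (?q choose i) (x [^] i))"
      using binomial_theorem[OF x one_closed, of ?q] x N by simp
    also have "\<dots> = x [^] ?q \<oplus> (\<Oplus>i\<in>{..N}. add_pow R (?q choose i) (x [^] i))"
      using x by (subst finsum_Suc) (auto simp: Pi_def N)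
    also have "x [^] ?q = x" using finite_pow_card[OF fin x] .
    also have "(\<Oplus>i\<in>{..N}. add_pow R (?q choose i) (x [^] i))
        = (\<Oplus>i\<in>{..N}. d i \<otimes> x [^] i \<oplus> (if i = 0 then \<one> else \<zero>))"
      using x by (intro finsum_cong') (auto simp: d_def add_pow_ldistr)
    also have "\<dots> = (\<Oplus>i\<in>{..N}. d i \<otimes> x [^] i) \<oplus> (\<Oplus>i\<in>{..N}. if i = 0 then \<one> else \<zero>)"
      using x d by (intro finsum_addf) auto
    also have "(\<Oplus>i\<in>{..N}. if i = 0 then \<one> else \<zero>) = \<one>"
      using finsum_singleton[of 0 "{..N}" "\<lambda>_. \<one>"] by (simp add: eq_commute)
    finally have "x \<oplus> \<one> = x \<oplus> ((\<Oplus>i\<in>{..N}. d i \<otimes> x [^] i) \<oplus> \<one>)" .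
    moreover have "(\<Oplus>i\<in>{..N}. d i \<otimes> x [^] i) \<in> carrier R" using x d by (intro finsum_closed) auto
    moreover define s where "s = (\<Oplus>i\<in>{..N}. d i \<otimes> x [^] i)"
    ultimately have s: "s \<in> carrier R" "x \<oplus> \<one> = x \<oplus> (s \<oplus> \<one>)" by simp_all
    hence "\<zero> \<oplus> \<one> = s \<oplus> \<one>" using x add.l_cancel[of x "\<one>" "s \<oplus> \<one>"] by simp
    hence "s = \<zero>" using s add.r_cancel[of "\<one>" "\<zero>" s] by simp
    thus ?thesis unfolding s_def .
  qed
  hence "{x \<in> carrier R. (\<Oplus>i\<in>{..N}. d i \<otimes> x [^] i) = \<zero>} = carrier R" by auto
  moreover have "card {x \<in> carrier R. (\<Oplus>i\<in>{..N}. d i \<otimes> x [^] i) = \<zero>} \<le> N"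
    using card_roots_le[of N d i] d nz i N by (auto simp: d_def)
  ultimately show False using N by simp
qed

text \<open>The inner binomial coefficients vanish already in \<open>K\<close>.\<close>

lemma frobenius_add:
  assumes K: "field K" "finite (carrier K)" and R: "cring R" and h: "h \<in> ring_hom K R"
    and xy: "x \<in> carrier R" "y \<in> carrier R"
  shows "(x \<oplus>\<^bsub>R\<^esub> y) [^]\<^bsub>R\<^esub> card (carrier K) = x [^]\<^bsub>R\<^esub> card (carrier K) \<oplus>\<^bsub>R\<^esub> y [^]\<^bsub>R\<^esub> card (carrier K)"
proof -
  interpret K: field K by fact
  interpret R: cring R by fact
  interpret h: ring_hom_cring K R h using h by unfold_locales
  let ?q = "card (carrier K)"
  have h_pow: "h (add_pow K n \<one>\<^bsub>K\<^esub>) = add_pow R n \<one>\<^bsub>R\<^esub>" for n :: nat by (induction n) auto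
  have zero: "[(?q choose i)] \<cdot>\<^bsub>R\<^esub> z = \<zero>\<^bsub>R\<^esub>" if "0 < i" "i < ?q" "z \<in> carrier R" for i z
  proof -
    have "[(?q choose i)] \<cdot>\<^bsub>R\<^esub> \<one>\<^bsub>R\<^esub> = \<zero>\<^bsub>R\<^esub>"
      using K.choose_card_eq_zero[OF K(2) that(1,2)] h_pow[of "?q choose i"] by simp
    hence "([(?q choose i)] \<cdot>\<^bsub>R\<^esub> \<one>\<^bsub>R\<^esub>) \<otimes>\<^bsub>R\<^esub> z = \<zero>\<^bsub>R\<^esub>" using that by simp
    thus ?thesis using that R.add_pow_ldistr[of "\<one>\<^bsub>R\<^esub>" z "?q choose i"] by simp
  qed
  have "card {\<zero>\<^bsub>K\<^esub>, \<one>\<^bsub>K\<^esub>} \<le> ?q" using K(2) by (intro card_mono) auto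
  hence "?q \<ge> 2" using K.one_not_zero by (simp add: card_insert_if)
  then obtain N where N: "?q = Suc (Suc N)" by (metis add_2_eq_Suc le_Suc_ex)
  let ?f = "\<lambda>i. [(?q choose i)] \<cdot>\<^bsub>R\<^esub> (x [^]\<^bsub>R\<^esub> i \<otimes>\<^bsub>R\<^esub> y [^]\<^bsub>R\<^esub> (?q - i))"
  have f: "?f \<in> UNIV \<rightarrow> carrier R" using xy by auto
  have "(x \<oplus>\<^bsub>R\<^esub> y) [^]\<^bsub>R\<^esub> ?q = finsum R ?f {..Suc (Suc N)}"
    using R.binomial_theorem[OF xy, of ?q] N by simp
  also have "\<dots> = ?f ?q \<oplus>\<^bsub>R\<^esub> finsum R ?f {..Suc N}"
    using f by (subst R.finsum_Suc) (auto simp: N simp del: binomial_Suc_Suc)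
  also have "finsum R ?f {..Suc N} = finsum R (\<lambda>i. ?f (Suc i)) {..N} \<oplus>\<^bsub>R\<^esub> ?f 0"
    using f by (subst R.finsum_Suc2) auto
  also have "finsum R (\<lambda>i. ?f (Suc i)) {..N} = finsum R (\<lambda>i. \<zero>\<^bsub>R\<^esub>) {..N}"
    using zero N xy by (intro R.finsum_cong') (auto simp del: binomial_Suc_Suc)
  also have "?f ?q \<oplus>\<^bsub>R\<^esub> (finsum R (\<lambda>i. \<zero>\<^bsub>R\<^esub>) {..N} \<oplus>\<^bsub>R\<^esub> ?f 0) = x [^]\<^bsub>R\<^esub> ?q \<oplus>\<^bsub>R\<^esub> y [^]\<^bsub>R\<^esub> ?q"
    using xy by (simp add: R.finsum_zero)
  finally show ?thesis .
qed

section \<open>Additive polynomials over an algebraically closed field\<close>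

text \<open>The additive polynomial \<open>\<Sum> c\<^sub>i \<tau>\<^sup>i\<close>, evaluated at \<open>x\<close>.\<close>

definition qpoly :: "('l, 'x) ring_scheme \<Rightarrow> nat \<Rightarrow> nat \<Rightarrow> (nat \<Rightarrow> 'l) \<Rightarrow> 'l \<Rightarrow> 'l" where
  "qpoly L q n c x = (\<Oplus>\<^bsub>L\<^esub>i\<in>{..n}. c i \<otimes>\<^bsub>L\<^esub> x [^]\<^bsub>L\<^esub> (q ^ i))"

locale frobenius_ring = cring L for L (structure) +
  fixes q :: nat
  assumes q_ge_2: "q \<ge> 2"
    and frob_add: "x \<in> carrier L \<Longrightarrow> y \<in> carrier L \<Longrightarrow> (x \<oplus> y) [^] q = x [^] q \<oplus> y [^] q"
begin

lemma frob_pow_add: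
  assumes "x \<in> carrier L" "y \<in> carrier L"
  shows "(x \<oplus> y) [^] (q ^ i) = x [^] (q ^ i) \<oplus> y [^] (q ^ i)"
proof (induction i)
  case (Suc i)
  have p: "z [^] (q ^ Suc i) = (z [^] (q ^ i)) [^] q" if "z \<in> carrier L" for z
    using that by (simp add: nat_pow_pow mult.commute)
  show ?case using Suc assms p frob_add by simp
qed (use assms in simp)

lemma frob_pow_sum:
  assumes "finite I" "f \<in> I \<rightarrow> carrier L"
  shows "(\<Oplus>i\<in>I. f i) [^] (q ^ k) = (\<Oplus>i\<in>I. f i [^] (q ^ k))"
  using assms
proof (induction I)
  case empty
  have "q ^ k \<noteq> 0" using q_ge_2 by simp
  thus ?case by (simp add: nat_pow_zero)
next
  case (insert i I)
  thus ?case by (simp add: frob_pow_add Pi_def)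
qed

lemma qpoly_closed:
  assumes "\<And>i. i \<le> n \<Longrightarrow> c i \<in> carrier L" "x \<in> carrier L"
  shows "qpoly L q n c x \<in> carrier L"
  unfolding qpoly_def using assms by (auto intro: finsum_closed)

lemma qpoly_add:
  assumes c: "\<And>i. i \<le> n \<Longrightarrow> c i \<in> carrier L" and xy: "x \<in> carrier L" "y \<in> carrier L"
  shows "qpoly L q n c (x \<oplus> y) = qpoly L q n c x \<oplus> qpoly L q n c y"
proof -
  have "qpoly L q n c (x \<oplus> y) = (\<Oplus>i\<in>{..n}. c i \<otimes> x [^] (q ^ i) \<oplus> c i \<otimes> y [^] (q ^ i))"
    unfolding qpoly_def using c xy by (intro finsum_cong') (auto simp: frob_pow_add r_distr)
  thus ?thesis unfolding qpoly_def using c xy by (subst (asm) finsum_addf) auto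
qed

lemma qpoly_Suc:
  assumes "\<And>i. i \<le> Suc n \<Longrightarrow> c i \<in> carrier L" "x \<in> carrier L"
  shows "qpoly L q (Suc n) c x = qpoly L q n c x \<oplus> c (Suc n) \<otimes> x [^] (q ^ Suc n)"
proof -
  have "(\<Oplus>i\<in>{..n}. c i \<otimes> x [^] (q ^ i)) \<in> carrier L" using assms by (auto intro: finsum_closed)
  thus ?thesis unfolding qpoly_def using assms by (subst finsum_Suc) (auto simp: a_comm)
qed

lemma qpoly_cong:
  assumes "\<And>i. i \<le> n \<Longrightarrow> c i \<in> carrier L" "x \<in> carrier L" "\<And>i. i \<le> n \<Longrightarrow> c i = d i"
  shows "qpoly L q n c x = qpoly L q n d x"
proof -
  have "d i \<in> carrier L" if "i \<le> n" for i using assms(1,3) that by metis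
  thus ?thesis unfolding qpoly_def using assms by (intro finsum_cong') auto
qed

lemma inj_qpow: "inj_on (\<lambda>i. q ^ i) A"
  using q_ge_2 by (auto simp: inj_on_def power_inject_exp)

text \<open>Rewriting in terms of all powers of \<open>x\<close> makes the results on roots of polynomials
applicable.\<close>

lemma qpoly_as_poly:
  assumes c: "\<And>i. i \<le> n \<Longrightarrow> c i \<in> carrier L"
  obtains d where "\<And>j. d j \<in> carrier L" "d 0 = \<zero>" "\<And>i. i \<le> n \<Longrightarrow> d (q ^ i) = c i"
    "\<And>x. x \<in> carrier L \<Longrightarrow> (\<Oplus>j\<in>{..q ^ n}. d j \<otimes> x [^] j) = qpoly L q n c x"
proof -
  define P where "P = (\<lambda>i. q ^ i) ` {..n}"
  define d where "d = (\<lambda>j. if j \<in> P then c (the_inv_into {..n} (\<lambda>i. q ^ i) j) else \<zero>)"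
  have dq: "d (q ^ i) = c i" if "i \<le> n" for i
    unfolding d_def P_def using that the_inv_into_f_f[OF inj_qpow, of i "{..n}"] by auto
  have d: "d j \<in> carrier L" for j
  proof (cases "j \<in> P")
    case True
    then obtain i where "i \<le> n" "j = q ^ i" unfolding P_def by auto
    thus ?thesis using dq c by simp
  qed (simp add: d_def)
  have d0: "d 0 = \<zero>"
  proof -
    have "0 \<notin> P" using q_ge_2 unfolding P_def by auto
    thus ?thesis by (simp add: d_def)
  qed
  have "(\<Oplus>j\<in>{..q ^ n}. d j \<otimes> x [^] j) = qpoly L q n c x" if x: "x \<in> carrier L" for x
  proof -
    have sub: "P \<subseteq> {..q ^ n}" unfolding P_def using q_ge_2 by (auto intro: power_increasing)
    have out: "d j = \<zero>" if "j \<notin> P" for j using that by (simp add: d_def)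
    have "(\<Oplus>j\<in>{..q ^ n}. d j \<otimes> x [^] j) = (\<Oplus>j\<in>P. d j \<otimes> x [^] j)"
      by (rule add.finprod_mono_neutral_cong_right) (use x d sub out in auto)
    also have "\<dots> = (\<Oplus>i\<in>{..n}. d (q ^ i) \<otimes> x [^] (q ^ i))"
      unfolding P_def by (rule finsum_reindex) (use inj_qpow x d in auto)
    also have "\<dots> = qpoly L q n c x"
      unfolding qpoly_def using x c dq by (intro finsum_cong') auto
    finally show ?thesis .
  qed
  thus ?thesis using that d d0 dq by blast
qed

text \<open>Right division by \<open>\<tau> - b\<close>, leaving a constant remainder.\<close>

lemma qpoly_right_division:
  assumes b: "b \<in> carrier L" and c: "\<And>i. i \<le> Suc n \<Longrightarrow> c i \<in> carrier L"
  shows "\<exists>g. (\<forall>i\<le>n. g i \<in> carrier L) \<and> g n = c (Suc n) \<and>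
    (\<forall>x\<in>carrier L. qpoly L q (Suc n) c x
       = qpoly L q n g (x [^] q \<ominus> b \<otimes> x) \<oplus> (c 0 \<oplus> g 0 \<otimes> b) \<otimes> x)"
  using c
proof (induction n arbitrary: c)
  case 0
  have "qpoly L q (Suc 0) c x = qpoly L q 0 (\<lambda>_. c (Suc 0)) (x [^] q \<ominus> b \<otimes> x) \<oplus> (c 0 \<oplus> c (Suc 0) \<otimes> b) \<otimes> x"
    if x: "x \<in> carrier L" for x
  proof -
    have C: "c 0 \<in> carrier L" "c (Suc 0) \<in> carrier L" "x [^] q \<in> carrier L" using 0 x by auto
    have "qpoly L q (Suc 0) c x = c 0 \<otimes> x \<oplus> c (Suc 0) \<otimes> x [^] q"
      using 0 x by (subst qpoly_Suc) (auto simp: qpoly_def)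
    also have "\<dots> = c (Suc 0) \<otimes> (x [^] q \<ominus> b \<otimes> x) \<oplus> (c 0 \<oplus> c (Suc 0) \<otimes> b) \<otimes> x"
      using C b x by algebra
    finally show ?thesis using C x b by (simp add: qpoly_def)
  qed
  thus ?case using 0 by (intro exI[of _ "\<lambda>_. c (Suc 0)"]) auto
next
  case (Suc n)
  let ?b = "b [^] (q ^ Suc n)" and ?e = "c (Suc (Suc n))"
  define c' where "c' = (\<lambda>i. if i = Suc n then c (Suc n) \<oplus> ?e \<otimes> ?b else c i)"
  have c': "c' i \<in> carrier L" if "i \<le> Suc n" for i
    using that Suc.prems b by (auto simp: c'_def)
  from Suc.IH[of c', OF c'] obtain g where g: "\<And>i. i \<le> n \<Longrightarrow> g i \<in> carrier L" "g n = c' (Suc n)"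
    and gx: "\<And>x. x \<in> carrier L \<Longrightarrow> qpoly L q (Suc n) c' x
       = qpoly L q n g (x [^] q \<ominus> b \<otimes> x) \<oplus> (c' 0 \<oplus> g 0 \<otimes> b) \<otimes> x" by blast
  define g' where "g' = g(Suc n := ?e)"
  have g': "g' i \<in> carrier L" if "i \<le> Suc n" for i
    using that g Suc.prems by (auto simp: g'_def)
  have "qpoly L q (Suc (Suc n)) c x
       = qpoly L q (Suc n) g' (x [^] q \<ominus> b \<otimes> x) \<oplus> (c 0 \<oplus> g' 0 \<otimes> b) \<otimes> x" if x: "x \<in> carrier L" for x
  proof -
    let ?Q = "q ^ Suc n" and ?y = "x [^] q \<ominus> b \<otimes> x"
    have y: "?y \<in> carrier L" using x b by simp
    have e: "?e \<in> carrier L" "c (Suc n) \<in> carrier L" using Suc.prems by auto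
    have "(?y \<oplus> b \<otimes> x) [^] ?Q = ?y [^] ?Q \<oplus> (b \<otimes> x) [^] ?Q"
      using frob_pow_add[of ?y "b \<otimes> x" "Suc n"] y b x by simp
    moreover have "?y \<oplus> b \<otimes> x = x [^] q" using x b by (simp add: minus_eq a_assoc l_neg)
    ultimately have "(x [^] q) [^] ?Q = ?y [^] ?Q \<oplus> ?b \<otimes> x [^] ?Q"
      using x b by (simp add: nat_pow_distrib)
    hence yQ: "x [^] (q ^ Suc (Suc n)) = ?y [^] ?Q \<oplus> ?b \<otimes> x [^] ?Q"
      using x by (simp add: nat_pow_pow)
    have cl: "qpoly L q n c x \<in> carrier L" "qpoly L q n g ?y \<in> carrier L" "x [^] ?Q \<in> carrier L"
      "?y [^] ?Q \<in> carrier L" "?b \<in> carrier L" "g 0 \<in> carrier L" "c 0 \<in> carrier L"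
      using Suc.prems x y g b by (auto intro!: qpoly_closed)
    have n0: "c' 0 = c 0" "g' 0 = g 0" by (auto simp: c'_def g'_def)
    have 1: "qpoly L q (Suc n) c' x = qpoly L q n c x \<oplus> (c (Suc n) \<oplus> ?e \<otimes> ?b) \<otimes> x [^] ?Q"
    proof -
      have "qpoly L q n c' x = qpoly L q n c x"
        by (rule qpoly_cong[OF c' x]) (simp_all add: c'_def)
      thus ?thesis using qpoly_Suc[of n c' x, OF c' x] by (simp add: c'_def)
    qed
    have 2: "qpoly L q (Suc n) g' ?y = qpoly L q n g ?y \<oplus> ?e \<otimes> ?y [^] ?Q"
    proof -
      have "qpoly L q n g' ?y = qpoly L q n g ?y"
        by (rule qpoly_cong[OF g' y]) (simp_all add: g'_def)
      thus ?thesis using qpoly_Suc[of n g' ?y, OF g' y] by (simp add: g'_def)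
    qed
    have "qpoly L q (Suc (Suc n)) c x
        = (qpoly L q n c x \<oplus> c (Suc n) \<otimes> x [^] ?Q) \<oplus> ?e \<otimes> (?y [^] ?Q \<oplus> ?b \<otimes> x [^] ?Q)"
      using qpoly_Suc[of "Suc n" c x] qpoly_Suc[of n c x] Suc.prems x yQ by simp
    also have "\<dots> = (qpoly L q n c x \<oplus> (c (Suc n) \<oplus> ?e \<otimes> ?b) \<otimes> x [^] ?Q) \<oplus> ?e \<otimes> ?y [^] ?Q"
      using cl e by algebra
    also have "\<dots> = (qpoly L q n g ?y \<oplus> (c 0 \<oplus> g 0 \<otimes> b) \<otimes> x) \<oplus> ?e \<otimes> ?y [^] ?Q"
      using 1 gx[OF x] n0 by simp
    also have "\<dots> = (qpoly L q n g ?y \<oplus> ?e \<otimes> ?y [^] ?Q) \<oplus> (c 0 \<oplus> g 0 \<otimes> b) \<otimes> x"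
      using cl e x b by algebra
    finally show ?thesis using 2 n0 by simp
  qed
  moreover have "g' (Suc n) = ?e" by (simp add: g'_def)
  ultimately show ?case using g' by blast
qed

end

text \<open>The subfield with \<open>q\<close> elements is the set of solutions of \<open>x\<^sup>q = x\<close>; only its size enters.\<close>

locale frobenius_closed = algebraically_closed L + frobenius_ring L q for L (structure) and q :: nat +
  assumes card_fixed: "card {x \<in> carrier L. x [^] q = x} = q"
begin

lemma qpoly_surj:
  assumes c: "\<And>i. i \<le> n \<Longrightarrow> c i \<in> carrier L" "c n \<noteq> \<zero>" and b: "b \<in> carrier L"
  obtains x where "x \<in> carrier L" "qpoly L q n c x = b"
proof -
  obtain d where d: "\<And>j. d j \<in> carrier L" "d 0 = \<zero>" "\<And>i. i \<le> n \<Longrightarrow> d (q ^ i) = c i"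
    "\<And>x. x \<in> carrier L \<Longrightarrow> (\<Oplus>j\<in>{..q ^ n}. d j \<otimes> x [^] j) = qpoly L q n c x"
    using qpoly_as_poly[of n c] c by blast
  obtain N where N: "q ^ n = Suc N" using q_ge_2 by (cases "q ^ n") auto
  define d' where "d' = d(0 := \<ominus> b)"
  have d': "d' j \<in> carrier L" for j using d b by (simp add: d'_def)
  have "d' (q ^ n) \<noteq> \<zero>" using d(3)[of n] c N by (simp add: d'_def)
  then obtain x where x: "x \<in> carrier L" "(\<Oplus>j\<in>{..q ^ n}. d' j \<otimes> x [^] j) = \<zero>"
    using exists_root_of_sum[of "q ^ n" d'] d' N by auto
  have s: "(\<Oplus>j\<in>{..N}. d (Suc j) \<otimes> x [^] Suc j) \<in> carrier L"
    using d x by (auto intro!: finsum_closed)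
  have "(\<Oplus>j\<in>{..q ^ n}. d' j \<otimes> x [^] j) = (\<Oplus>j\<in>{..N}. d (Suc j) \<otimes> x [^] Suc j) \<oplus> \<ominus> b"
    unfolding N using x d' b by (subst finsum_Suc2) (auto simp: d'_def simp del: nat_pow_Suc)
  moreover have "(\<Oplus>j\<in>{..q ^ n}. d j \<otimes> x [^] j) = (\<Oplus>j\<in>{..N}. d (Suc j) \<otimes> x [^] Suc j)"
    unfolding N using x d s by (subst finsum_Suc2) (auto simp: d(2) simp del: nat_pow_Suc)
  ultimately have "qpoly L q n c x \<oplus> \<ominus> b = \<zero>" using x d(4) by simp
  hence "qpoly L q n c x = b"
    using qpoly_closed[of n c x] c x b r_right_minus_eq[of "qpoly L q n c x" b] by (simp add: minus_eq)
  thus ?thesis using that x by blast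
qed

text \<open>The roots are the multiples of \<open>\<beta>\<close> by solutions of \<open>z\<^sup>q = z\<close>.\<close>

lemma card_twisted_fixed:
  assumes b: "\<beta> \<in> carrier L" "\<beta> \<noteq> \<zero>"
  shows "card {x \<in> carrier L. x [^] q \<ominus> \<beta> [^] (q - 1) \<otimes> x = \<zero>} = q"
proof -
  let ?b = "\<beta> [^] (q - 1)"
  have bq: "?b \<otimes> \<beta> = \<beta> [^] q" using q_ge_2 by (metis One_nat_def Suc_pred' less_le_trans nat_pow_Suc pos2)
  have inv: "inv \<beta> \<in> carrier L" "inv \<beta> \<otimes> \<beta> = \<one>" "\<beta> \<otimes> inv \<beta> = \<one>" using b field_Units by auto
  have iff: "x [^] q \<ominus> ?b \<otimes> x = \<zero> \<longleftrightarrow> x [^] q = ?b \<otimes> x" if "x \<in> carrier L" for x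
    using that b by (intro r_right_minus_eq) auto
  have "bij_betw (\<lambda>z. \<beta> \<otimes> z) {z \<in> carrier L. z [^] q = z}
    {x \<in> carrier L. x [^] q \<ominus> ?b \<otimes> x = \<zero>}"
  proof (rule bij_betwI[where g = "\<lambda>x. inv \<beta> \<otimes> x"])
    show "(\<lambda>z. \<beta> \<otimes> z) \<in> {z \<in> carrier L. z [^] q = z} \<rightarrow> {x \<in> carrier L. x [^] q \<ominus> ?b \<otimes> x = \<zero>}"
    proof
      fix z assume "z \<in> {z \<in> carrier L. z [^] q = z}"
      hence z: "z \<in> carrier L" "z [^] q = z" by auto
      have "(\<beta> \<otimes> z) [^] q = \<beta> [^] q \<otimes> z" using z b by (simp add: nat_pow_distrib)
      also have "\<dots> = ?b \<otimes> (\<beta> \<otimes> z)" using bq z b by (metis m_assoc nat_pow_closed)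
      finally show "\<beta> \<otimes> z \<in> {x \<in> carrier L. x [^] q \<ominus> ?b \<otimes> x = \<zero>}" using iff z b by simp
    qed
    show "(\<lambda>x. inv \<beta> \<otimes> x) \<in> {x \<in> carrier L. x [^] q \<ominus> ?b \<otimes> x = \<zero>} \<rightarrow> {z \<in> carrier L. z [^] q = z}"
    proof
      fix x assume "x \<in> {x \<in> carrier L. x [^] q \<ominus> ?b \<otimes> x = \<zero>}"
      hence x: "x \<in> carrier L" "x [^] q = ?b \<otimes> x" using iff by auto
      have "\<beta> \<otimes> x [^] q = \<beta> [^] q \<otimes> x" using x bq b
        by (metis m_assoc m_comm nat_pow_closed)
      hence "(inv \<beta>) [^] q \<otimes> (\<beta> \<otimes> x [^] q) = (inv \<beta>) [^] q \<otimes> (\<beta> [^] q \<otimes> x)" by simp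
      also have "\<dots> = ((inv \<beta>) \<otimes> \<beta>) [^] q \<otimes> x" using x b inv(1) by (simp add: nat_pow_distrib m_assoc)
      finally have "\<beta> \<otimes> (inv \<beta> \<otimes> x) [^] q = x" using x b inv by (simp add: nat_pow_distrib m_lcomm)
      hence "inv \<beta> \<otimes> x = inv \<beta> \<otimes> (\<beta> \<otimes> (inv \<beta> \<otimes> x) [^] q)" by simp
      also have "\<dots> = (inv \<beta> \<otimes> x) [^] q" using x b inv by (simp add: m_assoc[symmetric])
      finally show "inv \<beta> \<otimes> x \<in> {z \<in> carrier L. z [^] q = z}" using x inv by simp
    qed
  qed (use b inv in \<open>auto simp: m_assoc[symmetric]\<close>)
  from bij_betw_same_card[OF this] show ?thesis using card_fixed by simp
qed

text \<open>By induction on \<open>n\<close>: a nonzero root \<open>\<beta>\<close> exists because the constant coefficient is nonzero, and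
right division by \<open>\<tau> - \<beta>\<^sup>q\<^sup>-\<^sup>1\<close> factors the polynomial through a surjective map with \<open>q\<close> elements in the kernel.\<close>

lemma card_ker_separable:
  assumes "\<And>i. i \<le> n \<Longrightarrow> c i \<in> carrier L" "c n \<noteq> \<zero>" "c 0 \<noteq> \<zero>"
  shows "card {x \<in> carrier L. qpoly L q n c x = \<zero>} = q ^ n"
  using assms
proof (induction n arbitrary: c)
  case 0
  have "{x \<in> carrier L. qpoly L q 0 c x = \<zero>} = {\<zero>}"
    using 0 integral_iff by (auto simp: qpoly_def)
  thus ?case by simp
next
  case (Suc n)
  obtain d where d: "\<And>j. d j \<in> carrier L" "d 0 = \<zero>" "\<And>i. i \<le> Suc n \<Longrightarrow> d (q ^ i) = c i"
    "\<And>x. x \<in> carrier L \<Longrightarrow> (\<Oplus>j\<in>{..q ^ Suc n}. d j \<otimes> x [^] j) = qpoly L q (Suc n) c x"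
    using qpoly_as_poly[of "Suc n" c] Suc.prems by blast
  have "1 < q ^ Suc n" using q_ge_2 by (intro one_less_power) auto
  then obtain N where N: "q ^ Suc n = Suc N" "N > 0" by (cases "q ^ Suc n") auto
  obtain \<beta> where \<beta>0: "\<beta> \<in> carrier L" "(\<Oplus>j\<in>{..N}. d (Suc j) \<otimes> \<beta> [^] j) = \<zero>"
    using exists_root_of_sum[of N "\<lambda>j. d (Suc j)"] d(1) d(3)[of "Suc n"] Suc.prems(2) N by auto
  have \<beta>: "\<beta> \<noteq> \<zero>"
  proof
    assume "\<beta> = \<zero>"
    hence "(\<Oplus>j\<in>{..N}. d (Suc j) \<otimes> \<beta> [^] j) = (\<Oplus>j\<in>{..N}. if 0 = j then d (Suc 0) else \<zero>)"
      using d by (intro finsum_cong') (auto simp: nat_pow_zero)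
    also have "\<dots> = d (Suc 0)" using finsum_singleton[of 0 "{..N}" "\<lambda>_. d (Suc 0)"] d by simp
    finally show False using \<beta>0 d(3)[of 0] Suc.prems(3) by simp
  qed
  have root: "qpoly L q (Suc n) c \<beta> = \<zero>"
  proof -
    have "qpoly L q (Suc n) c \<beta> = (\<Oplus>j\<in>{..N}. d (Suc j) \<otimes> \<beta> [^] Suc j) \<oplus> d 0 \<otimes> \<beta> [^] (0::nat)"
      unfolding d(4)[OF \<beta>0(1), symmetric] N(1) using d \<beta>0 by (subst finsum_Suc2) (auto simp del: nat_pow_Suc)
    also have "\<dots> = (\<Oplus>j\<in>{..N}. d (Suc j) \<otimes> \<beta> [^] j \<otimes> \<beta>)"
      using d \<beta>0 by (simp add: m_assoc finsum_closed)
    also have "\<dots> = (\<Oplus>j\<in>{..N}. d (Suc j) \<otimes> \<beta> [^] j) \<otimes> \<beta>"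
      using d \<beta>0 by (subst finsum_ldistr) auto
    finally show ?thesis using \<beta>0 by simp
  qed
  let ?b = "\<beta> [^] (q - 1)"
  let ?t = "\<lambda>x. x [^] q \<ominus> ?b \<otimes> x"
  obtain g where g: "\<And>i. i \<le> n \<Longrightarrow> g i \<in> carrier L" "g n = c (Suc n)"
    and gx: "\<And>x. x \<in> carrier L \<Longrightarrow> qpoly L q (Suc n) c x
       = qpoly L q n g (?t x) \<oplus> (c 0 \<oplus> g 0 \<otimes> ?b) \<otimes> x"
    using qpoly_right_division[of ?b n c] Suc.prems \<beta>0 by auto
  have c0: "c 0 \<in> carrier L" and g0: "g 0 \<in> carrier L" using Suc.prems g by auto
  have bq: "?b \<otimes> \<beta> = \<beta> [^] q" using q_ge_2 by (metis One_nat_def Suc_pred' less_le_trans nat_pow_Suc pos2)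
  have t\<beta>: "?t \<beta> = \<zero>" using bq \<beta>0 by (simp add: r_neg minus_eq)
  have q0: "qpoly L q n g \<zero> = \<zero>"
    using qpoly_add[of n g \<zero> \<zero>] qpoly_closed[of n g \<zero>] g by (simp add: add.l_cancel_one)
  have "(c 0 \<oplus> g 0 \<otimes> ?b) \<otimes> \<beta> = \<zero>"
  proof -
    have "(c 0 \<oplus> g 0 \<otimes> ?b) \<otimes> \<beta> \<in> carrier L" using c0 g0 \<beta>0 by simp
    thus ?thesis using gx[OF \<beta>0(1)] unfolding t\<beta> q0 root by (metis l_zero)
  qed
  hence rem: "c 0 \<oplus> g 0 \<otimes> ?b = \<zero>" using integral_iff[of "c 0 \<oplus> g 0 \<otimes> ?b" \<beta>] \<beta> \<beta>0 c0 g0 by auto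
  have g0nz: "g 0 \<noteq> \<zero>" using rem c0 Suc.prems(3) \<beta>0 by auto
  have gxx: "qpoly L q (Suc n) c x = qpoly L q n g (?t x)" if "x \<in> carrier L" for x
    using gx[OF that] rem that qpoly_closed[of n g "?t x"] g \<beta>0 by simp
  let ?S = "{x \<in> carrier L. qpoly L q n g x = \<zero>}"
  have cS: "card ?S = q ^ n" using Suc.IH[of g] g g0nz Suc.prems(2) by auto
  have tq: "?t x = qpoly L q (Suc 0) (\<lambda>i. if i = 0 then \<ominus> ?b else \<one>) x" if "x \<in> carrier L" for x
    using that \<beta>0 by (subst qpoly_Suc) (auto simp: qpoly_def minus_eq l_minus a_comm)
  have "card {x \<in> carrier L. ?t x \<in> ?S} = card ?S * card {x \<in> carrier L. ?t x = \<zero>}"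
  proof (rule conjunct2[OF card_additive_preimage[of L L ?t ?S]])
    show "abelian_group L" "abelian_group L" by unfold_locales
    show "?t \<in> carrier L \<rightarrow> carrier L" using \<beta>0 by auto
    show "?t (x \<oplus> y) = ?t x \<oplus> ?t y" if "x \<in> carrier L" "y \<in> carrier L" for x y
    proof -
      have cl: "x [^] q \<in> carrier L" "y [^] q \<in> carrier L" "?b \<in> carrier L" using that \<beta>0 by auto
      show ?thesis unfolding frob_add[OF that] using cl that by algebra
    qed
    show "finite ?S" using cS q_ge_2 by (intro card_ge_0_finite) auto
    show "?S \<subseteq> ?t ` carrier L"
    proof
      fix s assume "s \<in> ?S"
      hence s: "s \<in> carrier L" by simp
      obtain x where "x \<in> carrier L" "qpoly L q (Suc 0) (\<lambda>i. if i = 0 then \<ominus> ?b else \<one>) x = s"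
        by (rule qpoly_surj[of "Suc 0" "\<lambda>i. if i = 0 then \<ominus> ?b else \<one>" s]) (use s \<beta>0 in auto)
      thus "s \<in> ?t ` carrier L" using tq by force
    qed
    show "finite {x \<in> carrier L. ?t x = \<zero>}"
      using card_twisted_fixed[OF \<beta>0(1) \<beta>] q_ge_2 by (intro card_ge_0_finite) auto
  qed
  moreover have "{x \<in> carrier L. ?t x \<in> ?S} = {x \<in> carrier L. qpoly L q (Suc n) c x = \<zero>}"
    using gxx \<beta>0 by auto
  ultimately show ?case using cS card_twisted_fixed[OF \<beta>0(1) \<beta>] by simp
qed

lemma pow_zero:
  assumes "x \<in> carrier L" "x [^] (k::nat) = \<zero>"
  shows "x = \<zero>"
  using assms(2)
proof (induction k)
  case (Suc k)
  thus ?case using assms(1) integral[of "x [^] k" x] by auto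
qed simp

lemma frob_bij: "bij_betw (\<lambda>x. x [^] (q ^ l)) (carrier L) (carrier L)"
  unfolding bij_betw_def
proof
  show "inj_on (\<lambda>x. x [^] (q ^ l)) (carrier L)"
  proof (rule inj_onI)
    fix x y assume xy: "x \<in> carrier L" "y \<in> carrier L" "x [^] (q ^ l) = y [^] (q ^ l)"
    have "((x \<ominus> y) \<oplus> y) [^] (q ^ l) = (x \<ominus> y) [^] (q ^ l) \<oplus> y [^] (q ^ l)"
      using xy by (intro frob_pow_add) auto
    moreover have "(x \<ominus> y) \<oplus> y = x" using xy by (simp add: minus_eq a_assoc l_neg)
    ultimately have "(x \<ominus> y) [^] (q ^ l) = \<zero>"
      using xy by (metis add.l_cancel_one' add.m_comm minus_closed nat_pow_closed)
    hence "x \<ominus> y = \<zero>" using pow_zero[of "x \<ominus> y" "q ^ l"] xy by auto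
    thus "x = y" using xy by simp
  qed
  show "(\<lambda>x. x [^] (q ^ l)) ` carrier L = carrier L"
  proof
    show "carrier L \<subseteq> (\<lambda>x. x [^] (q ^ l)) ` carrier L"
    proof
      fix b assume b: "b \<in> carrier L"
      obtain x where x: "x \<in> carrier L" "qpoly L q l (\<lambda>i. if i = l then \<one> else \<zero>) x = b"
        by (rule qpoly_surj[of l "\<lambda>i. if i = l then \<one> else \<zero>" b]) (use b in auto)
      have "qpoly L q l (\<lambda>i. if i = l then \<one> else \<zero>) x = (\<Oplus>i\<in>{..l}. if l = i then x [^] (q ^ i) else \<zero>)"
        unfolding qpoly_def using x by (intro finsum_cong') auto
      also have "\<dots> = x [^] (q ^ l)" using x by (subst finsum_singleton) auto
      finally show "b \<in> (\<lambda>x. x [^] (q ^ l)) ` carrier L" using x by force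
    qed
  qed auto
qed

text \<open>A polynomial without coefficients below \<open>l\<close> is a separable one composed with the bijection
\<open>\<tau>\<^sup>l\<close>.\<close>

lemma card_ker_qpoly:
  assumes c: "\<And>i. i \<le> n \<Longrightarrow> c i \<in> carrier L" "c n \<noteq> \<zero>"
    and l: "\<And>i. i < l \<Longrightarrow> c i = \<zero>" "c l \<noteq> \<zero>" "l \<le> n"
  shows "card {x \<in> carrier L. qpoly L q n c x = \<zero>} * q ^ l = q ^ n"
proof -
  let ?g = "\<lambda>i. c (i + l)"
  have "qpoly L q n c x = qpoly L q (n - l) ?g (x [^] (q ^ l))" if x: "x \<in> carrier L" for x
  proof -
    have im: "(\<lambda>i. i + l) ` {..n - l} = {l..n}"
    proof
      show "{l..n} \<subseteq> (\<lambda>i. i + l) ` {..n - l}"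
      proof
        fix j assume "j \<in> {l..n}"
        hence "j = (j - l) + l" "j - l \<in> {..n - l}" by auto
        thus "j \<in> (\<lambda>i. i + l) ` {..n - l}" by (rule image_eqI)
      qed
    qed (use l(3) in auto)
    have "qpoly L q n c x = (\<Oplus>i\<in>{l..n}. c i \<otimes> x [^] (q ^ i))"
      unfolding qpoly_def
      by (rule add.finprod_mono_neutral_cong_right) (use c l x in auto)
    also have "\<dots> = (\<Oplus>i\<in>{..n - l}. c (i + l) \<otimes> x [^] (q ^ (i + l)))"
      unfolding im[symmetric] by (rule finsum_reindex) (use c l x im in auto)
    also have "\<dots> = qpoly L q (n - l) ?g (x [^] (q ^ l))"
      unfolding qpoly_def using c l x
      by (intro finsum_cong') (auto simp: nat_pow_pow power_add mult.commute)
    finally show ?thesis .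
  qed
  hence "{x \<in> carrier L. qpoly L q n c x = \<zero>}
      = {x \<in> carrier L. x [^] (q ^ l) \<in> {y \<in> carrier L. qpoly L q (n - l) ?g y = \<zero>}}" by auto
  moreover have "bij_betw (\<lambda>x. x [^] (q ^ l)) {x \<in> carrier L. x [^] (q ^ l) \<in> {y \<in> carrier L. qpoly L q (n - l) ?g y = \<zero>}}
      {y \<in> carrier L. qpoly L q (n - l) ?g y = \<zero>}"
    using frob_bij[of l] unfolding bij_betw_def inj_on_def by (auto simp: image_iff)
  ultimately have "card {x \<in> carrier L. qpoly L q n c x = \<zero>} = card {y \<in> carrier L. qpoly L q (n - l) ?g y = \<zero>}"
    using bij_betw_same_card by simp
  also have "\<dots> = q ^ (n - l)" using c l by (intro card_ker_separable) auto
  finally show ?thesis using l(3) by (simp add: power_add[symmetric])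
qed

end

section \<open>A discrete valuation on a ring of functions\<close>

lemma nat_pigeonhole:
  assumes "finite Z" "\<And>n::nat. f n \<in> Z"
  obtains i j where "i < j" "f i = f j"
proof -
  have "\<not> inj f" using assms finite_subset[of "range f" Z] finite_imageD[of f UNIV] by auto
  then obtain i j where "i \<noteq> j" "f i = f j" by (auto simp: inj_def)
  thus ?thesis using that by (metis linorder_neqE_nat)
qed

text \<open>The properties of the ring \<open>A\<close> of functions regular away from \<open>\<infinity>\<close>, and of the valuation ring \<open>Ov\<close>,
from which the component of \<open>A/a\<close> at \<open>v\<close> is constructed. The last assumption is integral closedness of \<open>A\<close>, for
the equations that the pigeonhole principle produces.\<close>

locale valued_ring = field F for F :: "'a ring" (structure) +
  fixes A Ov :: "'a set"
  assumes A_subring: "subring A F" and Ov_subring: "subring Ov F" and A_le_Ov: "A \<subseteq> Ov"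
    and Ov_proper: "Ov \<noteq> carrier F"
    and Ov_val: "x \<in> carrier F \<Longrightarrow> x \<noteq> \<zero> \<Longrightarrow> x \<in> Ov \<or> inv x \<in> Ov"
    and A_integral: "z \<in> carrier F \<Longrightarrow> y \<in> A \<Longrightarrow> i < j \<Longrightarrow> z [^] (j::nat) = z [^] i \<oplus> y \<Longrightarrow> z \<in> A"
begin

abbreviation \<mm> where "\<mm> \<equiv> place_ideal F Ov"
abbreviation \<pp> where "\<pp> \<equiv> A \<inter> \<mm>"

lemma A_carr [simp]: "x \<in> A \<Longrightarrow> x \<in> carrier F"
  and O_carr: "x \<in> Ov \<Longrightarrow> x \<in> carrier F"
  and A_O: "x \<in> A \<Longrightarrow> x \<in> Ov"
  using subringE(1)[OF A_subring] subringE(1)[OF Ov_subring] A_le_Ov by auto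

lemma A_closed [simp]:
  "\<zero> \<in> A" "\<one> \<in> A" "x \<in> A \<Longrightarrow> y \<in> A \<Longrightarrow> x \<oplus> y \<in> A" "x \<in> A \<Longrightarrow> y \<in> A \<Longrightarrow> x \<otimes> y \<in> A"
  "x \<in> A \<Longrightarrow> \<ominus> x \<in> A"
  using subringE[OF A_subring] by auto

lemma O_closed:
  "\<zero> \<in> Ov" "\<one> \<in> Ov" "x \<in> Ov \<Longrightarrow> y \<in> Ov \<Longrightarrow> x \<oplus> y \<in> Ov" "x \<in> Ov \<Longrightarrow> y \<in> Ov \<Longrightarrow> x \<otimes> y \<in> Ov"
  "x \<in> Ov \<Longrightarrow> \<ominus> x \<in> Ov"
  using subringE[OF Ov_subring] by auto

lemma A_minus [simp]: "x \<in> A \<Longrightarrow> y \<in> A \<Longrightarrow> x \<ominus> y \<in> A"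
  by (simp add: minus_eq)

lemma A_pow [simp]: "x \<in> A \<Longrightarrow> x [^] (n::nat) \<in> A"
  by (induction n) auto

lemma inv_field: "x \<in> carrier F \<Longrightarrow> x \<noteq> \<zero> \<Longrightarrow> inv x \<in> carrier F \<and> inv x \<otimes> x = \<one> \<and> x \<otimes> inv x = \<one> \<and> inv x \<noteq> \<zero>"
  using field_Units by (metis Diff_iff Units_inv_Units Units_l_inv Units_r_inv Units_inv_closed empty_iff insert_iff)

lemma inv_mult: "x \<in> carrier F \<Longrightarrow> x \<noteq> \<zero> \<Longrightarrow> y \<in> carrier F \<Longrightarrow> y \<noteq> \<zero> \<Longrightarrow> inv (x \<otimes> y) = inv x \<otimes> inv y"
proof -
  assume a: "x \<in> carrier F" "x \<noteq> \<zero>" "y \<in> carrier F" "y \<noteq> \<zero>"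
  have "(x \<otimes> y) \<otimes> (inv x \<otimes> inv y) = (x \<otimes> inv x) \<otimes> (y \<otimes> inv y)"
    using a inv_field by (simp add: m_ac)
  hence "(x \<otimes> y) \<otimes> (inv x \<otimes> inv y) = \<one>" using a inv_field by simp
  thus ?thesis using a inv_field by (intro comm_inv_char) auto
qed

lemma m_mult:
  assumes "u \<in> \<mm>" "y \<in> Ov" shows "u \<otimes> y \<in> \<mm>"
proof (cases "u = \<zero> \<or> y = \<zero>")
  case True thus ?thesis using assms O_closed O_carr by (auto simp: place_ideal_def)
next
  case False
  have u: "u \<in> carrier F" "u \<in> Ov" "inv u \<notin> Ov" using assms False O_carr by (auto simp: place_ideal_def)
  have y: "y \<in> carrier F" using assms O_carr by simp
  have "inv (u \<otimes> y) \<notin> Ov"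
  proof
    assume "inv (u \<otimes> y) \<in> Ov"
    hence "inv (u \<otimes> y) \<otimes> y \<in> Ov" using assms O_closed by simp
    moreover have "inv (u \<otimes> y) \<otimes> y = inv u"
      using inv_mult[of u y] u y False inv_field by (simp add: m_assoc)
    ultimately show False using u by simp
  qed
  thus ?thesis using u assms O_closed by (simp add: place_ideal_def)
qed

lemma m_add:
  assumes u: "u \<in> \<mm>" and w: "w \<in> \<mm>" shows "u \<oplus> w \<in> \<mm>"
proof -
  have *: "u \<oplus> w \<in> \<mm>" if u: "u \<in> \<mm>" and w: "w \<in> \<mm>" and nz: "w \<noteq> \<zero>" and q: "u \<otimes> inv w \<in> Ov" for u w
  proof -
    have c: "u \<in> carrier F" "w \<in> carrier F" using u w O_carr by (auto simp: place_ideal_def)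
    have "w \<otimes> (u \<otimes> inv w \<oplus> \<one>) \<in> \<mm>" using m_mult[OF w] q O_closed by simp
    moreover have "w \<otimes> (u \<otimes> inv w \<oplus> \<one>) = u \<otimes> (w \<otimes> inv w) \<oplus> w"
      using c inv_field[of w] nz by (simp add: r_distr m_ac)
    ultimately show ?thesis using c inv_field[of w] nz by simp
  qed
  have c: "u \<in> carrier F" "w \<in> carrier F" using u w O_carr by (auto simp: place_ideal_def)
  consider "u = \<zero>" | "w = \<zero>" | "u \<noteq> \<zero>" "w \<noteq> \<zero>" by auto
  thus ?thesis
  proof cases
    case 3
    have "u \<otimes> inv w \<in> Ov \<or> inv (u \<otimes> inv w) \<in> Ov"
      using 3 c inv_field[of w] integral_iff by (intro Ov_val) auto
    moreover have "inv (u \<otimes> inv w) = w \<otimes> inv u"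
    proof -
      have "(u \<otimes> inv w) \<otimes> (w \<otimes> inv u) = u \<otimes> (inv w \<otimes> w) \<otimes> inv u"
        using c inv_field[OF c(1) 3(1)] inv_field[OF c(2) 3(2)] by algebra
      thus ?thesis using c 3 inv_field[of u] inv_field[of w] by (intro comm_inv_char) auto
    qed
    ultimately show ?thesis using *[of u w] *[of w u] u w 3 c by (auto simp: a_comm)
  qed (use c u w in auto)
qed

lemma m_uminus: "u \<in> \<mm> \<Longrightarrow> \<ominus> u \<in> \<mm>"
proof -
  assume u: "u \<in> \<mm>"
  hence "u \<otimes> (\<ominus> \<one>) \<in> \<mm>" by (intro m_mult) (auto simp: O_closed)
  thus "\<ominus> u \<in> \<mm>" using u O_carr by (simp add: place_ideal_def r_minus)
qed

lemma one_notin_m: "\<one> \<notin> \<mm>"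
  using O_closed by (simp add: place_ideal_def)

lemma m_nonzero: "\<mm> \<noteq> {\<zero>}"
proof -
  obtain x where x: "x \<in> carrier F" "x \<notin> Ov" using Ov_proper O_carr by blast
  hence xz: "x \<noteq> \<zero>" using O_closed by auto
  have "inv (inv x) = x" using inv_field[OF x(1) xz] x by (intro comm_inv_char) auto
  hence "inv x \<in> \<mm>" using Ov_val[OF x(1) xz] x by (auto simp: place_ideal_def)
  thus ?thesis using inv_field[OF x(1) xz] by auto
qed

text \<open>Of two elements outside the maximal ideal both inverses lie in \<open>Ov\<close>.\<close>

lemma m_prime:
  assumes "x \<in> Ov" "y \<in> Ov" "x \<otimes> y \<in> \<mm>" shows "x \<in> \<mm> \<or> y \<in> \<mm>"
proof (rule ccontr)
  assume "\<not> (x \<in> \<mm> \<or> y \<in> \<mm>)"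
  hence c: "x \<noteq> \<zero>" "y \<noteq> \<zero>" "inv x \<in> Ov" "inv y \<in> Ov" using assms by (auto simp: place_ideal_def)
  have c': "x \<in> carrier F" "y \<in> carrier F" using assms O_carr by auto
  have "x \<otimes> y \<noteq> \<zero>" using c c' integral_iff by auto
  moreover have "inv (x \<otimes> y) \<in> Ov" using inv_mult c c' O_closed by simp
  ultimately show False using assms(3) by (simp add: place_ideal_def)
qed

lemma p_props:
  "\<pp> \<subseteq> A" "\<zero> \<in> \<pp>" "x \<in> \<pp> \<Longrightarrow> y \<in> \<pp> \<Longrightarrow> x \<oplus> y \<in> \<pp>" "x \<in> \<pp> \<Longrightarrow> \<ominus> x \<in> \<pp>"
  "x \<in> \<pp> \<Longrightarrow> y \<in> A \<Longrightarrow> x \<otimes> y \<in> \<pp>" "x \<in> \<pp> \<Longrightarrow> y \<in> A \<Longrightarrow> y \<otimes> x \<in> \<pp>"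
  "\<one> \<notin> \<pp>" "x \<in> A \<Longrightarrow> y \<in> A \<Longrightarrow> x \<otimes> y \<in> \<pp> \<Longrightarrow> x \<in> \<pp> \<or> y \<in> \<pp>"
proof -
  show "\<zero> \<in> \<pp>" by (auto simp: place_ideal_def O_closed)
  show "x \<in> \<pp> \<Longrightarrow> y \<in> \<pp> \<Longrightarrow> x \<oplus> y \<in> \<pp>" using m_add by auto
  show "x \<in> \<pp> \<Longrightarrow> \<ominus> x \<in> \<pp>" using m_uminus by auto
  show 1: "x \<in> \<pp> \<Longrightarrow> y \<in> A \<Longrightarrow> x \<otimes> y \<in> \<pp>" using m_mult A_O by auto
  show "x \<in> \<pp> \<Longrightarrow> y \<in> A \<Longrightarrow> y \<otimes> x \<in> \<pp>" using 1 m_comm[of y x] by simp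
  show "x \<in> A \<Longrightarrow> y \<in> A \<Longrightarrow> x \<otimes> y \<in> \<pp> \<Longrightarrow> x \<in> \<pp> \<or> y \<in> \<pp>" using m_prime A_O by auto
qed (use one_notin_m in auto)

lemma p_pow: "x \<in> A \<Longrightarrow> x \<notin> \<pp> \<Longrightarrow> x [^] (n::nat) \<in> A - \<pp>"
proof (induction n)
  case (Suc n)
  thus ?case using p_props(8)[of "x [^] n" x] by auto
qed (use p_props(7) in simp)

lemma unit_minus_p: "x \<in> \<pp> \<Longrightarrow> \<one> \<ominus> x \<in> A - \<pp>"
proof -
  assume x: "x \<in> \<pp>"
  have "\<one> \<ominus> x \<notin> \<pp>"
  proof
    assume "\<one> \<ominus> x \<in> \<pp>"
    hence "(\<one> \<ominus> x) \<oplus> x \<in> \<pp>" using x p_props(3) by blast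
    moreover have "(\<one> \<ominus> x) \<oplus> x = \<one>" using x by (simp add: minus_eq a_assoc l_neg)
    ultimately show False using p_props(7) by simp
  qed
  thus ?thesis using x by simp
qed

lemma p_cong: "x \<in> A \<Longrightarrow> y \<in> A \<Longrightarrow> \<one> \<ominus> x \<in> \<pp> \<Longrightarrow> x \<notin> \<pp>"
  using unit_minus_p[of x] by (auto simp: place_ideal_def)

lemma val_one:
  assumes a: "a \<in> A" and val: "has_valuation F Ov a 1"
  shows "a \<in> \<pp>" "a \<noteq> \<zero> \<or> \<mm> = {\<zero>}" "u \<in> \<mm> \<Longrightarrow> \<exists>y\<in>Ov. u = a \<otimes> y"
proof -
  obtain t v where t: "t \<in> Ov" "\<mm> = PIdl\<^bsub>F\<lparr>carrier := Ov\<rparr>\<^esub> t" and v: "v \<in> Ov" "v \<noteq> \<zero>" "inv v \<in> Ov"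
    and av: "a = v \<otimes> t [^] (1::int)"
    using val unfolding has_valuation_def uniformizer_def by blast
  have tc: "t \<in> carrier F" "v \<in> carrier F" using t v O_carr by auto
  hence av: "a = v \<otimes> t" using av by (simp add: int_pow_def2)
  have m: "\<mm> = {x \<otimes> t | x. x \<in> Ov}" unfolding t(2) cgenideal_def by simp
  show "a \<in> \<pp>" using a av m v by auto
  show 3: "\<exists>y\<in>Ov. u = a \<otimes> y" if um: "u \<in> \<mm>" for u
  proof -
    obtain x where x: "x \<in> Ov" "u = x \<otimes> t" using um unfolding m by blast
    have xc: "x \<in> carrier F" "inv v \<in> carrier F" using x v O_carr by auto
    have "a \<otimes> (inv v \<otimes> x) = (v \<otimes> inv v) \<otimes> (x \<otimes> t)" using xc av tc by (simp add: m_ac)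
    also have "\<dots> = u" using inv_field[of v] tc v xc x by simp
    finally show ?thesis using x v O_closed by (intro bexI[of _ "inv v \<otimes> x"]) auto
  qed
  show "a \<noteq> \<zero> \<or> \<mm> = {\<zero>}"
  proof (cases "a = \<zero>")
    case True
    hence "t = \<zero>" using av v tc integral by auto
    moreover have "{x \<otimes> \<zero> | x. x \<in> Ov} = {\<zero>}" using O_carr O_closed(1) by force
    ultimately show ?thesis using m by simp
  qed simp
qed

context
  fixes a and Z
  assumes a: "a \<in> A" and val: "has_valuation F Ov a 1"
    and Z: "finite Z" "Z \<subseteq> A" and cover: "\<And>x. x \<in> A \<Longrightarrow> \<exists>z\<in>Z. \<exists>y\<in>A. x = z \<oplus> a \<otimes> y"
begin

lemmas val_one' = val_one[OF a val]

lemma mod_pigeonhole: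
  assumes "\<And>n::nat. f n \<in> A"
  obtains i j y where "i < j" "y \<in> A" "f j = f i \<oplus> a \<otimes> y"
proof -
  obtain z g where z: "\<And>n. z n \<in> Z \<and> g n \<in> A \<and> f n = z n \<oplus> a \<otimes> g n"
    using cover[OF assms] by metis
  obtain i j where ij: "i < j" "z i = z j" using nat_pigeonhole[of Z z] Z z by blast
  have c: "z i \<in> carrier F" "g i \<in> carrier F" "g j \<in> carrier F" "a \<in> carrier F"
    using z Z a A_carr by blast+
  have "f i = z i \<oplus> a \<otimes> g i" "f j = z i \<oplus> a \<otimes> g j" using z ij by auto
  hence "f j = f i \<oplus> a \<otimes> (g j \<ominus> g i)" using c by algebra
  moreover have "g j \<ominus> g i \<in> A" using z by simp
  ultimately show ?thesis using that ij by blast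
qed

text \<open>In the finite ring \<open>A/a\<close> the powers of \<open>v\<close> repeat.\<close>

lemma power_relation:
  assumes v: "v \<in> A"
  obtains i n y where "y \<in> A" "v [^] (i::nat) \<otimes> (\<one> \<ominus> v [^] (Suc n)) = a \<otimes> y"
proof -
  obtain i j :: nat and y where ij: "i < j" "y \<in> A" "v [^] j = v [^] i \<oplus> a \<otimes> y"
    by (rule mod_pigeonhole[of "\<lambda>n::nat. v [^] n"]) ((use v in simp)[1], blast)
  obtain n where n: "j = i + Suc n" using ij by (metis less_imp_Suc_add add_Suc_right)
  have "v [^] j = v [^] i \<otimes> v [^] Suc n"
    unfolding n by (rule nat_pow_mult[symmetric]) (use v in simp)
  hence *: "v [^] i \<otimes> v [^] Suc n = v [^] i \<oplus> a \<otimes> y" using ij(3) by simp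
  have c: "v [^] i \<in> carrier F" "v [^] Suc n \<in> carrier F" "a \<otimes> y \<in> carrier F" "a \<in> carrier F" "y \<in> carrier F"
    using v a ij by auto
  have "v [^] i \<otimes> (\<one> \<ominus> v [^] Suc n) = v [^] i \<ominus> v [^] i \<otimes> v [^] Suc n"
    using c by algebra
  also have "\<dots> = \<ominus> (a \<otimes> y)" unfolding * using c by algebra
  also have "\<dots> = a \<otimes> (\<ominus> y)" using c by algebra
  finally show ?thesis using that ij by (metis A_closed(5))
qed

text \<open>Since \<open>v\<close> is not in the prime \<open>\<pp> \<ni> a\<close>, the relation between its powers makes a power of \<open>v\<close> congruent
to \<open>1\<close>.\<close>

lemma inverse_mod_p:
  assumes v: "v \<in> A" "v \<notin> \<pp>"
  obtains v' where "v' \<in> A" "\<one> \<ominus> v \<otimes> v' \<in> \<pp>"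
proof -
  obtain i n y where y: "y \<in> A" "v [^] (i::nat) \<otimes> (\<one> \<ominus> v [^] (Suc n)) = a \<otimes> y"
    using power_relation v by blast
  have "v [^] i \<otimes> (\<one> \<ominus> v [^] (Suc n)) \<in> \<pp>" unfolding y(2) using val_one'(1) y(1) by (rule p_props(5))
  hence "\<one> \<ominus> v [^] (Suc n) \<in> \<pp>" using p_props(8)[of "v [^] i" "\<one> \<ominus> v [^] (Suc n)"] p_pow[of v i] v by auto
  moreover have "v [^] Suc n = v \<otimes> v [^] n" using v by (simp add: m_comm)
  ultimately show ?thesis using that[of "v [^] n"] v by simp
qed

text \<open>The contraction to \<open>A\<close> of the ideal generated by \<open>a\<close> in the localization at \<open>\<pp>\<close>.\<close>

definition local_multiples where
  "local_multiples = {c \<in> A. \<exists>s\<in>A - \<pp>. \<exists>y\<in>A. s \<otimes> c = a \<otimes> y}"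

lemma lmI: "s \<in> A - \<pp> \<Longrightarrow> y \<in> A \<Longrightarrow> c \<in> A \<Longrightarrow> s \<otimes> c = a \<otimes> y \<Longrightarrow> c \<in> local_multiples"
  unfolding local_multiples_def by blast

lemma lm_mult: assumes "c \<in> local_multiples" "d \<in> A" shows "c \<otimes> d \<in> local_multiples"
proof -
  obtain s y where s: "s \<in> A - \<pp>" "y \<in> A" "s \<otimes> c = a \<otimes> y" and c: "c \<in> A"
    using assms unfolding local_multiples_def by auto
  have "s \<otimes> (c \<otimes> d) = a \<otimes> (y \<otimes> d)" using s c assms a by (simp add: m_assoc[symmetric])
  thus ?thesis using s c assms by (intro lmI[of s "y \<otimes> d"]) auto
qed

lemma lm_saturated: assumes "s \<in> A - \<pp>" "c \<in> A" "s \<otimes> c \<in> local_multiples" shows "c \<in> local_multiples"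
proof -
  obtain s' y where s: "s' \<in> A - \<pp>" "y \<in> A" "s' \<otimes> (s \<otimes> c) = a \<otimes> y"
    using assms unfolding local_multiples_def by auto
  have "(s' \<otimes> s) \<otimes> c = a \<otimes> y" using s assms by (simp add: m_assoc)
  moreover have "s' \<otimes> s \<in> A - \<pp>" using s assms p_props(8)[of s' s] by auto
  ultimately show ?thesis using s assms by (intro lmI[of "s' \<otimes> s" y]) auto
qed

lemma one_notin_lm: "\<one> \<notin> local_multiples"
proof
  assume "\<one> \<in> local_multiples"
  then obtain s y where "s \<in> A - \<pp>" "y \<in> A" "s \<otimes> \<one> = a \<otimes> y" unfolding local_multiples_def by auto
  moreover have "a \<otimes> y \<in> \<pp>" using p_props(5)[OF val_one'(1)] calculation by simp
  ultimately show False by auto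
qed

lemma lm_a: "y \<in> A \<Longrightarrow> a \<otimes> y \<in> local_multiples"
  using a p_props(7) by (intro lmI[of \<one> y]) auto

lemma lm_add: assumes "c \<in> local_multiples" "d \<in> local_multiples" shows "c \<oplus> d \<in> local_multiples"
proof -
  obtain s y where s: "s \<in> A - \<pp>" "y \<in> A" "s \<otimes> c = a \<otimes> y" and c: "c \<in> A"
    using assms unfolding local_multiples_def by auto
  obtain s' y' where s': "s' \<in> A - \<pp>" "y' \<in> A" "s' \<otimes> d = a \<otimes> y'" and d: "d \<in> A"
    using assms unfolding local_multiples_def by auto
  have cs: "s \<in> carrier F" "s' \<in> carrier F" "c \<in> carrier F" "d \<in> carrier F" using s s' c d by auto
  have "(s \<otimes> s') \<otimes> (c \<oplus> d) = s' \<otimes> (s \<otimes> c) \<oplus> s \<otimes> (s' \<otimes> d)"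
    using cs by algebra
  also have "\<dots> = a \<otimes> (s' \<otimes> y \<oplus> s \<otimes> y')" unfolding s s' using s s' a by (simp add: r_distr m_ac)
  finally show ?thesis using s s' c d p_props(8)[of s s']
    by (intro lmI[of "s \<otimes> s'" "s' \<otimes> y \<oplus> s \<otimes> y'"]) auto
qed

definition annih where "annih w = {u \<in> A. w \<otimes> u \<in> local_multiples}"

lemma annih_add_a:
  assumes "w \<in> A" "z \<in> A" "y \<in> A" "z \<in> annih w" shows "z \<oplus> a \<otimes> y \<in> annih w"
proof -
  have "w \<otimes> (z \<oplus> a \<otimes> y) = w \<otimes> z \<oplus> a \<otimes> (w \<otimes> y)" using assms a by (simp add: r_distr m_ac)
  moreover have "w \<otimes> z \<oplus> a \<otimes> (w \<otimes> y) \<in> local_multiples"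
    using assms lm_a by (intro lm_add) (auto simp: annih_def)
  ultimately show ?thesis using assms a by (simp add: annih_def)
qed

text \<open>These annihilators contain \<open>a\<close>, so they are determined by their intersections with \<open>Z\<close>.\<close>

lemma finite_annih: "finite (annih ` A)"
proof -
  have "inj_on (\<lambda>I. I \<inter> Z) (annih ` A)"
  proof (rule inj_onI)
    fix I J assume IJ: "I \<in> annih ` A" "J \<in> annih ` A" "I \<inter> Z = J \<inter> Z"
    have "I \<subseteq> J" if IJ: "I \<in> annih ` A" "J \<in> annih ` A" "I \<inter> Z = J \<inter> Z" for I J
    proof
      fix x assume x: "x \<in> I"
      obtain w w' where w: "w \<in> A" "I = annih w" "w' \<in> A" "J = annih w'" using IJ by auto
      have xA: "x \<in> A" using x w by (auto simp: annih_def)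
      obtain z y where zy: "z \<in> Z" "y \<in> A" "x = z \<oplus> a \<otimes> y" using cover xA by blast
      have zA: "z \<in> A" using zy Z by auto
      have "z = x \<oplus> a \<otimes> (\<ominus> y)" unfolding zy using zA zy a by (simp add: a_assoc r_minus r_neg)
      hence "z \<in> I" using annih_add_a[OF w(1) xA, of "\<ominus> y"] x w zy by simp
      hence "z \<in> J" using that zy by auto
      thus "x \<in> J" unfolding zy(3) using annih_add_a[OF w(3) zA zy(2)] w by simp
    qed
    thus "I = J" using IJ by blast
  qed
  moreover have "(\<lambda>I. I \<inter> Z) ` (annih ` A) \<subseteq> Pow Z" by auto
  ultimately show ?thesis using Z(1) by (meson finite_Pow_iff inj_on_finite)
qed

text \<open>This produces an associated prime of the localization modulo \<open>a\<close>: choose \<open>w\<close> with maximal annihilator.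
If some \<open>u \<in> \<pp>\<close> did not kill \<open>w\<close>, no power of \<open>u\<close> would kill \<open>w\<close>, whereas by the relation between its powers \<open>u\<close> is
nilpotent modulo \<open>a\<close> locally at \<open>\<pp>\<close>.\<close>

lemma exists_socle: obtains w where "w \<in> A - local_multiples" "\<And>u. u \<in> \<pp> \<Longrightarrow> w \<otimes> u \<in> local_multiples"
proof -
  let ?\<F> = "annih ` (A - local_multiples)"
  have "finite ?\<F>" using finite_annih by (rule finite_subset[rotated]) auto
  moreover have "\<one> \<in> A - local_multiples" using one_notin_lm by simp
  hence "?\<F> \<noteq> {}" by blast
  ultimately obtain I where I: "I \<in> ?\<F>" "\<And>J. J \<in> ?\<F> \<Longrightarrow> I \<subseteq> J \<Longrightarrow> I = J"
    using finite_has_maximal[of ?\<F>] by metis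
  then obtain w where w: "w \<in> A" "w \<notin> local_multiples" "I = annih w" by auto
  have "w \<otimes> u \<in> local_multiples" if u: "u \<in> \<pp>" for u
  proof (rule ccontr)
    assume nu: "w \<otimes> u \<notin> local_multiples"
    have uA: "u \<in> A" using u by simp
    have ind: "w \<otimes> u [^] n \<notin> local_multiples \<and> annih (w \<otimes> u [^] n) = I" for n :: nat
    proof (induction n)
      case 0 thus ?case using w by simp
    next
      case (Suc n)
      have eq: "w \<otimes> u [^] Suc n = (w \<otimes> u [^] n) \<otimes> u" using w uA by (simp add: m_assoc)
      have "u \<notin> annih (w \<otimes> u [^] n)" using Suc nu uA w by (simp add: annih_def)
      hence n: "w \<otimes> u [^] Suc n \<notin> local_multiples" unfolding eq using uA by (simp add: annih_def)
      have "annih (w \<otimes> u [^] n) \<subseteq> annih (w \<otimes> u [^] Suc n)"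
      proof
        fix x assume x: "x \<in> annih (w \<otimes> u [^] n)"
        hence "(w \<otimes> u [^] n) \<otimes> x \<otimes> u \<in> local_multiples" using lm_mult uA by (simp add: annih_def)
        moreover have "(w \<otimes> u [^] n) \<otimes> x \<otimes> u = w \<otimes> u [^] Suc n \<otimes> x"
          using x w uA by (simp add: annih_def m_ac)
        ultimately show "x \<in> annih (w \<otimes> u [^] Suc n)" using x by (simp add: annih_def)
      qed
      moreover have "annih (w \<otimes> u [^] Suc n) \<in> ?\<F>" using n w uA by auto
      ultimately show ?case using n Suc I(2) by auto
    qed
    obtain i n y where y: "y \<in> A" "u [^] (i::nat) \<otimes> (\<one> \<ominus> u [^] (Suc n)) = a \<otimes> y"
      using power_relation uA by blast
    have "u [^] Suc n \<in> \<pp>" using p_props(6)[OF u, of "u [^] n"] uA by simp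
    hence "\<one> \<ominus> u [^] Suc n \<in> A - \<pp>" by (rule unit_minus_p)
    moreover have "(\<one> \<ominus> u [^] Suc n) \<otimes> u [^] i = a \<otimes> y" using y uA by (simp add: m_comm del: nat_pow_Suc)
    ultimately have "u [^] i \<in> local_multiples" using y uA by (intro lmI[of "\<one> \<ominus> u [^] Suc n" y]) auto
    hence "u [^] i \<otimes> w \<in> local_multiples" using lm_mult w by blast
    thus False using ind[of i] w uA by (simp add: m_comm)
  qed
  thus ?thesis using that w by blast
qed

text \<open>Let \<open>s'\<close> be a multiple of the \<open>w\<close> just found with \<open>s' \<pp> \<subseteq> a A\<close>, which exists because \<open>\<pp>\<close> is finitely
generated modulo \<open>a\<close>, and let \<open>\<zeta> = s'/a\<close>. Then \<open>\<zeta> \<pp> \<subseteq> A\<close>. If \<open>\<zeta> \<pp> \<subseteq> \<pp>\<close>, then \<open>\<zeta>\<close> is integral, hence in \<open>A\<close>, which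
contradicts the choice of \<open>w\<close>. So \<open>\<zeta> \<pi> \<notin> \<pp>\<close> for some \<open>\<pi> \<in> \<pp>\<close>; as \<open>v(\<pi>) \<ge> v(a)\<close>, this forces \<open>s' \<notin> \<pp>\<close>. It is the
argument that makes \<open>A\<close> a Dedekind ring, for the one prime \<open>\<pp>\<close>.\<close>

lemma exists_conductor:
  obtains s where "s \<in> A - \<pp>" "\<And>u. u \<in> \<pp> \<Longrightarrow> \<exists>y\<in>A. s \<otimes> u = a \<otimes> y"
proof -
  obtain w where w: "w \<in> A" "w \<notin> local_multiples" "\<And>u. u \<in> \<pp> \<Longrightarrow> w \<otimes> u \<in> local_multiples"
    using exists_socle by blast
  have ex: "\<exists>s\<in>A - \<pp>. \<forall>z\<in>Y. \<exists>y\<in>A. s \<otimes> (w \<otimes> z) = a \<otimes> y" if "finite Y" "Y \<subseteq> Z \<inter> \<pp>" for Y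
    using that
  proof (induction Y)
    case empty
    show ?case by (intro bexI[of _ \<one>]) (use p_props(7) in auto)
  next
    case (insert x Y)
    then obtain s where s: "s \<in> A - \<pp>" "\<And>z. z \<in> Y \<Longrightarrow> \<exists>y\<in>A. s \<otimes> (w \<otimes> z) = a \<otimes> y" by auto
    have x: "x \<in> \<pp>" using insert by auto
    obtain s' y' where s': "s' \<in> A - \<pp>" "y' \<in> A" "s' \<otimes> (w \<otimes> x) = a \<otimes> y'"
      using w(3)[OF x] unfolding local_multiples_def by auto
    have "\<exists>y\<in>A. (s \<otimes> s') \<otimes> (w \<otimes> z) = a \<otimes> y" if z: "z \<in> insert x Y" for z
    proof (cases "z = x")
      case True
      have "(s \<otimes> s') \<otimes> (w \<otimes> x) = s \<otimes> (s' \<otimes> (w \<otimes> x))" using s s' x w by (simp add: m_assoc)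
      also have "\<dots> = a \<otimes> (s \<otimes> y')" unfolding s' using s s' a by (simp add: m_ac)
      finally show ?thesis using True s s' by (intro bexI[of _ "s \<otimes> y'"]) auto
    next
      case False
      hence zY: "z \<in> Y" using z by simp
      then obtain y where y: "y \<in> A" "s \<otimes> (w \<otimes> z) = a \<otimes> y" using s by blast
      have zA: "z \<in> A" using zY insert by auto
      have "(s \<otimes> s') \<otimes> (w \<otimes> z) = s' \<otimes> (s \<otimes> (w \<otimes> z))" using s s' zA w by (simp add: m_ac)
      also have "\<dots> = a \<otimes> (s' \<otimes> y)" unfolding y using s s' a y by (simp add: m_ac)
      finally show ?thesis using s' y by (intro bexI[of _ "s' \<otimes> y"]) auto
    qed
    moreover have "s \<otimes> s' \<in> A - \<pp>" using s s' p_props(8)[of s s'] by auto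
    ultimately show ?case by blast
  qed
  obtain s where s: "s \<in> A - \<pp>" "\<And>z. z \<in> Z \<inter> \<pp> \<Longrightarrow> \<exists>y\<in>A. s \<otimes> (w \<otimes> z) = a \<otimes> y"
    using ex[of "Z \<inter> \<pp>"] Z by auto
  define s' where "s' = s \<otimes> w"
  have s'A: "s' \<in> A" using s w by (simp add: s'_def)
  have s'n: "s' \<notin> local_multiples" using lm_saturated[of s w] s w by (auto simp: s'_def)
  have s'p: "\<exists>y\<in>A. s' \<otimes> u = a \<otimes> y" if u: "u \<in> \<pp>" for u
  proof -
    obtain z y where zy: "z \<in> Z" "y \<in> A" "u = z \<oplus> a \<otimes> y" using cover[of u] u by auto
    have zA: "z \<in> A" using zy Z by auto
    have "z = u \<oplus> \<ominus> (a \<otimes> y)" unfolding zy using zA zy a by (simp add: a_assoc r_neg)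
    moreover have "a \<otimes> y \<in> \<pp>" using p_props(5)[OF val_one'(1) zy(2)] .
    ultimately have "z \<in> \<pp>" using p_props(3)[OF u p_props(4)] by simp
    then obtain y' where y': "y' \<in> A" "s \<otimes> (w \<otimes> z) = a \<otimes> y'" using s zy by blast
    have "s' \<otimes> u = s \<otimes> (w \<otimes> z) \<oplus> a \<otimes> (s' \<otimes> y)" unfolding zy(3) s'_def
      using s w zA zy a by (simp add: r_distr m_ac)
    also have "\<dots> = a \<otimes> (y' \<oplus> s' \<otimes> y)" unfolding y' using y' s'A zy a by (simp add: r_distr)
    finally show ?thesis using y' s'A zy by (intro bexI[of _ "y' \<oplus> s' \<otimes> y"]) auto
  qed
  have anz: "a \<noteq> \<zero>" using val_one'(2) m_nonzero by simp
  define \<zeta> where "\<zeta> = s' \<otimes> inv a"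
  have ia: "inv a \<in> carrier F" "a \<otimes> inv a = \<one>" "inv a \<otimes> a = \<one>" using inv_field[of a] a anz by auto
  have \<zeta>c: "\<zeta> \<in> carrier F" using ia s'A by (simp add: \<zeta>_def)
  have \<zeta>p: "\<zeta> \<otimes> u \<in> A" if u: "u \<in> \<pp>" for u
  proof -
    obtain y where y: "y \<in> A" "s' \<otimes> u = a \<otimes> y" using s'p[OF u] by auto
    have "\<zeta> \<otimes> u = inv a \<otimes> (s' \<otimes> u)" using s'A u ia by (simp add: \<zeta>_def m_ac)
    also have "\<dots> = y" unfolding y using ia y a by (simp add: m_assoc[symmetric])
    finally show ?thesis using y by simp
  qed
  have "\<not> (\<forall>u\<in>\<pp>. \<zeta> \<otimes> u \<in> \<pp>)"
  proof
    assume all: "\<forall>u\<in>\<pp>. \<zeta> \<otimes> u \<in> \<pp>"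
    \<comment> \<open>\<open>\<zeta>\<close> has the common denominator \<open>a\<close> in all its powers, so they repeat modulo \<open>A\<close>.\<close>
    have f: "\<zeta> [^] n \<otimes> a \<in> \<pp>" for n :: nat
    proof (induction n)
      case (Suc n)
      have "\<zeta> [^] Suc n \<otimes> a = \<zeta> \<otimes> (\<zeta> [^] n \<otimes> a)" using \<zeta>c a by (simp add: m_ac)
      thus ?case using Suc all by simp
    qed (use val_one' a in simp)
    obtain i j :: nat and y where ij: "i < j" "y \<in> A" "\<zeta> [^] j \<otimes> a = \<zeta> [^] i \<otimes> a \<oplus> a \<otimes> y"
      by (rule mod_pigeonhole[of "\<lambda>n::nat. \<zeta> [^] n \<otimes> a"]) ((use f in blast)[1], blast)
    have "\<zeta> [^] j \<otimes> a = (\<zeta> [^] i \<oplus> y) \<otimes> a" unfolding ij using \<zeta>c a ij by (simp add: l_distr r_distr m_comm)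
    hence "\<zeta> [^] j = \<zeta> [^] i \<oplus> y" using m_rcancel[of a "\<zeta> [^] j" "\<zeta> [^] i \<oplus> y"] anz a \<zeta>c ij by simp
    hence "\<zeta> \<in> A" using A_integral[OF \<zeta>c ij(2,1)] by simp
    moreover have "a \<otimes> \<zeta> = s'" unfolding \<zeta>_def using m_lcomm[of a s' "inv a"] s'A a ia by simp
    ultimately show False using s'n lm_a[of \<zeta>] by simp
  qed
  then obtain \<pi> where \<pi>: "\<pi> \<in> \<pp>" "\<zeta> \<otimes> \<pi> \<notin> \<pp>" by auto
  obtain y where y: "y \<in> Ov" "\<pi> = a \<otimes> y" using val_one'(3)[of \<pi>] \<pi> by auto
  have yc: "y \<in> carrier F" using y O_carr by simp
  have "\<zeta> \<otimes> \<pi> = s' \<otimes> (inv a \<otimes> a) \<otimes> y" unfolding y \<zeta>_def using ia(1) s'A a yc by (simp add: m_assoc)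
  hence "\<zeta> \<otimes> \<pi> = s' \<otimes> y" using ia s'A by simp
  hence "s' \<otimes> y \<notin> \<mm>" using \<pi> \<zeta>p[OF \<pi>(1)] by auto
  hence "s' \<notin> \<mm>" using m_mult y by blast
  thus ?thesis using that[of s'] s'A s'p by blast
qed

text \<open>Modulo \<open>a\<close>, this \<open>E\<close> is the idempotent that belongs to the component of \<open>A/a\<close> at \<open>v\<close>; that component is
\<open>A/\<pp>\<close> because \<open>v(a) = 1\<close>.\<close>

lemma exists_idempotent:
  obtains E where "E \<in> A" "\<one> \<ominus> E \<in> \<pp>" "\<And>u. u \<in> \<pp> \<Longrightarrow> \<exists>y\<in>A. E \<otimes> u = a \<otimes> y"
proof -
  obtain s where s: "s \<in> A - \<pp>" "\<And>u. u \<in> \<pp> \<Longrightarrow> \<exists>y\<in>A. s \<otimes> u = a \<otimes> y"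
    using exists_conductor by blast
  obtain v where v: "v \<in> A" "\<one> \<ominus> s \<otimes> v \<in> \<pp>" using inverse_mod_p[of s] s by auto
  have "\<exists>y\<in>A. (s \<otimes> v) \<otimes> u = a \<otimes> y" if u: "u \<in> \<pp>" for u
  proof -
    obtain y where y: "y \<in> A" "s \<otimes> u = a \<otimes> y" using s(2)[OF u] by auto
    have "(s \<otimes> v) \<otimes> u = v \<otimes> (s \<otimes> u)" using s v u by (simp add: m_ac)
    also have "\<dots> = a \<otimes> (v \<otimes> y)" unfolding y using v y a by (simp add: m_ac)
    finally show ?thesis using v y by (intro bexI[of _ "v \<otimes> y"]) auto
  qed
  thus ?thesis using that[of "s \<otimes> v"] s v by auto
qed

end

end

section \<open>Degrees and counting\<close>

text \<open>If \<open>x > y\<close>, then \<open>(x/y)\<^sup>n\<close> exceeds every constant.\<close>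

lemma power_bound_imp_le:
  fixes x y C :: nat
  assumes "\<And>n. x ^ n \<le> C * y ^ n"
  shows "x \<le> y"
proof (rule ccontr)
  assume "\<not> x \<le> y"
  hence xy: "y < x" by simp
  show False
  proof (cases "y = 0")
    case True thus ?thesis using assms[of 1] xy by simp
  next
    case False
    hence "1 < real x / real y" using xy by simp
    then obtain n where n: "real C < (real x / real y) ^ n" using real_arch_pow by blast
    have "real x ^ n \<le> real C * real y ^ n" using assms[of n] by (metis of_nat_le_iff of_nat_mult of_nat_power)
    hence "(real x / real y) ^ n \<le> real C" using False by (simp add: power_divide divide_le_eq)
    thus False using n by simp
  qed
qed

text \<open>Ring homomorphisms from \<open>A\<close> to twisted polynomials over a field for which \<open>D c\<close> is the degree in \<open>\<tau>\<close> of
the image of \<open>c\<close>.\<close>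

locale drinfeld_degree = valued_ring F A Ov + L: field L
  for F :: "'f ring" (structure) and A Ov and L :: "'l ring" (structure) +
  fixes q :: nat and \<psi> :: "'f \<Rightarrow> nat \<Rightarrow> 'l" and D :: "'f \<Rightarrow> nat"
  assumes q2: "q \<ge> 2"
    and psi_closed [simp]: "c \<in> A \<Longrightarrow> \<psi> c i \<in> carrier L"
    and psi_add: "c \<in> A \<Longrightarrow> d \<in> A \<Longrightarrow> \<psi> (c \<oplus>\<^bsub>F\<^esub> d) i = \<psi> c i \<oplus>\<^bsub>L\<^esub> \<psi> d i"
    and psi_mult: "c \<in> A \<Longrightarrow> d \<in> A \<Longrightarrow>
      \<psi> (c \<otimes>\<^bsub>F\<^esub> d) k = (\<Oplus>\<^bsub>L\<^esub>i\<in>{..k}. \<psi> c i \<otimes>\<^bsub>L\<^esub> (\<psi> d (k - i)) [^]\<^bsub>L\<^esub> (q ^ i))"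
    and psi_one: "\<psi> \<one>\<^bsub>F\<^esub> i = (if i = 0 then \<one>\<^bsub>L\<^esub> else \<zero>\<^bsub>L\<^esub>)"
    and D_top: "c \<in> A \<Longrightarrow> c \<noteq> \<zero>\<^bsub>F\<^esub> \<Longrightarrow> \<psi> c (D c) \<noteq> \<zero>\<^bsub>L\<^esub>"
    and D_above: "c \<in> A \<Longrightarrow> c \<noteq> \<zero>\<^bsub>F\<^esub> \<Longrightarrow> i > D c \<Longrightarrow> \<psi> c i = \<zero>\<^bsub>L\<^esub>"
begin

lemma q_pos [simp]: "0 < q ^ i" "q ^ i \<noteq> 0" "0 < q" using q2 by auto

lemma psi_zero: "\<psi> \<zero>\<^bsub>F\<^esub> i = \<zero>\<^bsub>L\<^esub>"
  using psi_add[of "\<zero>\<^bsub>F\<^esub>" "\<zero>\<^bsub>F\<^esub>" i] psi_closed[of "\<zero>\<^bsub>F\<^esub>" i] by (simp add: L.add.l_cancel_one)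

lemma psi_uminus: assumes "c \<in> A" shows "\<psi> (\<ominus>\<^bsub>F\<^esub> c) i = \<ominus>\<^bsub>L\<^esub> \<psi> c i"
proof -
  have "\<psi> (\<ominus>\<^bsub>F\<^esub> c) i \<oplus>\<^bsub>L\<^esub> \<psi> c i = \<zero>\<^bsub>L\<^esub>"
    using psi_add[of "\<ominus>\<^bsub>F\<^esub> c" c i] assms by (simp add: l_neg psi_zero)
  thus ?thesis using assms by (intro L.minus_equality[symmetric]) auto
qed

lemma psi_minus: "c \<in> A \<Longrightarrow> d \<in> A \<Longrightarrow> \<psi> (c \<ominus>\<^bsub>F\<^esub> d) i = \<psi> c i \<ominus>\<^bsub>L\<^esub> \<psi> d i"
  by (simp add: minus_eq L.minus_eq psi_add psi_uminus)

text \<open>The elements of \<open>A\<close> of degree below \<open>n\<close>, with zero.\<close>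

definition Bd where "Bd n = {c \<in> A. \<forall>i\<ge>n. \<psi> c i = \<zero>\<^bsub>L\<^esub>}"

lemma Bd_zero: "Bd 0 = {\<zero>\<^bsub>F\<^esub>}"
  unfolding Bd_def using psi_zero D_top by auto

lemma Bd_mono: "n \<le> m \<Longrightarrow> Bd n \<subseteq> Bd m"
  unfolding Bd_def by auto

lemma Bd_diff: "c \<in> Bd n \<Longrightarrow> d \<in> Bd n \<Longrightarrow> c \<ominus>\<^bsub>F\<^esub> d \<in> Bd n"
  unfolding Bd_def by (auto simp: psi_minus)

lemma Bd_add: "c \<in> Bd n \<Longrightarrow> d \<in> Bd n \<Longrightarrow> c \<oplus>\<^bsub>F\<^esub> d \<in> Bd n"
  unfolding Bd_def by (auto simp: psi_add)

lemma D_in_Bd: "c \<in> A \<Longrightarrow> c \<noteq> \<zero>\<^bsub>F\<^esub> \<Longrightarrow> c \<in> Bd (Suc (D c))"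
  unfolding Bd_def using D_above by auto

lemma Bd_D: "c \<in> Bd n \<Longrightarrow> c \<noteq> \<zero>\<^bsub>F\<^esub> \<Longrightarrow> D c < n"
  unfolding Bd_def using D_top by (metis (mono_tags, lifting) linorder_not_less mem_Collect_eq)

lemma Bd_mult:
  assumes c: "c \<in> Bd n" and d: "d \<in> Bd (Suc m)" shows "d \<otimes>\<^bsub>F\<^esub> c \<in> Bd (n + m)"
proof -
  have cA: "c \<in> A" "d \<in> A" using c d by (auto simp: Bd_def)
  have "\<psi> (d \<otimes>\<^bsub>F\<^esub> c) k = \<zero>\<^bsub>L\<^esub>" if k: "k \<ge> n + m" for k
  proof -
    have "\<psi> d i \<otimes>\<^bsub>L\<^esub> (\<psi> c (k - i)) [^]\<^bsub>L\<^esub> (q ^ i) = \<zero>\<^bsub>L\<^esub>" if i: "i \<le> k" for i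
    proof (cases "i \<le> m")
      case True
      hence "\<psi> c (k - i) = \<zero>\<^bsub>L\<^esub>" using c k by (auto simp: Bd_def)
      thus ?thesis using cA by (simp add: L.nat_pow_zero)
    next
      case False
      hence "\<psi> d i = \<zero>\<^bsub>L\<^esub>" using d by (auto simp: Bd_def)
      thus ?thesis using cA by simp
    qed
    hence "(\<Oplus>\<^bsub>L\<^esub>i\<in>{..k}. \<psi> d i \<otimes>\<^bsub>L\<^esub> (\<psi> c (k - i)) [^]\<^bsub>L\<^esub> (q ^ i)) = (\<Oplus>\<^bsub>L\<^esub>i\<in>{..k}. \<zero>\<^bsub>L\<^esub>)"
      by (intro L.finsum_cong') auto
    thus ?thesis using psi_mult[of d c k] cA by (simp add: L.finsum_zero)
  qed
  thus ?thesis using cA by (simp add: Bd_def)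
qed

lemma psi_mult_top:
  assumes c: "c \<in> Bd (Suc n)" and d: "d \<in> Bd (Suc m)"
  shows "\<psi> (c \<otimes>\<^bsub>F\<^esub> d) (n + m) = \<psi> c n \<otimes>\<^bsub>L\<^esub> (\<psi> d m) [^]\<^bsub>L\<^esub> (q ^ n)"
proof -
  have cA: "c \<in> A" "d \<in> A" using c d by (auto simp: Bd_def)
  have "\<psi> (c \<otimes>\<^bsub>F\<^esub> d) (n + m) = (\<Oplus>\<^bsub>L\<^esub>i\<in>{..n + m}. if n = i then \<psi> c i \<otimes>\<^bsub>L\<^esub> (\<psi> d (n + m - i)) [^]\<^bsub>L\<^esub> (q ^ i) else \<zero>\<^bsub>L\<^esub>)"
  proof (subst psi_mult[OF cA], rule L.finsum_cong'[OF HOL.refl])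
    fix i assume i: "i \<in> {..n + m}"
    consider "i = n" | "i < n" | "i > n" by linarith
    thus "\<psi> c i \<otimes>\<^bsub>L\<^esub> (\<psi> d (n + m - i)) [^]\<^bsub>L\<^esub> (q ^ i) = (if n = i then \<psi> c i \<otimes>\<^bsub>L\<^esub> (\<psi> d (n + m - i)) [^]\<^bsub>L\<^esub> (q ^ i) else \<zero>\<^bsub>L\<^esub>)"
    proof cases
      case 2
      hence "\<psi> d (n + m - i) = \<zero>\<^bsub>L\<^esub>" using d by (auto simp: Bd_def)
      thus ?thesis using cA 2 by (simp add: L.nat_pow_zero)
    next
      case 3
      hence "\<psi> c i = \<zero>\<^bsub>L\<^esub>" using c by (auto simp: Bd_def)
      thus ?thesis using cA 3 by simp
    qed simp
  qed (use cA in auto)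
  also have "\<dots> = \<psi> c n \<otimes>\<^bsub>L\<^esub> (\<psi> d (n + m - n)) [^]\<^bsub>L\<^esub> (q ^ n)"
    using cA by (subst L.finsum_singleton) auto
  finally show ?thesis by simp
qed

definition low where "low n c \<longleftrightarrow> (\<forall>i<n. \<psi> c i = \<zero>\<^bsub>L\<^esub>)"

lemma low_mult:
  assumes "c \<in> A" "d \<in> A" "low n c" "low m d" shows "low (n + m) (c \<otimes>\<^bsub>F\<^esub> d)"
  unfolding low_def
proof (intro allI impI)
  fix k assume k: "k < n + m"
  have "\<psi> c i \<otimes>\<^bsub>L\<^esub> (\<psi> d (k - i)) [^]\<^bsub>L\<^esub> (q ^ i) = \<zero>\<^bsub>L\<^esub>" if i: "i \<le> k" for i
  proof (cases "i < n")
    case True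
    hence "\<psi> c i = \<zero>\<^bsub>L\<^esub>" using assms by (auto simp: low_def)
    thus ?thesis using assms by simp
  next
    case False
    hence "\<psi> d (k - i) = \<zero>\<^bsub>L\<^esub>" using assms k i by (auto simp: low_def)
    thus ?thesis using assms by (simp add: L.nat_pow_zero)
  qed
  hence "(\<Oplus>\<^bsub>L\<^esub>i\<in>{..k}. \<psi> c i \<otimes>\<^bsub>L\<^esub> (\<psi> d (k - i)) [^]\<^bsub>L\<^esub> (q ^ i)) = (\<Oplus>\<^bsub>L\<^esub>i\<in>{..k}. \<zero>\<^bsub>L\<^esub>)"
    by (intro L.finsum_cong') auto
  thus "\<psi> (c \<otimes>\<^bsub>F\<^esub> d) k = \<zero>\<^bsub>L\<^esub>" using psi_mult[of c d k] assms by (simp add: L.finsum_zero)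
qed

lemma low_pow: "a \<in> A \<Longrightarrow> low l a \<Longrightarrow> low (n * l) (a [^]\<^bsub>F\<^esub> (n::nat))"
proof (induction n)
  case (Suc n)
  thus ?case using low_mult[of "a [^]\<^bsub>F\<^esub> n" a "n * l" l] by (simp add: add.commute)
qed (simp add: low_def)

lemma low_cancel:
  assumes "c \<in> A" "d \<in> A" "\<psi> c 0 \<noteq> \<zero>\<^bsub>L\<^esub>" "low n (c \<otimes>\<^bsub>F\<^esub> d)" shows "low n d"
proof -
  have "k < n \<longrightarrow> \<psi> d k = \<zero>\<^bsub>L\<^esub>" for k
  proof (induction k rule: less_induct)
    case (less k)
    show ?case
    proof
      assume k: "k < n"
      have "\<psi> (c \<otimes>\<^bsub>F\<^esub> d) k = (\<Oplus>\<^bsub>L\<^esub>i\<in>{..k}. if 0 = i then \<psi> c i \<otimes>\<^bsub>L\<^esub> (\<psi> d (k - i)) [^]\<^bsub>L\<^esub> (q ^ i) else \<zero>\<^bsub>L\<^esub>)"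
      proof (subst psi_mult[OF assms(1,2)], rule L.finsum_cong'[OF HOL.refl])
        fix i assume i: "i \<in> {..k}"
        show "\<psi> c i \<otimes>\<^bsub>L\<^esub> (\<psi> d (k - i)) [^]\<^bsub>L\<^esub> (q ^ i) = (if 0 = i then \<psi> c i \<otimes>\<^bsub>L\<^esub> (\<psi> d (k - i)) [^]\<^bsub>L\<^esub> (q ^ i) else \<zero>\<^bsub>L\<^esub>)"
        proof (cases "i = 0")
          case False
          hence "\<psi> d (k - i) = \<zero>\<^bsub>L\<^esub>" using less[of "k - i"] i k by auto
          thus ?thesis using assms False by (simp add: L.nat_pow_zero)
        qed simp
      qed (use assms in auto)
      also have "\<dots> = \<psi> c 0 \<otimes>\<^bsub>L\<^esub> (\<psi> d (k - 0)) [^]\<^bsub>L\<^esub> (q ^ 0)"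
        using assms by (subst L.finsum_singleton) auto
      finally have "\<psi> c 0 \<otimes>\<^bsub>L\<^esub> \<psi> d k = \<zero>\<^bsub>L\<^esub>" using assms k by (simp add: low_def)
      thus "\<psi> d k = \<zero>\<^bsub>L\<^esub>" using L.integral[of "\<psi> c 0" "\<psi> d k"] assms by auto
    qed
  qed
  thus ?thesis by (simp add: low_def)
qed

lemma psi_mult_0: "c \<in> A \<Longrightarrow> d \<in> A \<Longrightarrow> \<psi> (c \<otimes>\<^bsub>F\<^esub> d) 0 = \<psi> c 0 \<otimes>\<^bsub>L\<^esub> \<psi> d 0"
  by (simp add: psi_mult)

lemma psi_pow_0: "c \<in> A \<Longrightarrow> \<psi> c 0 = \<one>\<^bsub>L\<^esub> \<Longrightarrow> \<psi> (c [^]\<^bsub>F\<^esub> (n::nat)) 0 = \<one>\<^bsub>L\<^esub>"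
  by (induction n) (simp_all add: psi_one psi_mult_0)

definition congr where "congr a x y \<longleftrightarrow> (\<exists>t\<in>A. x = y \<oplus>\<^bsub>F\<^esub> a \<otimes>\<^bsub>F\<^esub> t)"

lemma congr_refl: "a \<in> A \<Longrightarrow> x \<in> A \<Longrightarrow> congr a x x"
  unfolding congr_def by (intro bexI[of _ "\<zero>\<^bsub>F\<^esub>"]) auto

lemma congrI:
  assumes "a \<in> A" "x \<in> A" "y \<in> A" "t \<in> A" "x \<ominus>\<^bsub>F\<^esub> y = a \<otimes>\<^bsub>F\<^esub> t" shows "congr a x y"
proof -
  have "x \<in> carrier F" "y \<in> carrier F" using assms by auto
  hence "x = y \<oplus>\<^bsub>F\<^esub> (x \<ominus>\<^bsub>F\<^esub> y)" by algebra
  thus ?thesis unfolding congr_def assms(5) using assms(4) by blast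
qed

lemma congrD: assumes "a \<in> A" "x \<in> A" "y \<in> A" "congr a x y" obtains t where "t \<in> A" "x \<ominus>\<^bsub>F\<^esub> y = a \<otimes>\<^bsub>F\<^esub> t"
proof -
  obtain t where t: "t \<in> A" "x = y \<oplus>\<^bsub>F\<^esub> a \<otimes>\<^bsub>F\<^esub> t" using assms unfolding congr_def by auto
  have c: "y \<in> carrier F" "t \<in> carrier F" "a \<in> carrier F" using assms t by auto
  have "x \<ominus>\<^bsub>F\<^esub> y = a \<otimes>\<^bsub>F\<^esub> t" unfolding t using c by algebra
  thus ?thesis using that t by blast
qed

lemma congr_sym: assumes "a \<in> A" "x \<in> A" "y \<in> A" "congr a x y" shows "congr a y x"
proof -
  obtain t where t: "t \<in> A" "x \<ominus>\<^bsub>F\<^esub> y = a \<otimes>\<^bsub>F\<^esub> t" using congrD assms by blast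
  have c: "y \<in> carrier F" "t \<in> carrier F" "a \<in> carrier F" "x \<in> carrier F" using assms t by auto
  have "y \<ominus>\<^bsub>F\<^esub> x = \<ominus>\<^bsub>F\<^esub> (x \<ominus>\<^bsub>F\<^esub> y)" using c by algebra
  also have "\<dots> = a \<otimes>\<^bsub>F\<^esub> (\<ominus>\<^bsub>F\<^esub> t)" unfolding t using c by algebra
  finally show ?thesis using congrI[of a y x "\<ominus>\<^bsub>F\<^esub> t"] assms t by simp
qed

lemma congr_trans:
  assumes "a \<in> A" "x \<in> A" "y \<in> A" "z \<in> A" "congr a x y" "congr a y z" shows "congr a x z"
proof -
  obtain t where t: "t \<in> A" "x \<ominus>\<^bsub>F\<^esub> y = a \<otimes>\<^bsub>F\<^esub> t" using congrD assms by blast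
  obtain s where s: "s \<in> A" "y \<ominus>\<^bsub>F\<^esub> z = a \<otimes>\<^bsub>F\<^esub> s" using congrD assms by blast
  have c: "y \<in> carrier F" "t \<in> carrier F" "a \<in> carrier F" "x \<in> carrier F" "z \<in> carrier F" "s \<in> carrier F"
    using assms t s by auto
  have "x \<ominus>\<^bsub>F\<^esub> z = (x \<ominus>\<^bsub>F\<^esub> y) \<oplus>\<^bsub>F\<^esub> (y \<ominus>\<^bsub>F\<^esub> z)" using c by algebra
  also have "\<dots> = a \<otimes>\<^bsub>F\<^esub> (t \<oplus>\<^bsub>F\<^esub> s)" unfolding t s using c by algebra
  finally show ?thesis using congrI[of a x z "t \<oplus>\<^bsub>F\<^esub> s"] assms t s by simp
qed

definition incongruent where "incongruent a Z \<longleftrightarrow> (\<forall>x\<in>Z. \<forall>y\<in>Z. congr a x y \<longrightarrow> x = y)"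

text \<open>Expansions of length \<open>k\<close> in base \<open>a\<close> with digits in \<open>Z\<close>.\<close>

primrec expansions where
  "expansions a Z 0 = {\<zero>\<^bsub>F\<^esub>}"
| "expansions a Z (Suc k) = (\<lambda>(z, t). z \<oplus>\<^bsub>F\<^esub> a \<otimes>\<^bsub>F\<^esub> t) ` (Z \<times> expansions a Z k)"

context
  fixes a assumes a: "a \<in> A" "a \<noteq> \<zero>\<^bsub>F\<^esub>" and Dpos: "D a > 0"
begin

text \<open>Let \<open>l\<close> be the leading coefficient of \<open>a\<close> and \<open>Q = q\<^sup>D\<^sup>(\<^sup>a\<^sup>)\<close>. Comparison of the top coefficients of \<open>a c\<close> and \<open>c a\<close>
shows that the leading coefficient \<open>x\<close> of an element \<open>c\<close> of degree \<open>n\<close> satisfies \<open>l x\<^sup>Q = l\<^sup>Q\<^sup>' x\<close>, where \<open>Q' = q\<^sup>n\<close>. So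
there are at most \<open>Q\<close> leading coefficients in each degree.\<close>

lemma finite_Bd: "finite (Bd n) \<and> card (Bd n) \<le> (q ^ D a) ^ n"
proof (induction n)
  case 0 show ?case by (simp add: Bd_zero)
next
  case (Suc n)
  let ?l = "\<psi> a (D a)"
  let ?d = "\<lambda>j. if j = q ^ D a then ?l else if j = 1 then \<ominus>\<^bsub>L\<^esub> (?l [^]\<^bsub>L\<^esub> (q ^ n)) else \<zero>\<^bsub>L\<^esub>"
  have lL: "?l \<in> carrier L" "?l \<noteq> \<zero>\<^bsub>L\<^esub>" using a D_top by auto
  have Q: "1 < q ^ D a" using q2 Dpos by (intro one_less_power) auto
  define R where "R = {x \<in> carrier L. (\<Oplus>\<^bsub>L\<^esub>j\<in>{..q ^ D a}. ?d j \<otimes>\<^bsub>L\<^esub> x [^]\<^bsub>L\<^esub> j) = \<zero>\<^bsub>L\<^esub>}"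
  have R: "finite R" "card R \<le> q ^ D a"
    unfolding R_def using L.card_roots_le_aux[of "q ^ D a" ?d] lL by auto
  have sumR: "(\<Oplus>\<^bsub>L\<^esub>j\<in>{..q ^ D a}. ?d j \<otimes>\<^bsub>L\<^esub> x [^]\<^bsub>L\<^esub> j)
      = ?l \<otimes>\<^bsub>L\<^esub> x [^]\<^bsub>L\<^esub> (q ^ D a) \<ominus>\<^bsub>L\<^esub> (?l [^]\<^bsub>L\<^esub> (q ^ n)) \<otimes>\<^bsub>L\<^esub> x" if x: "x \<in> carrier L" for x
  proof -
    have "(\<Oplus>\<^bsub>L\<^esub>j\<in>{..q ^ D a}. ?d j \<otimes>\<^bsub>L\<^esub> x [^]\<^bsub>L\<^esub> j)
       = (\<Oplus>\<^bsub>L\<^esub>j\<in>{1, q ^ D a}. ?d j \<otimes>\<^bsub>L\<^esub> x [^]\<^bsub>L\<^esub> j)"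
      by (rule L.add.finprod_mono_neutral_cong_right) (use x lL Q in auto)
    also have "\<dots> = ?d 1 \<otimes>\<^bsub>L\<^esub> x [^]\<^bsub>L\<^esub> (1::nat) \<oplus>\<^bsub>L\<^esub> ?d (q ^ D a) \<otimes>\<^bsub>L\<^esub> x [^]\<^bsub>L\<^esub> (q ^ D a)"
      using x lL Q by (subst L.finsum_insert) auto
    finally show ?thesis using x lL Q by (simp add: L.minus_eq L.l_minus L.a_comm)
  qed
  have "finite (Bd (Suc n)) \<and> card (Bd (Suc n)) \<le> card R * (q ^ D a) ^ n"
  proof (rule card_le_fibres[where f = "\<lambda>c. \<psi> c n"])
    show "(\<lambda>c. \<psi> c n) ` Bd (Suc n) \<subseteq> R"
    proof
      fix x assume "x \<in> (\<lambda>c. \<psi> c n) ` Bd (Suc n)"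
      then obtain c where c: "c \<in> Bd (Suc n)" "x = \<psi> c n" by auto
      have cA: "c \<in> A" using c by (simp add: Bd_def)
      have aB: "a \<in> Bd (Suc (D a))" using D_in_Bd a by simp
      have "\<psi> (c \<otimes>\<^bsub>F\<^esub> a) (n + D a) = x \<otimes>\<^bsub>L\<^esub> ?l [^]\<^bsub>L\<^esub> (q ^ n)"
        using psi_mult_top[OF c(1) aB] c by simp
      moreover have "\<psi> (a \<otimes>\<^bsub>F\<^esub> c) (D a + n) = ?l \<otimes>\<^bsub>L\<^esub> x [^]\<^bsub>L\<^esub> (q ^ D a)"
        using psi_mult_top[OF aB c(1)] c by simp
      moreover have "a \<otimes>\<^bsub>F\<^esub> c = c \<otimes>\<^bsub>F\<^esub> a" using a cA by (simp add: m_comm)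
      ultimately have "?l \<otimes>\<^bsub>L\<^esub> x [^]\<^bsub>L\<^esub> (q ^ D a) = (?l [^]\<^bsub>L\<^esub> (q ^ n)) \<otimes>\<^bsub>L\<^esub> x"
        using lL c cA by (simp add: add.commute L.m_comm)
      moreover have xL: "x \<in> carrier L" using c cA by simp
      ultimately show "x \<in> R" unfolding R_def using sumR[OF xL] lL by (simp add: L.minus_eq L.r_neg)
    qed
    show "finite R" by fact
    fix t assume "t \<in> R"
    let ?S = "{s \<in> Bd (Suc n). \<psi> s n = t}"
    show "finite ?S \<and> card ?S \<le> (q ^ D a) ^ n"
    proof (cases "?S = {}")
      case False
      then obtain c0 where c0: "c0 \<in> Bd (Suc n)" "\<psi> c0 n = t" by auto
      have c0A: "c0 \<in> A" using c0 by (simp add: Bd_def)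
      have inj: "inj_on (\<lambda>c. c \<ominus>\<^bsub>F\<^esub> c0) ?S"
        using c0A by (auto simp: inj_on_def Bd_def minus_eq)
      have sub: "(\<lambda>c. c \<ominus>\<^bsub>F\<^esub> c0) ` ?S \<subseteq> Bd n"
      proof (rule image_subsetI)
        fix c assume c: "c \<in> ?S"
        have "\<psi> (c \<ominus>\<^bsub>F\<^esub> c0) i = \<zero>\<^bsub>L\<^esub>" if "i \<ge> n" for i
        proof (cases "i = n")
          case True thus ?thesis using c c0 c0A by (auto simp: psi_minus Bd_def L.minus_eq L.r_neg)
        next
          case False
          thus ?thesis using that Bd_diff[of c "Suc n" c0] c c0 by (auto simp: Bd_def)
        qed
        thus "c \<ominus>\<^bsub>F\<^esub> c0 \<in> Bd n" using c c0A by (auto simp: Bd_def)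
      qed
      have "finite ?S" using inj sub Suc by (meson inj_on_finite)
      moreover have "card ?S \<le> card (Bd n)" using card_inj_on_le[OF inj sub] Suc by simp
      ultimately show ?thesis using Suc by simp
    qed (simp del: Collect_empty_eq)
  qed
  moreover have "card R * (q ^ D a) ^ n \<le> (q ^ D a) ^ Suc n" using R by simp
  ultimately show ?case by linarith
qed

lemma card_expansions:
  assumes Z: "finite Z" "Z \<subseteq> A" "incongruent a Z"
  shows "expansions a Z k \<subseteq> A \<and> finite (expansions a Z k) \<and> card (expansions a Z k) = card Z ^ k"
proof (induction k)
  case (Suc k)
  have "z \<oplus>\<^bsub>F\<^esub> a \<otimes>\<^bsub>F\<^esub> t \<in> A" if "z \<in> Z" "t \<in> expansions a Z k" for z t
    using that Suc Z(2) a by (intro A_closed) auto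
  hence sub: "expansions a Z (Suc k) \<subseteq> A" by auto
  have "inj_on (\<lambda>(z, t). z \<oplus>\<^bsub>F\<^esub> a \<otimes>\<^bsub>F\<^esub> t) (Z \<times> expansions a Z k)"
  proof (rule inj_onI, clarify)
    fix z t z' t'
    assume h: "z \<in> Z" "t \<in> expansions a Z k" "z' \<in> Z" "t' \<in> expansions a Z k"
      "z \<oplus>\<^bsub>F\<^esub> a \<otimes>\<^bsub>F\<^esub> t = z' \<oplus>\<^bsub>F\<^esub> a \<otimes>\<^bsub>F\<^esub> t'"
    have hA: "z \<in> A" "t \<in> A" "z' \<in> A" "t' \<in> A" using h Z Suc by auto
    have c: "z \<in> carrier F" "t \<in> carrier F" "z' \<in> carrier F" "t' \<in> carrier F" "a \<in> carrier F" using hA a by auto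
    have "z \<ominus>\<^bsub>F\<^esub> z' = (z \<oplus>\<^bsub>F\<^esub> a \<otimes>\<^bsub>F\<^esub> t) \<ominus>\<^bsub>F\<^esub> (z' \<oplus>\<^bsub>F\<^esub> a \<otimes>\<^bsub>F\<^esub> t)" using c by algebra
    also have "\<dots> = a \<otimes>\<^bsub>F\<^esub> (t' \<ominus>\<^bsub>F\<^esub> t)" unfolding h(5) using c by algebra
    finally have "congr a z z'" using congrI[of a z z' "t' \<ominus>\<^bsub>F\<^esub> t"] a hA by simp
    hence zz: "z = z'" using Z(3) h by (simp add: incongruent_def)
    hence "a \<otimes>\<^bsub>F\<^esub> t = a \<otimes>\<^bsub>F\<^esub> t'"
      using h(5) c add.l_cancel[of z' "a \<otimes>\<^bsub>F\<^esub> t" "a \<otimes>\<^bsub>F\<^esub> t'"] by simp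
    hence "t = t'" using a c m_lcancel by simp
    thus "z = z' \<and> t = t'" using zz by simp
  qed
  hence "card (expansions a Z (Suc k)) = card Z * card (expansions a Z k)"
    by (simp add: card_image card_cartesian_product)
  thus ?case using Suc Z sub by simp
qed simp

lemma expansions_Bd:
  assumes Z: "Z \<subseteq> Bd N" shows "expansions a Z k \<subseteq> Bd (N + k * D a)"
proof (induction k)
  case 0
  thus ?case using psi_zero by (simp add: Bd_def)
next
  case (Suc k)
  have "z \<oplus>\<^bsub>F\<^esub> a \<otimes>\<^bsub>F\<^esub> t \<in> Bd (N + Suc k * D a)" if "z \<in> Z" "t \<in> expansions a Z k" for z t
  proof (rule Bd_add)
    show "z \<in> Bd (N + Suc k * D a)" using Z that Bd_mono[of N "N + Suc k * D a"] by auto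
    have "a \<otimes>\<^bsub>F\<^esub> t \<in> Bd (N + k * D a + D a)"
      by (rule Bd_mult) (use that Suc D_in_Bd a in auto)
    thus "a \<otimes>\<^bsub>F\<^esub> t \<in> Bd (N + Suc k * D a)" by (simp add: algebra_simps)
  qed
  thus ?case by auto
qed

lemma finite_sub_Bd:
  assumes "finite Z" "Z \<subseteq> A" obtains N where "Z \<subseteq> Bd N"
proof -
  have "\<exists>N. Z \<subseteq> Bd N" using assms
  proof (induction Z)
    case (insert z Z)
    then obtain N where N: "Z \<subseteq> Bd N" by auto
    have "\<exists>M. z \<in> Bd M"
    proof (cases "z = \<zero>\<^bsub>F\<^esub>")
      case True thus ?thesis using Bd_zero by blast
    next
      case False thus ?thesis using D_in_Bd insert by blast
    qed
    then obtain M where "z \<in> Bd M" by auto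
    hence "insert z Z \<subseteq> Bd (max N M)" using N Bd_mono[of N "max N M"] Bd_mono[of M "max N M"] by auto
    thus ?case by blast
  qed simp
  thus ?thesis using that by blast
qed

text \<open>Expansions with \<open>k\<close> digits are distinct elements of degree at most a constant plus \<open>k D(a)\<close>, of
which there are boundedly many. Growing \<open>k\<close> bounds the number of digits.\<close>

lemma incongruent_card_le:
  assumes Z: "finite Z" "Z \<subseteq> A" "incongruent a Z" shows "card Z \<le> q ^ (D a * Suc (D a))"
proof -
  obtain N where N: "Z \<subseteq> Bd N" using finite_sub_Bd Z by blast
  have "card Z ^ k \<le> (q ^ D a) ^ N * (q ^ (D a * Suc (D a))) ^ k" for k
  proof -
    have "card Z ^ k = card (expansions a Z k)" using card_expansions[OF Z] by simp
    also have "\<dots> \<le> card (Bd (N + k * D a))" using expansions_Bd[OF N] finite_Bd by (intro card_mono) auto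
    also have "\<dots> \<le> (q ^ D a) ^ (N + k * D a)" using finite_Bd by blast
    also have "\<dots> = (q ^ D a) ^ N * (q ^ (D a * D a)) ^ k"
      by (simp add: power_add power_mult[symmetric] mult_ac)
    also have "\<dots> \<le> (q ^ D a) ^ N * (q ^ (D a * Suc (D a))) ^ k"
      using q2 by (intro mult_left_mono power_mono power_increasing) auto
    finally show ?thesis .
  qed
  thus ?thesis by (rule power_bound_imp_le)
qed

text \<open>A maximal set of incongruent elements. This is how \<open>A/a\<close> is seen to be finite.\<close>

lemma exists_residue_system:
  obtains Z where "finite Z" "Z \<subseteq> A" "incongruent a Z" "\<And>x. x \<in> A \<Longrightarrow> \<exists>z\<in>Z. congr a x z"
proof -
  let ?P = "\<lambda>n. \<exists>Z. finite Z \<and> Z \<subseteq> A \<and> incongruent a Z \<and> card Z = n"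
  have P0: "?P 0" by (intro exI[of _ "{}"]) (simp add: incongruent_def)
  have bd: "\<And>n. ?P n \<Longrightarrow> n \<le> q ^ (D a * Suc (D a))" using incongruent_card_le by blast
  obtain n where n: "?P n" "\<And>m. ?P m \<Longrightarrow> m \<le> n"
    using GreatestI_nat[of ?P 0, OF P0 bd] Greatest_le_nat[of ?P _ "q ^ (D a * Suc (D a))", OF _ bd] by blast
  then obtain Z where Z: "finite Z" "Z \<subseteq> A" "incongruent a Z" "card Z = n" by auto
  have "\<exists>z\<in>Z. congr a x z" if x: "x \<in> A" for x
  proof (rule ccontr)
    assume no: "\<not> (\<exists>z\<in>Z. congr a x z)"
    hence "x \<notin> Z" using congr_refl[of a x] a x by auto
    have "incongruent a (insert x Z)"
      using Z no x a congr_sym[of a _ x] unfolding incongruent_def by blast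
    hence "?P (Suc n)" using Z x \<open>x \<notin> Z\<close> by (intro exI[of _ "insert x Z"]) auto
    from n(2)[OF this] show False by simp
  qed
  thus ?thesis using that Z by blast
qed

text \<open>The replacement for the Riemann-Roch theorem: an additive invariant with values in \<open>X\<close> takes the same value on
  two of the expansions in base \<open>a\<close> with just enough digits to outnumber \<open>X\<close>. The constant \<open>C\<close> accounts for the
  degrees of the digits and for rounding the number of digits.\<close>

lemma exists_small_element:
  assumes Z: "finite Z" "Z \<subseteq> A" "incongruent a Z" and w: "card Z ^ \<rho> = q ^ D a"
  obtains C where "\<And>(f :: 'f \<Rightarrow> 'x) X. finite X \<Longrightarrow> f ` A \<subseteq> X \<Longrightarrow>
    \<exists>x\<in>A. \<exists>y\<in>A. x \<noteq> y \<and> f x = f y \<and> q ^ D (x \<ominus>\<^bsub>F\<^esub> y) \<le> C * card X ^ \<rho>"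
proof -
  obtain N where N: "Z \<subseteq> Bd N" using finite_sub_Bd Z by blast
  have "q ^ D a > 1" using q2 Dpos by (intro one_less_power) auto
  have w1: "card Z > 1"
  proof (rule ccontr)
    assume "\<not> card Z > 1"
    hence "card Z ^ \<rho> \<le> 1 ^ \<rho>" by (intro power_mono) auto
    thus False using \<open>q ^ D a > 1\<close> unfolding w by simp
  qed
  have *: "\<exists>x\<in>A. \<exists>y\<in>A. x \<noteq> y \<and> f x = f y \<and> q ^ D (x \<ominus>\<^bsub>F\<^esub> y) \<le> q ^ (N + D a) * card X ^ \<rho>"
    if X: "finite X" "f ` A \<subseteq> X" for f :: "'f \<Rightarrow> 'x" and X
  proof -
    have X1: "card X \<ge> 1" using X A_closed(1) by (metis One_nat_def Suc_leI card_gt_0_iff empty_iff image_subset_iff)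
    \<comment> \<open>Any \<open>k\<close> with \<open>|X| < |Z|\<^sup>k\<close> gives a collision; the least one keeps the degrees small.\<close>
    have ex: "card X < card Z ^ card X" using w1 by (simp add: less_exp power_gt_expt)
    define k where "k = (LEAST k. card X < card Z ^ k)"
    have k: "card X < card Z ^ k" unfolding k_def by (rule LeastI[of _ "card X"], rule ex)
    have "k \<noteq> 0"
    proof
      assume "k = 0"
      thus False using k X1 by simp
    qed
    then obtain k' where k': "k = Suc k'" by (cases k) auto
    have kk: "card Z ^ k' \<le> card X"
      using not_less_Least[of k' "\<lambda>k. card X < card Z ^ k"] k' unfolding k_def by auto
    let ?T = "expansions a Z k"
    have T: "?T \<subseteq> A" "finite ?T" "card ?T = card Z ^ k" using card_expansions[OF Z] by auto
    have "\<not> inj_on f ?T"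
    proof
      assume "inj_on f ?T"
      hence "card ?T \<le> card X" using T X by (intro card_inj_on_le[of f]) auto
      thus False using k T by simp
    qed
    then obtain x y where xy: "x \<in> ?T" "y \<in> ?T" "x \<noteq> y" "f x = f y" by (auto simp: inj_on_def)
    have xyA: "x \<in> A" "y \<in> A" using xy T by auto
    have "x \<ominus>\<^bsub>F\<^esub> y \<in> Bd (N + k * D a)" using expansions_Bd[OF N, of k] xy by (intro Bd_diff) auto
    moreover have "x \<ominus>\<^bsub>F\<^esub> y \<noteq> \<zero>\<^bsub>F\<^esub>" using xy xyA by simp
    ultimately have "D (x \<ominus>\<^bsub>F\<^esub> y) < N + k * D a" by (rule Bd_D)
    hence "q ^ D (x \<ominus>\<^bsub>F\<^esub> y) \<le> q ^ (N + k * D a)" using q2 by (intro power_increasing) auto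
    also have "\<dots> = q ^ (N + D a) * (q ^ D a) ^ k'"
      unfolding k' by (simp add: power_mult[symmetric] power_add[symmetric] algebra_simps)
    also have "(q ^ D a) ^ k' = (card Z ^ k') ^ \<rho>" unfolding w[symmetric] by (simp add: power_mult[symmetric] mult.commute)
    also have "q ^ (N + D a) * (card Z ^ k') ^ \<rho> \<le> q ^ (N + D a) * card X ^ \<rho>"
      using kk by (intro mult_left_mono power_mono) auto
    finally have "q ^ D (x \<ominus>\<^bsub>F\<^esub> y) \<le> q ^ (N + D a) * card X ^ \<rho>" .
    thus ?thesis using xy(3,4) xyA by (intro bexI[of _ x] bexI[of _ y] conjI)
  qed
  show ?thesis by (rule that[of "q ^ (N + D a)"]) (rule *)
qed

end

end

section \<open>Counting torsion points\<close>

text \<open>The points of such a homomorphism over an algebraically closed field, reduced to what the counting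
needs: surjectivity, and the sizes of the kernels.\<close>

locale drinfeld_points = drinfeld_degree F A Ov L q \<psi> D + W: abelian_group W
  for F :: "'f ring" (structure) and A Ov and L :: "'l ring" (structure) and q \<psi> D
    and W :: "('w, 'z) ring_scheme" (structure) +
  fixes act :: "'f \<Rightarrow> 'w \<Rightarrow> 'w"
  assumes act_closed [simp]: "c \<in> A \<Longrightarrow> x \<in> carrier W \<Longrightarrow> act c x \<in> carrier W"
    and act_add: "c \<in> A \<Longrightarrow> x \<in> carrier W \<Longrightarrow> y \<in> carrier W \<Longrightarrow> act c (x \<oplus>\<^bsub>W\<^esub> y) = act c x \<oplus>\<^bsub>W\<^esub> act c y"
    and act_plus: "c \<in> A \<Longrightarrow> d \<in> A \<Longrightarrow> x \<in> carrier W \<Longrightarrow> act (c \<oplus>\<^bsub>F\<^esub> d) x = act c x \<oplus>\<^bsub>W\<^esub> act d x"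
    and act_mult: "c \<in> A \<Longrightarrow> d \<in> A \<Longrightarrow> x \<in> carrier W \<Longrightarrow> act (c \<otimes>\<^bsub>F\<^esub> d) x = act c (act d x)"
    and act_one: "x \<in> carrier W \<Longrightarrow> act \<one>\<^bsub>F\<^esub> x = x"
    and act_surj: "c \<in> A \<Longrightarrow> c \<noteq> \<zero>\<^bsub>F\<^esub> \<Longrightarrow> y \<in> carrier W \<Longrightarrow> \<exists>x\<in>carrier W. act c x = y"
    and card_ker: "c \<in> A \<Longrightarrow> \<psi> c l \<noteq> \<zero>\<^bsub>L\<^esub> \<Longrightarrow> (\<And>i. i < l \<Longrightarrow> \<psi> c i = \<zero>\<^bsub>L\<^esub>) \<Longrightarrow>
      card {x \<in> carrier W. act c x = \<zero>\<^bsub>W\<^esub>} * q ^ l = q ^ D c"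
begin

lemma act_zero: "c \<in> A \<Longrightarrow> act c \<zero>\<^bsub>W\<^esub> = \<zero>\<^bsub>W\<^esub>"
  using act_add[of c "\<zero>\<^bsub>W\<^esub>" "\<zero>\<^bsub>W\<^esub>"] act_closed[of c "\<zero>\<^bsub>W\<^esub>"] by (simp add: W.add.l_cancel_one)

lemma card_ker_low:
  assumes c: "c \<in> A" "c \<noteq> \<zero>\<^bsub>F\<^esub>" and n: "low n c"
  shows "finite {x \<in> carrier W. act c x = \<zero>\<^bsub>W\<^esub>}"
    "card {x \<in> carrier W. act c x = \<zero>\<^bsub>W\<^esub>} * q ^ n \<le> q ^ D c"
proof -
  define l where "l = (LEAST i. \<psi> c i \<noteq> \<zero>\<^bsub>L\<^esub>)"
  have l: "\<psi> c l \<noteq> \<zero>\<^bsub>L\<^esub>" "\<And>i. i < l \<Longrightarrow> \<psi> c i = \<zero>\<^bsub>L\<^esub>"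
    unfolding l_def using LeastI[of "\<lambda>i. \<psi> c i \<noteq> \<zero>\<^bsub>L\<^esub>", OF D_top[OF c]] not_less_Least by auto
  have nl: "n \<le> l" using n l(1) unfolding low_def by (meson not_le)
  have e: "card {x \<in> carrier W. act c x = \<zero>\<^bsub>W\<^esub>} * q ^ l = q ^ D c" using card_ker[OF c(1)] l by simp
  have "card {x \<in> carrier W. act c x = \<zero>\<^bsub>W\<^esub>} \<noteq> 0"
  proof
    assume "card {x \<in> carrier W. act c x = \<zero>\<^bsub>W\<^esub>} = 0"
    thus False using e q2 by simp
  qed
  thus "finite {x \<in> carrier W. act c x = \<zero>\<^bsub>W\<^esub>}" using card_ge_0_finite by blast
  have "card {x \<in> carrier W. act c x = \<zero>\<^bsub>W\<^esub>} * q ^ n \<le> card {x \<in> carrier W. act c x = \<zero>\<^bsub>W\<^esub>} * q ^ l"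
    using nl q2 by (intro mult_left_mono power_increasing) auto
  thus "card {x \<in> carrier W. act c x = \<zero>\<^bsub>W\<^esub>} * q ^ n \<le> q ^ D c" using e by simp
qed

definition comax where "comax x y \<longleftrightarrow> (\<exists>g\<in>A. \<exists>h\<in>A. g \<otimes>\<^bsub>F\<^esub> x \<oplus>\<^bsub>F\<^esub> h \<otimes>\<^bsub>F\<^esub> y = \<one>\<^bsub>F\<^esub>)"

lemma comax_sym: "x \<in> A \<Longrightarrow> y \<in> A \<Longrightarrow> comax x y \<Longrightarrow> comax y x"
  unfolding comax_def by (metis a_comm A_carr A_closed(4))

lemma comax_mult:
  assumes A: "x \<in> A" "y \<in> A" "z \<in> A" and "comax x y" "comax x z"
  shows "comax x (y \<otimes>\<^bsub>F\<^esub> z)"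
proof -
  obtain g h where gh: "g \<in> A" "h \<in> A" "g \<otimes>\<^bsub>F\<^esub> x \<oplus>\<^bsub>F\<^esub> h \<otimes>\<^bsub>F\<^esub> y = \<one>\<^bsub>F\<^esub>" using assms by (auto simp: comax_def)
  obtain g' h' where gh': "g' \<in> A" "h' \<in> A" "g' \<otimes>\<^bsub>F\<^esub> x \<oplus>\<^bsub>F\<^esub> h' \<otimes>\<^bsub>F\<^esub> z = \<one>\<^bsub>F\<^esub>" using assms by (auto simp: comax_def)
  have c: "x \<in> carrier F" "y \<in> carrier F" "z \<in> carrier F" "g \<in> carrier F" "h \<in> carrier F" "g' \<in> carrier F" "h' \<in> carrier F"
    using A gh gh' by auto
  have "(g \<otimes>\<^bsub>F\<^esub> x \<oplus>\<^bsub>F\<^esub> h \<otimes>\<^bsub>F\<^esub> y) \<otimes>\<^bsub>F\<^esub> (g' \<otimes>\<^bsub>F\<^esub> x \<oplus>\<^bsub>F\<^esub> h' \<otimes>\<^bsub>F\<^esub> z)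
    = (g \<otimes>\<^bsub>F\<^esub> (g' \<otimes>\<^bsub>F\<^esub> x \<oplus>\<^bsub>F\<^esub> h' \<otimes>\<^bsub>F\<^esub> z) \<oplus>\<^bsub>F\<^esub> h \<otimes>\<^bsub>F\<^esub> y \<otimes>\<^bsub>F\<^esub> g') \<otimes>\<^bsub>F\<^esub> x \<oplus>\<^bsub>F\<^esub> (h \<otimes>\<^bsub>F\<^esub> h') \<otimes>\<^bsub>F\<^esub> (y \<otimes>\<^bsub>F\<^esub> z)"
    using c by algebra
  hence "(g \<otimes>\<^bsub>F\<^esub> (g' \<otimes>\<^bsub>F\<^esub> x \<oplus>\<^bsub>F\<^esub> h' \<otimes>\<^bsub>F\<^esub> z) \<oplus>\<^bsub>F\<^esub> h \<otimes>\<^bsub>F\<^esub> y \<otimes>\<^bsub>F\<^esub> g') \<otimes>\<^bsub>F\<^esub> x \<oplus>\<^bsub>F\<^esub> (h \<otimes>\<^bsub>F\<^esub> h') \<otimes>\<^bsub>F\<^esub> (y \<otimes>\<^bsub>F\<^esub> z) = \<one>\<^bsub>F\<^esub>"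
    unfolding gh(3) gh'(3) by simp
  moreover have "g \<otimes>\<^bsub>F\<^esub> (g' \<otimes>\<^bsub>F\<^esub> x \<oplus>\<^bsub>F\<^esub> h' \<otimes>\<^bsub>F\<^esub> z) \<oplus>\<^bsub>F\<^esub> h \<otimes>\<^bsub>F\<^esub> y \<otimes>\<^bsub>F\<^esub> g' \<in> A" "h \<otimes>\<^bsub>F\<^esub> h' \<in> A"
    using A gh(1,2) gh'(1,2) by simp_all
  ultimately show ?thesis unfolding comax_def by blast
qed

lemma comax_one: "x \<in> A \<Longrightarrow> comax x \<one>\<^bsub>F\<^esub>"
  unfolding comax_def by (rule bexI[of _ "\<zero>\<^bsub>F\<^esub>"], rule bexI[of _ "\<one>\<^bsub>F\<^esub>"]) auto

lemma comax_pow: "x \<in> A \<Longrightarrow> y \<in> A \<Longrightarrow> comax x y \<Longrightarrow> comax x (y [^]\<^bsub>F\<^esub> (n::nat))"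
  by (induction n) (auto intro: comax_mult comax_one)

context
  fixes a assumes a: "a \<in> A" "a \<noteq> \<zero>\<^bsub>F\<^esub>" and Dpos: "D a > 0"
begin

text \<open>When \<open>e\<close> is an idempotent modulo \<open>a\<close>, this is the \<open>n\<close>-th power of the ideal of elements whose
\<open>e\<close>-component vanishes; for the \<open>E\<close> of \<open>exists_idempotent\<close> it is \<open>\<pp>\<^sup>n\<close>. Working with \<open>e\<close> instead of \<open>\<pp>\<close> treats
\<open>E\<close> and \<open>1 - E\<close> on the same footing.\<close>

definition P where "P e n = {c \<in> A. \<exists>y\<in>A. e [^]\<^bsub>F\<^esub> n \<otimes>\<^bsub>F\<^esub> c = a [^]\<^bsub>F\<^esub> (n::nat) \<otimes>\<^bsub>F\<^esub> y}"

definition torsion where "torsion e n = {x \<in> carrier W. \<forall>c\<in>P e n. act c x = \<zero>\<^bsub>W\<^esub>}"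

lemma apow_nz: "a [^]\<^bsub>F\<^esub> (n::nat) \<noteq> \<zero>\<^bsub>F\<^esub>"
proof (induction n)
  case (Suc n)
  thus ?case using a integral[of "a [^]\<^bsub>F\<^esub> n" a] by auto
qed simp

lemma apow_in_P: "e \<in> A \<Longrightarrow> a [^]\<^bsub>F\<^esub> n \<in> P e n"
  unfolding P_def using a by (auto intro!: bexI[of _ "e [^]\<^bsub>F\<^esub> n"] simp: m_comm)

lemma finite_torsion: assumes "e \<in> A" shows "finite (torsion e n)"
proof (rule finite_subset)
  show "torsion e n \<subseteq> {x \<in> carrier W. act (a [^]\<^bsub>F\<^esub> n) x = \<zero>\<^bsub>W\<^esub>}"
    unfolding torsion_def using apow_in_P[OF assms] by auto
  show "finite {x \<in> carrier W. act (a [^]\<^bsub>F\<^esub> n) x = \<zero>\<^bsub>W\<^esub>}"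
    by (rule card_ker_low(1)[of _ 0]) (use a apow_nz in \<open>auto simp: low_def\<close>)
qed

context
  fixes e b assumes e: "e \<in> A" "b \<in> A" "e \<otimes>\<^bsub>F\<^esub> (\<one>\<^bsub>F\<^esub> \<ominus>\<^bsub>F\<^esub> e) = a \<otimes>\<^bsub>F\<^esub> b"
begin

lemma comax_e: "comax (e [^]\<^bsub>F\<^esub> (i::nat)) ((\<one>\<^bsub>F\<^esub> \<ominus>\<^bsub>F\<^esub> e) [^]\<^bsub>F\<^esub> (j::nat))"
proof -
  have c: "e \<in> carrier F" using e by simp
  have "\<one>\<^bsub>F\<^esub> \<otimes>\<^bsub>F\<^esub> e \<oplus>\<^bsub>F\<^esub> \<one>\<^bsub>F\<^esub> \<otimes>\<^bsub>F\<^esub> (\<one>\<^bsub>F\<^esub> \<ominus>\<^bsub>F\<^esub> e) = \<one>\<^bsub>F\<^esub>" using c by algebra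
  hence "comax e (\<one>\<^bsub>F\<^esub> \<ominus>\<^bsub>F\<^esub> e)" unfolding comax_def using A_closed(2) by blast
  hence "comax e ((\<one>\<^bsub>F\<^esub> \<ominus>\<^bsub>F\<^esub> e) [^]\<^bsub>F\<^esub> j)" using e by (intro comax_pow) auto
  from comax_sym[OF _ _ this] have "comax ((\<one>\<^bsub>F\<^esub> \<ominus>\<^bsub>F\<^esub> e) [^]\<^bsub>F\<^esub> j) e" using e(1) by simp
  hence "comax ((\<one>\<^bsub>F\<^esub> \<ominus>\<^bsub>F\<^esub> e) [^]\<^bsub>F\<^esub> j) (e [^]\<^bsub>F\<^esub> i)" using e by (intro comax_pow) auto
  from comax_sym[OF _ _ this] show ?thesis using e(1) by simp
qed

lemma e'_in_P: "(\<one>\<^bsub>F\<^esub> \<ominus>\<^bsub>F\<^esub> e) [^]\<^bsub>F\<^esub> n \<in> P e n"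
proof -
  have "e [^]\<^bsub>F\<^esub> n \<otimes>\<^bsub>F\<^esub> (\<one>\<^bsub>F\<^esub> \<ominus>\<^bsub>F\<^esub> e) [^]\<^bsub>F\<^esub> n = (e \<otimes>\<^bsub>F\<^esub> (\<one>\<^bsub>F\<^esub> \<ominus>\<^bsub>F\<^esub> e)) [^]\<^bsub>F\<^esub> n"
    by (rule nat_pow_distrib[symmetric]) (use e(1) in auto)
  also have "\<dots> = a [^]\<^bsub>F\<^esub> n \<otimes>\<^bsub>F\<^esub> b [^]\<^bsub>F\<^esub> n"
    unfolding e(3) by (rule nat_pow_distrib) (use a e in auto)
  finally show ?thesis unfolding P_def using e by auto
qed

lemma P_Suc_subset: "P e (Suc n) \<subseteq> P e 1"
proof
  fix c assume "c \<in> P e (Suc n)"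
  then obtain y where y: "y \<in> A" "e [^]\<^bsub>F\<^esub> Suc n \<otimes>\<^bsub>F\<^esub> c = a [^]\<^bsub>F\<^esub> Suc n \<otimes>\<^bsub>F\<^esub> y" and c: "c \<in> A" by (auto simp: P_def simp del: nat_pow_Suc)
  obtain g h where gh: "g \<in> A" "h \<in> A" "g \<otimes>\<^bsub>F\<^esub> e [^]\<^bsub>F\<^esub> n \<oplus>\<^bsub>F\<^esub> h \<otimes>\<^bsub>F\<^esub> (\<one>\<^bsub>F\<^esub> \<ominus>\<^bsub>F\<^esub> e) = \<one>\<^bsub>F\<^esub>"
    using comax_e[of n 1] e unfolding comax_def by auto
  have cc: "e [^]\<^bsub>F\<^esub> n \<in> carrier F" "e \<in> carrier F" "a [^]\<^bsub>F\<^esub> n \<in> carrier F" "a \<in> carrier F" "c \<in> carrier F" "y \<in> carrier F"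
    "g \<in> carrier F" "h \<in> carrier F" "b \<in> carrier F"
    using e a y c gh by auto
  have y': "(e [^]\<^bsub>F\<^esub> n \<otimes>\<^bsub>F\<^esub> e) \<otimes>\<^bsub>F\<^esub> c = (a [^]\<^bsub>F\<^esub> n \<otimes>\<^bsub>F\<^esub> a) \<otimes>\<^bsub>F\<^esub> y" using y(2) by simp
  have "e \<otimes>\<^bsub>F\<^esub> c = (g \<otimes>\<^bsub>F\<^esub> e [^]\<^bsub>F\<^esub> n \<oplus>\<^bsub>F\<^esub> h \<otimes>\<^bsub>F\<^esub> (\<one>\<^bsub>F\<^esub> \<ominus>\<^bsub>F\<^esub> e)) \<otimes>\<^bsub>F\<^esub> (e \<otimes>\<^bsub>F\<^esub> c)" unfolding gh(3) using cc by simp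
  also have "\<dots> = g \<otimes>\<^bsub>F\<^esub> ((e [^]\<^bsub>F\<^esub> n \<otimes>\<^bsub>F\<^esub> e) \<otimes>\<^bsub>F\<^esub> c) \<oplus>\<^bsub>F\<^esub> h \<otimes>\<^bsub>F\<^esub> (e \<otimes>\<^bsub>F\<^esub> (\<one>\<^bsub>F\<^esub> \<ominus>\<^bsub>F\<^esub> e)) \<otimes>\<^bsub>F\<^esub> c"
    using cc by algebra
  also have "\<dots> = a \<otimes>\<^bsub>F\<^esub> (g \<otimes>\<^bsub>F\<^esub> a [^]\<^bsub>F\<^esub> n \<otimes>\<^bsub>F\<^esub> y \<oplus>\<^bsub>F\<^esub> h \<otimes>\<^bsub>F\<^esub> b \<otimes>\<^bsub>F\<^esub> c)"
    unfolding y' e(3) using cc by algebra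
  finally show "c \<in> P e 1"
    unfolding P_def using c cc gh y e a by (auto intro!: bexI[of _ "g \<otimes>\<^bsub>F\<^esub> a [^]\<^bsub>F\<^esub> n \<otimes>\<^bsub>F\<^esub> y \<oplus>\<^bsub>F\<^esub> h \<otimes>\<^bsub>F\<^esub> b \<otimes>\<^bsub>F\<^esub> c"])
qed

text \<open>A preimage of \<open>y\<close> under \<open>a\<close> may have torsion away from the \<open>e\<close>-part. To remove it, one writes
\<open>y = e\<^sup>n\<^sup>+\<^sup>1 g y\<close>, lifts \<open>g y\<close> and multiplies the lift by \<open>e\<^sup>n\<^sup>+\<^sup>1\<close>.\<close>

lemma torsion_lift:
  assumes y: "y \<in> torsion e n" shows "\<exists>x\<in>torsion e (Suc n). act a x = y"
proof -
  have yW: "y \<in> carrier W" using y by (simp add: torsion_def)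
  let ?e = "e [^]\<^bsub>F\<^esub> Suc n" and ?e' = "(\<one>\<^bsub>F\<^esub> \<ominus>\<^bsub>F\<^esub> e) [^]\<^bsub>F\<^esub> n"
  have eA: "?e \<in> A" "?e' \<in> A" using e by auto
  obtain g h where gh: "g \<in> A" "h \<in> A" "g \<otimes>\<^bsub>F\<^esub> ?e \<oplus>\<^bsub>F\<^esub> h \<otimes>\<^bsub>F\<^esub> ?e' = \<one>\<^bsub>F\<^esub>"
    using comax_e[of "Suc n" n] unfolding comax_def by auto
  have "y = act (g \<otimes>\<^bsub>F\<^esub> ?e \<oplus>\<^bsub>F\<^esub> h \<otimes>\<^bsub>F\<^esub> ?e') y" unfolding gh(3) using act_one yW by simp
  also have "\<dots> = act (g \<otimes>\<^bsub>F\<^esub> ?e) y \<oplus>\<^bsub>W\<^esub> act (h \<otimes>\<^bsub>F\<^esub> ?e') y" using gh eA yW by (intro act_plus) auto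
  also have "act (h \<otimes>\<^bsub>F\<^esub> ?e') y = act h (act ?e' y)" using gh eA yW by (intro act_mult) auto
  also have "act ?e' y = \<zero>\<^bsub>W\<^esub>" using y e'_in_P by (simp add: torsion_def)
  also have "act (g \<otimes>\<^bsub>F\<^esub> ?e) y = act (?e \<otimes>\<^bsub>F\<^esub> g) y" using gh eA by (simp add: m_comm)
  also have "act (?e \<otimes>\<^bsub>F\<^esub> g) y = act ?e (act g y)" using gh eA yW by (intro act_mult) auto
  finally have yy: "y = act ?e (act g y)" using gh eA yW by (simp add: act_zero)
  obtain x where x: "x \<in> carrier W" "act a x = act g y" using act_surj[of a "act g y"] a gh yW by auto
  have exW: "act ?e x \<in> carrier W" using eA x by simp
  have "act a (act ?e x) = act (a \<otimes>\<^bsub>F\<^esub> ?e) x" using act_mult[of a ?e x] a eA x by simp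
  also have "a \<otimes>\<^bsub>F\<^esub> ?e = ?e \<otimes>\<^bsub>F\<^esub> a" using a eA by (simp add: m_comm)
  also have "act (?e \<otimes>\<^bsub>F\<^esub> a) x = act ?e (act a x)" using act_mult[of ?e a x] a eA x by simp
  finally have ax: "act a (act ?e x) = y" using x yy by simp
  have "act c (act ?e x) = \<zero>\<^bsub>W\<^esub>" if cP: "c \<in> P e (Suc n)" for c
  proof -
    obtain z where z: "z \<in> A" "?e \<otimes>\<^bsub>F\<^esub> c = a [^]\<^bsub>F\<^esub> Suc n \<otimes>\<^bsub>F\<^esub> z" and cA: "c \<in> A"
      using cP by (auto simp: P_def simp del: nat_pow_Suc)
    have "act c (act ?e x) = act (c \<otimes>\<^bsub>F\<^esub> ?e) x" using act_mult[of c ?e x] cA eA x by simp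
    also have "c \<otimes>\<^bsub>F\<^esub> ?e = ?e \<otimes>\<^bsub>F\<^esub> c" using cA eA by (intro m_comm) auto
    also have "\<dots> = (z \<otimes>\<^bsub>F\<^esub> a [^]\<^bsub>F\<^esub> n) \<otimes>\<^bsub>F\<^esub> a" unfolding z(2) using z a by (simp add: m_ac)
    also have "act ((z \<otimes>\<^bsub>F\<^esub> a [^]\<^bsub>F\<^esub> n) \<otimes>\<^bsub>F\<^esub> a) x = act (z \<otimes>\<^bsub>F\<^esub> a [^]\<^bsub>F\<^esub> n) (act g y)"
      using z a x act_mult[of "z \<otimes>\<^bsub>F\<^esub> a [^]\<^bsub>F\<^esub> n" a x] by simp
    also have "\<dots> = act ((z \<otimes>\<^bsub>F\<^esub> a [^]\<^bsub>F\<^esub> n) \<otimes>\<^bsub>F\<^esub> g) y"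
      using z a gh yW act_mult[of "z \<otimes>\<^bsub>F\<^esub> a [^]\<^bsub>F\<^esub> n" g y] by simp
    also have "(z \<otimes>\<^bsub>F\<^esub> a [^]\<^bsub>F\<^esub> n) \<otimes>\<^bsub>F\<^esub> g = (z \<otimes>\<^bsub>F\<^esub> g) \<otimes>\<^bsub>F\<^esub> a [^]\<^bsub>F\<^esub> n" using z a gh by (simp add: m_ac)
    also have "act ((z \<otimes>\<^bsub>F\<^esub> g) \<otimes>\<^bsub>F\<^esub> a [^]\<^bsub>F\<^esub> n) y = act (z \<otimes>\<^bsub>F\<^esub> g) (act (a [^]\<^bsub>F\<^esub> n) y)"
      using z a gh yW by (intro act_mult) auto
    also have "act (a [^]\<^bsub>F\<^esub> n) y = \<zero>\<^bsub>W\<^esub>" using y apow_in_P e by (simp add: torsion_def)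
    finally show ?thesis using z gh by (simp add: act_zero)
  qed
  hence "act ?e x \<in> torsion e (Suc n)" using exW by (simp add: torsion_def)
  thus ?thesis using ax by blast
qed

lemma torsion_add: "x \<in> torsion e n \<Longrightarrow> y \<in> torsion e n \<Longrightarrow> x \<oplus>\<^bsub>W\<^esub> y \<in> torsion e n"
  unfolding torsion_def P_def by (auto simp: act_add)

text \<open>Sums of a point killed by \<open>P e 1\<close> and a chosen \<open>a\<close>-preimage of a point killed by \<open>P e n\<close> are
distinct.\<close>

lemma card_torsion_ge: "card (torsion e 1) ^ n \<le> card (torsion e n)"
proof (induction n)
  case 0
  have "\<zero>\<^bsub>W\<^esub> \<in> torsion e 0" unfolding torsion_def P_def by (auto simp: act_zero)
  hence "card (torsion e 0) \<noteq> 0" using finite_torsion[OF e(1), of 0] by auto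
  thus ?case by simp
next
  case (Suc n)
  obtain \<sigma> where \<sigma>: "\<And>y. y \<in> torsion e n \<Longrightarrow> \<sigma> y \<in> torsion e (Suc n) \<and> act a (\<sigma> y) = y"
  proof -
    have "\<forall>y\<in>torsion e n. \<exists>x. x \<in> torsion e (Suc n) \<and> act a x = y" using torsion_lift by blast
    from bchoice[OF this] show ?thesis using that by blast
  qed
  have W1: "torsion e m \<subseteq> carrier W" for m by (auto simp: torsion_def)
  have sub: "torsion e 1 \<subseteq> torsion e (Suc n)" using P_Suc_subset by (auto simp: torsion_def)
  have a1: "act a z = \<zero>\<^bsub>W\<^esub>" if "z \<in> torsion e 1" for z
    using that apow_in_P[OF e(1), of 1] a by (auto simp: torsion_def)
  have "inj_on (\<lambda>(z, y). z \<oplus>\<^bsub>W\<^esub> \<sigma> y) (torsion e 1 \<times> torsion e n)"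
  proof (rule inj_onI, clarify)
    fix z y z' y'
    assume h: "z \<in> torsion e 1" "y \<in> torsion e n" "z' \<in> torsion e 1" "y' \<in> torsion e n" "z \<oplus>\<^bsub>W\<^esub> \<sigma> y = z' \<oplus>\<^bsub>W\<^esub> \<sigma> y'"
    have c: "z \<in> carrier W" "z' \<in> carrier W" "\<sigma> y \<in> carrier W" "\<sigma> y' \<in> carrier W" "y \<in> carrier W" "y' \<in> carrier W"
      using h \<sigma> W1 by blast+
    have *: "act a (z \<oplus>\<^bsub>W\<^esub> \<sigma> y) = y" if "z \<in> torsion e 1" "y \<in> torsion e n" for z y
    proof -
      have c: "z \<in> carrier W" "\<sigma> y \<in> carrier W" "y \<in> carrier W" using that \<sigma> W1 by blast+
      have "act a (z \<oplus>\<^bsub>W\<^esub> \<sigma> y) = act a z \<oplus>\<^bsub>W\<^esub> act a (\<sigma> y)" using act_add a c by simp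
      thus ?thesis using a1 \<sigma> that c by simp
    qed
    have "y = y'" using *[OF h(1,2)] *[OF h(3,4)] h(5) by simp
    moreover have "z = z'" using h(5) c unfolding \<open>y = y'\<close> by simp
    ultimately show "z = z' \<and> y = y'" by simp
  qed
  moreover have "(\<lambda>(z, y). z \<oplus>\<^bsub>W\<^esub> \<sigma> y) ` (torsion e 1 \<times> torsion e n) \<subseteq> torsion e (Suc n)"
    using torsion_add sub \<sigma> by fastforce
  ultimately have "card (torsion e 1 \<times> torsion e n) \<le> card (torsion e (Suc n))"
    using finite_torsion[OF e(1), of "Suc n"] by (intro card_inj_on_le)
  hence "card (torsion e 1) * card (torsion e n) \<le> card (torsion e (Suc n))" by (simp add: card_cartesian_product)
  moreover have "card (torsion e 1) ^ Suc n \<le> card (torsion e 1) * card (torsion e n)" using Suc by simp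
  ultimately show ?case by linarith
qed

text \<open>The index of \<open>P e n\<close> is at most the \<open>n\<close>-th power of that of \<open>P e 1\<close>: if \<open>x\<close> and its chosen
representative \<open>r x\<close> agree modulo \<open>P e n\<close>, one records in addition the class of \<open>e\<^sup>n (x - r x)/a\<^sup>n\<close>.\<close>

lemma exists_classifier:
  assumes f1: "\<And>x y. x \<in> A \<Longrightarrow> y \<in> A \<Longrightarrow> f1 x = f1 y \<Longrightarrow> x \<ominus>\<^bsub>F\<^esub> y \<in> P e 1"
    and X: "f1 ` A \<subseteq> X"
  shows "\<exists>f. f ` A \<subseteq> {xs. set xs \<subseteq> X \<and> length xs = n} \<and>
    (\<forall>x\<in>A. \<forall>y\<in>A. f x = f y \<longrightarrow> x \<ominus>\<^bsub>F\<^esub> y \<in> P e n)"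
proof (induction n)
  case 0
  show ?case by (rule exI[of _ "\<lambda>_. []"]) (auto simp: P_def)
next
  case (Suc n)
  then obtain f where f: "f ` A \<subseteq> {xs. set xs \<subseteq> X \<and> length xs = n}"
    "\<And>x y. x \<in> A \<Longrightarrow> y \<in> A \<Longrightarrow> f x = f y \<Longrightarrow> x \<ominus>\<^bsub>F\<^esub> y \<in> P e n" by blast
  define r where "r = (\<lambda>x. SOME y. y \<in> A \<and> f y = f x)"
  have r: "r x \<in> A" "f (r x) = f x" if "x \<in> A" for x
    unfolding r_def using someI[of "\<lambda>y. y \<in> A \<and> f y = f x" x] that by auto
  have r_eq: "r x = r y" if "f x = f y" for x y unfolding r_def that ..
  define k where "k = (\<lambda>x. SOME y. y \<in> A \<and> e [^]\<^bsub>F\<^esub> n \<otimes>\<^bsub>F\<^esub> (x \<ominus>\<^bsub>F\<^esub> r x) = a [^]\<^bsub>F\<^esub> n \<otimes>\<^bsub>F\<^esub> y)"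
  have k: "k x \<in> A \<and> e [^]\<^bsub>F\<^esub> n \<otimes>\<^bsub>F\<^esub> (x \<ominus>\<^bsub>F\<^esub> r x) = a [^]\<^bsub>F\<^esub> n \<otimes>\<^bsub>F\<^esub> k x" if "x \<in> A" for x
  proof -
    have "x \<ominus>\<^bsub>F\<^esub> r x \<in> P e n" using f(2)[of x "r x"] r that by simp
    hence "\<exists>y. y \<in> A \<and> e [^]\<^bsub>F\<^esub> n \<otimes>\<^bsub>F\<^esub> (x \<ominus>\<^bsub>F\<^esub> r x) = a [^]\<^bsub>F\<^esub> n \<otimes>\<^bsub>F\<^esub> y" by (auto simp: P_def)
    thus ?thesis unfolding k_def by (rule someI_ex)
  qed
  let ?f = "\<lambda>x. f1 (k x) # f x"
  have "?f ` A \<subseteq> {xs. set xs \<subseteq> X \<and> length xs = Suc n}"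
  proof (rule image_subsetI)
    fix x assume x: "x \<in> A"
    have "f x \<in> {xs. set xs \<subseteq> X \<and> length xs = n}" "f1 (k x) \<in> X" using f(1) X k[OF x] x by blast+
    thus "?f x \<in> {xs. set xs \<subseteq> X \<and> length xs = Suc n}" by simp
  qed
  moreover have "x \<ominus>\<^bsub>F\<^esub> y \<in> P e (Suc n)" if xy: "x \<in> A" "y \<in> A" "?f x = ?f y" for x y
  proof -
    have rr: "r x = r y" by (rule r_eq) (use xy(3) in simp)
    have fe: "f1 (k x) = f1 (k y)" using xy(3) by simp
    have "k x \<ominus>\<^bsub>F\<^esub> k y \<in> P e 1"
      by (rule f1[OF conjunct1[OF k[OF xy(1)]] conjunct1[OF k[OF xy(2)]] fe])
    then obtain t where t: "t \<in> A" "e \<otimes>\<^bsub>F\<^esub> (k x \<ominus>\<^bsub>F\<^esub> k y) = a \<otimes>\<^bsub>F\<^esub> t" using e a by (auto simp: P_def)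
    have kx: "e [^]\<^bsub>F\<^esub> n \<otimes>\<^bsub>F\<^esub> (x \<ominus>\<^bsub>F\<^esub> r y) = a [^]\<^bsub>F\<^esub> n \<otimes>\<^bsub>F\<^esub> k x" using k[OF xy(1)] rr by simp
    have ky: "e [^]\<^bsub>F\<^esub> n \<otimes>\<^bsub>F\<^esub> (y \<ominus>\<^bsub>F\<^esub> r y) = a [^]\<^bsub>F\<^esub> n \<otimes>\<^bsub>F\<^esub> k y" using k[OF xy(2)] by simp
    have "x \<in> carrier F" "y \<in> carrier F" "r y \<in> carrier F" "k x \<in> carrier F" "k y \<in> carrier F" "t \<in> carrier F"
      "e [^]\<^bsub>F\<^esub> n \<in> carrier F" "a [^]\<^bsub>F\<^esub> n \<in> carrier F" "e \<in> carrier F" "a \<in> carrier F"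
      using xy r k t e a by auto
    note c = this
    have "e [^]\<^bsub>F\<^esub> Suc n \<otimes>\<^bsub>F\<^esub> (x \<ominus>\<^bsub>F\<^esub> y)
       = e \<otimes>\<^bsub>F\<^esub> (e [^]\<^bsub>F\<^esub> n \<otimes>\<^bsub>F\<^esub> (x \<ominus>\<^bsub>F\<^esub> r y) \<ominus>\<^bsub>F\<^esub> e [^]\<^bsub>F\<^esub> n \<otimes>\<^bsub>F\<^esub> (y \<ominus>\<^bsub>F\<^esub> r y))"
      unfolding nat_pow_Suc using c by algebra
    also have "\<dots> = a [^]\<^bsub>F\<^esub> n \<otimes>\<^bsub>F\<^esub> (e \<otimes>\<^bsub>F\<^esub> (k x \<ominus>\<^bsub>F\<^esub> k y))" unfolding kx ky using c by algebra
    also have "\<dots> = a [^]\<^bsub>F\<^esub> Suc n \<otimes>\<^bsub>F\<^esub> t" unfolding t nat_pow_Suc using c by algebra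
    finally show ?thesis unfolding P_def using xy t by (auto simp del: nat_pow_Suc)
  qed
  ultimately show ?case by (intro exI[of _ ?f]) auto
qed

text \<open>The pigeonhole principle applied to the classes modulo \<open>P e n\<close> gives a nonzero \<open>c \<in> P e n\<close> whose kernel
has at most \<open>C |X|\<^sup>\<rho>\<^sup>n/q\<^sup>n\<^sup>l\<close> elements, and this kernel contains \<open>torsion e n\<close>. Taking \<open>n\<close>-th roots for \<open>n \<rightarrow> \<infinity>\<close>
removes \<open>C\<close>.\<close>

lemma card_torsion_le:
  assumes Z: "finite Z" "Z \<subseteq> A" "incongruent a Z" and w: "card Z ^ \<rho> = q ^ D a"
    and f1: "\<And>x y. x \<in> A \<Longrightarrow> y \<in> A \<Longrightarrow> f1 x = f1 y \<Longrightarrow> x \<ominus>\<^bsub>F\<^esub> y \<in> P e 1"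
    and X: "f1 ` A \<subseteq> X" "finite X"
    and lo: "\<And>n c. c \<in> P e n \<Longrightarrow> low (n * l) c"
  shows "card (torsion e 1) * q ^ l \<le> card X ^ \<rho>"
proof -
  obtain C where C: "\<And>f Y. finite Y \<Longrightarrow> f ` A \<subseteq> Y \<Longrightarrow>
    \<exists>x\<in>A. \<exists>y\<in>A. x \<noteq> y \<and> f x = (f y :: 'a list) \<and> q ^ D (x \<ominus>\<^bsub>F\<^esub> y) \<le> C * card Y ^ \<rho>"
    using exists_small_element[OF a Dpos Z w, where 'x = "'a list"] by blast
  have "(card (torsion e 1) * q ^ l) ^ n \<le> C * (card X ^ \<rho>) ^ n" for n
  proof -
    let ?Y = "{xs. set xs \<subseteq> X \<and> length xs = n}"
    obtain f where f: "f ` A \<subseteq> ?Y" "\<And>x y. x \<in> A \<Longrightarrow> y \<in> A \<Longrightarrow> f x = f y \<Longrightarrow> x \<ominus>\<^bsub>F\<^esub> y \<in> P e n"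
      using exists_classifier[of f1 X n, OF f1 X(1)] by blast
    obtain x y where xy: "x \<in> A" "y \<in> A" "x \<noteq> y" "f x = f y" "q ^ D (x \<ominus>\<^bsub>F\<^esub> y) \<le> C * card ?Y ^ \<rho>"
      using C[OF finite_lists_length_eq[OF X(2)] f(1)] by blast
    let ?c = "x \<ominus>\<^bsub>F\<^esub> y"
    have c: "?c \<in> A" "?c \<noteq> \<zero>\<^bsub>F\<^esub>" "?c \<in> P e n" using xy f(2) by auto
    note K = card_ker_low[OF c(1,2) lo[OF c(3)]]
    have "(card (torsion e 1) * q ^ l) ^ n = card (torsion e 1) ^ n * q ^ (n * l)"
      by (simp add: power_mult_distrib power_mult[symmetric] mult.commute)
    also have "\<dots> \<le> card (torsion e n) * q ^ (n * l)" using card_torsion_ge by simp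
    also have "card (torsion e n) \<le> card {x \<in> carrier W. act ?c x = \<zero>\<^bsub>W\<^esub>}"
      using c(3) K(1) by (intro card_mono) (auto simp: torsion_def)
    hence "card (torsion e n) * q ^ (n * l) \<le> card {x \<in> carrier W. act ?c x = \<zero>\<^bsub>W\<^esub>} * q ^ (n * l)" by simp
    also have "\<dots> \<le> q ^ D ?c" by (rule K(2))
    also have "\<dots> \<le> C * card ?Y ^ \<rho>" by (rule xy(5))
    also have "card ?Y = card X ^ n" by (rule card_lists_length_eq[OF X(2)])
    also have "(card X ^ n) ^ \<rho> = (card X ^ \<rho>) ^ n" by (simp add: power_mult[symmetric] mult.commute)
    finally show ?thesis .
  qed
  thus ?thesis by (rule power_bound_imp_le)
qed

end

text \<open>The upper bounds for \<open>E\<close>, where all of the inseparability of \<open>a\<close> sits, and for \<open>1 - E\<close> multiply to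
an upper bound for \<open>\<psi>[a]\<close> that is attained. So both are equalities.\<close>

lemma card_torsion_eq:
  assumes Z: "finite Z" "Z \<subseteq> A" "incongruent a Z" and z: "\<And>x. x \<in> A \<Longrightarrow> z x \<in> Z \<and> congr a x (z x)"
    and w: "card Z ^ \<rho> = q ^ D a"
    and E: "E \<in> A" "b \<in> A" "E \<otimes>\<^bsub>F\<^esub> (\<one>\<^bsub>F\<^esub> \<ominus>\<^bsub>F\<^esub> E) = a \<otimes>\<^bsub>F\<^esub> b" "\<psi> E 0 = \<one>\<^bsub>L\<^esub>"
    and l: "low l a" "\<psi> a l \<noteq> \<zero>\<^bsub>L\<^esub>"
  shows "card (torsion E 1) * q ^ l = card ((\<lambda>x. z (E \<otimes>\<^bsub>F\<^esub> x)) ` A) ^ \<rho>"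
proof -
  define E' where "E' = \<one>\<^bsub>F\<^esub> \<ominus>\<^bsub>F\<^esub> E"
  have cE: "E \<in> carrier F" "a \<in> carrier F" "b \<in> carrier F" using E a by auto
  have E'A: "E' \<in> A" using E by (simp add: E'_def)
  have EE: "\<one>\<^bsub>F\<^esub> \<ominus>\<^bsub>F\<^esub> E' = E" unfolding E'_def using cE by algebra
  have E': "E' \<in> A" "b \<in> A" "E' \<otimes>\<^bsub>F\<^esub> (\<one>\<^bsub>F\<^esub> \<ominus>\<^bsub>F\<^esub> E') = a \<otimes>\<^bsub>F\<^esub> b"
  proof -
    show "E' \<otimes>\<^bsub>F\<^esub> (\<one>\<^bsub>F\<^esub> \<ominus>\<^bsub>F\<^esub> E') = a \<otimes>\<^bsub>F\<^esub> b" unfolding EE E(3)[symmetric] using cE E'A by (simp add: E'_def m_comm)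
  qed (use E'A E in auto)
  have zz: "congr a x y" if "x \<in> A" "y \<in> A" "z x = z y" for x y
  proof -
    have "congr a x (z x)" "congr a (z x) y" "z x \<in> A"
      using z[OF that(1)] z[OF that(2)] that congr_sym[of a y "z y"] a Z by auto
    thus ?thesis using congr_trans[of a x "z x" y] a that by simp
  qed
  have f1: "x \<ominus>\<^bsub>F\<^esub> y \<in> P e 1" if exy: "e \<in> A" "x \<in> A" "y \<in> A" "z (e \<otimes>\<^bsub>F\<^esub> x) = z (e \<otimes>\<^bsub>F\<^esub> y)" for e x y
  proof -
    have "congr a (e \<otimes>\<^bsub>F\<^esub> x) (e \<otimes>\<^bsub>F\<^esub> y)" using zz exy by simp
    then obtain t where t: "t \<in> A" "e \<otimes>\<^bsub>F\<^esub> x \<ominus>\<^bsub>F\<^esub> e \<otimes>\<^bsub>F\<^esub> y = a \<otimes>\<^bsub>F\<^esub> t"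
      by (rule congrD[rotated 3]) (use a exy in auto)
    have c: "e \<in> carrier F" "x \<in> carrier F" "y \<in> carrier F" using exy by auto
    have "e \<otimes>\<^bsub>F\<^esub> (x \<ominus>\<^bsub>F\<^esub> y) = a \<otimes>\<^bsub>F\<^esub> t" unfolding t(2)[symmetric] using c by algebra
    thus ?thesis unfolding P_def using exy t a by auto
  qed
  let ?X = "\<lambda>e. (\<lambda>x. z (e \<otimes>\<^bsub>F\<^esub> x)) ` A"
  have XZ: "?X e \<subseteq> Z" if "e \<in> A" for e using z that by auto
  have Xf: "finite (?X e)" if "e \<in> A" for e using XZ[OF that] Z finite_subset by blast
  let ?u = "card (torsion E 1)" and ?u' = "card (torsion E' 1)" and ?m = "card (?X E)" and ?m' = "card (?X E')"
  have loE: "low (n * l) c" if c: "c \<in> P E n" for n c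
  proof -
    obtain y where y: "y \<in> A" "E [^]\<^bsub>F\<^esub> n \<otimes>\<^bsub>F\<^esub> c = a [^]\<^bsub>F\<^esub> n \<otimes>\<^bsub>F\<^esub> y" and cA: "c \<in> A" using c by (auto simp: P_def)
    have "low (n * l + 0) (a [^]\<^bsub>F\<^esub> n \<otimes>\<^bsub>F\<^esub> y)" using a y low_pow[OF a(1) l(1)] by (intro low_mult) (auto simp: low_def)
    hence "low (n * l) (E [^]\<^bsub>F\<^esub> n \<otimes>\<^bsub>F\<^esub> c)" using y by simp
    moreover have "\<psi> (E [^]\<^bsub>F\<^esub> n) 0 \<noteq> \<zero>\<^bsub>L\<^esub>" using psi_pow_0[OF E(1,4), of n] by simp
    ultimately show ?thesis using low_cancel[of "E [^]\<^bsub>F\<^esub> n" c] E cA by simp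
  qed
  have 1: "?u * q ^ l \<le> ?m ^ \<rho>"
    using card_torsion_le[OF E(1-3) Z w f1[OF E(1)] subset_refl Xf[OF E(1)] loE] .
  have "?u' * q ^ 0 \<le> ?m' ^ \<rho>"
    by (rule card_torsion_le[OF E' Z w f1[OF E'(1)] subset_refl Xf[OF E'(1)]]) (simp_all add: low_def)
  hence 2: "?u' \<le> ?m' ^ \<rho>" by simp
  \<comment> \<open>Chinese remainders: the residue of \<open>E x + E' y\<close> determines those of \<open>E x\<close> and \<open>E' y\<close>.\<close>
  have 3: "?m * ?m' \<le> card Z"
  proof -
    define g where "g = (\<lambda>s. (z (E \<otimes>\<^bsub>F\<^esub> s), z (E' \<otimes>\<^bsub>F\<^esub> s)))"
    have zc: "z x = z y" if "x \<in> A" "y \<in> A" "congr a x y" for x y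
    proof -
      have "congr a (z x) x" "congr a y (z y)" "z x \<in> A" "z y \<in> A" "z x \<in> Z" "z y \<in> Z"
        using z[OF that(1)] z[OF that(2)] that congr_sym[of a x "z x"] a Z by auto
      hence "congr a (z x) (z y)" using congr_trans[of a "z x" x y] congr_trans[of a "z x" y "z y"] a that by simp
      thus ?thesis using Z(3) \<open>z x \<in> Z\<close> \<open>z y \<in> Z\<close> by (simp add: incongruent_def)
    qed
    have "?X E \<times> ?X E' \<subseteq> g ` Z"
    proof clarify
      fix x y assume xy: "x \<in> A" "y \<in> A"
      define s where "s = E \<otimes>\<^bsub>F\<^esub> x \<oplus>\<^bsub>F\<^esub> E' \<otimes>\<^bsub>F\<^esub> y"
      have sA: "s \<in> A" using xy E E' by (simp add: s_def)
      define w where "w = z s"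
      have zsA: "w \<in> A" "w \<in> Z" using z[OF sA] Z by (auto simp: w_def)
      obtain t where t: "t \<in> A" "s \<ominus>\<^bsub>F\<^esub> w = a \<otimes>\<^bsub>F\<^esub> t"
        by (rule congrD[of a s "w"]) (use z[OF sA] sA zsA a in \<open>auto simp: w_def\<close>)
      have c: "x \<in> carrier F" "y \<in> carrier F" "E' \<in> carrier F" "w \<in> carrier F" "t \<in> carrier F" "s \<in> carrier F"
        using xy E' zsA t sA by auto
      have zs: "w = s \<ominus>\<^bsub>F\<^esub> a \<otimes>\<^bsub>F\<^esub> t" unfolding t(2)[symmetric] using c by algebra
      have sq: "v \<otimes>\<^bsub>F\<^esub> v = v \<ominus>\<^bsub>F\<^esub> v \<otimes>\<^bsub>F\<^esub> (\<one>\<^bsub>F\<^esub> \<ominus>\<^bsub>F\<^esub> v)" if v: "v \<in> carrier F" for v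
      proof -
        have "v \<otimes>\<^bsub>F\<^esub> (\<one>\<^bsub>F\<^esub> \<ominus>\<^bsub>F\<^esub> v) = v \<ominus>\<^bsub>F\<^esub> v \<otimes>\<^bsub>F\<^esub> v" using v by (simp add: minus_eq r_distr r_minus)
        thus ?thesis using v by algebra
      qed
      have e1: "E \<otimes>\<^bsub>F\<^esub> E = E \<ominus>\<^bsub>F\<^esub> a \<otimes>\<^bsub>F\<^esub> b" unfolding E(3)[symmetric] by (rule sq[OF cE(1)])
      have e2: "E' \<otimes>\<^bsub>F\<^esub> E' = E' \<ominus>\<^bsub>F\<^esub> a \<otimes>\<^bsub>F\<^esub> b" unfolding E'(3)[symmetric] by (rule sq[OF c(3)])
      have e3: "E \<otimes>\<^bsub>F\<^esub> E' = a \<otimes>\<^bsub>F\<^esub> b" using E(3) by (simp add: E'_def)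
      have "E \<otimes>\<^bsub>F\<^esub> w = (E \<otimes>\<^bsub>F\<^esub> E) \<otimes>\<^bsub>F\<^esub> x \<oplus>\<^bsub>F\<^esub> (E \<otimes>\<^bsub>F\<^esub> E') \<otimes>\<^bsub>F\<^esub> y \<ominus>\<^bsub>F\<^esub> a \<otimes>\<^bsub>F\<^esub> (E \<otimes>\<^bsub>F\<^esub> t)"
        unfolding zs s_def using c cE by algebra
      hence "E \<otimes>\<^bsub>F\<^esub> w \<ominus>\<^bsub>F\<^esub> E \<otimes>\<^bsub>F\<^esub> x = a \<otimes>\<^bsub>F\<^esub> (b \<otimes>\<^bsub>F\<^esub> y \<ominus>\<^bsub>F\<^esub> b \<otimes>\<^bsub>F\<^esub> x \<ominus>\<^bsub>F\<^esub> E \<otimes>\<^bsub>F\<^esub> t)"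
        unfolding e1 e3 using c cE by algebra
      hence k1: "congr a (E \<otimes>\<^bsub>F\<^esub> w) (E \<otimes>\<^bsub>F\<^esub> x)"
        using a E xy zsA t by (intro congrI[of a _ _ "b \<otimes>\<^bsub>F\<^esub> y \<ominus>\<^bsub>F\<^esub> b \<otimes>\<^bsub>F\<^esub> x \<ominus>\<^bsub>F\<^esub> E \<otimes>\<^bsub>F\<^esub> t"]) auto
      have "E' \<otimes>\<^bsub>F\<^esub> w = (E \<otimes>\<^bsub>F\<^esub> E') \<otimes>\<^bsub>F\<^esub> x \<oplus>\<^bsub>F\<^esub> (E' \<otimes>\<^bsub>F\<^esub> E') \<otimes>\<^bsub>F\<^esub> y \<ominus>\<^bsub>F\<^esub> a \<otimes>\<^bsub>F\<^esub> (E' \<otimes>\<^bsub>F\<^esub> t)"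
        unfolding zs s_def using c cE by algebra
      hence "E' \<otimes>\<^bsub>F\<^esub> w \<ominus>\<^bsub>F\<^esub> E' \<otimes>\<^bsub>F\<^esub> y = a \<otimes>\<^bsub>F\<^esub> (b \<otimes>\<^bsub>F\<^esub> x \<ominus>\<^bsub>F\<^esub> b \<otimes>\<^bsub>F\<^esub> y \<ominus>\<^bsub>F\<^esub> E' \<otimes>\<^bsub>F\<^esub> t)"
        unfolding e2 e3 using c cE by algebra
      hence k2: "congr a (E' \<otimes>\<^bsub>F\<^esub> w) (E' \<otimes>\<^bsub>F\<^esub> y)"
        using a E E' xy zsA t by (intro congrI[of a _ _ "b \<otimes>\<^bsub>F\<^esub> x \<ominus>\<^bsub>F\<^esub> b \<otimes>\<^bsub>F\<^esub> y \<ominus>\<^bsub>F\<^esub> E' \<otimes>\<^bsub>F\<^esub> t"]) auto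
      have "g (w) = (z (E \<otimes>\<^bsub>F\<^esub> x), z (E' \<otimes>\<^bsub>F\<^esub> y))"
        unfolding g_def using zc[OF _ _ k1] zc[OF _ _ k2] E E' xy zsA by simp
      thus "(z (E \<otimes>\<^bsub>F\<^esub> x), z (E' \<otimes>\<^bsub>F\<^esub> y)) \<in> g ` Z" using zsA by (metis image_eqI)
    qed
    hence "card (?X E \<times> ?X E') \<le> card Z" using Z(1) by (meson card_image_le card_mono finite_imageI le_trans)
    thus ?thesis by (simp add: card_cartesian_product)
  qed
  \<comment> \<open>A point killed by \<open>a\<close> is the sum of its two components.\<close>
  have 4: "q ^ D a \<le> ?u * ?u' * q ^ l"
  proof -
    let ?K = "{x \<in> carrier W. act a x = \<zero>\<^bsub>W\<^esub>}"
    have tor: "act e x \<in> torsion e 1" if "e \<in> A" "x \<in> ?K" for e x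
    proof -
      have "act c (act e x) = \<zero>\<^bsub>W\<^esub>" if c: "c \<in> P e 1" for c
      proof -
        obtain y where y: "y \<in> A" "e \<otimes>\<^bsub>F\<^esub> c = a \<otimes>\<^bsub>F\<^esub> y" and cA: "c \<in> A" using c \<open>e \<in> A\<close> a by (auto simp: P_def)
        have "act c (act e x) = act (c \<otimes>\<^bsub>F\<^esub> e) x" using act_mult[of c e x] cA \<open>e \<in> A\<close> \<open>x \<in> ?K\<close> by simp
        also have "c \<otimes>\<^bsub>F\<^esub> e = y \<otimes>\<^bsub>F\<^esub> a" using y cA \<open>e \<in> A\<close> a m_comm[of c e] m_comm[of y a] by simp
        also have "act (y \<otimes>\<^bsub>F\<^esub> a) x = act y (act a x)" using act_mult[of y a x] y a \<open>x \<in> ?K\<close> by simp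
        finally show ?thesis using \<open>x \<in> ?K\<close> y by (simp add: act_zero)
      qed
      thus ?thesis using that by (simp add: torsion_def)
    qed
    have "inj_on (\<lambda>x. (act E x, act E' x)) ?K"
    proof (rule inj_onI)
      fix x y assume h: "x \<in> ?K" "y \<in> ?K" "(act E x, act E' x) = (act E y, act E' y)"
      have s: "v = act E v \<oplus>\<^bsub>W\<^esub> act E' v" if "v \<in> carrier W" for v
      proof -
        have "E \<oplus>\<^bsub>F\<^esub> E' = \<one>\<^bsub>F\<^esub>" unfolding E'_def using cE by algebra
        thus ?thesis using act_plus[of E E' v] act_one[of v] E E' that by simp
      qed
      show "x = y" using s[of x] s[of y] h by simp
    qed
    moreover have "(\<lambda>x. (act E x, act E' x)) ` ?K \<subseteq> torsion E 1 \<times> torsion E' 1"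
      using tor[OF E(1)] tor[OF E'(1)] by auto
    ultimately have "card ?K \<le> card (torsion E 1 \<times> torsion E' 1)"
      using finite_torsion E E' by (intro card_inj_on_le) auto
    hence "card ?K * q ^ l \<le> ?u * ?u' * q ^ l" by (simp add: card_cartesian_product)
    moreover have "card ?K * q ^ l = q ^ D a" using card_ker[OF a(1) l(2)] l(1) by (simp add: low_def)
    ultimately show ?thesis by simp
  qed
  have "?X E' \<noteq> {}" using A_closed(1) by blast
  hence "?m' \<noteq> 0" using Xf[OF E'(1)] by (simp add: card_eq_0_iff)
  hence m'pos: "?m' ^ \<rho> > 0" by simp
  show ?thesis
  proof (rule antisym[OF 1], rule ccontr)
    assume "\<not> ?m ^ \<rho> \<le> ?u * q ^ l"
    hence "?u * q ^ l < ?m ^ \<rho>" by simp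
    hence "?u * q ^ l * ?m' ^ \<rho> < ?m ^ \<rho> * ?m' ^ \<rho>" using m'pos by simp
    also have "\<dots> = (?m * ?m') ^ \<rho>" by (simp add: power_mult_distrib)
    also have "\<dots> \<le> card Z ^ \<rho>" using 3 by (intro power_mono) auto
    also have "\<dots> = q ^ D a" by (rule w)
    also have "\<dots> \<le> ?u * q ^ l * ?u'" using 4 by (simp add: mult_ac)
    also have "\<dots> \<le> ?u * q ^ l * ?m' ^ \<rho>" using 2 by (intro mult_left_mono) auto
    finally show False by simp
  qed
qed

end

end

section \<open>Finite modules over a residue field\<close>

context module
begin

definition lin :: "(nat \<Rightarrow> 'c) \<Rightarrow> nat \<Rightarrow> (nat \<Rightarrow> 'a) \<Rightarrow> 'c" where
  "lin x j c = (\<Oplus>\<^bsub>M\<^esub>i\<in>{..<j}. c i \<odot>\<^bsub>M\<^esub> x i)"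

lemma lin_closed: "x \<in> {..<j} \<rightarrow> carrier M \<Longrightarrow> c \<in> {..<j} \<rightarrow> carrier R \<Longrightarrow> lin x j c \<in> carrier M"
  unfolding lin_def by (intro M.finsum_closed) auto

lemma lin_cong: "x \<in> {..<j} \<rightarrow> carrier M \<Longrightarrow> c \<in> {..<j} \<rightarrow> carrier R \<Longrightarrow>
    (\<And>i. i < j \<Longrightarrow> c i = d i) \<Longrightarrow> (\<And>i. i < j \<Longrightarrow> x i = y i) \<Longrightarrow> lin x j c = lin y j d"
proof -
  assume a: "x \<in> {..<j} \<rightarrow> carrier M" "c \<in> {..<j} \<rightarrow> carrier R" "\<And>i. i < j \<Longrightarrow> c i = d i" "\<And>i. i < j \<Longrightarrow> x i = y i"
  have "d i \<odot>\<^bsub>M\<^esub> y i \<in> carrier M" if "i < j" for i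
    using a(3)[OF that, symmetric] a(4)[OF that, symmetric] a(1,2) that by (auto simp: Pi_def)
  thus ?thesis unfolding lin_def using a by (intro M.finsum_cong') auto
qed

lemma lin_Suc:
  assumes "x \<in> {..<Suc j} \<rightarrow> carrier M" "c \<in> {..<Suc j} \<rightarrow> carrier R"
  shows "lin x (Suc j) c = c j \<odot>\<^bsub>M\<^esub> x j \<oplus>\<^bsub>M\<^esub> lin x j c"
proof -
  have "(\<Oplus>\<^bsub>M\<^esub>i\<in>insert j {..<j}. c i \<odot>\<^bsub>M\<^esub> x i) = c j \<odot>\<^bsub>M\<^esub> x j \<oplus>\<^bsub>M\<^esub> (\<Oplus>\<^bsub>M\<^esub>i\<in>{..<j}. c i \<odot>\<^bsub>M\<^esub> x i)"
    by (rule M.finsum_insert) (use assms in \<open>auto simp: Pi_def\<close>)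
  moreover have "insert j {..<j} = {..<Suc j}" by auto
  ultimately show ?thesis by (simp add: lin_def)
qed

lemma lin_add:
  assumes "x \<in> {..<j} \<rightarrow> carrier M" "c \<in> {..<j} \<rightarrow> carrier R" "d \<in> {..<j} \<rightarrow> carrier R"
  shows "lin x j (\<lambda>i. c i \<oplus> d i) = lin x j c \<oplus>\<^bsub>M\<^esub> lin x j d"
proof -
  have "lin x j (\<lambda>i. c i \<oplus> d i) = (\<Oplus>\<^bsub>M\<^esub>i\<in>{..<j}. c i \<odot>\<^bsub>M\<^esub> x i \<oplus>\<^bsub>M\<^esub> d i \<odot>\<^bsub>M\<^esub> x i)"
    unfolding lin_def using assms by (intro M.finsum_cong') (auto simp: smult_l_distr Pi_def)
  thus ?thesis unfolding lin_def using assms by (subst (asm) M.finsum_addf) (auto simp: Pi_def)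
qed

lemma lin_smult:
  assumes "x \<in> {..<j} \<rightarrow> carrier M" "c \<in> {..<j} \<rightarrow> carrier R" "a \<in> carrier R"
  shows "lin x j (\<lambda>i. a \<otimes> c i) = a \<odot>\<^bsub>M\<^esub> lin x j c"
proof -
  have "a \<odot>\<^bsub>M\<^esub> lin x j c = (\<Oplus>\<^bsub>M\<^esub>i\<in>{..<j}. a \<odot>\<^bsub>M\<^esub> (c i \<odot>\<^bsub>M\<^esub> x i))"
    unfolding lin_def using assms by (intro finsum_smult_ldistr) (auto simp: Pi_def)
  also have "\<dots> = lin x j (\<lambda>i. a \<otimes> c i)"
    unfolding lin_def using assms by (intro M.finsum_cong') (auto simp: smult_assoc1 Pi_def)
  finally show ?thesis by simp
qed

lemma lin_zero: "x \<in> {..<j} \<rightarrow> carrier M \<Longrightarrow> (\<And>i. i < j \<Longrightarrow> c i \<odot>\<^bsub>M\<^esub> x i = \<zero>\<^bsub>M\<^esub>) \<Longrightarrow> lin x j c = \<zero>\<^bsub>M\<^esub>"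
proof -
  assume a: "x \<in> {..<j} \<rightarrow> carrier M" "\<And>i. i < j \<Longrightarrow> c i \<odot>\<^bsub>M\<^esub> x i = \<zero>\<^bsub>M\<^esub>"
  have "lin x j c = (\<Oplus>\<^bsub>M\<^esub>i\<in>{..<j}. \<zero>\<^bsub>M\<^esub>)" unfolding lin_def using a by (intro M.finsum_cong') auto
  thus ?thesis by (simp add: M.finsum_zero)
qed

context
  fixes p
  assumes p: "ideal p R" and one_p: "\<one> \<notin> p"
    and inv_p: "\<And>v. v \<in> carrier R \<Longrightarrow> v \<notin> p \<Longrightarrow> \<exists>w\<in>carrier R. \<one> \<ominus> v \<otimes> w \<in> p"
    and pM: "\<And>c x. c \<in> p \<Longrightarrow> x \<in> carrier M \<Longrightarrow> c \<odot>\<^bsub>M\<^esub> x = \<zero>\<^bsub>M\<^esub>"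
    and finM: "finite (carrier M)"
begin

text \<open>Linear independence over the residue field \<open>R/p\<close>, expressed with coefficients in \<open>R\<close>.\<close>

definition indep where
  "indep x j \<longleftrightarrow> x \<in> {..<j} \<rightarrow> carrier M \<and>
     (\<forall>c\<in>{..<j} \<rightarrow> carrier R. lin x j c = \<zero>\<^bsub>M\<^esub> \<longrightarrow> (\<forall>i<j. c i \<in> p))"

definition span where "span x j = lin x j ` ({..<j} \<rightarrow> carrier R)"

lemma span_sub: "x \<in> {..<j} \<rightarrow> carrier M \<Longrightarrow> span x j \<subseteq> carrier M"
  unfolding span_def using lin_closed by auto

lemma indep_Suc_imp: assumes "indep x (Suc j)" shows "indep x j"
  unfolding indep_def
proof (intro conjI ballI impI allI)
  have xM: "x \<in> {..<Suc j} \<rightarrow> carrier M" using assms by (simp add: indep_def)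
  thus xj: "x \<in> {..<j} \<rightarrow> carrier M" by auto
  fix c i assume c: "c \<in> {..<j} \<rightarrow> carrier R" "lin x j c = \<zero>\<^bsub>M\<^esub>" and i: "i < j"
  let ?c = "c(j := \<zero>)"
  have cR: "?c \<in> {..<Suc j} \<rightarrow> carrier R" using c by (auto simp: less_Suc_eq)
  have "lin x j ?c = lin x j c" using xj c by (intro lin_cong[symmetric]) auto
  hence "lin x (Suc j) ?c = \<zero>\<^bsub>M\<^esub>" using lin_Suc[OF xM cR] c xM by (simp add: Pi_def)
  hence "?c i \<in> p" using assms cR i unfolding indep_def by (metis less_Suc_eq)
  thus "c i \<in> p" using i by simp
qed

lemma card_span_ge: "indep x j \<Longrightarrow> Suc j \<le> card (span x j)"
proof (induction j)
  case 0
  have "span x 0 \<noteq> {}" unfolding span_def by auto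
  moreover have "finite (span x 0)" using span_sub[of x 0] finM finite_subset by auto
  ultimately show ?case by (simp add: Suc_le_eq card_gt_0_iff)
next
  case (Suc j)
  have xM: "x \<in> {..<Suc j} \<rightarrow> carrier M" using Suc.prems by (simp add: indep_def)
  have xj: "x \<in> {..<j} \<rightarrow> carrier M" and xjj: "x j \<in> carrier M" using xM by auto
  have IH: "Suc j \<le> card (span x j)" using Suc indep_Suc_imp by blast
  have sub: "span x j \<subseteq> span x (Suc j)"
  proof
    fix n assume "n \<in> span x j"
    then obtain c where c: "c \<in> {..<j} \<rightarrow> carrier R" "n = lin x j c" by (auto simp: span_def)
    let ?c = "c(j := \<zero>)"
    have cR: "?c \<in> {..<Suc j} \<rightarrow> carrier R" using c by (auto simp: less_Suc_eq)
    have "lin x j ?c = lin x j c" using xj c by (intro lin_cong[symmetric]) auto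
    hence "lin x (Suc j) ?c = n" using lin_Suc[OF xM cR] c xjj lin_closed[OF xj c(1)] by simp
    thus "n \<in> span x (Suc j)" using cR by (auto simp: span_def)
  qed
  have "x j \<in> span x (Suc j)"
  proof -
    let ?c = "\<lambda>i. if i = j then \<one> else \<zero>"
    have cR: "?c \<in> {..<Suc j} \<rightarrow> carrier R" by auto
    have "lin x j ?c = \<zero>\<^bsub>M\<^esub>" using xj by (intro lin_zero) (auto simp: Pi_def)
    hence "lin x (Suc j) ?c = x j" using lin_Suc[OF xM cR] xjj by simp
    thus ?thesis using cR unfolding span_def by (metis image_eqI)
  qed
  moreover have "x j \<notin> span x j"
  proof
    assume "x j \<in> span x j"
    then obtain c where c: "c \<in> {..<j} \<rightarrow> carrier R" "x j = lin x j c" by (auto simp: span_def)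
    let ?c = "c(j := \<ominus> \<one>)"
    have cR: "?c \<in> {..<Suc j} \<rightarrow> carrier R" using c by (auto simp: less_Suc_eq)
    have "lin x j ?c = lin x j c" using xj c by (intro lin_cong[symmetric]) auto
    hence "lin x (Suc j) ?c = (\<ominus> \<one>) \<odot>\<^bsub>M\<^esub> x j \<oplus>\<^bsub>M\<^esub> x j" using lin_Suc[OF xM cR] c by simp
    also have "\<dots> = \<zero>\<^bsub>M\<^esub>" using xjj by (simp add: smult_l_minus M.l_neg)
    finally have "?c j \<in> p" using Suc.prems cR unfolding indep_def by blast
    hence "\<ominus> \<one> \<in> p" by simp
    from additive_subgroup.a_inv_closed[OF ideal.axioms(1)[OF p] this] show False using one_p by simp
  qed
  ultimately have "span x j \<subset> span x (Suc j)" using sub by auto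
  moreover have "finite (span x (Suc j))" using span_sub[OF xM] finM finite_subset by auto
  ultimately have "card (span x j) < card (span x (Suc j))" by (rule psubset_card_mono[rotated])
  thus ?case using IH by simp
qed

text \<open>An independent sequence of maximal length spans. The length is bounded because the spans of longer
independent sequences are larger.\<close>

lemma exists_basis: obtains x j where "indep x j" "span x j = carrier M"
proof -
  let ?P = "\<lambda>j. \<exists>x. indep x j"
  have P0: "?P 0" by (auto simp: indep_def)
  have bd: "\<And>j. ?P j \<Longrightarrow> j \<le> card (carrier M)"
  proof -
    fix j assume "?P j"
    then obtain x where x: "indep x j" by auto
    have "card (span x j) \<le> card (carrier M)"
      using span_sub[of x j] x finM by (intro card_mono) (auto simp: indep_def)
    thus "j \<le> card (carrier M)" using card_span_ge[OF x] by simp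
  qed
  obtain j where j: "?P j" "\<And>m. ?P m \<Longrightarrow> m \<le> j"
    using GreatestI_nat[of ?P 0, OF P0 bd] Greatest_le_nat[of ?P _ "card (carrier M)", OF _ bd] by blast
  then obtain x where x: "indep x j" by auto
  have xj: "x \<in> {..<j} \<rightarrow> carrier M" using x by (simp add: indep_def)
  have "n \<in> span x j" if n: "n \<in> carrier M" for n
  proof -
    let ?x = "x(j := n)"
    have xM: "?x \<in> {..<Suc j} \<rightarrow> carrier M" using xj n by (auto simp: less_Suc_eq)
    have "\<not> indep ?x (Suc j)" using j(2)[of "Suc j"] by auto
    then obtain c i where c: "c \<in> {..<Suc j} \<rightarrow> carrier R" "lin ?x (Suc j) c = \<zero>\<^bsub>M\<^esub>" "i < Suc j" "c i \<notin> p"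
      using xM by (auto simp: indep_def)
    have cj: "c \<in> {..<j} \<rightarrow> carrier R" and cjj: "c j \<in> carrier R" using c by auto
    have "lin ?x j c = lin x j c" using xj cj by (intro lin_cong[symmetric]) auto
    hence eq: "c j \<odot>\<^bsub>M\<^esub> n \<oplus>\<^bsub>M\<^esub> lin x j c = \<zero>\<^bsub>M\<^esub>" using lin_Suc[OF xM c(1)] c(2) by simp
    have l: "lin x j c \<in> carrier M" using lin_closed xj cj by blast
    have "c j \<notin> p"
    proof
      assume "c j \<in> p"
      hence "lin x j c = \<zero>\<^bsub>M\<^esub>" using eq pM n l by simp
      hence all: "\<forall>i<j. c i \<in> p" using x cj unfolding indep_def by blast
      thus False using c(3,4) \<open>c j \<in> p\<close> by (auto simp: less_Suc_eq)
    qed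
    then obtain w where w: "w \<in> carrier R" "\<one> \<ominus> c j \<otimes> w \<in> p" using inv_p cjj by blast
    have "\<one> \<odot>\<^bsub>M\<^esub> n = ((\<one> \<ominus> c j \<otimes> w) \<oplus> c j \<otimes> w) \<odot>\<^bsub>M\<^esub> n"
      using w cjj by (simp add: R.minus_eq R.a_assoc R.l_neg)
    also have "\<dots> = (\<one> \<ominus> c j \<otimes> w) \<odot>\<^bsub>M\<^esub> n \<oplus>\<^bsub>M\<^esub> (c j \<otimes> w) \<odot>\<^bsub>M\<^esub> n"
      using w cjj n by (intro smult_l_distr) auto
    also have "\<dots> = (w \<otimes> c j) \<odot>\<^bsub>M\<^esub> n" using pM[OF w(2) n] w cjj n by (simp add: m_comm)
    also have "\<dots> = w \<odot>\<^bsub>M\<^esub> (c j \<odot>\<^bsub>M\<^esub> n)" using w cjj n by (intro smult_assoc1) auto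
    also have "c j \<odot>\<^bsub>M\<^esub> n = \<ominus>\<^bsub>M\<^esub> lin x j c" using M.minus_equality[OF eq l] cjj n by simp
    also have "\<dots> = (\<ominus> \<one>) \<odot>\<^bsub>M\<^esub> lin x j c" using l by (simp add: smult_l_minus)
    also have "\<dots> = lin x j (\<lambda>i. (\<ominus> \<one>) \<otimes> c i)" using xj cj by (intro lin_smult[symmetric]) auto
    also have "w \<odot>\<^bsub>M\<^esub> \<dots> = lin x j (\<lambda>i. w \<otimes> ((\<ominus> \<one>) \<otimes> c i))"
      using xj cj w by (intro lin_smult[symmetric]) (auto simp: Pi_def)
    finally have "n = lin x j (\<lambda>i. w \<otimes> ((\<ominus> \<one>) \<otimes> c i))" using n by simp
    moreover have "(\<lambda>i. w \<otimes> ((\<ominus> \<one>) \<otimes> c i)) \<in> {..<j} \<rightarrow> carrier R" using cj w by (auto simp: Pi_def)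
    ultimately show ?thesis unfolding span_def by blast
  qed
  hence "span x j = carrier M" using span_sub[OF xj] by auto
  thus ?thesis using that x by blast
qed

lemma lin_eq_iff:
  assumes x: "indep x j" and c: "c \<in> {..<j} \<rightarrow> carrier R" "d \<in> {..<j} \<rightarrow> carrier R"
  shows "lin x j c = lin x j d \<longleftrightarrow> (\<forall>i<j. c i \<ominus> d i \<in> p)"
proof -
  have xj: "x \<in> {..<j} \<rightarrow> carrier M" using x by (simp add: indep_def)
  let ?e = "\<lambda>i. c i \<ominus> d i"
  have e: "?e \<in> {..<j} \<rightarrow> carrier R" using c by (auto simp: Pi_def)
  have "lin x j c = lin x j (\<lambda>i. ?e i \<oplus> d i)"
    using xj c by (intro lin_cong) (auto simp: Pi_def R.minus_eq R.a_assoc R.l_neg)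
  also have "\<dots> = lin x j ?e \<oplus>\<^bsub>M\<^esub> lin x j d" using xj e c by (intro lin_add)
  finally have eq: "lin x j c = lin x j ?e \<oplus>\<^bsub>M\<^esub> lin x j d" .
  have cl: "lin x j ?e \<in> carrier M" "lin x j d \<in> carrier M" using lin_closed xj e c by blast+
  have "lin x j c = lin x j d \<longleftrightarrow> lin x j ?e = \<zero>\<^bsub>M\<^esub>" unfolding eq using cl by simp
  also have "\<dots> \<longleftrightarrow> (\<forall>i<j. ?e i \<in> p)"
  proof
    assume "lin x j ?e = \<zero>\<^bsub>M\<^esub>"
    thus "\<forall>i<j. ?e i \<in> p" using x e unfolding indep_def by blast
  next
    assume "\<forall>i<j. ?e i \<in> p"
    thus "lin x j ?e = \<zero>\<^bsub>M\<^esub>" using xj pM by (intro lin_zero) (auto simp: Pi_def)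
  qed
  finally show ?thesis .
qed

text \<open>\<open>Q\<close> is a copy of the residue field as a module, with \<open>\<kappa>\<close> inducing the isomorphism.\<close>

lemma exists_iso_power:
  fixes Q :: "('a, 'q) module" and \<kappa> :: "'a \<Rightarrow> 'q"
  assumes \<kappa>: "\<kappa> ` carrier R = carrier Q"
    and \<kappa>_eq: "\<And>r s. r \<in> carrier R \<Longrightarrow> s \<in> carrier R \<Longrightarrow> \<kappa> r = \<kappa> s \<longleftrightarrow> r \<ominus> s \<in> p"
    and \<kappa>_add: "\<And>r s. r \<in> carrier R \<Longrightarrow> s \<in> carrier R \<Longrightarrow> \<kappa> (r \<oplus> s) = \<kappa> r \<oplus>\<^bsub>Q\<^esub> \<kappa> s"
    and \<kappa>_smult: "\<And>r s. r \<in> carrier R \<Longrightarrow> s \<in> carrier R \<Longrightarrow> \<kappa> (r \<otimes> s) = r \<odot>\<^bsub>Q\<^esub> \<kappa> s"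
  shows "\<exists>j u. bij_betw u (carrier M) (carrier (mod_power Q j)) \<and> u \<in> carrier M \<rightarrow>\<^sub>E carrier (mod_power Q j) \<and>
    (\<forall>m\<in>carrier M. \<forall>n\<in>carrier M. u (m \<oplus>\<^bsub>M\<^esub> n) = u m \<oplus>\<^bsub>mod_power Q j\<^esub> u n) \<and>
    (\<forall>a\<in>carrier R. \<forall>m\<in>carrier M. u (a \<odot>\<^bsub>M\<^esub> m) = a \<odot>\<^bsub>mod_power Q j\<^esub> u m)"
proof -
  obtain x j where x: "indep x j" and sp: "span x j = carrier M" by (rule exists_basis)
  have xj: "x \<in> {..<j} \<rightarrow> carrier M" using x by (simp add: indep_def)
  define co where "co = (\<lambda>n. SOME c. c \<in> {..<j} \<rightarrow> carrier R \<and> lin x j c = n)"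
  have co: "co n \<in> {..<j} \<rightarrow> carrier R" "lin x j (co n) = n" if "n \<in> carrier M" for n
  proof -
    have "\<exists>c. c \<in> {..<j} \<rightarrow> carrier R \<and> lin x j c = n" using that unfolding sp[symmetric] span_def by blast
    from someI_ex[OF this] show "co n \<in> {..<j} \<rightarrow> carrier R" "lin x j (co n) = n" unfolding co_def by auto
  qed
  define u where "u = (\<lambda>n\<in>carrier M. \<lambda>i\<in>{..<j}. \<kappa> (co n i))"
  have u_eq: "u n = (\<lambda>i\<in>{..<j}. \<kappa> (c i))" if "n \<in> carrier M" "c \<in> {..<j} \<rightarrow> carrier R" "lin x j c = n" for n c
  proof -
    have "\<forall>i<j. co n i \<ominus> c i \<in> p" using lin_eq_iff[OF x co(1)[OF that(1)] that(2)] co(2)[OF that(1)] that(3) by simp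
    hence "\<kappa> (co n i) = \<kappa> (c i)" if "i < j" for i
      using \<kappa>_eq[of "co n i" "c i"] that co(1)[OF \<open>n \<in> carrier M\<close>] \<open>c \<in> {..<j} \<rightarrow> carrier R\<close> by (auto simp: Pi_def)
    thus ?thesis using that(1) by (auto simp: u_def)
  qed
  have inj: "inj_on u (carrier M)"
  proof (rule inj_onI)
    fix m n assume mn: "m \<in> carrier M" "n \<in> carrier M" "u m = u n"
    have "\<kappa> (co m i) = \<kappa> (co n i)" if "i < j" for i
    proof -
      have "u m i = u n i" using mn by simp
      thus ?thesis using that mn by (simp add: u_def)
    qed
    hence "\<forall>i<j. co m i \<ominus> co n i \<in> p" using \<kappa>_eq co(1)[OF mn(1)] co(1)[OF mn(2)] by (auto simp: Pi_def)
    hence "lin x j (co m) = lin x j (co n)" using lin_eq_iff[OF x] co mn by blast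
    thus "m = n" using co mn by simp
  qed
  have uE: "u \<in> carrier M \<rightarrow>\<^sub>E carrier (mod_power Q j)"
  proof (rule PiE_I)
    fix n assume n: "n \<in> carrier M"
    have "\<kappa> (co n i) \<in> carrier Q" if "i < j" for i using \<kappa> co(1)[OF n] that by (auto simp: Pi_def)
    thus "u n \<in> carrier (mod_power Q j)" using n by (auto simp: u_def mod_power_def)
  qed (simp add: u_def)
  have surj: "u ` carrier M = carrier (mod_power Q j)"
  proof
    show "u ` carrier M \<subseteq> carrier (mod_power Q j)" using uE by auto
    show "carrier (mod_power Q j) \<subseteq> u ` carrier M"
    proof
      fix y assume "y \<in> carrier (mod_power Q j)"
      hence y: "y \<in> {..<j} \<rightarrow>\<^sub>E carrier Q" by (simp add: mod_power_def)
      hence "\<forall>i\<in>{..<j}. \<exists>r. r \<in> carrier R \<and> \<kappa> r = y i" using \<kappa> by (auto simp: PiE_def Pi_def) (metis imageE)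
      from bchoice[OF this] obtain c where c: "\<And>i. i < j \<Longrightarrow> c i \<in> carrier R \<and> \<kappa> (c i) = y i" by auto
      have cR: "c \<in> {..<j} \<rightarrow> carrier R" using c by auto
      have "u (lin x j c) = (\<lambda>i\<in>{..<j}. \<kappa> (c i))" using u_eq[OF lin_closed[OF xj cR] cR] by simp
      also have "\<dots> = y" using y c by (auto simp: PiE_def extensional_def)
      finally show "y \<in> u ` carrier M" using lin_closed[OF xj cR] by blast
    qed
  qed
  have add: "u (m \<oplus>\<^bsub>M\<^esub> n) = u m \<oplus>\<^bsub>mod_power Q j\<^esub> u n" if mn: "m \<in> carrier M" "n \<in> carrier M" for m n
  proof -
    have cR: "(\<lambda>i. co m i \<oplus> co n i) \<in> {..<j} \<rightarrow> carrier R" using co(1)[OF mn(1)] co(1)[OF mn(2)] by (auto simp: Pi_def)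
    have "lin x j (\<lambda>i. co m i \<oplus> co n i) = m \<oplus>\<^bsub>M\<^esub> n" using lin_add[OF xj] co mn by simp
    hence "u (m \<oplus>\<^bsub>M\<^esub> n) = (\<lambda>i\<in>{..<j}. \<kappa> (co m i \<oplus> co n i))" using u_eq cR mn by simp
    also have "\<dots> = (\<lambda>i\<in>{..<j}. \<kappa> (co m i) \<oplus>\<^bsub>Q\<^esub> \<kappa> (co n i))"
      using co(1)[OF mn(1)] co(1)[OF mn(2)] by (intro restrict_ext \<kappa>_add) (auto simp: Pi_def)
    also have "\<dots> = u m \<oplus>\<^bsub>mod_power Q j\<^esub> u n" using mn by (auto simp: u_def mod_power_def)
    finally show ?thesis .
  qed
  have smult: "u (a \<odot>\<^bsub>M\<^esub> m) = a \<odot>\<^bsub>mod_power Q j\<^esub> u m" if am: "a \<in> carrier R" "m \<in> carrier M" for a m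
  proof -
    have cR: "(\<lambda>i. a \<otimes> co m i) \<in> {..<j} \<rightarrow> carrier R" using co(1)[OF am(2)] am by (auto simp: Pi_def)
    have "lin x j (\<lambda>i. a \<otimes> co m i) = a \<odot>\<^bsub>M\<^esub> m" using lin_smult[OF xj] co am by simp
    hence "u (a \<odot>\<^bsub>M\<^esub> m) = (\<lambda>i\<in>{..<j}. \<kappa> (a \<otimes> co m i))" using u_eq cR am by simp
    also have "\<dots> = (\<lambda>i\<in>{..<j}. a \<odot>\<^bsub>Q\<^esub> \<kappa> (co m i))"
      using co(1)[OF am(2)] am by (intro restrict_ext \<kappa>_smult) (auto simp: Pi_def)
    also have "\<dots> = a \<odot>\<^bsub>mod_power Q j\<^esub> u m" using am by (auto simp: u_def mod_power_def)
    finally show ?thesis .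
  qed
  show ?thesis using inj surj uE add smult by (intro exI[of _ j] exI[of _ u]) (auto simp: bij_betw_def)
qed

text \<open>Counting elements shows that the exponent \<open>j\<close> of such an isomorphism is unique, so the definite
description denotes it. The structures \<open>N\<close> and \<open>R'\<close> only have to share the relevant components with \<open>M\<close> and \<open>R\<close>, because
the record fields without meaning for modules may differ.\<close>

lemma card_eq_residue_power:
  fixes Q :: "('a, 'q) module" and \<kappa> :: "'a \<Rightarrow> 'q" and N :: "('a, 'c) module"
  assumes \<kappa>: "\<kappa> ` carrier R = carrier Q"
    and \<kappa>_eq: "\<And>r s. r \<in> carrier R \<Longrightarrow> s \<in> carrier R \<Longrightarrow> \<kappa> r = \<kappa> s \<longleftrightarrow> r \<ominus> s \<in> p"
    and \<kappa>_add: "\<And>r s. r \<in> carrier R \<Longrightarrow> s \<in> carrier R \<Longrightarrow> \<kappa> (r \<oplus> s) = \<kappa> r \<oplus>\<^bsub>Q\<^esub> \<kappa> s"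
    and \<kappa>_smult: "\<And>r s. r \<in> carrier R \<Longrightarrow> s \<in> carrier R \<Longrightarrow> \<kappa> (r \<otimes> s) = r \<odot>\<^bsub>Q\<^esub> \<kappa> s"
    and finQ: "finite (carrier Q)"
    and NM: "carrier N = carrier M" "ring.add N = ring.add M" "smult N = smult M"
    and R': "carrier R' = carrier R"
  shows "card (carrier M) = card (carrier Q) ^ (THE j. mod_iso R' N (mod_power Q j) \<noteq> {})"
proof -
  have iff: "mod_iso R' N (mod_power Q j) \<noteq> {} \<longleftrightarrow>
    (\<exists>u. bij_betw u (carrier M) (carrier (mod_power Q j)) \<and> u \<in> carrier M \<rightarrow>\<^sub>E carrier (mod_power Q j) \<and>
    (\<forall>m\<in>carrier M. \<forall>n\<in>carrier M. u (m \<oplus>\<^bsub>M\<^esub> n) = u m \<oplus>\<^bsub>mod_power Q j\<^esub> u n) \<and>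
    (\<forall>a\<in>carrier R. \<forall>m\<in>carrier M. u (a \<odot>\<^bsub>M\<^esub> m) = a \<odot>\<^bsub>mod_power Q j\<^esub> u m))" for j
    unfolding mod_iso_def mod_hom_def NM R' by blast
  obtain j where j: "mod_iso R' N (mod_power Q j) \<noteq> {}"
    using exists_iso_power[OF \<kappa> \<kappa>_eq \<kappa>_add \<kappa>_smult] unfolding iff by blast
  have card: "card (carrier M) = card (carrier Q) ^ i" if "mod_iso R' N (mod_power Q i) \<noteq> {}" for i
  proof -
    obtain u where "bij_betw u (carrier M) (carrier (mod_power Q i))" using \<open>mod_iso R' N (mod_power Q i) \<noteq> {}\<close> unfolding iff by blast
    hence "card (carrier M) = card ({..<i} \<rightarrow>\<^sub>E carrier Q)" using bij_betw_same_card by (fastforce simp: mod_power_def)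
    thus ?thesis by (simp add: card_funcsetE)
  qed
  have "\<kappa> \<zero> \<noteq> \<kappa> \<one>"
  proof
    assume "\<kappa> \<zero> = \<kappa> \<one>"
    hence "\<one> \<ominus> \<zero> \<in> p" using \<kappa>_eq[of \<one> \<zero>] by simp
    thus False using one_p by (simp add: R.minus_eq)
  qed
  moreover have "{\<kappa> \<zero>, \<kappa> \<one>} \<subseteq> carrier Q" using \<kappa> by auto
  ultimately have Q2: "card (carrier Q) \<ge> 2" using card_mono[OF finQ, of "{\<kappa> \<zero>, \<kappa> \<one>}"] by simp
  have "(THE j. mod_iso R' N (mod_power Q j) \<noteq> {}) = j"
  proof (rule the_equality)
    show "mod_iso R' N (mod_power Q j) \<noteq> {}" by (rule j)
    fix i assume "mod_iso R' N (mod_power Q i) \<noteq> {}"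
    hence "card (carrier Q) ^ i = card (carrier Q) ^ j" using card[of i] card[OF j] by simp
    thus "i = j" using Q2 by (simp add: power_inject_exp)
  qed
  thus ?thesis using card[OF j] by simp
qed

end

end

section \<open>Cardinality and dimension\<close>

lemma (in ring) card_of_dimension:
  assumes "dimension n K E" "subfield K R" "finite K"
  shows "finite E \<and> card E = card K ^ n"
  using assms
proof (induction rule: dimension.induct)
  case (zero_dim K) thus ?case by simp
next
  case (Suc_dim v E n K)
  note sp = space_subgroup_props[OF Suc_dim(5) Suc_dim(3)]
  have KR: "K \<subseteq> carrier R" using subfieldE(3)[OF Suc_dim(5)] .
  have Km: "k \<ominus> l \<in> K" if "k \<in> K" "l \<in> K" for k l
    using subringE(5,7)[OF subfieldE(1)[OF Suc_dim(5)]] that by (simp add: minus_eq)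
  let ?f = "\<lambda>(k, e). k \<otimes> v \<oplus> e"
  have im: "line_extension K v E = ?f ` (K \<times> E)" by (auto simp: line_extension_mem_iff, blast)
  have "inj_on ?f (K \<times> E)"
  proof (rule inj_onI, clarify)
    fix k e k' e' assume h: "k \<in> K" "e \<in> E" "k' \<in> K" "e' \<in> E" "k \<otimes> v \<oplus> e = k' \<otimes> v \<oplus> e'"
    have c: "k \<in> carrier R" "k' \<in> carrier R" "e \<in> carrier R" "e' \<in> carrier R" "v \<in> carrier R"
      using h KR sp(1) Suc_dim(1) by auto
    have "(k \<ominus> k') \<otimes> v = (k \<otimes> v \<oplus> e) \<ominus> (k' \<otimes> v \<oplus> e)" using c by algebra
    also have "\<dots> = e' \<ominus> e" unfolding h(5) using c by algebra
    finally have "(k \<ominus> k') \<otimes> v \<in> E" using sp(3,4) h by (simp add: minus_eq)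
    hence "k \<ominus> k' = \<zero>" using sp(6)[of "k \<ominus> k'" v] Km h Suc_dim(1,2) by blast
    hence "k = k'" using c by simp
    thus "k = k' \<and> e = e'" using h(5) c by simp
  qed
  hence "card (line_extension K v E) = card K * card E" unfolding im by (simp add: card_image card_cartesian_product)
  moreover have "finite (line_extension K v E)" unfolding im using Suc_dim by auto
  ultimately show ?case using Suc_dim by simp
qed

lemma card_quotient_dim:
  assumes I: "ideal I R" and k: "subfield k R" "finite k" and one: "\<one>\<^bsub>R\<^esub> \<notin> I"
    and fin: "finite (carrier (R Quot I))"
  shows "card (carrier (R Quot I)) = card k ^ ring.dim (R Quot I) ((\<lambda>c. I +>\<^bsub>R\<^esub> c) ` k) (carrier (R Quot I))"
proof -
  have z: "\<zero>\<^bsub>R Quot I\<^esub> = I" "\<one>\<^bsub>R Quot I\<^esub> = I +>\<^bsub>R\<^esub> \<one>\<^bsub>R\<^esub>" by (simp_all add: FactRing_def)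
  interpret I: ideal I R by fact
  interpret h: ring_hom_ring R "R Quot I" "\<lambda>c. I +>\<^bsub>R\<^esub> c" by (rule I.rcos_ring_hom_ring)
  let ?k = "(\<lambda>c. I +>\<^bsub>R\<^esub> c) ` k"
  have "\<one>\<^bsub>R Quot I\<^esub> \<noteq> \<zero>\<^bsub>R Quot I\<^esub>"
  proof
    assume "\<one>\<^bsub>R Quot I\<^esub> = \<zero>\<^bsub>R Quot I\<^esub>"
    hence eq: "I +>\<^bsub>R\<^esub> \<one>\<^bsub>R\<^esub> = I" unfolding z .
    have "\<one>\<^bsub>R\<^esub> \<in> I +>\<^bsub>R\<^esub> \<one>\<^bsub>R\<^esub>" by (rule I.a_rcos_self) (rule I.one_closed)
    thus False using one unfolding eq by (rule notE[rotated])
  qed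
  note sub = h.img_is_subfield[OF k(1) this]
  obtain Us where Us: "set Us = carrier (R Quot I)" using fin finite_list by blast
  have UsR: "set Us \<subseteq> carrier (R Quot I)" by (rule equalityD1[OF Us])
  have "h.S.Span ?k Us = carrier (R Quot I)"
  proof (rule subset_antisym)
    show "h.S.Span ?k Us \<subseteq> carrier (R Quot I)"
      by (rule h.S.Span_in_carrier[OF subfieldE(3)[OF sub(2)] UsR])
    show "carrier (R Quot I) \<subseteq> h.S.Span ?k Us"
      using h.S.Span_base_incl[OF sub(2) UsR] unfolding Us .
  qed
  from h.S.Span_finite_dimension[OF sub(2) UsR] this
  have "h.S.finite_dimension ?k (carrier (R Quot I))" by (rule back_subst)
  then obtain n where n: "h.S.dimension n ?k (carrier (R Quot I))" by (auto simp: h.S.finite_dimension_def)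
  have "h.S.dim ?k (carrier (R Quot I)) = n" using h.S.dimI[OF sub(2) n] by (simp add: over_def)
  moreover have "card ?k = card k" using sub(1) by (rule card_image)
  ultimately show ?thesis using h.S.card_of_dimension[OF n sub(2)] k(2) by simp
qed

section \<open>The ring of functions regular away from infinity\<close>

locale function_base =
  fixes B :: "'f base"
  assumes is_base: "is_base B"
begin

lemma F_field: "field (ffield B)"
  using is_base by (simp add: is_base_def global_function_field_def)

lemma AA_subring: "subring (AA B) (ffield B)"
proof -
  interpret F: field "ffield B" by (rule F_field)
  have pl: "\<one>\<^bsub>ffield B\<^esub> \<in> Ow" "x \<in> Ow \<Longrightarrow> \<ominus>\<^bsub>ffield B\<^esub> x \<in> Ow"
    "x \<in> Ow \<Longrightarrow> y \<in> Ow \<Longrightarrow> x \<otimes>\<^bsub>ffield B\<^esub> y \<in> Ow" "x \<in> Ow \<Longrightarrow> y \<in> Ow \<Longrightarrow> x \<oplus>\<^bsub>ffield B\<^esub> y \<in> Ow"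
    if "place (ffield B) (constf B) Ow" for Ow x y
    using that subringE[of Ow "ffield B"] by (auto simp: place_def)
  show ?thesis
    unfolding AA_def regular_away_def
    by (rule F.subringI) (auto simp: pl)
qed

text \<open>If \<open>z\<close> had a pole at a place then \<open>z\<^sup>j\<close> would have a pole of larger order than the right-hand side.\<close>

lemma AA_integral:
  assumes z: "z \<in> carrier (ffield B)" and y: "y \<in> AA B" and ij: "i < j"
    and eq: "z [^]\<^bsub>ffield B\<^esub> (j::nat) = z [^]\<^bsub>ffield B\<^esub> i \<oplus>\<^bsub>ffield B\<^esub> y"
  shows "z \<in> AA B"
proof -
  interpret F: field "ffield B" by (rule F_field)
  have "z \<in> Ow" if Ow: "place (ffield B) (constf B) Ow" "Ow \<noteq> inft B" for Ow
  proof (rule ccontr)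
    assume nz: "z \<notin> Ow"
    have sub: "subring Ow (ffield B)" using Ow by (simp add: place_def)
    note Oc = subringE[OF sub]
    have z0: "z \<noteq> \<zero>\<^bsub>ffield B\<^esub>" using nz Oc by auto
    define w where "w = inv\<^bsub>ffield B\<^esub> z"
    have zU: "z \<in> Units (ffield B)" using z z0 F.field_Units by auto
    have w: "w \<in> Ow" "w \<in> carrier (ffield B)" "z \<otimes>\<^bsub>ffield B\<^esub> w = \<one>\<^bsub>ffield B\<^esub>"
      using Ow nz z z0 zU by (auto simp: place_def w_def F.Units_r_inv)
    have yO: "y \<in> Ow" using y Ow by (auto simp: AA_def regular_away_def)
    have yc: "y \<in> carrier (ffield B)" using yO Oc(1) by auto
    have wp: "w [^]\<^bsub>ffield B\<^esub> (n::nat) \<in> Ow" for n using w Oc(3,6) by (induction n) auto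
    have zw: "z [^]\<^bsub>ffield B\<^esub> n \<otimes>\<^bsub>ffield B\<^esub> w [^]\<^bsub>ffield B\<^esub> n = \<one>\<^bsub>ffield B\<^esub>" for n :: nat
      using w z by (simp add: F.nat_pow_distrib[symmetric])
    obtain k where k: "j = Suc k" using ij by (cases j) auto
    obtain m where m: "k = i + m" using ij k by (metis less_Suc_eq_le le_Suc_ex)
    have "z = z [^]\<^bsub>ffield B\<^esub> j \<otimes>\<^bsub>ffield B\<^esub> w [^]\<^bsub>ffield B\<^esub> k"
    proof -
      have "z [^]\<^bsub>ffield B\<^esub> j \<otimes>\<^bsub>ffield B\<^esub> w [^]\<^bsub>ffield B\<^esub> k = z \<otimes>\<^bsub>ffield B\<^esub> (z [^]\<^bsub>ffield B\<^esub> k \<otimes>\<^bsub>ffield B\<^esub> w [^]\<^bsub>ffield B\<^esub> k)"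
        unfolding k using z w by (simp add: F.m_ac)
      thus ?thesis using zw z by simp
    qed
    also have "\<dots> = z [^]\<^bsub>ffield B\<^esub> i \<otimes>\<^bsub>ffield B\<^esub> w [^]\<^bsub>ffield B\<^esub> k \<oplus>\<^bsub>ffield B\<^esub> y \<otimes>\<^bsub>ffield B\<^esub> w [^]\<^bsub>ffield B\<^esub> k"
      unfolding eq using z w yc by (simp add: F.l_distr)
    also have "z [^]\<^bsub>ffield B\<^esub> i \<otimes>\<^bsub>ffield B\<^esub> w [^]\<^bsub>ffield B\<^esub> k = (z [^]\<^bsub>ffield B\<^esub> i \<otimes>\<^bsub>ffield B\<^esub> w [^]\<^bsub>ffield B\<^esub> i) \<otimes>\<^bsub>ffield B\<^esub> w [^]\<^bsub>ffield B\<^esub> m"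
      unfolding m F.nat_pow_mult[OF w(2), symmetric] using z w by (simp add: F.m_assoc)
    also have "\<dots> = w [^]\<^bsub>ffield B\<^esub> m" using zw w by simp
    finally have "z = w [^]\<^bsub>ffield B\<^esub> m \<oplus>\<^bsub>ffield B\<^esub> y \<otimes>\<^bsub>ffield B\<^esub> w [^]\<^bsub>ffield B\<^esub> k" .
    hence "z \<in> Ow" using wp yO Oc(6,7) by simp
    thus False using nz by simp
  qed
  thus ?thesis using z by (auto simp: AA_def regular_away_def)
qed

sublocale V: valued_ring "ffield B" "AA B" "vpl B"
proof -
  interpret F: field "ffield B" by (rule F_field)
  have v: "place (ffield B) (constf B) (vpl B)" "vpl B \<noteq> inft B" using is_base by (auto simp: is_base_def)
  show "valued_ring (ffield B) (AA B) (vpl B)"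
  proof (intro valued_ring.intro valued_ring_axioms.intro)
    show "field (ffield B)" by (rule F_field)
    show "subring (AA B) (ffield B)" by (rule AA_subring)
    show "subring (vpl B) (ffield B)" "vpl B \<noteq> carrier (ffield B)" using v by (auto simp: place_def)
    show "AA B \<subseteq> vpl B" using v by (auto simp: AA_def regular_away_def)
    fix x assume "x \<in> carrier (ffield B)" "x \<noteq> \<zero>\<^bsub>ffield B\<^esub>"
    thus "x \<in> vpl B \<or> inv\<^bsub>ffield B\<^esub> x \<in> vpl B" using v by (auto simp: place_def)
  qed (rule AA_integral)
qed

lemma vprime_eq: "vprime B = AA B \<inter> place_ideal (ffield B) (vpl B)"
  by (simp add: vprime_def)

lemma vprime_AA: "x \<in> vprime B \<Longrightarrow> x \<in> AA B"
  by (simp add: vprime_def)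

lemma Aring_simps [simp]:
  "carrier (Aring B) = AA B" "monoid.mult (Aring B) = monoid.mult (ffield B)" "ring.add (Aring B) = ring.add (ffield B)"
  "\<one>\<^bsub>Aring B\<^esub> = \<one>\<^bsub>ffield B\<^esub>" "\<zero>\<^bsub>Aring B\<^esub> = \<zero>\<^bsub>ffield B\<^esub>"
  by (simp_all add: Aring_def)

lemma Aring_domain: "domain (Aring B)"
  unfolding Aring_def using V.subring_is_domain[OF AA_subring] .

lemma Aring_uminus: "x \<in> AA B \<Longrightarrow> \<ominus>\<^bsub>Aring B\<^esub> x = \<ominus>\<^bsub>ffield B\<^esub> x"
proof -
  interpret A: domain "Aring B" by (rule Aring_domain)
  assume x: "x \<in> AA B"
  have "\<ominus>\<^bsub>ffield B\<^esub> x \<oplus>\<^bsub>Aring B\<^esub> x = \<zero>\<^bsub>Aring B\<^esub>" using x by (simp add: V.l_neg)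
  thus ?thesis by (rule A.minus_equality) (use x in auto)
qed

lemma Aring_minus [simp]: "x \<in> AA B \<Longrightarrow> y \<in> AA B \<Longrightarrow> x \<ominus>\<^bsub>Aring B\<^esub> y = x \<ominus>\<^bsub>ffield B\<^esub> y"
  by (simp add: a_minus_def Aring_uminus)

lemma constf_subfield_F: "subfield (constf B) (ffield B)"
  using is_base by (simp add: is_base_def global_function_field_def)

lemma constf_AA: "constf B \<subseteq> AA B"
proof
  fix c assume c: "c \<in> constf B"
  have "c \<in> Ow" if "place (ffield B) (constf B) Ow" for Ow using that c unfolding place_def by blast
  thus "c \<in> AA B" using subfieldE(3)[OF constf_subfield_F] c unfolding AA_def regular_away_def by blast
qed

lemma constf_finite: "finite (constf B)"
  using is_base by (simp add: is_base_def global_function_field_def)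

lemma constf_field: "field ((ffield B)\<lparr>carrier := constf B\<rparr>)"
  using V.subfield_iff(2)[OF constf_subfield_F] .

lemma constf_subfield: "subfield (constf B) (Aring B)"
proof -
  interpret A: domain "Aring B" by (rule Aring_domain)
  have "field ((Aring B)\<lparr>carrier := constf B\<rparr>)" using constf_field by (simp add: Aring_def)
  thus ?thesis using A.subfield_iff(1)[of "constf B"] constf_AA by simp
qed

lemma q_ge_2: "qB B \<ge> 2"
proof -
  have "\<zero>\<^bsub>ffield B\<^esub> \<in> constf B" "\<one>\<^bsub>ffield B\<^esub> \<in> constf B"
    using subringE(2,3)[OF subfieldE(1)[OF constf_subfield_F]] by auto
  hence "card {\<zero>\<^bsub>ffield B\<^esub>, \<one>\<^bsub>ffield B\<^esub>} \<le> card (constf B)" using constf_finite by (intro card_mono) auto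
  thus ?thesis by (simp add: qB_def)
qed

lemma ideal_AringI:
  assumes "I \<subseteq> AA B" "\<zero>\<^bsub>ffield B\<^esub> \<in> I" "\<And>x y. x \<in> I \<Longrightarrow> y \<in> I \<Longrightarrow> x \<oplus>\<^bsub>ffield B\<^esub> y \<in> I"
    "\<And>x y. x \<in> I \<Longrightarrow> y \<in> AA B \<Longrightarrow> x \<otimes>\<^bsub>ffield B\<^esub> y \<in> I"
  shows "ideal I (Aring B)"
proof -
  interpret A: domain "Aring B" by (rule Aring_domain)
  show ?thesis
  proof (rule idealI)
    show "ring (Aring B)" by unfold_locales
    show "subgroup I (add_monoid (Aring B))"
    proof (rule A.add.subgroupI)
      show "\<ominus>\<^bsub>Aring B\<^esub> x \<in> I" if "x \<in> I" for x
      proof -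
        have "x \<otimes>\<^bsub>ffield B\<^esub> (\<ominus>\<^bsub>ffield B\<^esub> \<one>\<^bsub>ffield B\<^esub>) \<in> I" using assms(4)[OF that] by simp
        moreover have xA: "x \<in> AA B" using that assms by auto
        ultimately show ?thesis using Aring_uminus[OF xA] by (simp add: V.r_minus)
      qed
    qed (use assms in auto)
    fix a x assume ax: "a \<in> I" "x \<in> carrier (Aring B)"
    thus "x \<otimes>\<^bsub>Aring B\<^esub> a \<in> I" using assms(4)[of a x] assms(1) V.m_comm[of x a] by auto
    show "a \<otimes>\<^bsub>Aring B\<^esub> x \<in> I" using assms(4)[of a x] ax by simp
  qed
qed

lemma vprime_ideal: "ideal (vprime B) (Aring B)"
  by (rule ideal_AringI) (use V.p_props in \<open>simp_all add: vprime_eq\<close>)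

lemma vprime_primeideal: "primeideal (vprime B) (Aring B)"
proof (rule primeidealI)
  show "ideal (vprime B) (Aring B)" by (rule vprime_ideal)
  show "cring (Aring B)" using Aring_domain by (simp add: domain_def)
  show "carrier (Aring B) \<noteq> vprime B"
    using V.p_props(7) V.A_closed(2) unfolding vprime_eq Aring_simps by blast
  show "a \<in> vprime B \<or> b \<in> vprime B" if "a \<in> carrier (Aring B)" "b \<in> carrier (Aring B)" "a \<otimes>\<^bsub>Aring B\<^esub> b \<in> vprime B" for a b
    using V.p_props(8)[of a b] that by (simp add: vprime_eq)
qed

lemma principal_ideal: "a \<in> AA B \<Longrightarrow> ideal (PIdl\<^bsub>Aring B\<^esub> a) (Aring B)"
  using cring.cgenideal_ideal[of "Aring B" a] Aring_domain by (simp add: domain_def)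

lemma principal_eq: "a \<in> AA B \<Longrightarrow> PIdl\<^bsub>Aring B\<^esub> a = {a \<otimes>\<^bsub>ffield B\<^esub> x | x. x \<in> AA B}"
proof -
  assume a: "a \<in> AA B"
  have "x \<otimes>\<^bsub>ffield B\<^esub> a = a \<otimes>\<^bsub>ffield B\<^esub> x" if "x \<in> AA B" for x by (rule V.m_comm[OF V.A_carr[OF that] V.A_carr[OF a]])
  hence "\<And>y. (\<exists>x. y = x \<otimes>\<^bsub>ffield B\<^esub> a \<and> x \<in> AA B) \<longleftrightarrow> (\<exists>x. y = a \<otimes>\<^bsub>ffield B\<^esub> x \<and> x \<in> AA B)" by metis
  thus ?thesis unfolding cgenideal_def Aring_simps by simp
qed

lemma coset_eq_iff:
  assumes "ideal I (Aring B)" "x \<in> AA B" "y \<in> AA B"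
  shows "I +>\<^bsub>Aring B\<^esub> x = I +>\<^bsub>Aring B\<^esub> y \<longleftrightarrow> x \<ominus>\<^bsub>ffield B\<^esub> y \<in> I"
proof -
  interpret A: domain "Aring B" by (rule Aring_domain)
  show ?thesis using A.quotient_eq_iff_same_a_r_cos[OF assms(1), of x y] assms by simp
qed

lemma quot_carrier: "carrier (Aring B Quot I) = (\<lambda>x. I +>\<^bsub>Aring B\<^esub> x) ` AA B"
  by (auto simp: FactRing_def A_RCOSETS_def' image_iff)

text \<open>Sizes of quotients of \<open>A\<close> are computed through classifying maps, to avoid working with cosets.\<close>

lemma card_quot:
  assumes I: "ideal I (Aring B)"
    and f: "\<And>x y. x \<in> AA B \<Longrightarrow> y \<in> AA B \<Longrightarrow> f x = f y \<longleftrightarrow> x \<ominus>\<^bsub>ffield B\<^esub> y \<in> I"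
    and fin: "finite (f ` AA B)"
  shows "finite (carrier (Aring B Quot I)) \<and> card (carrier (Aring B Quot I)) = card (f ` AA B)"
proof -
  let ?g = "\<lambda>x. I +>\<^bsub>Aring B\<^esub> x" and ?i = "inv_into (AA B) f"
  have fg: "f x = f y \<longleftrightarrow> ?g x = ?g y" if "x \<in> AA B" "y \<in> AA B" for x y
    using f coset_eq_iff[OF I] that by simp
  have "bij_betw (\<lambda>s. ?g (?i s)) (f ` AA B) (?g ` AA B)"
    unfolding bij_betw_def
  proof
    show "inj_on (\<lambda>s. ?g (?i s)) (f ` AA B)"
    proof (rule inj_onI)
      fix s t assume st: "s \<in> f ` AA B" "t \<in> f ` AA B" "?g (?i s) = ?g (?i t)"
      have "f (?i s) = f (?i t)" using fg[of "?i s" "?i t"] inv_into_into[of _ f "AA B"] st by simp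
      thus "s = t" using f_inv_into_f[of s f "AA B"] f_inv_into_f[of t f "AA B"] st by simp
    qed
    have gi: "?g (?i (f x)) = ?g x" if "x \<in> AA B" for x
      using fg[of "?i (f x)" x] that inv_into_into[of "f x" f "AA B"] f_inv_into_f[of "f x" f "AA B"] by simp
    show "(\<lambda>s. ?g (?i s)) ` f ` AA B = ?g ` AA B" unfolding image_image using gi by (intro image_cong) auto
  qed
  thus ?thesis unfolding quot_carrier using fin bij_betw_finite bij_betw_same_card by fastforce
qed

lemma card_ideal_deg:
  assumes "ideal I (Aring B)" "\<one>\<^bsub>ffield B\<^esub> \<notin> I" "finite (carrier (Aring B Quot I))"
  shows "card (carrier (Aring B Quot I)) = qB B ^ ideal_deg B I"
  unfolding ideal_deg_def qB_def
  by (rule card_quotient_dim) (use assms constf_subfield constf_finite in auto)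

text \<open>The module \<open>\<pp>\<^sup>-\<^sup>1/A\<close> is isomorphic to the residue field, through multiplication by \<open>E/a\<close>.\<close>

context
  fixes a E
  assumes a: "a \<in> AA B" "a \<noteq> \<zero>\<^bsub>ffield B\<^esub>" "a \<in> vprime B"
    and E: "E \<in> AA B" "\<one>\<^bsub>ffield B\<^esub> \<ominus>\<^bsub>ffield B\<^esub> E \<in> vprime B"
    and Ep: "\<And>u. u \<in> vprime B \<Longrightarrow> \<exists>y\<in>AA B. E \<otimes>\<^bsub>ffield B\<^esub> u = a \<otimes>\<^bsub>ffield B\<^esub> y"
begin

abbreviation (input) FF where "FF \<equiv> ffield B"

lemma E_mult_iff:
  assumes "c \<in> AA B" shows "(\<exists>y\<in>AA B. E \<otimes>\<^bsub>FF\<^esub> c = a \<otimes>\<^bsub>FF\<^esub> y) \<longleftrightarrow> c \<in> vprime B"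
proof
  assume "\<exists>y\<in>AA B. E \<otimes>\<^bsub>FF\<^esub> c = a \<otimes>\<^bsub>FF\<^esub> y"
  then obtain y where "y \<in> AA B" "E \<otimes>\<^bsub>FF\<^esub> c = a \<otimes>\<^bsub>FF\<^esub> y" by auto
  hence "E \<otimes>\<^bsub>FF\<^esub> c \<in> vprime B" using V.p_props(5)[of a y] a by (simp add: vprime_eq)
  moreover have "E \<notin> vprime B" using V.p_cong[of E E] E by (simp add: vprime_eq)
  ultimately show "c \<in> vprime B" using V.p_props(8)[of E c] E assms by (simp add: vprime_eq)
qed (rule Ep)

text \<open>A generator of \<open>\<pp>\<^sup>-\<^sup>1\<close> modulo \<open>A\<close>.\<close>

definition zeta where "zeta = E \<otimes>\<^bsub>FF\<^esub> inv\<^bsub>FF\<^esub> a"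

definition kappa where "kappa c = AA B +>\<^bsub>FF\<^esub> (c \<otimes>\<^bsub>FF\<^esub> zeta)"

lemma inv_a: "inv\<^bsub>FF\<^esub> a \<in> carrier FF" "a \<otimes>\<^bsub>FF\<^esub> inv\<^bsub>FF\<^esub> a = \<one>\<^bsub>FF\<^esub>" "inv\<^bsub>FF\<^esub> a \<otimes>\<^bsub>FF\<^esub> a = \<one>\<^bsub>FF\<^esub>"
  using V.inv_field[of a] a by auto

lemma zeta_closed: "zeta \<in> carrier FF" using inv_a E by (simp add: zeta_def)

lemma zeta_a: "zeta \<otimes>\<^bsub>FF\<^esub> a = E" unfolding zeta_def using inv_a E a by (simp add: V.m_assoc)

lemma a_cancel: "x \<in> carrier FF \<Longrightarrow> y \<in> carrier FF \<Longrightarrow> x \<otimes>\<^bsub>FF\<^esub> a = y \<otimes>\<^bsub>FF\<^esub> a \<Longrightarrow> x = y"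
  using V.m_rcancel[of a x y] a by simp

lemma mult_zeta_iff:
  assumes c: "c \<in> AA B" shows "c \<otimes>\<^bsub>FF\<^esub> zeta \<in> AA B \<longleftrightarrow> c \<in> vprime B"
proof -
  have eq: "(c \<otimes>\<^bsub>FF\<^esub> zeta) \<otimes>\<^bsub>FF\<^esub> a = E \<otimes>\<^bsub>FF\<^esub> c"
  proof -
    have "(c \<otimes>\<^bsub>FF\<^esub> zeta) \<otimes>\<^bsub>FF\<^esub> a = c \<otimes>\<^bsub>FF\<^esub> (zeta \<otimes>\<^bsub>FF\<^esub> a)"
      using c zeta_closed a by (intro V.m_assoc) auto
    also have "\<dots> = E \<otimes>\<^bsub>FF\<^esub> c" unfolding zeta_a using c E by (intro V.m_comm) auto
    finally show ?thesis .
  qed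
  have "c \<otimes>\<^bsub>FF\<^esub> zeta \<in> AA B \<longleftrightarrow> (\<exists>y\<in>AA B. E \<otimes>\<^bsub>FF\<^esub> c = a \<otimes>\<^bsub>FF\<^esub> y)"
  proof
    assume "c \<otimes>\<^bsub>FF\<^esub> zeta \<in> AA B"
    thus "\<exists>y\<in>AA B. E \<otimes>\<^bsub>FF\<^esub> c = a \<otimes>\<^bsub>FF\<^esub> y"
      using eq a V.m_comm[of "c \<otimes>\<^bsub>FF\<^esub> zeta" a] by (intro bexI[of _ "c \<otimes>\<^bsub>FF\<^esub> zeta"]) auto
  next
    assume "\<exists>y\<in>AA B. E \<otimes>\<^bsub>FF\<^esub> c = a \<otimes>\<^bsub>FF\<^esub> y"
    then obtain y where y: "y \<in> AA B" "E \<otimes>\<^bsub>FF\<^esub> c = a \<otimes>\<^bsub>FF\<^esub> y" by auto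
    have "c \<otimes>\<^bsub>FF\<^esub> zeta = y"
      by (rule a_cancel) (use y eq c zeta_closed a V.m_comm[of a y] in auto)
    thus "c \<otimes>\<^bsub>FF\<^esub> zeta \<in> AA B" using y by simp
  qed
  thus ?thesis using E_mult_iff[OF c] by simp
qed

lemma AA_coset_eq_iff:
  assumes "x \<in> carrier FF" "y \<in> carrier FF"
  shows "AA B +>\<^bsub>FF\<^esub> x = AA B +>\<^bsub>FF\<^esub> y \<longleftrightarrow> x \<ominus>\<^bsub>FF\<^esub> y \<in> AA B"
proof
  assume eq: "AA B +>\<^bsub>FF\<^esub> x = AA B +>\<^bsub>FF\<^esub> y"
  have "x \<in> AA B +>\<^bsub>FF\<^esub> x" using assms by (auto simp: a_r_coset_def' intro!: bexI[of _ "\<zero>\<^bsub>FF\<^esub>"])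
  then obtain h where h: "h \<in> AA B" "x = h \<oplus>\<^bsub>FF\<^esub> y" unfolding eq by (auto simp: a_r_coset_def')
  have "h \<in> carrier FF" using h by simp
  hence "x \<ominus>\<^bsub>FF\<^esub> y = h" unfolding h(2) using assms by algebra
  thus "x \<ominus>\<^bsub>FF\<^esub> y \<in> AA B" using h by simp
next
  assume d: "x \<ominus>\<^bsub>FF\<^esub> y \<in> AA B"
  have sub: "AA B +>\<^bsub>FF\<^esub> x \<subseteq> AA B +>\<^bsub>FF\<^esub> y" if xy: "x \<in> carrier FF" "y \<in> carrier FF" "x \<ominus>\<^bsub>FF\<^esub> y \<in> AA B" for x y
  proof
    fix u assume "u \<in> AA B +>\<^bsub>FF\<^esub> x"
    then obtain h where h: "h \<in> AA B" "u = h \<oplus>\<^bsub>FF\<^esub> x" by (auto simp: a_r_coset_def')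
    have "h \<in> carrier FF" using h by simp
    hence "u = (h \<oplus>\<^bsub>FF\<^esub> (x \<ominus>\<^bsub>FF\<^esub> y)) \<oplus>\<^bsub>FF\<^esub> y" unfolding h(2) using xy(1,2) by algebra
    moreover have "h \<oplus>\<^bsub>FF\<^esub> (x \<ominus>\<^bsub>FF\<^esub> y) \<in> AA B" using h xy(3) by simp
    ultimately show "u \<in> AA B +>\<^bsub>FF\<^esub> y" unfolding a_r_coset_def' by blast
  qed
  have "y \<ominus>\<^bsub>FF\<^esub> x = \<ominus>\<^bsub>FF\<^esub> (x \<ominus>\<^bsub>FF\<^esub> y)" using assms by algebra
  hence "y \<ominus>\<^bsub>FF\<^esub> x \<in> AA B" using d by simp
  thus "AA B +>\<^bsub>FF\<^esub> x = AA B +>\<^bsub>FF\<^esub> y" using sub[OF assms d] sub[OF assms(2,1)] by blast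
qed

lemma AA_abelian_subgroup: "abelian_subgroup (AA B) FF"
  by (intro abelian_subgroupI3 additive_subgroup.intro)
    (use subring.axioms(1)[OF AA_subring] V.abelian_group_axioms in auto)

lemma kappa_image: "kappa ` AA B = carrier (inv_prime_quot B)"
proof
  show "kappa ` AA B \<subseteq> carrier (inv_prime_quot B)"
  proof
    fix s assume "s \<in> kappa ` AA B"
    then obtain c where c: "c \<in> AA B" "s = AA B +>\<^bsub>FF\<^esub> (c \<otimes>\<^bsub>FF\<^esub> zeta)" by (auto simp: kappa_def)
    have "c \<otimes>\<^bsub>FF\<^esub> zeta \<otimes>\<^bsub>FF\<^esub> b \<in> AA B" if b: "b \<in> vprime B" for b
    proof -
      have bA: "b \<in> AA B" using b vprime_AA by simp
      have "b \<otimes>\<^bsub>FF\<^esub> zeta \<in> AA B" using mult_zeta_iff[OF bA] b by simp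
      hence "c \<otimes>\<^bsub>FF\<^esub> (b \<otimes>\<^bsub>FF\<^esub> zeta) \<in> AA B" using c by simp
      moreover have "c \<otimes>\<^bsub>FF\<^esub> (b \<otimes>\<^bsub>FF\<^esub> zeta) = c \<otimes>\<^bsub>FF\<^esub> zeta \<otimes>\<^bsub>FF\<^esub> b" using c bA zeta_closed by (simp add: V.m_ac)
      ultimately show ?thesis by simp
    qed
    thus "s \<in> carrier (inv_prime_quot B)"
      unfolding inv_prime_quot_def Let_def using c zeta_closed by auto
  qed
  show "carrier (inv_prime_quot B) \<subseteq> kappa ` AA B"
  proof
    fix s assume "s \<in> carrier (inv_prime_quot B)"
    then obtain x where x: "x \<in> carrier FF" "s = AA B +>\<^bsub>FF\<^esub> x" "\<And>b. b \<in> vprime B \<Longrightarrow> x \<otimes>\<^bsub>FF\<^esub> b \<in> AA B"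
      unfolding inv_prime_quot_def Let_def by auto
    have xa: "x \<otimes>\<^bsub>FF\<^esub> a \<in> AA B" using x a by simp
    have "(x \<otimes>\<^bsub>FF\<^esub> a) \<otimes>\<^bsub>FF\<^esub> zeta = x \<otimes>\<^bsub>FF\<^esub> E" using zeta_a x a zeta_closed V.m_comm[of zeta a] by (simp add: V.m_assoc)
    hence "x \<ominus>\<^bsub>FF\<^esub> (x \<otimes>\<^bsub>FF\<^esub> a) \<otimes>\<^bsub>FF\<^esub> zeta = x \<otimes>\<^bsub>FF\<^esub> (\<one>\<^bsub>FF\<^esub> \<ominus>\<^bsub>FF\<^esub> E)"
      using x E by (simp add: V.minus_eq V.r_distr V.r_minus)
    hence "x \<ominus>\<^bsub>FF\<^esub> (x \<otimes>\<^bsub>FF\<^esub> a) \<otimes>\<^bsub>FF\<^esub> zeta \<in> AA B" using x(3)[OF E(2)] by simp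
    hence "s = kappa (x \<otimes>\<^bsub>FF\<^esub> a)" unfolding x(2) kappa_def
      using AA_coset_eq_iff[of x "(x \<otimes>\<^bsub>FF\<^esub> a) \<otimes>\<^bsub>FF\<^esub> zeta"] x zeta_closed xa by simp
    thus "s \<in> kappa ` AA B" using xa by simp
  qed
qed

lemma kappa_eq_iff:
  assumes "r \<in> AA B" "s \<in> AA B" shows "kappa r = kappa s \<longleftrightarrow> r \<ominus>\<^bsub>FF\<^esub> s \<in> vprime B"
proof -
  have c: "r \<in> carrier FF" "s \<in> carrier FF" "zeta \<in> carrier FF" using assms zeta_closed by auto
  have "r \<otimes>\<^bsub>FF\<^esub> zeta \<ominus>\<^bsub>FF\<^esub> s \<otimes>\<^bsub>FF\<^esub> zeta = (r \<ominus>\<^bsub>FF\<^esub> s) \<otimes>\<^bsub>FF\<^esub> zeta" using c by algebra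
  thus ?thesis unfolding kappa_def
    using AA_coset_eq_iff[of "r \<otimes>\<^bsub>FF\<^esub> zeta" "s \<otimes>\<^bsub>FF\<^esub> zeta"] mult_zeta_iff[of "r \<ominus>\<^bsub>FF\<^esub> s"] c assms by simp
qed

lemma kappa_add:
  assumes "r \<in> AA B" "s \<in> AA B"
  shows "kappa (r \<oplus>\<^bsub>FF\<^esub> s) = kappa r \<oplus>\<^bsub>inv_prime_quot B\<^esub> kappa s"
proof -
  interpret S: abelian_subgroup "AA B" FF by (rule AA_abelian_subgroup)
  show ?thesis unfolding kappa_def inv_prime_quot_def Let_def
    using S.a_rcos_sum[of "r \<otimes>\<^bsub>FF\<^esub> zeta" "s \<otimes>\<^bsub>FF\<^esub> zeta"] assms zeta_closed by (simp add: V.l_distr)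
qed

lemma kappa_smult:
  assumes "r \<in> AA B" "s \<in> AA B"
  shows "kappa (r \<otimes>\<^bsub>FF\<^esub> s) = r \<odot>\<^bsub>inv_prime_quot B\<^esub> kappa s"
proof -
  let ?y = "s \<otimes>\<^bsub>FF\<^esub> zeta"
  have y: "?y \<in> carrier FF" using assms zeta_closed by simp
  have "AA B +>\<^bsub>FF\<^esub> (r \<otimes>\<^bsub>FF\<^esub> x) = AA B +>\<^bsub>FF\<^esub> (r \<otimes>\<^bsub>FF\<^esub> ?y)" if "x \<in> AA B +>\<^bsub>FF\<^esub> ?y" for x
  proof -
    obtain h where h: "h \<in> AA B" "x = h \<oplus>\<^bsub>FF\<^esub> ?y" using \<open>x \<in> AA B +>\<^bsub>FF\<^esub> ?y\<close> by (auto simp: a_r_coset_def')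
    have c: "h \<in> carrier FF" "r \<in> carrier FF" using h assms by auto
    have "r \<otimes>\<^bsub>FF\<^esub> x \<ominus>\<^bsub>FF\<^esub> r \<otimes>\<^bsub>FF\<^esub> ?y = r \<otimes>\<^bsub>FF\<^esub> h" unfolding h(2) using c y by algebra
    thus ?thesis using AA_coset_eq_iff[of "r \<otimes>\<^bsub>FF\<^esub> x" "r \<otimes>\<^bsub>FF\<^esub> ?y"] c y h assms by simp
  qed
  moreover have "?y \<in> AA B +>\<^bsub>FF\<^esub> ?y" using y by (auto simp: a_r_coset_def' intro!: bexI[of _ "\<zero>\<^bsub>FF\<^esub>"])
  ultimately have "(\<Union>x\<in>AA B +>\<^bsub>FF\<^esub> ?y. AA B +>\<^bsub>FF\<^esub> (r \<otimes>\<^bsub>FF\<^esub> x)) = AA B +>\<^bsub>FF\<^esub> (r \<otimes>\<^bsub>FF\<^esub> ?y)" by blast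
  moreover have "r \<otimes>\<^bsub>FF\<^esub> ?y = (r \<otimes>\<^bsub>FF\<^esub> s) \<otimes>\<^bsub>FF\<^esub> zeta" using assms zeta_closed by (simp add: V.m_assoc)
  ultimately show ?thesis unfolding kappa_def inv_prime_quot_def Let_def by simp
qed

end

end

section \<open>Drinfeld modules in characteristic \<open>\<pp>\<close>\<close>

lemma (in abelian_monoid) finsum_triangle:
  assumes "\<And>i j. t i j \<in> carrier G"
  shows "(\<Oplus>k\<in>{..n::nat}. \<Oplus>i\<in>{..k}. t i (k - i)) = (\<Oplus>i\<in>{..n}. \<Oplus>j\<in>{..n - i}. t i j)"
proof (induction n)
  case 0 show ?case by (simp add: assms Pi_def)
next
  case (Suc n)
  have cl: "(\<Oplus>j\<in>S. t i j) \<in> carrier G" "(\<Oplus>i\<in>S. t i (m - i)) \<in> carrier G"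
    "(\<Oplus>i\<in>S. \<Oplus>j\<in>{..m - i}. t i j) \<in> carrier G" for i m and S :: "nat set"
    using assms by (auto intro!: finsum_closed)
  have "(\<Oplus>i\<in>{..n}. \<Oplus>j\<in>{..Suc n - i}. t i j) = (\<Oplus>i\<in>{..n}. (\<Oplus>j\<in>{..n - i}. t i j) \<oplus> t i (Suc n - i))"
    using assms by (intro finsum_cong') (auto simp: Suc_diff_le a_comm cl)
  also have "\<dots> = (\<Oplus>i\<in>{..n}. \<Oplus>j\<in>{..n - i}. t i j) \<oplus> (\<Oplus>i\<in>{..n}. t i (Suc n - i))"
    using assms cl by (intro finsum_addf) auto
  finally have 1: "(\<Oplus>i\<in>{..n}. \<Oplus>j\<in>{..Suc n - i}. t i j)
     = (\<Oplus>i\<in>{..n}. \<Oplus>j\<in>{..n - i}. t i j) \<oplus> (\<Oplus>i\<in>{..n}. t i (Suc n - i))" .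
  have "(\<Oplus>i\<in>{..Suc n}. \<Oplus>j\<in>{..Suc n - i}. t i j) = t (Suc n) 0 \<oplus> (\<Oplus>i\<in>{..n}. \<Oplus>j\<in>{..Suc n - i}. t i j)"
    using assms cl by (subst finsum_Suc) auto
  also have "\<dots> = (t (Suc n) 0 \<oplus> (\<Oplus>i\<in>{..n}. t i (Suc n - i))) \<oplus> (\<Oplus>i\<in>{..n}. \<Oplus>j\<in>{..n - i}. t i j)"
    unfolding 1 using assms cl by (simp add: a_ac)
  also have "t (Suc n) 0 \<oplus> (\<Oplus>i\<in>{..n}. t i (Suc n - i)) = (\<Oplus>i\<in>{..Suc n}. t i (Suc n - i))"
    using assms by (subst finsum_Suc) auto
  also have "(\<Oplus>i\<in>{..Suc n}. t i (Suc n - i)) \<oplus> (\<Oplus>i\<in>{..n}. \<Oplus>j\<in>{..n - i}. t i j)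
     = (\<Oplus>k\<in>{..Suc n}. \<Oplus>i\<in>{..k}. t i (k - i))"
    using assms cl by (subst finsum_Suc) (auto simp: Suc)
  finally show ?case by simp
qed

lemma (in field) card_pow_fixed:
  assumes Q: "Q > 1"
  shows "finite {x \<in> carrier R. x [^] (Q::nat) = x} \<and> card {x \<in> carrier R. x [^] Q = x} \<le> Q"
proof -
  let ?d = "\<lambda>j. if j = Q then \<one> else if j = 1 then \<ominus> \<one> else \<zero>"
  let ?T = "{x \<in> carrier R. (\<Oplus>j\<in>{..Q}. ?d j \<otimes> x [^] j) = \<zero>}"
  have sum: "(\<Oplus>j\<in>{..Q}. ?d j \<otimes> x [^] j) = \<ominus> x \<oplus> x [^] Q" if x: "x \<in> carrier R" for x
  proof -
    have "(\<Oplus>j\<in>{..Q}. ?d j \<otimes> x [^] j) = (\<Oplus>j\<in>{1, Q}. ?d j \<otimes> x [^] j)"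
      by (rule add.finprod_mono_neutral_cong_right) (use x Q in auto)
    also have "\<dots> = ?d 1 \<otimes> x [^] (1::nat) \<oplus> ?d Q \<otimes> x [^] Q"
      using x Q by (subst finsum_insert) auto
    finally show ?thesis using x Q by (simp add: l_minus)
  qed
  have T: "finite ?T" "card ?T \<le> Q" using card_roots_le_aux[of Q ?d] by auto
  have sub: "{x \<in> carrier R. x [^] Q = x} \<subseteq> ?T"
  proof
    fix x assume "x \<in> {x \<in> carrier R. x [^] Q = x}"
    hence x: "x \<in> carrier R" "x [^] Q = x" by auto
    thus "x \<in> ?T" using sum[OF x(1)] by (simp only: x(2) l_neg[OF x(1)] mem_Collect_eq simp_thms)
  qed
  show ?thesis using finite_subset[OF sub T(1)] card_mono[OF T(1) sub] T(2) by simp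
qed

text \<open>A Drinfeld module of characteristic \<open>\<pp>\<close>, given by its coefficients on \<open>A\<close>.\<close>

locale special_fibre = function_base B + L: field L
  for B :: "'f base" and L :: "'l ring" (structure) +
  fixes \<psi> :: "'f \<Rightarrow> nat \<Rightarrow> 'l" and \<rho> :: nat
  assumes psi_closed: "c \<in> AA B \<Longrightarrow> \<psi> c i \<in> carrier L"
    and psi_add: "c \<in> AA B \<Longrightarrow> d \<in> AA B \<Longrightarrow> \<psi> (c \<oplus>\<^bsub>ffield B\<^esub> d) i = \<psi> c i \<oplus> \<psi> d i"
    and psi_mult: "c \<in> AA B \<Longrightarrow> d \<in> AA B \<Longrightarrow>
      \<psi> (c \<otimes>\<^bsub>ffield B\<^esub> d) k = (\<Oplus>i\<in>{..k}. \<psi> c i \<otimes> (\<psi> d (k - i)) [^] (qB B ^ i))"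
    and psi_one: "\<psi> \<one>\<^bsub>ffield B\<^esub> i = (if i = 0 then \<one> else \<zero>)"
    and psi_p: "c \<in> vprime B \<Longrightarrow> \<psi> c 0 = \<zero>"
    and rank: "has_rank B L \<psi> \<rho>"
begin

abbreviation D where "D c \<equiv> \<rho> * degA B c"

lemma D_facts: "c \<in> AA B \<Longrightarrow> c \<noteq> \<zero>\<^bsub>ffield B\<^esub> \<Longrightarrow> \<psi> c (D c) \<noteq> \<zero>"
  "c \<in> AA B \<Longrightarrow> c \<noteq> \<zero>\<^bsub>ffield B\<^esub> \<Longrightarrow> i > D c \<Longrightarrow> \<psi> c i = \<zero>"
  using rank by (auto simp: has_rank_def)

sublocale dd: drinfeld_degree "ffield B" "AA B" "vpl B" L "qB B" \<psi> D
proof (intro drinfeld_degree.intro drinfeld_degree_axioms.intro)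
  show "valued_ring (ffield B) (AA B) (vpl B)" by (rule V.valued_ring_axioms)
  show "field L" by (rule L.field_axioms)
qed (rule q_ge_2 psi_closed psi_add psi_mult psi_one D_facts, assumption?, assumption?, assumption?)+

abbreviation Om where "Om \<equiv> field.alg_closure L"
abbreviation emb :: "'l \<Rightarrow> ('l list \<times> nat) multiset \<Rightarrow> 'l" where "emb \<equiv> ring.indexed_const L"

lemma closure_facts: "algebraically_closed Om" "emb \<in> ring_hom L Om"
proof -
  interpret C: algebraic_closure Om "emb ` carrier L" by (rule L.alg_closureE(1))
  show "algebraically_closed Om" by unfold_locales
  show "emb \<in> ring_hom L Om" by (rule L.alg_closureE(2))
qed

sublocale Om: algebraically_closed Om by (rule closure_facts(1))

sublocale io: ring_hom_cring L Om emb
  by unfold_locales (rule closure_facts(2))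

lemma emb_pow: "y \<in> carrier L \<Longrightarrow> emb (y [^] (n::nat)) = emb y [^]\<^bsub>Om\<^esub> n"
  by (induction n) auto

lemma const_hom: "(\<lambda>c. emb (\<psi> c 0)) \<in> ring_hom ((ffield B)\<lparr>carrier := constf B\<rparr>) Om"
proof (rule ring_hom_memI)
  fix x y assume "x \<in> carrier (ffield B\<lparr>carrier := constf B\<rparr>)" "y \<in> carrier (ffield B\<lparr>carrier := constf B\<rparr>)"
  hence xy: "x \<in> AA B" "y \<in> AA B" using constf_AA by auto
  show "emb (\<psi> (x \<otimes>\<^bsub>ffield B\<lparr>carrier := constf B\<rparr>\<^esub> y) 0) = emb (\<psi> x 0) \<otimes>\<^bsub>Om\<^esub> emb (\<psi> y 0)"
    using xy psi_closed dd.psi_mult_0 by simp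
  show "emb (\<psi> (x \<oplus>\<^bsub>ffield B\<lparr>carrier := constf B\<rparr>\<^esub> y) 0) = emb (\<psi> x 0) \<oplus>\<^bsub>Om\<^esub> emb (\<psi> y 0)"
    using xy psi_closed psi_add by simp
next
  fix x assume "x \<in> carrier (ffield B\<lparr>carrier := constf B\<rparr>)"
  thus "emb (\<psi> x 0) \<in> carrier Om" using constf_AA psi_closed by auto
qed (simp add: psi_one)

text \<open>The constant field provides \<open>q\<close> solutions of \<open>x\<^sup>q = x\<close> in every field that \<open>A\<close> maps to.\<close>

lemma card_fixed_points: "card {x \<in> carrier Om. x [^]\<^bsub>Om\<^esub> qB B = x} = qB B"
proof (rule antisym)
  let ?k = "(ffield B)\<lparr>carrier := constf B\<rparr>" and ?h = "\<lambda>c. emb (\<psi> c 0)"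
  interpret k: field ?k by (rule constf_field)
  interpret h: ring_hom_cring ?k Om ?h using const_hom by unfold_locales
  let ?q = "qB B" and ?S = "{x \<in> carrier Om. x [^]\<^bsub>Om\<^esub> qB B = x}"
  have S: "finite ?S" "card ?S \<le> ?q" using Om.card_pow_fixed[of ?q] q_ge_2 by auto
  show "card ?S \<le> ?q" by (rule S(2))
  have "ring_hom_ring ?k Om ?h"
    by (rule ring_hom_ringI2[OF k.ring_axioms Om.ring_axioms const_hom])
  from ring_hom_ring.img_is_subfield(1)[OF this k.carrier_is_subfield] have "inj_on ?h (constf B)" by simp
  moreover have "?h ` constf B \<subseteq> ?S"
  proof
    fix s assume "s \<in> ?h ` constf B"
    then obtain c where c: "c \<in> constf B" "s = ?h c" by auto
    have cp: "c [^]\<^bsub>?k\<^esub> ?q = c" using k.finite_pow_card[of c] c constf_finite by (simp add: qB_def)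
    have "?h (c [^]\<^bsub>?k\<^esub> n) = ?h c [^]\<^bsub>Om\<^esub> n" for n :: nat
    proof (induction n)
      case 0
      show ?case using h.hom_one by (simp del: h.hom_one)
    next
      case (Suc n)
      show ?case using h.hom_mult[of "c [^]\<^bsub>?k\<^esub> n" c] k.nat_pow_closed[of c n] c Suc by simp
    qed
    hence "s [^]\<^bsub>Om\<^esub> ?q = ?h (c [^]\<^bsub>?k\<^esub> ?q)" using c by simp
    hence "s [^]\<^bsub>Om\<^esub> ?q = s" unfolding cp using c by simp
    thus "s \<in> ?S" using c h.hom_closed[of c] by simp
  qed
  ultimately have "card (constf B) \<le> card ?S"
    using S(1) by (intro card_inj_on_le[of ?h]) auto
  thus "?q \<le> card ?S" by (simp add: qB_def)
qed

sublocale fc: frobenius_closed Om "qB B"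
proof (intro frobenius_closed.intro frobenius_ring.intro frobenius_ring_axioms.intro frobenius_closed_axioms.intro)
  show "algebraically_closed Om" by (rule closure_facts(1))
  show "cring Om" by (rule Om.is_cring)
  show "2 \<le> qB B" by (rule q_ge_2)
  show "card {x \<in> carrier Om. x [^]\<^bsub>Om\<^esub> qB B = x} = qB B" by (rule card_fixed_points)
  fix x y assume "x \<in> carrier Om" "y \<in> carrier Om"
  thus "(x \<oplus>\<^bsub>Om\<^esub> y) [^]\<^bsub>Om\<^esub> qB B = x [^]\<^bsub>Om\<^esub> qB B \<oplus>\<^bsub>Om\<^esub> y [^]\<^bsub>Om\<^esub> qB B"
    using frobenius_add[OF constf_field _ _ const_hom, of x y] constf_finite Om.is_cring by (simp add: qB_def)
qed

abbreviation act where "act \<equiv> closure_action B L \<psi>"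

lemma act_qpoly:
  assumes c: "c \<in> AA B" and N: "\<And>i. i > N \<Longrightarrow> \<psi> c i = \<zero>" and x: "x \<in> carrier Om"
  shows "act c x = qpoly Om (qB B) N (\<lambda>i. emb (\<psi> c i)) x"
proof -
  have sub: "{i. \<psi> c i \<noteq> \<zero>} \<subseteq> {..N}" using N by (auto simp: not_le[symmetric])
  have "qpoly Om (qB B) N (\<lambda>i. emb (\<psi> c i)) x = (\<Oplus>\<^bsub>Om\<^esub>i\<in>{i. \<psi> c i \<noteq> \<zero>}. emb (\<psi> c i) \<otimes>\<^bsub>Om\<^esub> x [^]\<^bsub>Om\<^esub> (qB B ^ i))"
    unfolding qpoly_def by (rule Om.add.finprod_mono_neutral_cong_right) (use x c psi_closed sub in auto)
  thus ?thesis by (simp add: closure_action_def Let_def)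
qed

lemma psi_bound: assumes "c \<in> AA B" obtains N where "\<And>i. i > N \<Longrightarrow> \<psi> c i = \<zero>"
proof (cases "c = \<zero>\<^bsub>ffield B\<^esub>")
  case True thus ?thesis using that dd.psi_zero by blast
next
  case False thus ?thesis using that D_facts(2) assms by blast
qed

lemma i_psi_closed: "c \<in> AA B \<Longrightarrow> emb (\<psi> c i) \<in> carrier Om" using psi_closed by simp

lemma act_mult':
  assumes c: "c \<in> AA B" "d \<in> AA B" and x: "x \<in> carrier Om"
  shows "act (c \<otimes>\<^bsub>ffield B\<^esub> d) x = act c (act d x)"
proof -
  obtain n where n: "\<And>i. i > n \<Longrightarrow> \<psi> c i = \<zero>" using psi_bound c by blast
  obtain m where m: "\<And>i. i > m \<Longrightarrow> \<psi> d i = \<zero>" using psi_bound c by blast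
  let ?q = "qB B"
  define t where "t = (\<lambda>i j. (emb (\<psi> c i) \<otimes>\<^bsub>Om\<^esub> (emb (\<psi> d j)) [^]\<^bsub>Om\<^esub> (?q ^ i)) \<otimes>\<^bsub>Om\<^esub> x [^]\<^bsub>Om\<^esub> (?q ^ (i + j)))"
  have t: "t i j \<in> carrier Om" for i j unfolding t_def using c x psi_closed by simp
  have t0: "t i j = \<zero>\<^bsub>Om\<^esub>" if "i > n \<or> j > m" for i j
    using that n[of i] m[of j] c x psi_closed q_ge_2 unfolding t_def by (auto simp: Om.nat_pow_zero)
  have "\<psi> (c \<otimes>\<^bsub>ffield B\<^esub> d) k = \<zero>" if "k > n + m" for k
  proof -
    have "\<psi> c i \<otimes> (\<psi> d (k - i)) [^] (?q ^ i) = \<zero>" if "i \<le> k" for i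
    proof (cases "i > n")
      case True thus ?thesis using n c psi_closed by simp
    next
      case False
      hence "\<psi> d (k - i) = \<zero>" using m \<open>k > n + m\<close> by simp
      thus ?thesis using c psi_closed q_ge_2 by (simp add: L.nat_pow_zero)
    qed
    hence "(\<Oplus>i\<in>{..k}. \<psi> c i \<otimes> (\<psi> d (k - i)) [^] (?q ^ i)) = (\<Oplus>i\<in>{..k}. \<zero>)"
      by (intro L.finsum_cong') auto
    thus ?thesis using psi_mult[OF c, of k] by (simp add: L.finsum_zero)
  qed
  hence "act (c \<otimes>\<^bsub>ffield B\<^esub> d) x = qpoly Om ?q (n + m) (\<lambda>k. emb (\<psi> (c \<otimes>\<^bsub>ffield B\<^esub> d) k)) x"
    using c x by (intro act_qpoly) auto
  also have "\<dots> = (\<Oplus>\<^bsub>Om\<^esub>k\<in>{..n + m}. \<Oplus>\<^bsub>Om\<^esub>i\<in>{..k}. t i (k - i))"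
    unfolding qpoly_def
  proof (rule Om.finsum_cong'[OF HOL.refl])
    show "(\<lambda>k. \<Oplus>\<^bsub>Om\<^esub>i\<in>{..k}. t i (k - i)) \<in> {..n + m} \<rightarrow> carrier Om" using t by (auto intro!: Om.finsum_closed)
    fix k
    have "emb (\<psi> (c \<otimes>\<^bsub>ffield B\<^esub> d) k) = (\<Oplus>\<^bsub>Om\<^esub>i\<in>{..k}. emb (\<psi> c i) \<otimes>\<^bsub>Om\<^esub> (emb (\<psi> d (k - i))) [^]\<^bsub>Om\<^esub> (?q ^ i))"
    proof -
      have "emb (\<psi> (c \<otimes>\<^bsub>ffield B\<^esub> d) k) = (\<Oplus>\<^bsub>Om\<^esub>i\<in>{..k}. emb (\<psi> c i \<otimes> (\<psi> d (k - i)) [^] (?q ^ i)))"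
        unfolding psi_mult[OF c] using c psi_closed by (subst io.hom_finsum) (auto simp: o_def)
      also have "\<dots> = (\<Oplus>\<^bsub>Om\<^esub>i\<in>{..k}. emb (\<psi> c i) \<otimes>\<^bsub>Om\<^esub> (emb (\<psi> d (k - i))) [^]\<^bsub>Om\<^esub> (?q ^ i))"
        using c psi_closed by (intro Om.finsum_cong') (auto simp: emb_pow)
      finally show ?thesis .
    qed
    hence "emb (\<psi> (c \<otimes>\<^bsub>ffield B\<^esub> d) k) \<otimes>\<^bsub>Om\<^esub> x [^]\<^bsub>Om\<^esub> (?q ^ k)
      = (\<Oplus>\<^bsub>Om\<^esub>i\<in>{..k}. emb (\<psi> c i) \<otimes>\<^bsub>Om\<^esub> (emb (\<psi> d (k - i))) [^]\<^bsub>Om\<^esub> (?q ^ i)) \<otimes>\<^bsub>Om\<^esub> x [^]\<^bsub>Om\<^esub> (?q ^ k)" by simp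
    also have "\<dots> = (\<Oplus>\<^bsub>Om\<^esub>i\<in>{..k}. (emb (\<psi> c i) \<otimes>\<^bsub>Om\<^esub> (emb (\<psi> d (k - i))) [^]\<^bsub>Om\<^esub> (?q ^ i)) \<otimes>\<^bsub>Om\<^esub> x [^]\<^bsub>Om\<^esub> (?q ^ k))"
      using c x i_psi_closed by (intro Om.finsum_ldistr) auto
    also have "\<dots> = (\<Oplus>\<^bsub>Om\<^esub>i\<in>{..k}. t i (k - i))"
      using c x i_psi_closed by (intro Om.finsum_cong') (auto simp: t_def)
    finally show "emb (\<psi> (c \<otimes>\<^bsub>ffield B\<^esub> d) k) \<otimes>\<^bsub>Om\<^esub> x [^]\<^bsub>Om\<^esub> (?q ^ k) = (\<Oplus>\<^bsub>Om\<^esub>i\<in>{..k}. t i (k - i))" .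
  qed
  also have "\<dots> = (\<Oplus>\<^bsub>Om\<^esub>i\<in>{..n + m}. \<Oplus>\<^bsub>Om\<^esub>j\<in>{..n + m - i}. t i j)" by (rule Om.finsum_triangle[OF t])
  also have "\<dots> = (\<Oplus>\<^bsub>Om\<^esub>i\<in>{..n}. \<Oplus>\<^bsub>Om\<^esub>j\<in>{..m}. t i j)"
  proof (rule Om.add.finprod_mono_neutral_cong_right)
    show "(\<Oplus>\<^bsub>Om\<^esub>j\<in>{..n + m - i}. t i j) = \<zero>\<^bsub>Om\<^esub>" if "i \<in> {..n + m} - {..n}" for i
      by (rule Om.add.finprod_one_eqI) (use t0 that in auto)
    show "(\<Oplus>\<^bsub>Om\<^esub>j\<in>{..n + m - i}. t i j) = (\<Oplus>\<^bsub>Om\<^esub>j\<in>{..m}. t i j)" if "i \<in> {..n}" for i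
      by (rule Om.add.finprod_mono_neutral_cong_right) (use t t0 that in auto)
    show "(\<lambda>i. \<Oplus>\<^bsub>Om\<^esub>j\<in>{..n + m - i}. t i j) \<in> {..n + m} \<rightarrow> carrier Om" using t by (auto intro!: Om.finsum_closed)
  qed auto
  also have "\<dots> = qpoly Om ?q n (\<lambda>i. emb (\<psi> c i)) (qpoly Om ?q m (\<lambda>i. emb (\<psi> d i)) x)"
    unfolding qpoly_def[of Om ?q n]
  proof (rule Om.finsum_cong'[OF HOL.refl])
    let ?y = "qpoly Om ?q m (\<lambda>i. emb (\<psi> d i)) x"
    have y: "?y \<in> carrier Om" using c x i_psi_closed by (intro fc.qpoly_closed) auto
    show "(\<lambda>i. emb (\<psi> c i) \<otimes>\<^bsub>Om\<^esub> ?y [^]\<^bsub>Om\<^esub> (?q ^ i)) \<in> {..n} \<rightarrow> carrier Om" using y c i_psi_closed by auto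
    fix i
    have "?y [^]\<^bsub>Om\<^esub> (?q ^ i) = (\<Oplus>\<^bsub>Om\<^esub>j\<in>{..m}. (emb (\<psi> d j) \<otimes>\<^bsub>Om\<^esub> x [^]\<^bsub>Om\<^esub> (?q ^ j)) [^]\<^bsub>Om\<^esub> (?q ^ i))"
      unfolding qpoly_def using c x i_psi_closed by (intro fc.frob_pow_sum) auto
    hence "emb (\<psi> c i) \<otimes>\<^bsub>Om\<^esub> ?y [^]\<^bsub>Om\<^esub> (?q ^ i)
      = emb (\<psi> c i) \<otimes>\<^bsub>Om\<^esub> (\<Oplus>\<^bsub>Om\<^esub>j\<in>{..m}. (emb (\<psi> d j) \<otimes>\<^bsub>Om\<^esub> x [^]\<^bsub>Om\<^esub> (?q ^ j)) [^]\<^bsub>Om\<^esub> (?q ^ i))" by simp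
    also have "\<dots> = (\<Oplus>\<^bsub>Om\<^esub>j\<in>{..m}. emb (\<psi> c i) \<otimes>\<^bsub>Om\<^esub> (emb (\<psi> d j) \<otimes>\<^bsub>Om\<^esub> x [^]\<^bsub>Om\<^esub> (?q ^ j)) [^]\<^bsub>Om\<^esub> (?q ^ i))"
      using c x i_psi_closed by (intro Om.finsum_rdistr) auto
    also have "\<dots> = (\<Oplus>\<^bsub>Om\<^esub>j\<in>{..m}. t i j)"
      using c x i_psi_closed t
      by (intro Om.finsum_cong') (auto simp: t_def Om.nat_pow_distrib Om.nat_pow_pow Om.m_assoc power_add mult.commute)
    finally show "(\<Oplus>\<^bsub>Om\<^esub>j\<in>{..m}. t i j) = emb (\<psi> c i) \<otimes>\<^bsub>Om\<^esub> ?y [^]\<^bsub>Om\<^esub> (?q ^ i)" by simp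
  qed
  also have "qpoly Om ?q m (\<lambda>i. emb (\<psi> d i)) x = act d x" using c x m by (intro act_qpoly[symmetric]) auto
  also have "qpoly Om ?q n (\<lambda>i. emb (\<psi> c i)) (act d x) = act c (act d x)"
  proof (rule act_qpoly[symmetric])
    have "act d x = qpoly Om ?q m (\<lambda>i. emb (\<psi> d i)) x" using c x m by (intro act_qpoly) auto
    thus "act d x \<in> carrier Om" using c x i_psi_closed by (auto intro!: fc.qpoly_closed)
  qed (use c n in auto)
  finally show ?thesis .
qed

lemma i_zero_iff: "y \<in> carrier L \<Longrightarrow> emb y = \<zero>\<^bsub>Om\<^esub> \<longleftrightarrow> y = \<zero>"
proof
  assume y: "y \<in> carrier L" "emb y = \<zero>\<^bsub>Om\<^esub>"
  show "y = \<zero>"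
  proof (rule ccontr)
    assume "y \<noteq> \<zero>"
    hence u: "y \<in> Units L" using y L.field_Units by simp
    hence "emb (y \<otimes> inv y) = emb y \<otimes>\<^bsub>Om\<^esub> emb (inv y)" using y by (intro io.hom_mult) auto
    hence "\<one>\<^bsub>Om\<^esub> = \<zero>\<^bsub>Om\<^esub>" using u y L.Units_r_inv by simp
    thus False by simp
  qed
qed simp

sublocale pts: drinfeld_points "ffield B" "AA B" "vpl B" L "qB B" \<psi> D Om act
proof (intro drinfeld_points.intro drinfeld_points_axioms.intro)
  show "drinfeld_degree (ffield B) (AA B) (vpl B) L (qB B) \<psi> D" by (rule dd.drinfeld_degree_axioms)
  show "abelian_group Om" by (rule Om.abelian_group_axioms)
next
  fix c x assume c: "c \<in> AA B" and x: "x \<in> carrier Om"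
  obtain N where N: "\<And>i. i > N \<Longrightarrow> \<psi> c i = \<zero>" using psi_bound c by blast
  have ac: "act c z = qpoly Om (qB B) N (\<lambda>i. emb (\<psi> c i)) z" if "z \<in> carrier Om" for z
    by (rule act_qpoly[OF c _ that]) (rule N)
  show "act c x \<in> carrier Om" using ac[OF x] c x i_psi_closed by (auto intro!: fc.qpoly_closed)
  show "act c (x \<oplus>\<^bsub>Om\<^esub> y) = act c x \<oplus>\<^bsub>Om\<^esub> act c y" if y: "y \<in> carrier Om" for y
  proof -
    have "qpoly Om (qB B) N (\<lambda>i. emb (\<psi> c i)) (x \<oplus>\<^bsub>Om\<^esub> y) = qpoly Om (qB B) N (\<lambda>i. emb (\<psi> c i)) x \<oplus>\<^bsub>Om\<^esub> qpoly Om (qB B) N (\<lambda>i. emb (\<psi> c i)) y"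
      using x y c i_psi_closed by (intro fc.qpoly_add) auto
    thus ?thesis using ac x y by simp
  qed
  show "act (c \<oplus>\<^bsub>ffield B\<^esub> d) x = act c x \<oplus>\<^bsub>Om\<^esub> act d x" if d: "d \<in> AA B" for d
  proof -
    obtain M where M: "\<And>i. i > M \<Longrightarrow> \<psi> d i = \<zero>" using psi_bound d by blast
    let ?N = "max N M"
    have 1: "act c x = qpoly Om (qB B) ?N (\<lambda>i. emb (\<psi> c i)) x" using N c x by (intro act_qpoly) auto
    have 2: "act d x = qpoly Om (qB B) ?N (\<lambda>i. emb (\<psi> d i)) x" using M d x by (intro act_qpoly) auto
    have "act (c \<oplus>\<^bsub>ffield B\<^esub> d) x = qpoly Om (qB B) ?N (\<lambda>i. emb (\<psi> (c \<oplus>\<^bsub>ffield B\<^esub> d) i)) x"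
      using N M c d x by (intro act_qpoly) (auto simp: psi_add)
    also have "\<dots> = (\<Oplus>\<^bsub>Om\<^esub>i\<in>{..?N}. emb (\<psi> c i) \<otimes>\<^bsub>Om\<^esub> x [^]\<^bsub>Om\<^esub> (qB B ^ i) \<oplus>\<^bsub>Om\<^esub> emb (\<psi> d i) \<otimes>\<^bsub>Om\<^esub> x [^]\<^bsub>Om\<^esub> (qB B ^ i))"
      unfolding qpoly_def using c d x psi_closed by (intro Om.finsum_cong') (auto simp: psi_add Om.l_distr)
    also have "\<dots> = act c x \<oplus>\<^bsub>Om\<^esub> act d x"
      unfolding 1 2 qpoly_def using c d x i_psi_closed by (intro Om.finsum_addf) auto
    finally show ?thesis .
  qed
  show "act (c \<otimes>\<^bsub>ffield B\<^esub> d) x = act c (act d x)" if "d \<in> AA B" for d using act_mult' c x that by blast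
next
  fix x assume x: "x \<in> carrier Om"
  have "act \<one>\<^bsub>ffield B\<^esub> x = qpoly Om (qB B) 0 (\<lambda>i. emb (\<psi> \<one>\<^bsub>ffield B\<^esub> i)) x"
    using x by (intro act_qpoly) (auto simp: psi_one)
  thus "act \<one>\<^bsub>ffield B\<^esub> x = x" using x by (simp add: qpoly_def psi_one)
next
  fix c y assume c: "c \<in> AA B" "c \<noteq> \<zero>\<^bsub>ffield B\<^esub>" and y: "y \<in> carrier Om"
  obtain x where "x \<in> carrier Om" "qpoly Om (qB B) (D c) (\<lambda>i. emb (\<psi> c i)) x = y"
    by (rule fc.qpoly_surj[of "D c" "\<lambda>i. emb (\<psi> c i)" y])
      (use c y i_psi_closed D_facts(1)[OF c] i_zero_iff psi_closed in auto)
  moreover from this have "act c x = qpoly Om (qB B) (D c) (\<lambda>i. emb (\<psi> c i)) x"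
    by (intro act_qpoly[OF c(1)] D_facts(2)[OF c]) auto
  ultimately show "\<exists>x\<in>carrier Om. act c x = y" by auto
next
  fix c l assume c: "c \<in> AA B" and l: "\<psi> c l \<noteq> \<zero>" "\<And>i. i < l \<Longrightarrow> \<psi> c i = \<zero>"
  have c0: "c \<noteq> \<zero>\<^bsub>ffield B\<^esub>" using l(1) dd.psi_zero by auto
  have lD: "l \<le> D c" using D_facts(2)[OF c c0, of l] l(1) by (meson not_le)
  have "{x \<in> carrier Om. act c x = \<zero>\<^bsub>Om\<^esub>} = {x \<in> carrier Om. qpoly Om (qB B) (D c) (\<lambda>i. emb (\<psi> c i)) x = \<zero>\<^bsub>Om\<^esub>}"
  proof (intro Collect_cong conj_cong HOL.refl)
    fix x assume "x \<in> carrier Om"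
    hence "act c x = qpoly Om (qB B) (D c) (\<lambda>i. emb (\<psi> c i)) x"
      by (intro act_qpoly[OF c] D_facts(2)[OF c c0]) auto
    thus "act c x = \<zero>\<^bsub>Om\<^esub> \<longleftrightarrow> qpoly Om (qB B) (D c) (\<lambda>i. emb (\<psi> c i)) x = \<zero>\<^bsub>Om\<^esub>" by simp
  qed
  thus "card {x \<in> carrier Om. act c x = \<zero>\<^bsub>Om\<^esub>} * qB B ^ l = qB B ^ D c"
    using fc.card_ker_qpoly[of "D c" "\<lambda>i. emb (\<psi> c i)" l] c l lD i_psi_closed D_facts(1)[OF c c0] i_zero_iff psi_closed by simp
qed

lemma torsion_module: "module (Aring B) (v_torsion B L \<psi>)"
proof -
  interpret A: domain "Aring B" by (rule Aring_domain)
  let ?N = "v_torsion B L \<psi>"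
  have N: "carrier ?N = {x \<in> carrier Om. \<forall>a\<in>vprime B. act a x = \<zero>\<^bsub>Om\<^esub>}" "\<zero>\<^bsub>?N\<^esub> = \<zero>\<^bsub>Om\<^esub>"
    "ring.add ?N = ring.add Om" "smult ?N = act"
    by (simp_all add: v_torsion_def Let_def)
  have sm: "act a x \<in> carrier ?N" if "a \<in> AA B" "x \<in> carrier ?N" for a x
  proof -
    have "act b (act a x) = \<zero>\<^bsub>Om\<^esub>" if b: "b \<in> vprime B" for b
    proof -
      have bA: "b \<in> AA B" using b vprime_AA by simp
      have "b \<otimes>\<^bsub>ffield B\<^esub> a \<in> vprime B" using V.p_props(5)[of b a] b \<open>a \<in> AA B\<close> by (simp add: vprime_eq)
      thus ?thesis using act_mult'[OF bA \<open>a \<in> AA B\<close>, of x] \<open>x \<in> carrier ?N\<close> by (simp add: N)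
    qed
    thus ?thesis using that by (simp add: N)
  qed
  have am: "\<ominus>\<^bsub>Om\<^esub> x \<in> carrier ?N" if x: "x \<in> carrier ?N" for x
  proof -
    have "act b (\<ominus>\<^bsub>Om\<^esub> x) = \<zero>\<^bsub>Om\<^esub>" if b: "b \<in> vprime B" for b
    proof -
      have bA: "b \<in> AA B" using b vprime_AA by simp
      have xO: "x \<in> carrier Om" "act b x = \<zero>\<^bsub>Om\<^esub>" using x b by (auto simp: N)
      have "act b (\<ominus>\<^bsub>Om\<^esub> x \<oplus>\<^bsub>Om\<^esub> x) = act b (\<ominus>\<^bsub>Om\<^esub> x) \<oplus>\<^bsub>Om\<^esub> act b x" using pts.act_add[OF bA] xO by simp
      thus ?thesis using xO bA pts.act_zero by (simp add: Om.l_neg)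
    qed
    thus ?thesis using x by (simp add: N)
  qed
  have add: "x \<oplus>\<^bsub>Om\<^esub> y \<in> carrier ?N" if "x \<in> carrier ?N" "y \<in> carrier ?N" for x y
    using that pts.act_add vprime_AA by (auto simp: N)
  have ag: "abelian_group ?N"
  proof (rule abelian_groupI)
    show "\<exists>y\<in>carrier ?N. y \<oplus>\<^bsub>?N\<^esub> x = \<zero>\<^bsub>?N\<^esub>" if "x \<in> carrier ?N" for x
      using am[OF that] that by (intro bexI[of _ "\<ominus>\<^bsub>Om\<^esub> x"]) (auto simp: N Om.l_neg)
    show "\<zero>\<^bsub>?N\<^esub> \<in> carrier ?N" using pts.act_zero vprime_AA by (auto simp: N)
  qed (use add in \<open>auto simp: N Om.a_ac\<close>)
  show ?thesis
  proof (rule moduleI)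
    show "cring (Aring B)" by unfold_locales
    show "abelian_group ?N" by (rule ag)
  qed (use sm in \<open>auto simp: N pts.act_plus pts.act_add act_mult' pts.act_one\<close>)
qed

end

section \<open>Height and low coefficients\<close>

lemma finite_image_same_fibres:
  assumes "\<And>x y. x \<in> S \<Longrightarrow> y \<in> S \<Longrightarrow> f x = f y \<Longrightarrow> g x = g y" "finite (f ` S)"
  shows "finite (g ` S)"
proof (rule finite_subset)
  show "g ` S \<subseteq> (\<lambda>s. g (inv_into S f s)) ` (f ` S)"
  proof
    fix u assume "u \<in> g ` S"
    then obtain x where x: "x \<in> S" "u = g x" by auto
    have "g (inv_into S f (f x)) = g x"
      by (rule assms(1)) (use x inv_into_into[of "f x" f S] f_inv_into_f[of "f x" f S] in auto)
    thus "u \<in> (\<lambda>s. g (inv_into S f s)) ` (f ` S)" using x by (intro image_eqI[of _ _ "f x"]) auto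
  qed
qed (use assms in auto)

context special_fibre
begin

context
  fixes a assumes a: "a \<in> AA B" and val: "has_valuation (ffield B) (vpl B) a 1"
begin

text \<open>The degree of \<open>a\<close> is positive since the constant coefficient of \<open>\<psi>\<^sub>a\<close> vanishes but \<open>\<psi>\<^sub>a\<close> does not.
Everything about the finiteness of \<open>A/a\<close> depends on this.\<close>

lemma uniformizer_facts: "a \<in> vprime B" "a \<noteq> \<zero>\<^bsub>ffield B\<^esub>" "D a > 0"
proof -
  show ap: "a \<in> vprime B" using V.val_one(1)[OF a val] by (simp add: vprime_eq)
  show a0: "a \<noteq> \<zero>\<^bsub>ffield B\<^esub>" using V.val_one(2)[OF a val] V.m_nonzero by simp
  show "D a > 0"
  proof (rule ccontr)
    assume "\<not> D a > 0"
    hence "\<psi> a 0 \<noteq> \<zero>" using D_facts(1)[OF a a0] by (metis not_gr_zero)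
    thus False using psi_p[OF ap] by simp
  qed
qed

text \<open>A residue system \<open>Z\<close> of \<open>A/a\<close> with its reduction map \<open>z\<close>, and the idempotent at \<open>v\<close>.\<close>

lemma residue_data:
  obtains Z z E b where "finite Z" "Z \<subseteq> AA B" "dd.incongruent a Z"
    "\<forall>x\<in>AA B. z x \<in> Z \<and> dd.congr a x (z x)"
    "\<forall>x\<in>AA B. \<forall>y\<in>AA B. z x = z y \<longleftrightarrow> dd.congr a x y"
    "z ` AA B = Z"
    "E \<in> AA B" "\<one>\<^bsub>ffield B\<^esub> \<ominus>\<^bsub>ffield B\<^esub> E \<in> vprime B"
    "\<forall>u\<in>vprime B. \<exists>y\<in>AA B. E \<otimes>\<^bsub>ffield B\<^esub> u = a \<otimes>\<^bsub>ffield B\<^esub> y"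
    "b \<in> AA B" "E \<otimes>\<^bsub>ffield B\<^esub> (\<one>\<^bsub>ffield B\<^esub> \<ominus>\<^bsub>ffield B\<^esub> E) = a \<otimes>\<^bsub>ffield B\<^esub> b"
    "\<forall>v\<in>AA B - vprime B. \<exists>w\<in>AA B. \<one>\<^bsub>ffield B\<^esub> \<ominus>\<^bsub>ffield B\<^esub> v \<otimes>\<^bsub>ffield B\<^esub> w \<in> vprime B"
proof -
  obtain Z where Z: "finite Z" "Z \<subseteq> AA B" "dd.incongruent a Z" "\<And>x. x \<in> AA B \<Longrightarrow> \<exists>z\<in>Z. dd.congr a x z"
    using dd.exists_residue_system[OF a uniformizer_facts(2,3)] by blast
  have cover: "\<And>x. x \<in> AA B \<Longrightarrow> \<exists>z\<in>Z. \<exists>y\<in>AA B. x = z \<oplus>\<^bsub>ffield B\<^esub> a \<otimes>\<^bsub>ffield B\<^esub> y"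
    using Z(4) unfolding dd.congr_def by blast
  obtain E where E: "E \<in> AA B" "\<one>\<^bsub>ffield B\<^esub> \<ominus>\<^bsub>ffield B\<^esub> E \<in> vprime B"
    "\<And>u. u \<in> vprime B \<Longrightarrow> \<exists>y\<in>AA B. E \<otimes>\<^bsub>ffield B\<^esub> u = a \<otimes>\<^bsub>ffield B\<^esub> y"
    unfolding vprime_eq using V.exists_idempotent[OF a val Z(1,2) cover] by blast
  obtain b where b: "b \<in> AA B" "E \<otimes>\<^bsub>ffield B\<^esub> (\<one>\<^bsub>ffield B\<^esub> \<ominus>\<^bsub>ffield B\<^esub> E) = a \<otimes>\<^bsub>ffield B\<^esub> b"
    using E(3)[OF E(2)] by blast
  have inv: "\<exists>w\<in>AA B. \<one>\<^bsub>ffield B\<^esub> \<ominus>\<^bsub>ffield B\<^esub> v \<otimes>\<^bsub>ffield B\<^esub> w \<in> vprime B" if "v \<in> AA B" "v \<notin> vprime B" for v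
    using V.inverse_mod_p[OF a val Z(1,2) cover, of v] that unfolding vprime_eq by blast
  define z where "z = (\<lambda>x. SOME z. z \<in> Z \<and> dd.congr a x z)"
  have z: "z x \<in> Z \<and> dd.congr a x (z x)" if "x \<in> AA B" for x
    unfolding z_def using Z(4)[OF that] by (intro someI_ex[of "\<lambda>z. z \<in> Z \<and> dd.congr a x z"]) blast
  have zA: "z x \<in> AA B" if "x \<in> AA B" for x using z[OF that] Z(2) by blast
  have z_iff: "z x = z y \<longleftrightarrow> dd.congr a x y" if xy: "x \<in> AA B" "y \<in> AA B" for x y
  proof
    assume "z x = z y"
    hence "dd.congr a (z x) y" using dd.congr_sym[OF a xy(2) zA[OF xy(2)]] z[OF xy(2)] by simp
    thus "dd.congr a x y" using dd.congr_trans[OF a xy(1) zA[OF xy(1)] xy(2)] z[OF xy(1)] by simp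
  next
    assume c: "dd.congr a x y"
    have "dd.congr a (z x) x" using dd.congr_sym[OF a xy(1) zA[OF xy(1)]] z[OF xy(1)] by simp
    hence "dd.congr a (z x) y" using dd.congr_trans[OF a zA[OF xy(1)] xy(1,2)] c by simp
    hence "dd.congr a (z x) (z y)" using dd.congr_trans[OF a zA[OF xy(1)] xy(2) zA[OF xy(2)]] z[OF xy(2)] by simp
    thus "z x = z y" using Z(3) z[OF xy(1)] z[OF xy(2)] unfolding dd.incongruent_def by blast
  qed
  have im: "z ` AA B = Z"
  proof
    show "z ` AA B \<subseteq> Z" using z by blast
    show "Z \<subseteq> z ` AA B"
    proof
      fix s assume s: "s \<in> Z"
      hence sA: "s \<in> AA B" using Z(2) by blast
      have "s = z s" using Z(3) s z[OF sA] unfolding dd.incongruent_def by blast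
      thus "s \<in> z ` AA B" using sA by blast
    qed
  qed
  show ?thesis
    by (rule that[of Z z E b]) (intro ballI | fact Z(1-3) im E(1,2) b | rule z z_iff E(3) inv | assumption | force)+
qed

lemma congr_iff_minus: "x \<in> AA B \<Longrightarrow> y \<in> AA B \<Longrightarrow> dd.congr a x y \<longleftrightarrow> (\<exists>t\<in>AA B. x \<ominus>\<^bsub>ffield B\<^esub> y = a \<otimes>\<^bsub>ffield B\<^esub> t)"
  using dd.congrI[OF a] dd.congrD[OF a] by metis

text \<open>Via \<open>x \<mapsto> z (E x)\<close> the residue field \<open>A/\<pp>\<close> is a part of the finite set \<open>Z\<close>, and \<open>\<psi>[\<pp>]\<close> is
\<open>torsion E 1\<close>. The size of the latter is then expressed in two ways.\<close>

lemma residue_field_facts: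
  "finite (carrier (Fv B))" "card (carrier (Fv B)) = qB B ^ deg_v B" "deg_v B > 0"
  "\<exists>E\<in>AA B. \<one>\<^bsub>ffield B\<^esub> \<ominus>\<^bsub>ffield B\<^esub> E \<in> vprime B \<and> (\<forall>u\<in>vprime B. \<exists>y\<in>AA B. E \<otimes>\<^bsub>ffield B\<^esub> u = a \<otimes>\<^bsub>ffield B\<^esub> y)"
  and rank_height: "\<And>l. (\<And>i. i < l \<Longrightarrow> \<psi> a i = \<zero>) \<Longrightarrow> \<psi> a l \<noteq> \<zero> \<Longrightarrow> deg_v B * v_rank B L \<psi> + l = deg_v B * \<rho>"
proof -
  obtain Z z E b where Z: "finite Z" "Z \<subseteq> AA B" "dd.incongruent a Z"
    and z': "\<forall>x\<in>AA B. z x \<in> Z \<and> dd.congr a x (z x)"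
    and z_iff': "\<forall>x\<in>AA B. \<forall>y\<in>AA B. z x = z y \<longleftrightarrow> dd.congr a x y"
    and zim: "z ` AA B = Z"
    and E': "E \<in> AA B" "\<one>\<^bsub>ffield B\<^esub> \<ominus>\<^bsub>ffield B\<^esub> E \<in> vprime B"
      "\<forall>u\<in>vprime B. \<exists>y\<in>AA B. E \<otimes>\<^bsub>ffield B\<^esub> u = a \<otimes>\<^bsub>ffield B\<^esub> y"
    and b: "b \<in> AA B" "E \<otimes>\<^bsub>ffield B\<^esub> (\<one>\<^bsub>ffield B\<^esub> \<ominus>\<^bsub>ffield B\<^esub> E) = a \<otimes>\<^bsub>ffield B\<^esub> b"
    and inv': "\<forall>v\<in>AA B - vprime B. \<exists>w\<in>AA B. \<one>\<^bsub>ffield B\<^esub> \<ominus>\<^bsub>ffield B\<^esub> v \<otimes>\<^bsub>ffield B\<^esub> w \<in> vprime B"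
    by (rule residue_data)
  note z = z'[rule_format] and z_iff = z_iff'[rule_format] and E = E'(1,2) E'(3)[rule_format]
  have inv: "\<exists>w\<in>AA B. \<one>\<^bsub>ffield B\<^esub> \<ominus>\<^bsub>ffield B\<^esub> v \<otimes>\<^bsub>ffield B\<^esub> w \<in> vprime B" if "v \<in> AA B" "v \<notin> vprime B" for v
    using inv' that by blast
  note uf = uniformizer_facts
  show "\<exists>E\<in>AA B. \<one>\<^bsub>ffield B\<^esub> \<ominus>\<^bsub>ffield B\<^esub> E \<in> vprime B \<and> (\<forall>u\<in>vprime B. \<exists>y\<in>AA B. E \<otimes>\<^bsub>ffield B\<^esub> u = a \<otimes>\<^bsub>ffield B\<^esub> y)"
    using E by blast
  have one: "\<one>\<^bsub>ffield B\<^esub> \<notin> vprime B" using V.p_props(7) by (simp add: vprime_eq)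
  have aI: "ideal (PIdl\<^bsub>Aring B\<^esub> a) (Aring B)" by (rule principal_ideal[OF a])
  have PI: "x \<in> PIdl\<^bsub>Aring B\<^esub> a \<longleftrightarrow> (\<exists>t\<in>AA B. x = a \<otimes>\<^bsub>ffield B\<^esub> t)" for x
    unfolding principal_eq[OF a] by blast
  have "finite (carrier (Aring B Quot PIdl\<^bsub>Aring B\<^esub> a)) \<and> card (carrier (Aring B Quot PIdl\<^bsub>Aring B\<^esub> a)) = card (z ` AA B)"
    by (rule card_quot[OF aI]) (use z_iff congr_iff_minus PI zim Z in auto)
  moreover have "\<one>\<^bsub>ffield B\<^esub> \<notin> PIdl\<^bsub>Aring B\<^esub> a"
  proof
    assume "\<one>\<^bsub>ffield B\<^esub> \<in> PIdl\<^bsub>Aring B\<^esub> a"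
    then obtain t where "t \<in> AA B" "\<one>\<^bsub>ffield B\<^esub> = a \<otimes>\<^bsub>ffield B\<^esub> t" using PI by blast
    thus False using V.p_props(5)[of a t] uf(1) one by (simp add: vprime_eq)
  qed
  ultimately have cZ: "card Z = qB B ^ degA B a"
    using card_ideal_deg[OF aI] zim by (simp add: degA_def)
  hence w: "card Z ^ \<rho> = qB B ^ D a" by (simp add: power_mult[symmetric] mult.commute)
  let ?f = "\<lambda>x. z (E \<otimes>\<^bsub>ffield B\<^esub> x)"
  have f_iff: "?f x = ?f y \<longleftrightarrow> x \<ominus>\<^bsub>ffield B\<^esub> y \<in> vprime B" if xy: "x \<in> AA B" "y \<in> AA B" for x y
  proof -
    have c: "E \<in> carrier (ffield B)" "x \<in> carrier (ffield B)" "y \<in> carrier (ffield B)" using xy E by auto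
    have m: "E \<otimes>\<^bsub>ffield B\<^esub> x \<ominus>\<^bsub>ffield B\<^esub> E \<otimes>\<^bsub>ffield B\<^esub> y = E \<otimes>\<^bsub>ffield B\<^esub> (x \<ominus>\<^bsub>ffield B\<^esub> y)" using c by algebra
    have "?f x = ?f y \<longleftrightarrow> (\<exists>t\<in>AA B. E \<otimes>\<^bsub>ffield B\<^esub> (x \<ominus>\<^bsub>ffield B\<^esub> y) = a \<otimes>\<^bsub>ffield B\<^esub> t)"
      using z_iff[of "E \<otimes>\<^bsub>ffield B\<^esub> x" "E \<otimes>\<^bsub>ffield B\<^esub> y"] congr_iff_minus[of "E \<otimes>\<^bsub>ffield B\<^esub> x" "E \<otimes>\<^bsub>ffield B\<^esub> y"] xy E(1)
      unfolding m by simp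
    thus ?thesis using E_mult_iff[OF a uf(2,1) E] xy by simp
  qed
  have fZ: "?f ` AA B \<subseteq> Z" using z E by auto
  have ff: "finite (?f ` AA B)" using finite_subset[OF fZ Z(1)] .
  have Fv1: "finite (carrier (Fv B)) \<and> card (carrier (Fv B)) = card (?f ` AA B)"
    unfolding Fv_def by (rule card_quot[OF vprime_ideal f_iff ff])
  thus "finite (carrier (Fv B))" ..
  have Fv2: "card (carrier (Fv B)) = qB B ^ deg_v B"
    using card_ideal_deg[OF vprime_ideal one] Fv1 unfolding Fv_def deg_v_def by simp
  thus "card (carrier (Fv B)) = qB B ^ deg_v B" .
  have k: "finite (kappa a E ` AA B)"
    by (rule finite_image_same_fibres[of _ ?f]) (use kappa_eq_iff[OF a uf(2,1) E] f_iff ff in auto)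
  have Q: "card (carrier (inv_prime_quot B)) = qB B ^ deg_v B" "finite (carrier (inv_prime_quot B))"
    using card_quot[OF vprime_ideal kappa_eq_iff[OF a uf(2,1) E] k] Fv2 k
    kappa_image[OF a uf(2,1) E, symmetric] unfolding Fv_def by simp_all
  have Fv3: "card (carrier (Fv B)) \<ge> 2"
  proof -
    have "?f \<zero>\<^bsub>ffield B\<^esub> \<noteq> ?f \<one>\<^bsub>ffield B\<^esub>"
      using f_iff[of "\<one>\<^bsub>ffield B\<^esub>" "\<zero>\<^bsub>ffield B\<^esub>"] one by (auto simp: V.minus_eq)
    moreover have "{?f \<zero>\<^bsub>ffield B\<^esub>, ?f \<one>\<^bsub>ffield B\<^esub>} \<subseteq> ?f ` AA B" by auto
    ultimately show ?thesis using card_mono[OF ff, of "{?f \<zero>\<^bsub>ffield B\<^esub>, ?f \<one>\<^bsub>ffield B\<^esub>}"] Fv1 by simp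
  qed
  show "deg_v B > 0"
  proof (rule ccontr)
    assume "\<not> deg_v B > 0"
    thus False using Fv3 Fv2 by simp
  qed
  fix l assume l: "\<And>i. i < l \<Longrightarrow> \<psi> a i = \<zero>" "\<psi> a l \<noteq> \<zero>"
  have E0: "\<psi> E 0 = \<one>"
  proof -
    have "\<psi> \<one>\<^bsub>ffield B\<^esub> 0 \<ominus> \<psi> E 0 = \<zero>" using psi_p[OF E(2)] dd.psi_minus[of "\<one>\<^bsub>ffield B\<^esub>" E 0] E by simp
    thus ?thesis using psi_closed[OF E(1), of 0] by (simp add: psi_one)
  qed
  \<comment> \<open>For \<open>n = 1\<close> the ideal attached to \<open>E\<close> is \<open>\<pp>\<close>.\<close>
  have tor: "pts.torsion a E 1 = carrier (v_torsion B L \<psi>)"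
  proof -
    have "pts.P a E 1 = vprime B"
      unfolding pts.P_def[OF a uf(2,3)] using E_mult_iff[OF a uf(2,1) E] E(1) a vprime_AA by auto
    thus ?thesis unfolding pts.torsion_def[OF a uf(2,3)] by (simp add: v_torsion_def Let_def)
  qed
  have main: "card (carrier (v_torsion B L \<psi>)) * qB B ^ l = (qB B ^ deg_v B) ^ \<rho>"
  proof -
    have "card (pts.torsion a E 1) * qB B ^ l = card (?f ` AA B) ^ \<rho>"
      by (rule pts.card_torsion_eq[OF a uf(2,3) Z z w E(1) b E0]) (use l in \<open>auto simp: dd.low_def\<close>)
    thus ?thesis unfolding tor using Fv1 Fv2 by simp
  qed
  interpret N: module "Aring B" "v_torsion B L \<psi>" by (rule torsion_module)
  have finN: "finite (carrier (v_torsion B L \<psi>))"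
    using pts.finite_torsion[OF a uf(2,3) E(1), of 1] unfolding tor .
  have "card (carrier (v_torsion B L \<psi>)) = card (carrier (inv_prime_quot B)) ^ v_rank B L \<psi>"
    unfolding v_rank_def
  proof (rule N.card_eq_residue_power[of "vprime B" "kappa a E"])
    show "ideal (vprime B) (Aring B)" by (rule vprime_ideal)
    show "\<one>\<^bsub>Aring B\<^esub> \<notin> vprime B" using one by simp
    show "\<exists>w\<in>carrier (Aring B). \<one>\<^bsub>Aring B\<^esub> \<ominus>\<^bsub>Aring B\<^esub> v \<otimes>\<^bsub>Aring B\<^esub> w \<in> vprime B"
      if v: "v \<in> carrier (Aring B)" "v \<notin> vprime B" for v
    proof -
      obtain w where w: "w \<in> AA B" "\<one>\<^bsub>ffield B\<^esub> \<ominus>\<^bsub>ffield B\<^esub> v \<otimes>\<^bsub>ffield B\<^esub> w \<in> vprime B" using inv v by auto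
      hence "\<one>\<^bsub>Aring B\<^esub> \<ominus>\<^bsub>Aring B\<^esub> v \<otimes>\<^bsub>Aring B\<^esub> w \<in> vprime B"
        using Aring_minus[of "\<one>\<^bsub>ffield B\<^esub>" "v \<otimes>\<^bsub>ffield B\<^esub> w"] v by simp
      thus ?thesis using w by (intro bexI[of _ w]) auto
    qed
    show "c \<odot>\<^bsub>v_torsion B L \<psi>\<^esub> x = \<zero>\<^bsub>v_torsion B L \<psi>\<^esub>" if "c \<in> vprime B" "x \<in> carrier (v_torsion B L \<psi>)" for c x
      using that by (simp add: v_torsion_def Let_def)
    show "finite (carrier (v_torsion B L \<psi>))" by (rule finN)
    show "kappa a E ` carrier (Aring B) = carrier (inv_prime_quot B)" using kappa_image[OF a uf(2,1) E] by simp
    show "kappa a E r = kappa a E s \<longleftrightarrow> r \<ominus>\<^bsub>Aring B\<^esub> s \<in> vprime B" if "r \<in> carrier (Aring B)" "s \<in> carrier (Aring B)" for r s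
      using kappa_eq_iff[OF a uf(2,1) E, of r s] that by simp
    show "kappa a E (r \<oplus>\<^bsub>Aring B\<^esub> s) = kappa a E r \<oplus>\<^bsub>inv_prime_quot B\<^esub> kappa a E s" if "r \<in> carrier (Aring B)" "s \<in> carrier (Aring B)" for r s
      using kappa_add[OF a uf(2,1) E, of r s] that by simp
    show "kappa a E (r \<otimes>\<^bsub>Aring B\<^esub> s) = r \<odot>\<^bsub>inv_prime_quot B\<^esub> kappa a E s" if "r \<in> carrier (Aring B)" "s \<in> carrier (Aring B)" for r s
      using kappa_smult[OF a uf(2,1) E, of r s] that by simp
    show "finite (carrier (inv_prime_quot B))" by (rule Q(2))
  qed (rule HOL.refl)+
  hence "(qB B ^ deg_v B) ^ v_rank B L \<psi> * qB B ^ l = (qB B ^ deg_v B) ^ \<rho>" using main Q(1) by simp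
  hence "qB B ^ (deg_v B * v_rank B L \<psi> + l) = qB B ^ (deg_v B * \<rho>)"
    by (simp add: power_add power_mult[symmetric])
  thus "deg_v B * v_rank B L \<psi> + l = deg_v B * \<rho>" using q_ge_2 by (simp add: power_inject_exp)
qed

lemma rank_eq: "rank_of B L \<psi> = \<rho>"
  unfolding rank_of_def
proof (rule the_equality[where P = "has_rank B L \<psi>"])
  fix r assume r: "has_rank B L \<psi> r"
  note uf = uniformizer_facts
  have "r * degA B a = \<rho> * degA B a"
  proof (rule ccontr)
    assume ne: "r * degA B a \<noteq> \<rho> * degA B a"
    have "a \<in> AA B - {\<zero>\<^bsub>ffield B\<^esub>}" using a uf by simp
    hence "\<psi> a (r * degA B a) \<noteq> \<zero>" "\<And>i. i > r * degA B a \<Longrightarrow> \<psi> a i = \<zero>"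
      "\<psi> a (\<rho> * degA B a) \<noteq> \<zero>" "\<And>i. i > \<rho> * degA B a \<Longrightarrow> \<psi> a i = \<zero>"
      using r rank unfolding has_rank_def by blast+
    thus False using ne by (metis linorder_neqE_nat)
  qed
  thus "r = \<rho>" using uf(3) by simp
qed (rule rank)

theorem height_ge_iff: "int h \<le> height B L \<psi> \<longleftrightarrow> (\<forall>i<h * deg_v B. \<psi> a i = \<zero>)"
proof -
  define l where "l = (LEAST i. \<psi> a i \<noteq> \<zero>)"
  have l: "\<psi> a l \<noteq> \<zero>" "\<And>i. i < l \<Longrightarrow> \<psi> a i = \<zero>"
    unfolding l_def using LeastI[of "\<lambda>i. \<psi> a i \<noteq> \<zero>", OF D_facts(1)[OF a uniformizer_facts(2)]] not_less_Least by auto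
  have eq: "deg_v B * v_rank B L \<psi> + l = deg_v B * \<rho>" by (rule rank_height[OF l(2,1)])
  have d: "deg_v B > 0" by (rule residue_field_facts(3))
  have "int h \<le> height B L \<psi> \<longleftrightarrow> h + v_rank B L \<psi> \<le> \<rho>" unfolding height_def rank_eq by linarith
  also have "\<dots> \<longleftrightarrow> deg_v B * (h + v_rank B L \<psi>) \<le> deg_v B * \<rho>" using d by simp
  also have "\<dots> \<longleftrightarrow> h * deg_v B \<le> l" unfolding eq[symmetric] by (simp add: algebra_simps)
  also have "\<dots> \<longleftrightarrow> (\<forall>i<h * deg_v B. \<psi> a i = \<zero>)"
  proof
    assume "\<forall>i<h * deg_v B. \<psi> a i = \<zero>"
    thus "h * deg_v B \<le> l" using l(1) by (meson not_le)
  qed (use l(2) in auto)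
  finally show ?thesis .
qed

end

end

section \<open>The ideal generated by the Hasse invariants\<close>

text \<open>The coefficients of a Drinfeld module over an \<open>A/\<pp>\<close>-algebra \<open>R\<close>, such as the functions on an open
subset of the special fibre on which the line bundle is trivial.\<close>

locale special_coefficients = function_base B + R: cring R
  for B :: "'f base" and R :: "'a ring" (structure) +
  fixes C :: "'f \<Rightarrow> nat \<Rightarrow> 'a" and \<delta> :: "'f set \<Rightarrow> 'a"
  assumes C_closed: "c \<in> AA B \<Longrightarrow> C c i \<in> carrier R"
    and C_mult: "c \<in> AA B \<Longrightarrow> d \<in> AA B \<Longrightarrow>
      C (c \<otimes>\<^bsub>ffield B\<^esub> d) k = (\<Oplus>i\<in>{..k}. C c i \<otimes> (C d (k - i)) [^] (qB B ^ i))"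
    and C_zero: "c \<in> AA B \<Longrightarrow> C c 0 = \<delta> (vprime B +>\<^bsub>Aring B\<^esub> c)"
    and \<delta>: "\<delta> \<in> ring_hom (Fv B) R"
    and Fv_fin: "finite (carrier (Fv B))" and Fv_card: "card (carrier (Fv B)) = qB B ^ deg_v B"
    and d_pos: "deg_v B > 0"
begin

lemma finsum_ideal:
  assumes J: "ideal J R" and f: "\<And>i. i \<in> S \<Longrightarrow> f i \<in> J" and S: "finite S"
  shows "(\<Oplus>i\<in>S. f i) \<in> J"
  using S f
proof (induction S)
  case empty thus ?case using additive_subgroup.zero_closed[OF ideal.axioms(1)[OF J]] by simp
next
  case (insert x S)
  have "J \<subseteq> carrier R" using additive_subgroup.a_subset[OF ideal.axioms(1)[OF J]] by auto
  hence "(\<Oplus>i\<in>insert x S. f i) = f x \<oplus> (\<Oplus>i\<in>S. f i)" using insert by (intro R.finsum_insert) auto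
  thus ?case using insert additive_subgroup.a_closed[OF ideal.axioms(1)[OF J]] by auto
qed

lemma pow_ideal: "ideal J R \<Longrightarrow> x \<in> J \<Longrightarrow> n > 0 \<Longrightarrow> x [^] (n::nat) \<in> J"
proof -
  assume J: "ideal J R" and x: "x \<in> J" and n: "n > 0"
  have xR: "x \<in> carrier R" using x additive_subgroup.a_subset[OF ideal.axioms(1)[OF J]] by auto
  obtain m where "n = Suc m" using n by (cases n) auto
  thus ?thesis using ideal.I_l_closed[OF J x, of "x [^] m"] xR by simp
qed

lemma Fv_field: "field (Fv B)"
proof -
  interpret D: domain "Fv B" unfolding Fv_def by (rule primeideal.quotient_is_domain[OF vprime_primeideal])
  show ?thesis
  proof (rule D.cring_fieldI2)
    fix x assume x: "x \<in> carrier (Fv B)" "x \<noteq> \<zero>\<^bsub>Fv B\<^esub>"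
    have "(\<lambda>y. x \<otimes>\<^bsub>Fv B\<^esub> y) ` carrier (Fv B) = carrier (Fv B)"
    proof (rule endo_inj_surj[OF Fv_fin])
      show "inj_on (\<lambda>y. x \<otimes>\<^bsub>Fv B\<^esub> y) (carrier (Fv B))" using x D.m_lcancel by (intro inj_onI) auto
    qed (use x in auto)
    then obtain y where "y \<in> carrier (Fv B)" "\<one>\<^bsub>Fv B\<^esub> = x \<otimes>\<^bsub>Fv B\<^esub> y" using D.one_closed by (metis imageE)
    thus "\<exists>y\<in>carrier (Fv B). x \<otimes>\<^bsub>Fv B\<^esub> y = \<one>\<^bsub>Fv B\<^esub>" by auto
  qed simp
qed

text \<open>On a field with \<open>q\<^sup>d\<close> elements the \<open>q\<^sup>k\<close>-Frobenius is trivial only if \<open>d\<close> divides \<open>k\<close>: reducing \<open>k\<close>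
modulo \<open>d\<close>, a smaller power would otherwise fix too many elements. The difference for a moved element is a unit, already in
the residue field.\<close>

lemma exists_moved:
  assumes "\<not> deg_v B dvd k"
  obtains c where "c \<in> AA B" "(C c 0) [^] (qB B ^ k) \<ominus> C c 0 \<in> Units R"
proof -
  interpret K: field "Fv B" by (rule Fv_field)
  interpret d: ring_hom_cring "Fv B" R \<delta> using \<delta> by unfold_locales
  let ?q = "qB B" and ?d = "deg_v B"
  \<comment> \<open>Only \<open>k\<close> modulo \<open>d\<close> matters, and \<open>k\<close> reduced modulo \<open>d\<close> is positive.\<close>
  have per: "x [^]\<^bsub>Fv B\<^esub> (?q ^ (?d * s)) = x" if "x \<in> carrier (Fv B)" for x s
  proof (induction s)
    case (Suc s)
    have "x [^]\<^bsub>Fv B\<^esub> (?q ^ (?d * Suc s)) = (x [^]\<^bsub>Fv B\<^esub> (?q ^ (?d * s))) [^]\<^bsub>Fv B\<^esub> (?q ^ ?d)"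
      using that by (simp add: K.nat_pow_pow power_add mult.commute)
    thus ?case using Suc K.finite_pow_card[OF Fv_fin that] Fv_card by simp
  qed (use that in simp)
  define r where "r = k mod ?d"
  have r: "0 < r" "r < ?d" using assms d_pos by (auto simp: r_def dvd_eq_mod_eq_0)
  have "\<exists>x\<in>carrier (Fv B). x [^]\<^bsub>Fv B\<^esub> (?q ^ k) \<noteq> x"
  proof (rule ccontr)
    assume "\<not> ?thesis"
    hence all: "\<And>x. x \<in> carrier (Fv B) \<Longrightarrow> x [^]\<^bsub>Fv B\<^esub> (?q ^ k) = x" by blast
    have "x [^]\<^bsub>Fv B\<^esub> (?q ^ r) = x" if x: "x \<in> carrier (Fv B)" for x
    proof -
      have "k = ?d * (k div ?d) + r" by (simp add: r_def)
      hence "?q ^ k = ?q ^ (?d * (k div ?d)) * ?q ^ r" by (metis power_add)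
      hence "x [^]\<^bsub>Fv B\<^esub> (?q ^ k) = (x [^]\<^bsub>Fv B\<^esub> (?q ^ (?d * (k div ?d)))) [^]\<^bsub>Fv B\<^esub> (?q ^ r)"
        using x by (simp add: K.nat_pow_pow)
      thus ?thesis using all[OF x] per[OF x] by simp
    qed
    hence "{x \<in> carrier (Fv B). x [^]\<^bsub>Fv B\<^esub> (?q ^ r) = x} = carrier (Fv B)" by auto
    moreover have "1 < ?q ^ r" using q_ge_2 r by (intro one_less_power) auto
    ultimately have "?q ^ ?d \<le> ?q ^ r" using K.card_pow_fixed[of "?q ^ r"] Fv_card by simp
    moreover have "?q ^ r < ?q ^ ?d" using q_ge_2 r by (intro power_strict_increasing) auto
    ultimately show False by simp
  qed
  then obtain x where x: "x \<in> carrier (Fv B)" "x [^]\<^bsub>Fv B\<^esub> (?q ^ k) \<noteq> x" by auto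
  obtain c where c: "c \<in> AA B" "x = vprime B +>\<^bsub>Aring B\<^esub> c" using x(1) unfolding Fv_def quot_carrier by auto
  let ?y = "x [^]\<^bsub>Fv B\<^esub> (?q ^ k) \<ominus>\<^bsub>Fv B\<^esub> x"
  have yU: "?y \<in> Units (Fv B)" using x K.field_Units by auto
  hence "\<delta> ?y \<in> Units R"
  proof -
    have "\<delta> ?y \<otimes> \<delta> (inv\<^bsub>Fv B\<^esub> ?y) = \<delta> (?y \<otimes>\<^bsub>Fv B\<^esub> inv\<^bsub>Fv B\<^esub> ?y)"
      using yU by (intro d.hom_mult[symmetric]) auto
    also have "\<dots> = \<one>" using K.Units_r_inv[OF yU] by simp
    finally have "\<delta> ?y \<otimes> \<delta> (inv\<^bsub>Fv B\<^esub> ?y) = \<one>" .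
    moreover have "\<delta> ?y \<in> carrier R" "\<delta> (inv\<^bsub>Fv B\<^esub> ?y) \<in> carrier R" using yU by auto
    ultimately show ?thesis using R.Units_one_closed R.unit_factor[of "\<delta> ?y" "\<delta> (inv\<^bsub>Fv B\<^esub> ?y)"] by simp
  qed
  moreover have "\<delta> ?y = (C c 0) [^] (?q ^ k) \<ominus> C c 0"
  proof -
    have p: "\<delta> (x [^]\<^bsub>Fv B\<^esub> n) = \<delta> x [^] n" for n :: nat using x(1) by (induction n) auto
    have "\<delta> ?y = \<delta> (x [^]\<^bsub>Fv B\<^esub> (?q ^ k)) \<ominus> \<delta> x" using x(1) by (simp add: a_minus_def)
    thus ?thesis unfolding p using C_zero[OF c(1)] c(2) by simp
  qed
  ultimately show ?thesis using that c by simp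
qed

text \<open>By induction on \<open>k\<close>. Only indices not divisible by \<open>deg v\<close> need an argument; there \<open>a c\<close> and \<open>c a\<close>
are compared for an element \<open>c\<close> moved by the \<open>q\<^sup>k\<close>-Frobenius.\<close>

lemma low_coefficients_in_ideal:
  assumes J: "ideal J R" and a: "a \<in> vprime B"
    and gen: "\<And>i. 1 \<le> i \<Longrightarrow> i < h \<Longrightarrow> C a (i * deg_v B) \<in> J"
  shows "k < h * deg_v B \<Longrightarrow> C a k \<in> J"
proof (induction k rule: less_induct)
  case (less k)
  interpret J: ideal J R by fact
  have aA: "a \<in> AA B" using a vprime_AA by simp
  show ?case
  proof (cases "deg_v B dvd k")
    case True
    then obtain i where i: "k = i * deg_v B" by (metis dvd_def mult.commute)
    show ?thesis
    proof (cases "i = 0")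
      case True
      interpret d: ring_hom_cring "Fv B" R \<delta>
      proof -
        interpret K: field "Fv B" by (rule Fv_field)
        show "ring_hom_cring (Fv B) R \<delta>" using \<delta> by unfold_locales
      qed
      interpret P: ideal "vprime B" "Aring B" by (rule vprime_ideal)
      have "vprime B +>\<^bsub>Aring B\<^esub> a = vprime B" using P.a_rcos_const[OF a] .
      hence "C a 0 = \<delta> \<zero>\<^bsub>Fv B\<^esub>" using C_zero[OF aA] by (simp add: Fv_def FactRing_def)
      thus ?thesis using True i by simp
    next
      case False
      thus ?thesis using gen[of i] less.prems d_pos unfolding i by simp
    qed
  next
    case False
    then obtain c where c: "c \<in> AA B" "(C c 0) [^] (qB B ^ k) \<ominus> C c 0 \<in> Units R" by (rule exists_moved)
    have JR: "J \<subseteq> carrier R" by (rule J.a_subset)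
    have IH: "C a i \<in> J" if "i < k" for i using less.IH[OF that] that less.prems by simp
    obtain m where m: "k = Suc m" using False by (cases k) auto
    have q0: "qB B > 0" using q_ge_2 by simp
    let ?x = "C a k" and ?g = "C c 0"
    have cl: "?x \<in> carrier R" "?g \<in> carrier R" using C_closed aA c by auto
    define s where "s = (\<Oplus>i\<in>{..m}. C a i \<otimes> (C c (k - i)) [^] (qB B ^ i))"
    have s: "s \<in> J" unfolding s_def
      by (rule finsum_ideal[OF J]) (use IH m C_closed c in \<open>auto intro!: J.I_r_closed\<close>)
    have 1: "C (a \<otimes>\<^bsub>ffield B\<^esub> c) k = ?x \<otimes> ?g [^] (qB B ^ k) \<oplus> s"
      unfolding C_mult[OF aA c(1)] s_def m using C_closed aA c by (subst R.finsum_Suc) auto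
    define t where "t = (\<Oplus>i\<in>{..m}. C c (Suc i) \<otimes> (C a (m - i)) [^] (qB B ^ Suc i))"
    have t: "t \<in> J" unfolding t_def
      by (rule finsum_ideal[OF J]) (use IH m C_closed c q0 in \<open>auto intro!: J.I_l_closed pow_ideal[OF J] simp del: power_Suc\<close>)
    have 2: "C (c \<otimes>\<^bsub>ffield B\<^esub> a) k = t \<oplus> ?g \<otimes> ?x"
      unfolding C_mult[OF c(1) aA] t_def m using C_closed aA c by (subst R.finsum_Suc2) (auto simp del: power_Suc)
    have "a \<otimes>\<^bsub>ffield B\<^esub> c = c \<otimes>\<^bsub>ffield B\<^esub> a" by (rule V.m_comm[OF V.A_carr[OF aA] V.A_carr[OF c(1)]])
    hence eq: "?x \<otimes> ?g [^] (qB B ^ k) \<oplus> s = t \<oplus> ?g \<otimes> ?x" using 1 2 by simp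
    define G where "G = ?g [^] (qB B ^ k)"
    have cl': "s \<in> carrier R" "t \<in> carrier R" "G \<in> carrier R" using s t JR cl by (auto simp: G_def)
    have "(G \<ominus> ?g) \<otimes> ?x = (?x \<otimes> G \<oplus> s) \<ominus> ?g \<otimes> ?x \<ominus> s" using cl cl' by algebra
    also have "\<dots> = t \<ominus> s" unfolding eq[folded G_def] using cl cl' by algebra
    finally have "(G \<ominus> ?g) \<otimes> ?x \<in> J" using s t J.a_closed J.a_inv_closed by (simp add: R.minus_eq)
    moreover have U: "G \<ominus> ?g \<in> Units R" using c by (simp add: G_def)
    ultimately have "inv (G \<ominus> ?g) \<otimes> ((G \<ominus> ?g) \<otimes> ?x) \<in> J" by (rule J.I_l_closed[OF _ R.Units_inv_closed])
    moreover have "inv (G \<ominus> ?g) \<otimes> ((G \<ominus> ?g) \<otimes> ?x) = ?x"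
      using U cl cl' R.Units_l_inv[OF U] R.Units_inv_closed[OF U] by (simp add: R.m_assoc[symmetric])
    ultimately show ?thesis by simp
  qed
qed

text \<open>The low coefficients of \<open>a y = E a'\<close> lie in \<open>J\<close>. As \<open>E\<close> has constant coefficient \<open>1\<close>, those of \<open>a'\<close>
can be solved for, one after the other.\<close>

lemma low_coefficients_transfer:
  assumes J: "ideal J R" and a: "a \<in> AA B" and a': "a' \<in> vprime B"
    and E: "E \<in> AA B" "\<one>\<^bsub>ffield B\<^esub> \<ominus>\<^bsub>ffield B\<^esub> E \<in> vprime B"
      "\<And>u. u \<in> vprime B \<Longrightarrow> \<exists>y\<in>AA B. E \<otimes>\<^bsub>ffield B\<^esub> u = a \<otimes>\<^bsub>ffield B\<^esub> y"
    and lo: "\<And>k. k < N \<Longrightarrow> C a k \<in> J"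
  shows "k < N \<Longrightarrow> C a' k \<in> J"
proof (induction k rule: less_induct)
  case (less k)
  interpret J: ideal J R by fact
  have JR: "J \<subseteq> carrier R" by (rule J.a_subset)
  have a'A: "a' \<in> AA B" using a' vprime_AA by simp
  have E0: "C E 0 = \<one>"
  proof -
    have "\<one>\<^bsub>Fv B\<^esub> = vprime B +>\<^bsub>Aring B\<^esub> \<one>\<^bsub>ffield B\<^esub>" by (simp add: Fv_def FactRing_def)
    also have "\<dots> = vprime B +>\<^bsub>Aring B\<^esub> E" using coset_eq_iff[OF vprime_ideal, of "\<one>\<^bsub>ffield B\<^esub>" E] E by simp
    finally show ?thesis using C_zero[OF E(1)] ring_hom_one[OF \<delta>] by simp
  qed
  obtain y where y: "y \<in> AA B" "E \<otimes>\<^bsub>ffield B\<^esub> a' = a \<otimes>\<^bsub>ffield B\<^esub> y" using E(3)[OF a'] by blast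
  have "C (a \<otimes>\<^bsub>ffield B\<^esub> y) k \<in> J"
    unfolding C_mult[OF a y(1)]
    by (rule finsum_ideal[OF J]) (use lo less.prems C_closed y in \<open>auto intro!: J.I_r_closed\<close>)
  hence Ck: "C (E \<otimes>\<^bsub>ffield B\<^esub> a') k \<in> J" using y by simp
  have q0: "qB B > 0" using q_ge_2 by simp
  have IH: "C a' i \<in> J" if "i < k" for i using less.IH[OF that] that less.prems by simp
  show ?case
  proof (cases k)
    case 0
    thus ?thesis using Ck C_mult[OF E(1) a'A, of 0] E0 C_closed[OF a'A] by simp
  next
    case (Suc m)
    define t where "t = (\<Oplus>i\<in>{..m}. C E (Suc i) \<otimes> (C a' (m - i)) [^] (qB B ^ Suc i))"
    have t: "t \<in> J" unfolding t_def
      by (rule finsum_ideal[OF J]) (use IH Suc C_closed E q0 in \<open>auto intro!: J.I_l_closed pow_ideal[OF J] simp del: power_Suc\<close>)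
    have "C (E \<otimes>\<^bsub>ffield B\<^esub> a') k = t \<oplus> C E 0 \<otimes> C a' k"
      unfolding C_mult[OF E(1) a'A] t_def Suc using C_closed a'A E by (subst R.finsum_Suc2) (auto simp del: power_Suc)
    hence eq: "C (E \<otimes>\<^bsub>ffield B\<^esub> a') k = t \<oplus> C a' k" using E0 C_closed[OF a'A] by simp
    define v where "v = C a' k"
    have cl: "t \<in> carrier R" "v \<in> carrier R" using t JR C_closed[OF a'A] by (auto simp: v_def)
    have "v = (t \<oplus> v) \<oplus> \<ominus> t" using cl by algebra
    thus ?thesis using Ck t J.a_closed J.a_inv_closed unfolding eq v_def[symmetric] by metis
  qed
qed

theorem hasse_ideal_le:
  assumes a: "a \<in> vprime B" "a' \<in> vprime B"
    and E: "E \<in> AA B" "\<one>\<^bsub>ffield B\<^esub> \<ominus>\<^bsub>ffield B\<^esub> E \<in> vprime B"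
      "\<And>u. u \<in> vprime B \<Longrightarrow> \<exists>y\<in>AA B. E \<otimes>\<^bsub>ffield B\<^esub> u = a \<otimes>\<^bsub>ffield B\<^esub> y"
  shows "Idl ((\<lambda>i. C a' (i * deg_v B)) ` {1..<h}) \<subseteq> Idl ((\<lambda>i. C a (i * deg_v B)) ` {1..<h})"
proof -
  let ?G = "\<lambda>a. (\<lambda>i. C a (i * deg_v B)) ` {1..<h}"
  have G: "?G a \<subseteq> carrier R" using C_closed vprime_AA a by auto
  have J: "ideal (Idl (?G a)) R" by (rule R.genideal_ideal[OF G])
  have lo: "C a k \<in> Idl (?G a)" if "k < h * deg_v B" for k
    by (rule low_coefficients_in_ideal[OF J a(1) _ that]) (use R.genideal_self[OF G] in auto)
  have "C a' k \<in> Idl (?G a)" if "k < h * deg_v B" for k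
    by (rule low_coefficients_transfer[where a = a and E = E and N = "h * deg_v B"]) (fact J vprime_AA[OF a(1)] a(2) E lo that)+
  hence "?G a' \<subseteq> Idl (?G a)" using d_pos by auto
  thus ?thesis by (rule R.genideal_minimal[OF J])
qed

end

section \<open>Local rings\<close>

text \<open>Zorn's lemma for the ideals that contain \<open>x\<close> and not \<open>1\<close>.\<close>

lemma (in cring) nonunit_in_maximalideal:
  assumes x: "x \<in> carrier R" "x \<notin> Units R"
  shows "\<exists>I. maximalideal I R \<and> x \<in> I"
proof -
  let ?A = "{I. ideal I R \<and> x \<in> I \<and> \<one> \<notin> I}"
  have "PIdl x \<in> ?A"
  proof -
    have "\<one> \<notin> PIdl x"
    proof
      assume "\<one> \<in> PIdl x"
      then obtain y where "y \<in> carrier R" "\<one> = y \<otimes> x" unfolding cgenideal_def by auto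
      hence "x \<in> Units R" using x m_comm unfolding Units_def by auto
      thus False using x by simp
    qed
    thus ?thesis using cgenideal_ideal[OF x(1)] cgenideal_self[OF x(1)] by simp
  qed
  moreover have "\<Union>C \<in> ?A" if C: "C \<noteq> {}" "subset.chain ?A C" for C
  proof -
    have "subset.chain {I. ideal I R} C" using C(2) unfolding subset_chain_def by auto
    hence "ideal (\<Union>C) R" using chain_Union_is_ideal[of C] C(1) by simp
    moreover have "C \<subseteq> ?A" using C(2) unfolding subset_chain_def by blast
    ultimately show ?thesis using C(1) by blast
  qed
  ultimately have "\<exists>M\<in>?A. \<forall>X\<in>?A. M \<subseteq> X \<longrightarrow> X = M" by (intro subset_Zorn_nonempty) blast+
  then obtain M where M: "ideal M R" "x \<in> M" "\<one> \<notin> M"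
    and max: "\<And>X. ideal X R \<Longrightarrow> x \<in> X \<Longrightarrow> \<one> \<notin> X \<Longrightarrow> M \<subseteq> X \<Longrightarrow> X = M" by blast
  have "maximalideal M R"
  proof (rule maximalidealI)
    show "carrier R \<noteq> M" using M by auto
    fix J assume J: "ideal J R" "M \<subseteq> J" "J \<subseteq> carrier R"
    show "J = M \<or> J = carrier R"
    proof (cases "\<one> \<in> J")
      case True
      thus ?thesis using ideal.one_imp_carrier[OF J(1)] by simp
    next
      case False
      thus ?thesis using max[OF J(1)] J M by blast
    qed
  qed fact
  thus ?thesis using M by blast
qed

lemma
  assumes "local_ring R"
  shows local_ring_maximal: "maximalideal (max_ideal R) R"
    and local_ring_nonunit: "x \<in> carrier R \<Longrightarrow> x \<in> max_ideal R \<longleftrightarrow> x \<notin> Units R"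
proof -
  interpret cring R using assms by (simp add: local_ring_def)
  have ex: "\<exists>!I. maximalideal I R" using assms by (simp add: local_ring_def)
  show max: "maximalideal (max_ideal R) R" unfolding max_ideal_def by (rule theI'[OF ex])
  interpret M: maximalideal "max_ideal R" R by (rule max)
  assume x: "x \<in> carrier R"
  show "x \<in> max_ideal R \<longleftrightarrow> x \<notin> Units R"
  proof
    assume "x \<in> max_ideal R"
    thus "x \<notin> Units R" using M.I_l_closed[of x "inv\<^bsub>R\<^esub> x"] M.one_imp_carrier M.I_notcarr by auto
  next
    assume "x \<notin> Units R"
    then obtain I where "maximalideal I R" "x \<in> I" using nonunit_in_maximalideal[OF x] by blast
    thus "x \<in> max_ideal R" using ex max by blast
  qed
qed

section \<open>Germs and values of functions\<close>

locale ringed =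
  fixes X :: "('p, 'a) rspace"
  assumes ringed: "ringed_space X"
begin

lemma shf_cring: "openin (spc X) U \<Longrightarrow> cring (shf X U)"
  using ringed by (simp add: ringed_space_def)

lemma res_hom: "openin (spc X) U \<Longrightarrow> openin (spc X) V \<Longrightarrow> V \<subseteq> U \<Longrightarrow> res X U V \<in> ring_hom (shf X U) (shf X V)"
  using ringed by (simp add: ringed_space_def)

lemma res_closed: "openin (spc X) U \<Longrightarrow> openin (spc X) V \<Longrightarrow> V \<subseteq> U \<Longrightarrow> s \<in> carrier (shf X U) \<Longrightarrow>
  res X U V s \<in> carrier (shf X V)"
  using ring_hom_closed[OF res_hom] by blast

lemma res_self: "openin (spc X) U \<Longrightarrow> s \<in> carrier (shf X U) \<Longrightarrow> res X U U s = s"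
  using ringed by (simp add: ringed_space_def is_sheaf_def)

lemma res_res: "openin (spc X) U \<Longrightarrow> openin (spc X) V \<Longrightarrow> openin (spc X) W \<Longrightarrow> W \<subseteq> V \<Longrightarrow> V \<subseteq> U \<Longrightarrow>
  s \<in> carrier (shf X U) \<Longrightarrow> res X V W (res X U V s) = res X U W s"
proof -
  have "\<forall>U V W. openin (spc X) U \<and> openin (spc X) V \<and> openin (spc X) W \<and> W \<subseteq> V \<and> V \<subseteq> U \<longrightarrow>
       (\<forall>s\<in>carrier (shf X U). res X V W (res X U V s) = res X U W s)"
    using ringed unfolding ringed_space_def is_sheaf_def by (elim conjE)
  thus "openin (spc X) U \<Longrightarrow> openin (spc X) V \<Longrightarrow> openin (spc X) W \<Longrightarrow> W \<subseteq> V \<Longrightarrow> V \<subseteq> U \<Longrightarrow>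
    s \<in> carrier (shf X U) \<Longrightarrow> res X V W (res X U V s) = res X U W s" by simp
qed

context
  fixes x :: 'p
begin

lemma germ_self: "openin (spc X) U \<Longrightarrow> x \<in> U \<Longrightarrow> s \<in> carrier (shf X U) \<Longrightarrow> (U, s) \<in> germ X x U s"
  unfolding germ_def by auto

lemma germ_eqI:
  assumes U: "openin (spc X) U" "s \<in> carrier (shf X U)" and V: "openin (spc X) V" "t \<in> carrier (shf X V)"
    and W: "openin (spc X) W" "x \<in> W" "W \<subseteq> U" "W \<subseteq> V" and eq: "res X U W s = res X V W t"
  shows "germ X x U s = germ X x V t"
proof -
  have sub: "germ X x U s \<subseteq> germ X x V t"
    if U: "openin (spc X) U" "s \<in> carrier (shf X U)" and V: "openin (spc X) V" "t \<in> carrier (shf X V)"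
      and W: "W \<subseteq> U" "W \<subseteq> V" and eq: "res X U W s = res X V W t" for U V s t
  proof
    fix z assume "z \<in> germ X x U s"
    then obtain Y y T where z: "z = (Y, y)" "openin (spc X) Y" "x \<in> Y" "y \<in> carrier (shf X Y)"
      and T: "openin (spc X) T" "x \<in> T" "T \<subseteq> U" "T \<subseteq> Y" "res X U T s = res X Y T y"
      unfolding germ_def by auto
    note WT = openin_Int[OF \<open>openin (spc X) W\<close> T(1)]
    have "res X V (W \<inter> T) t = res X W (W \<inter> T) (res X V W t)"
      using res_res[OF V(1) \<open>openin (spc X) W\<close> WT _ W(2) V(2)] by simp
    also have "\<dots> = res X U (W \<inter> T) s"
      using res_res[OF U(1) \<open>openin (spc X) W\<close> WT _ W(1) U(2)] by (simp add: eq[symmetric])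
    also have "\<dots> = res X T (W \<inter> T) (res X U T s)" using res_res[OF U(1) T(1) WT _ T(3) U(2)] by simp
    also have "\<dots> = res X Y (W \<inter> T) y" using res_res[OF z(2) T(1) WT _ T(4) z(4)] by (simp add: T(5))
    finally have e: "res X V (W \<inter> T) t = res X Y (W \<inter> T) y" .
    show "z \<in> germ X x V t" unfolding germ_def z(1)
    proof (clarsimp, intro conjI exI)
      show "W \<inter> T \<subseteq> V" "W \<inter> T \<subseteq> Y" using W T by auto
    qed (use z T WT e \<open>x \<in> W\<close> in auto)
  qed
  show ?thesis using sub[OF U V W(3,4) eq] sub[OF V U W(4,3) eq[symmetric]] by blast
qed

lemma germ_eqD:
  assumes "openin (spc X) V" "x \<in> V" "t \<in> carrier (shf X V)" "germ X x U s = germ X x V t"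
  obtains W where "openin (spc X) W" "x \<in> W" "W \<subseteq> U" "W \<subseteq> V" "res X U W s = res X V W t"
  using germ_self[OF assms(1-3)] unfolding assms(4)[symmetric] unfolding germ_def by auto

lemma germ_res:
  assumes "openin (spc X) U" "openin (spc X) V" "x \<in> V" "V \<subseteq> U" "s \<in> carrier (shf X U)"
  shows "germ X x V (res X U V s) = germ X x U s"
  by (rule germ_eqI[where W = V]) (use assms res_closed res_self in auto)

text \<open>Sums and products of germs are formed by uniting over all representatives; all of these give the same germ.\<close>

lemma germ_op:
  assumes op: "\<And>U s t. openin (spc X) U \<Longrightarrow> s \<in> carrier (shf X U) \<Longrightarrow> t \<in> carrier (shf X U) \<Longrightarrow> op U s t \<in> carrier (shf X U)"
      "\<And>U V s t. openin (spc X) U \<Longrightarrow> openin (spc X) V \<Longrightarrow> V \<subseteq> U \<Longrightarrow> s \<in> carrier (shf X U) \<Longrightarrow> t \<in> carrier (shf X U) \<Longrightarrow>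
        res X U V (op U s t) = op V (res X U V s) (res X U V t)"
    and U: "openin (spc X) U" "x \<in> U" and s: "s \<in> carrier (shf X U)" and t: "t \<in> carrier (shf X U)"
  shows "(\<Union>(Y, y)\<in>germ X x U s. \<Union>(Z, z)\<in>germ X x U t. germ X x (Y \<inter> Z) (op (Y \<inter> Z) (res X Y (Y \<inter> Z) y) (res X Z (Y \<inter> Z) z)))
    = germ X x U (op U s t)"
proof -
  have main: "germ X x (Y \<inter> Z) (op (Y \<inter> Z) (res X Y (Y \<inter> Z) y) (res X Z (Y \<inter> Z) z)) = germ X x U (op U s t)"
    if y: "(Y, y) \<in> germ X x U s" and z: "(Z, z) \<in> germ X x U t" for Y y Z z
  proof -
    obtain V where V: "openin (spc X) V" "x \<in> V" "V \<subseteq> U" "V \<subseteq> Y" "res X U V s = res X Y V y"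
      and Y: "openin (spc X) Y" "y \<in> carrier (shf X Y)" using y unfolding germ_def by auto
    obtain W where W: "openin (spc X) W" "x \<in> W" "W \<subseteq> U" "W \<subseteq> Z" "res X U W t = res X Z W z"
      and Z: "openin (spc X) Z" "z \<in> carrier (shf X Z)" using z unfolding germ_def by auto
    note O = openin_Int[OF V(1) W(1)] openin_Int[OF Y(1) Z(1)]
    have yz: "res X Y (Y \<inter> Z) y \<in> carrier (shf X (Y \<inter> Z))" "res X Z (Y \<inter> Z) z \<in> carrier (shf X (Y \<inter> Z))"
      using res_closed[OF Y(1) O(2) _ Y(2)] res_closed[OF Z(1) O(2) _ Z(2)] by auto
    have sub: "V \<inter> W \<subseteq> Y \<inter> Z" using V W by auto
    show ?thesis
    proof (rule germ_eqI[where W = "V \<inter> W"])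
      have "res X (Y \<inter> Z) (V \<inter> W) (op (Y \<inter> Z) (res X Y (Y \<inter> Z) y) (res X Z (Y \<inter> Z) z))
        = op (V \<inter> W) (res X Y (V \<inter> W) y) (res X Z (V \<inter> W) z)"
        unfolding op(2)[OF O(2,1) sub yz]
        using res_res[OF Y(1) O(2,1) sub _ Y(2)] res_res[OF Z(1) O(2,1) sub _ Z(2)] by simp
      also have "res X Y (V \<inter> W) y = res X U (V \<inter> W) s"
        using res_res[OF Y(1) V(1) O(1) _ V(4) Y(2)] res_res[OF U(1) V(1) O(1) _ V(3) s] V(5) by simp
      also have "res X Z (V \<inter> W) z = res X U (V \<inter> W) t"
        using res_res[OF Z(1) W(1) O(1) _ W(4) Z(2)] res_res[OF U(1) W(1) O(1) _ W(3) t] W(5) by simp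
      also have "op (V \<inter> W) (res X U (V \<inter> W) s) (res X U (V \<inter> W) t) = res X U (V \<inter> W) (op U s t)"
        by (rule op(2)[OF U(1) O(1) _ s t, symmetric]) (use V in auto)
      finally show "res X (Y \<inter> Z) (V \<inter> W) (op (Y \<inter> Z) (res X Y (Y \<inter> Z) y) (res X Z (Y \<inter> Z) z))
        = res X U (V \<inter> W) (op U s t)" .
    qed (use O U V W sub op(1)[OF O(2) yz] op(1)[OF U(1) s t] in auto)
  qed
  have mem: "(U, s) \<in> germ X x U s" "(U, t) \<in> germ X x U t" using germ_self U s t by auto
  show ?thesis
  proof (intro equalityI subsetI)
    fix e assume "e \<in> germ X x U (op U s t)"
    hence "e \<in> germ X x (U \<inter> U) (op (U \<inter> U) (res X U (U \<inter> U) s) (res X U (U \<inter> U) t))"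
      unfolding main[OF mem] .
    thus "e \<in> (\<Union>(Y, y)\<in>germ X x U s. \<Union>(Z, z)\<in>germ X x U t. germ X x (Y \<inter> Z) (op (Y \<inter> Z) (res X Y (Y \<inter> Z) y) (res X Z (Y \<inter> Z) z)))"
      by (intro UN_I[OF mem(1)] case_prodI UN_I[OF mem(2)] | simp only: split)+
  next
    fix e assume "e \<in> (\<Union>(Y, y)\<in>germ X x U s. \<Union>(Z, z)\<in>germ X x U t. germ X x (Y \<inter> Z) (op (Y \<inter> Z) (res X Y (Y \<inter> Z) y) (res X Z (Y \<inter> Z) z)))"
    then obtain Y y Z z where "(Y, y) \<in> germ X x U s" "(Z, z) \<in> germ X x U t"
      "e \<in> germ X x (Y \<inter> Z) (op (Y \<inter> Z) (res X Y (Y \<inter> Z) y) (res X Z (Y \<inter> Z) z))"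
      by (elim UN_E) (simp only: split_paired_all split, elim UN_E, simp only: split_paired_all split)
    thus "e \<in> germ X x U (op U s t)" using main by simp
  qed
qed

lemma germ_hom:
  assumes U: "openin (spc X) U" "x \<in> U"
  shows "germ X x U \<in> ring_hom (shf X U) (stalk X x)"
proof (rule ring_hom_memI)
  interpret cring "shf X U" by (rule shf_cring[OF U(1)])
  fix s t assume st: "s \<in> carrier (shf X U)" "t \<in> carrier (shf X U)"
  show "germ X x U s \<in> carrier (stalk X x)" using U st by (auto simp: stalk_def)
  have "germ X x U s \<otimes>\<^bsub>stalk X x\<^esub> germ X x U t = (\<Union>(Y, y)\<in>germ X x U s. \<Union>(Z, z)\<in>germ X x U t.
    germ X x (Y \<inter> Z) (res X Y (Y \<inter> Z) y \<otimes>\<^bsub>shf X (Y \<inter> Z)\<^esub> res X Z (Y \<inter> Z) z))"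
    by (simp add: stalk_def)
  also have "\<dots> = germ X x U (s \<otimes>\<^bsub>shf X U\<^esub> t)"
  proof (rule germ_op[where op = "\<lambda>U. monoid.mult (shf X U)"])
    show "s \<otimes>\<^bsub>shf X U\<^esub> t \<in> carrier (shf X U)" if "openin (spc X) U" "s \<in> carrier (shf X U)" "t \<in> carrier (shf X U)" for U s t
      using shf_cring[OF that(1)] that by (simp add: cring.cring_simprules)
  qed (use ring_hom_mult[OF res_hom] U st in auto)
  finally show "germ X x U (s \<otimes>\<^bsub>shf X U\<^esub> t) = germ X x U s \<otimes>\<^bsub>stalk X x\<^esub> germ X x U t" ..
  have "germ X x U s \<oplus>\<^bsub>stalk X x\<^esub> germ X x U t = (\<Union>(Y, y)\<in>germ X x U s. \<Union>(Z, z)\<in>germ X x U t.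
    germ X x (Y \<inter> Z) (res X Y (Y \<inter> Z) y \<oplus>\<^bsub>shf X (Y \<inter> Z)\<^esub> res X Z (Y \<inter> Z) z))"
    by (simp add: stalk_def)
  also have "\<dots> = germ X x U (s \<oplus>\<^bsub>shf X U\<^esub> t)"
  proof (rule germ_op[where op = "\<lambda>U. ring.add (shf X U)"])
    show "s \<oplus>\<^bsub>shf X U\<^esub> t \<in> carrier (shf X U)" if "openin (spc X) U" "s \<in> carrier (shf X U)" "t \<in> carrier (shf X U)" for U s t
      using shf_cring[OF that(1)] that by (simp add: cring.cring_simprules)
  qed (use ring_hom_add[OF res_hom] U st in auto)
  finally show "germ X x U (s \<oplus>\<^bsub>shf X U\<^esub> t) = germ X x U s \<oplus>\<^bsub>stalk X x\<^esub> germ X x U t" ..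
next
  interpret G: cring "glob X" by (rule shf_cring[OF openin_topspace])
  have "germ X x U (res X (pts X) U \<one>\<^bsub>glob X\<^esub>) = germ X x (pts X) \<one>\<^bsub>glob X\<^esub>"
    by (rule germ_res) (use U openin_subset in auto)
  thus "germ X x U \<one>\<^bsub>shf X U\<^esub> = \<one>\<^bsub>stalk X x\<^esub>"
    using ring_hom_one[OF res_hom[OF openin_topspace U(1) openin_subset[OF U(1)]]] by (simp add: stalk_def)
qed

end

end

locale locally_ringed = ringed X for X :: "('p, 'a) rspace" +
  assumes local: "x \<in> pts X \<Longrightarrow> local_ring (stalk X x)"
begin

context
  fixes x assumes x: "x \<in> pts X"
begin

lemma stalk_cring: "cring (stalk X x)"
  using local[OF x] by (simp add: local_ring_def)

lemma residue_field_field: "field (residue_field X x)"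
  unfolding residue_field_def
  by (rule maximalideal.quotient_is_field[OF local_ring_maximal[OF local[OF x]] stalk_cring])

lemma value_eq: "openin (spc X) U \<Longrightarrow> x \<in> U \<Longrightarrow> s \<in> carrier (shf X U) \<Longrightarrow>
  smap (residue_point X x) U s = max_ideal (stalk X x) +>\<^bsub>stalk X x\<^esub> germ X x U s"
  by (simp add: residue_point_def)

lemma value_hom:
  assumes U: "openin (spc X) U" "x \<in> U"
  shows "smap (residue_point X x) U \<in> ring_hom (shf X U) (residue_field X x)"
proof -
  interpret cring "shf X U" by (rule shf_cring[OF U(1)])
  have "ideal (max_ideal (stalk X x)) (stalk X x)"
    using local_ring_maximal[OF local[OF x]] by (simp add: maximalideal_def)
  hence "(\<lambda>g. max_ideal (stalk X x) +>\<^bsub>stalk X x\<^esub> g) \<in> ring_hom (stalk X x) (residue_field X x)"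
    unfolding residue_field_def by (rule ideal.rcos_ring_hom)
  hence "(\<lambda>g. max_ideal (stalk X x) +>\<^bsub>stalk X x\<^esub> g) \<circ> germ X x U \<in> ring_hom (shf X U) (residue_field X x)"
    using germ_hom[OF U] ring_hom_trans by blast
  thus ?thesis by (rule ring_hom_restrict) (use value_eq[OF U] in simp)
qed

lemma value_zero_iff:
  assumes U: "openin (spc X) U" "x \<in> U" "s \<in> carrier (shf X U)"
  shows "smap (residue_point X x) U s = \<zero>\<^bsub>residue_field X x\<^esub> \<longleftrightarrow> germ X x U s \<notin> Units (stalk X x)"
proof -
  interpret S: cring "stalk X x" by (rule stalk_cring)
  interpret M: maximalideal "max_ideal (stalk X x)" "stalk X x" by (rule local_ring_maximal[OF local[OF x]])
  have g: "germ X x U s \<in> carrier (stalk X x)" using ring_hom_closed[OF germ_hom[OF U(1,2)] U(3)] .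
  have "max_ideal (stalk X x) +>\<^bsub>stalk X x\<^esub> germ X x U s = max_ideal (stalk X x) \<longleftrightarrow> germ X x U s \<in> max_ideal (stalk X x)"
    using M.a_rcos_const M.a_rcos_self[OF g] by auto
  thus ?thesis using local_ring_nonunit[OF local[OF x] g] value_eq[OF U] by (simp add: residue_field_def FactRing_def)
qed

lemma value_res:
  assumes "openin (spc X) U" "openin (spc X) V" "x \<in> V" "V \<subseteq> U" "s \<in> carrier (shf X U)"
  shows "smap (residue_point X x) V (res X U V s) = smap (residue_point X x) U s"
  using value_eq germ_res[OF assms] res_closed[OF assms(1,2,4,5)] assms by auto

text \<open>An inverse of the germ is represented near \<open>x\<close>, and is still an inverse on a smaller neighbourhood.\<close>

lemma invertible_near:
  assumes U: "openin (spc X) U" "x \<in> U" "s \<in> carrier (shf X U)" and unit: "germ X x U s \<in> Units (stalk X x)"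
  obtains W z where "openin (spc X) W" "x \<in> W" "W \<subseteq> U" "z \<in> carrier (shf X W)" "res X U W s \<otimes>\<^bsub>shf X W\<^esub> z = \<one>\<^bsub>shf X W\<^esub>"
proof -
  interpret S: cring "stalk X x" by (rule stalk_cring)
  obtain h where h: "h \<in> carrier (stalk X x)" "germ X x U s \<otimes>\<^bsub>stalk X x\<^esub> h = \<one>\<^bsub>stalk X x\<^esub>"
    using unit S.Units_inv_closed S.Units_r_inv by blast
  then obtain V t where V: "openin (spc X) V" "x \<in> V" "t \<in> carrier (shf X V)" "h = germ X x V t"
    by (auto simp: stalk_def)
  note O = openin_Int[OF U(1) V(1)]
  interpret R: cring "shf X (U \<inter> V)" by (rule shf_cring[OF O])
  have st: "res X U (U \<inter> V) s \<in> carrier (shf X (U \<inter> V))" "res X V (U \<inter> V) t \<in> carrier (shf X (U \<inter> V))"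
    using res_closed[OF U(1) O _ U(3)] res_closed[OF V(1) O _ V(3)] by auto
  have "germ X x (U \<inter> V) (res X U (U \<inter> V) s \<otimes>\<^bsub>shf X (U \<inter> V)\<^esub> res X V (U \<inter> V) t) = \<one>\<^bsub>stalk X x\<^esub>"
    using ring_hom_mult[OF germ_hom[OF O] st] germ_res[OF U(1) O _ _ U(3)] germ_res[OF V(1) O _ _ V(3)] U V h by simp
  also have "\<dots> = germ X x (U \<inter> V) \<one>\<^bsub>shf X (U \<inter> V)\<^esub>" using ring_hom_one[OF germ_hom[OF O]] U V by simp
  finally have eq: "germ X x (U \<inter> V) (res X U (U \<inter> V) s \<otimes>\<^bsub>shf X (U \<inter> V)\<^esub> res X V (U \<inter> V) t) = germ X x (U \<inter> V) \<one>\<^bsub>shf X (U \<inter> V)\<^esub>" .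
  have xUV: "x \<in> U \<inter> V" using U V by simp
  obtain W where W: "openin (spc X) W" "x \<in> W" "W \<subseteq> U \<inter> V" "W \<subseteq> U \<inter> V"
    "res X (U \<inter> V) W (res X U (U \<inter> V) s \<otimes>\<^bsub>shf X (U \<inter> V)\<^esub> res X V (U \<inter> V) t) = res X (U \<inter> V) W \<one>\<^bsub>shf X (U \<inter> V)\<^esub>"
    by (rule germ_eqD[OF O xUV R.one_closed eq])
  have "res X U W s \<otimes>\<^bsub>shf X W\<^esub> res X V W t = \<one>\<^bsub>shf X W\<^esub>"
    using W(5) ring_hom_mult[OF res_hom[OF O W(1,3)] st] ring_hom_one[OF res_hom[OF O W(1,3)]]
      res_res[OF U(1) O W(1,3) _ U(3)] res_res[OF V(1) O W(1,3) _ V(3)] by simp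
  thus ?thesis using that[OF W(1,2) _ res_closed[OF V(1) W(1) _ V(3)]] W(3) by simp
qed

lemma unit_germI:
  assumes U: "openin (spc X) U" "x \<in> U" "s \<in> carrier (shf X U)" "z \<in> carrier (shf X U)" "s \<otimes>\<^bsub>shf X U\<^esub> z = \<one>\<^bsub>shf X U\<^esub>"
  shows "germ X x U s \<in> Units (stalk X x)"
proof -
  interpret S: cring "stalk X x" by (rule stalk_cring)
  note g = germ_hom[OF U(1,2)]
  have "germ X x U s \<otimes>\<^bsub>stalk X x\<^esub> germ X x U z = \<one>\<^bsub>stalk X x\<^esub>"
    using ring_hom_mult[OF g U(3,4)] ring_hom_one[OF g] U(5) by simp
  moreover have c: "germ X x U s \<in> carrier (stalk X x)" "germ X x U z \<in> carrier (stalk X x)"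
    using ring_hom_closed[OF g] U(3,4) by auto
  ultimately show ?thesis using S.m_comm[OF c] unfolding Units_def by auto
qed

end

end

lemma locally_ringedI: "scheme X \<Longrightarrow> locally_ringed X"
  by unfold_locales (auto simp: scheme_def locally_ringed_space_def)

locale scheme_mor = X: locally_ringed X + Y: locally_ringed Y
  for X :: "('p, 'a) rspace" and Y :: "('q, 'b) rspace" +
  fixes f :: "('p, 'a, 'q, 'b) rmor"
  assumes f: "f \<in> mor X Y"
begin

lemma mor_conj:
  "continuous_map (spc X) (spc Y) (pmap f) \<and>
   (\<forall>V. openin (spc Y) V \<longrightarrow> smap f V \<in> extensional (carrier (shf Y V)) \<and> smap f V \<in> ring_hom (shf Y V) (shf X (preim X f V))) \<and>
   (\<forall>V W. openin (spc Y) V \<and> openin (spc Y) W \<and> W \<subseteq> V \<longrightarrow> (\<forall>t\<in>carrier (shf Y V).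
     smap f W (res Y V W t) = res X (preim X f V) (preim X f W) (smap f V t))) \<and>
   (\<forall>x\<in>pts X. \<forall>V. openin (spc Y) V \<and> pmap f x \<in> V \<longrightarrow> (\<forall>t\<in>carrier (shf Y V).
     germ X x (preim X f V) (smap f V t) \<in> Units (stalk X x) \<longrightarrow> germ Y (pmap f x) V t \<in> Units (stalk Y (pmap f x))))"
  using f unfolding mor_def mem_Collect_eq by (elim conjE, intro conjI)

lemmas f_facts = mor_conj[THEN conjunct1] mor_conj[THEN conjunct2, THEN conjunct1]
  mor_conj[THEN conjunct2, THEN conjunct2, THEN conjunct1] mor_conj[THEN conjunct2, THEN conjunct2, THEN conjunct2]

lemma preim_open: "openin (spc Y) V \<Longrightarrow> openin (spc X) (preim X f V)"
  unfolding preim_def by (rule openin_continuous_map_preimage[OF f_facts(1)])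

lemma pmap_pts: "x \<in> pts X \<Longrightarrow> pmap f x \<in> pts Y"
  using f_facts(1) by (auto simp: continuous_map_def)

lemma smap_hom: "openin (spc Y) V \<Longrightarrow> smap f V \<in> ring_hom (shf Y V) (shf X (preim X f V))"
  using f_facts(2) by simp

lemma smap_res: "openin (spc Y) V \<Longrightarrow> openin (spc Y) W \<Longrightarrow> W \<subseteq> V \<Longrightarrow> t \<in> carrier (shf Y V) \<Longrightarrow>
  smap f W (res Y V W t) = res X (preim X f V) (preim X f W) (smap f V t)"
  using f_facts(3) by simp

lemma preim_mono: "W \<subseteq> V \<Longrightarrow> preim X f W \<subseteq> preim X f V"
  unfolding preim_def by auto

lemma preim_pts: "preim X f (pts Y) = pts X"
  using pmap_pts unfolding preim_def by auto

text \<open>Locality of the morphism gives one direction; invertibility near the image point pulls back for the other.\<close>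

lemma value_pullback_zero_iff:
  assumes x: "x \<in> pts X" and V: "openin (spc Y) V" "pmap f x \<in> V" "t \<in> carrier (shf Y V)"
  shows "smap (residue_point X x) (preim X f V) (smap f V t) = \<zero>\<^bsub>residue_field X x\<^esub> \<longleftrightarrow>
    smap (residue_point Y (pmap f x)) V t = \<zero>\<^bsub>residue_field Y (pmap f x)\<^esub>"
proof -
  let ?y = "pmap f x"
  have y: "?y \<in> pts Y" by (rule pmap_pts[OF x])
  note O = preim_open[OF V(1)]
  have xV: "x \<in> preim X f V" using x V by (simp add: preim_def)
  have c: "smap f V t \<in> carrier (shf X (preim X f V))" by (rule ring_hom_closed[OF smap_hom[OF V(1)] V(3)])
  have "germ X x (preim X f V) (smap f V t) \<in> Units (stalk X x) \<longleftrightarrow> germ Y ?y V t \<in> Units (stalk Y ?y)"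
  proof
    assume "germ X x (preim X f V) (smap f V t) \<in> Units (stalk X x)"
    thus "germ Y ?y V t \<in> Units (stalk Y ?y)" using f_facts(4) x V by simp
  next
    assume "germ Y ?y V t \<in> Units (stalk Y ?y)"
    then obtain W z where W: "openin (spc Y) W" "?y \<in> W" "W \<subseteq> V" "z \<in> carrier (shf Y W)"
      "res Y V W t \<otimes>\<^bsub>shf Y W\<^esub> z = \<one>\<^bsub>shf Y W\<^esub>" by (rule Y.invertible_near[OF y V])
    note h = smap_hom[OF W(1)]
    have "smap f W (res Y V W t) \<otimes>\<^bsub>shf X (preim X f W)\<^esub> smap f W z = \<one>\<^bsub>shf X (preim X f W)\<^esub>"
      using ring_hom_mult[OF h Y.res_closed[OF V(1) W(1,3) V(3)] W(4)] ring_hom_one[OF h] W(5) by simp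
    hence "germ X x (preim X f W) (smap f W (res Y V W t)) \<in> Units (stalk X x)"
      by (intro X.unit_germI[OF x preim_open[OF W(1)] _ ring_hom_closed[OF h] ring_hom_closed[OF h W(4)]])
        (use x W Y.res_closed[OF V(1) W(1,3) V(3)] in \<open>auto simp: preim_def\<close>)
    moreover have "germ X x (preim X f W) (smap f W (res Y V W t)) = germ X x (preim X f V) (smap f V t)"
      unfolding smap_res[OF V(1) W(1,3) V(3)]
      by (rule X.germ_res[OF O preim_open[OF W(1)] _ preim_mono[OF W(3)] c]) (use x W in \<open>simp add: preim_def\<close>)
    ultimately show "germ X x (preim X f V) (smap f V t) \<in> Units (stalk X x)" by simp
  qed
  thus ?thesis using X.value_zero_iff[OF x O xV c] Y.value_zero_iff[OF y V] by simp
qed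

end

section \<open>Coefficients of a Drinfeld module with respect to a generator\<close>

lemma (in module) finsum_smult_rdistr:
  "finite A \<Longrightarrow> x \<in> carrier M \<Longrightarrow> f \<in> A \<rightarrow> carrier R \<Longrightarrow>
    (\<Oplus>i\<in>A. f i) \<odot>\<^bsub>M\<^esub> x = (\<Oplus>\<^bsub>M\<^esub>i\<in>A. f i \<odot>\<^bsub>M\<^esub> x)"
proof (induction A rule: finite_induct)
  case (insert a A)
  hence f: "f a \<in> carrier R" "f \<in> A \<rightarrow> carrier R" by auto
  hence "(\<lambda>i. f i \<odot>\<^bsub>M\<^esub> x) \<in> A \<rightarrow> carrier M" using insert by auto
  thus ?case using insert f by (simp add: R.finsum_insert M.finsum_insert smult_l_distr R.finsum_closed)
qed simp

locale line_bundle_on = ringed X for X :: "('p, 'a) rspace" +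
  fixes E :: "('p, 'a, 'm) lbundle"
  assumes line: "line_bundle X E"
begin

lemma line_conj:
  "is_sheaf (spc X) (\<lambda>U. carrier (sec E U)) (mres E) \<and>
   (\<forall>U. openin (spc X) U \<longrightarrow> module (shf X U) (sec E U)) \<and>
   (\<forall>U V. openin (spc X) U \<and> openin (spc X) V \<and> V \<subseteq> U \<longrightarrow>
      (\<forall>x\<in>carrier (sec E U). \<forall>y\<in>carrier (sec E U).
         mres E U V (x \<oplus>\<^bsub>sec E U\<^esub> y) = mres E U V x \<oplus>\<^bsub>sec E V\<^esub> mres E U V y) \<and>
      (\<forall>c\<in>carrier (shf X U). \<forall>x\<in>carrier (sec E U).
         mres E U V (c \<odot>\<^bsub>sec E U\<^esub> x) = res X U V c \<odot>\<^bsub>sec E V\<^esub> mres E U V x))"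
  using line unfolding line_bundle_def by (elim conjE, intro conjI)

lemma sheaf_conj:
  "(\<forall>U V. openin (spc X) U \<and> openin (spc X) V \<and> V \<subseteq> U \<longrightarrow> mres E U V \<in> carrier (sec E U) \<rightarrow> carrier (sec E V)) \<and>
   (\<forall>U. openin (spc X) U \<longrightarrow> (\<forall>s\<in>carrier (sec E U). mres E U U s = s))"
  using line_conj[THEN conjunct1] unfolding is_sheaf_def by (elim conjE, intro conjI)

lemma sec_module: "openin (spc X) U \<Longrightarrow> module (shf X U) (sec E U)"
  using line_conj[THEN conjunct2, THEN conjunct1] by simp

lemma mres_closed: "openin (spc X) U \<Longrightarrow> openin (spc X) V \<Longrightarrow> V \<subseteq> U \<Longrightarrow> s \<in> carrier (sec E U) \<Longrightarrow>
  mres E U V s \<in> carrier (sec E V)"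
  using sheaf_conj[THEN conjunct1] by (simp add: Pi_def)

lemma mres_self: "openin (spc X) U \<Longrightarrow> s \<in> carrier (sec E U) \<Longrightarrow> mres E U U s = s"
  using sheaf_conj[THEN conjunct2] by simp

lemma mres_smult: "openin (spc X) U \<Longrightarrow> openin (spc X) V \<Longrightarrow> V \<subseteq> U \<Longrightarrow> c \<in> carrier (shf X U) \<Longrightarrow>
  s \<in> carrier (sec E U) \<Longrightarrow> mres E U V (c \<odot>\<^bsub>sec E U\<^esub> s) = res X U V c \<odot>\<^bsub>sec E V\<^esub> mres E U V s"
  using line_conj[THEN conjunct2, THEN conjunct2] by simp

lemma gensD:
  assumes "(U, m) \<in> gens X E"
  shows "openin (spc X) U" "m \<in> carrier (sec E U)"
    "\<And>V. openin (spc X) V \<Longrightarrow> V \<subseteq> U \<Longrightarrow>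
      bij_betw (\<lambda>c. c \<odot>\<^bsub>sec E V\<^esub> mres E U V m) (carrier (shf X V)) (carrier (sec E V))"
  using assms by (simp_all add: gens_def)

text \<open>The case \<open>V = U\<close> of the defining property of a generator.\<close>

lemma coef_ex1:
  assumes g: "(U, m) \<in> gens X E" and y: "y \<in> carrier (sec E U)"
  shows "\<exists>!c. c \<in> carrier (shf X U) \<and> y = c \<odot>\<^bsub>sec E U\<^esub> m"
proof -
  have b: "bij_betw (\<lambda>c. c \<odot>\<^bsub>sec E U\<^esub> m) (carrier (shf X U)) (carrier (sec E U))"
    using gensD(3)[OF g gensD(1)[OF g] order.refl] mres_self[OF gensD(1,2)[OF g]] by simp
  then obtain c where "c \<in> carrier (shf X U)" "y = c \<odot>\<^bsub>sec E U\<^esub> m" using y unfolding bij_betw_def by auto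
  moreover have "c = d" if "c \<in> carrier (shf X U)" "d \<in> carrier (shf X U)" "c \<odot>\<^bsub>sec E U\<^esub> m = d \<odot>\<^bsub>sec E U\<^esub> m" for c d
    using b that unfolding bij_betw_def inj_on_def by simp
  ultimately show ?thesis by (metis (no_types, lifting))
qed

lemma coef_closed: "(U, m) \<in> gens X E \<Longrightarrow> y \<in> carrier (sec E U) \<Longrightarrow> coef X E U m y \<in> carrier (shf X U)"
  and coef_smult: "(U, m) \<in> gens X E \<Longrightarrow> y \<in> carrier (sec E U) \<Longrightarrow> coef X E U m y \<odot>\<^bsub>sec E U\<^esub> m = y"
  using theI'[OF coef_ex1, of U m y] unfolding coef_def by auto

lemma coef_eqI: "(U, m) \<in> gens X E \<Longrightarrow> c \<in> carrier (shf X U) \<Longrightarrow> y = c \<odot>\<^bsub>sec E U\<^esub> m \<Longrightarrow> coef X E U m y = c"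
proof -
  assume g: "(U, m) \<in> gens X E" and c: "c \<in> carrier (shf X U)" and y: "y = c \<odot>\<^bsub>sec E U\<^esub> m"
  interpret module "shf X U" "sec E U" by (rule sec_module[OF gensD(1)[OF g]])
  have yc: "y \<in> carrier (sec E U)" using c y gensD(2)[OF g] by simp
  show "coef X E U m y = c"
    using coef_ex1[OF g yc] coef_closed[OF g yc] coef_smult[OF g yc] c y by metis
qed

end

context function_base
begin

lemma one_not_vprime: "\<one>\<^bsub>ffield B\<^esub> \<notin> vprime B"
  using V.p_props(7) by (simp add: vprime_eq)

lemma one_AA: "\<one>\<^bsub>ffield B\<^esub> \<in> AA B"
  using subringE(3)[OF AA_subring] .

lemma AA_Aloc: "c \<in> AA B \<Longrightarrow> c \<in> carrier (Aloc B)"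
proof -
  assume c: "c \<in> AA B"
  have "c = c \<otimes>\<^bsub>ffield B\<^esub> inv\<^bsub>ffield B\<^esub> \<one>\<^bsub>ffield B\<^esub> \<and> c \<in> AA B \<and> \<one>\<^bsub>ffield B\<^esub> \<in> AA B - vprime B"
    using c V.A_carr[OF c] one_AA one_not_vprime by simp
  hence "\<exists>b d. c = b \<otimes>\<^bsub>ffield B\<^esub> inv\<^bsub>ffield B\<^esub> d \<and> b \<in> AA B \<and> d \<in> AA B - vprime B" by (intro exI)
  thus ?thesis by (simp add: Aloc_def)
qed

lemma Aloc_simps: "monoid.mult (Aloc B) = monoid.mult (ffield B)" "ring.add (Aloc B) = ring.add (ffield B)"
  "\<one>\<^bsub>Aloc B\<^esub> = \<one>\<^bsub>ffield B\<^esub>"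
  by (simp_all add: Aloc_def)

lemma coset_hom: "(\<lambda>c. vprime B +>\<^bsub>Aring B\<^esub> c) \<in> ring_hom (Aring B) (Fv B)"
  unfolding Fv_def by (rule ideal.rcos_ring_hom[OF vprime_ideal])

text \<open>Any other fraction representing \<open>c\<close> gives the same class, because denominators are nonzero in the
integral domain \<open>A/\<pp>\<close>.\<close>

lemma Aloc_residue_AA:
  assumes c: "c \<in> AA B"
  shows "Aloc_residue B c = vprime B +>\<^bsub>Aring B\<^esub> c"
  unfolding Aloc_residue_def
proof (rule the_equality)
  interpret D: domain "Fv B" unfolding Fv_def by (rule primeideal.quotient_is_domain[OF vprime_primeideal])
  have h: "(vprime B +>\<^bsub>Aring B\<^esub> x) \<in> carrier (Fv B)" if "x \<in> AA B" for x
    using ring_hom_closed[OF coset_hom, of x] that by simp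
  have one: "vprime B +>\<^bsub>Aring B\<^esub> \<one>\<^bsub>ffield B\<^esub> = \<one>\<^bsub>Fv B\<^esub>" using ring_hom_one[OF coset_hom] by simp
  have c': "c = c \<otimes>\<^bsub>ffield B\<^esub> inv\<^bsub>ffield B\<^esub> \<one>\<^bsub>ffield B\<^esub>" using V.A_carr[OF c] by simp
  show "vprime B +>\<^bsub>Aring B\<^esub> c \<in> carrier (Fv B) \<and>
    (\<exists>b\<in>AA B. \<exists>d\<in>AA B - vprime B. c = b \<otimes>\<^bsub>ffield B\<^esub> inv\<^bsub>ffield B\<^esub> d \<and>
      (vprime B +>\<^bsub>Aring B\<^esub> c) \<otimes>\<^bsub>Fv B\<^esub> (vprime B +>\<^bsub>Aring B\<^esub> d) = vprime B +>\<^bsub>Aring B\<^esub> b)"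
    using h[OF c] one one_AA one_not_vprime c c' by (intro conjI bexI[of _ c] bexI[of _ "\<one>\<^bsub>ffield B\<^esub>"]) auto
  fix y assume y: "y \<in> carrier (Fv B) \<and>
    (\<exists>b\<in>AA B. \<exists>d\<in>AA B - vprime B. c = b \<otimes>\<^bsub>ffield B\<^esub> inv\<^bsub>ffield B\<^esub> d \<and>
      y \<otimes>\<^bsub>Fv B\<^esub> (vprime B +>\<^bsub>Aring B\<^esub> d) = vprime B +>\<^bsub>Aring B\<^esub> b)"
  then obtain b d where b: "b \<in> AA B" and d: "d \<in> AA B" "d \<notin> vprime B"
    and e: "c = b \<otimes>\<^bsub>ffield B\<^esub> inv\<^bsub>ffield B\<^esub> d"
    and yd: "y \<otimes>\<^bsub>Fv B\<^esub> (vprime B +>\<^bsub>Aring B\<^esub> d) = vprime B +>\<^bsub>Aring B\<^esub> b" by auto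
  have z: "\<zero>\<^bsub>ffield B\<^esub> \<in> vprime B" using additive_subgroup.zero_closed[OF ideal.axioms(1)[OF vprime_ideal]] by simp
  have d0: "d \<noteq> \<zero>\<^bsub>ffield B\<^esub>" using d z by auto
  note F = V.A_carr[OF b] V.A_carr[OF d(1)]
  have i: "inv\<^bsub>ffield B\<^esub> d \<in> carrier (ffield B)" "inv\<^bsub>ffield B\<^esub> d \<otimes>\<^bsub>ffield B\<^esub> d = \<one>\<^bsub>ffield B\<^esub>"
    using V.inv_field[of d] F d0 by auto
  have "c \<otimes>\<^bsub>ffield B\<^esub> d = b" unfolding e using F i by (simp add: V.m_assoc)
  hence "(vprime B +>\<^bsub>Aring B\<^esub> c) \<otimes>\<^bsub>Fv B\<^esub> (vprime B +>\<^bsub>Aring B\<^esub> d) = vprime B +>\<^bsub>Aring B\<^esub> b"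
    using ring_hom_mult[OF coset_hom, of c d] c d by simp
  hence eq: "y \<otimes>\<^bsub>Fv B\<^esub> (vprime B +>\<^bsub>Aring B\<^esub> d) = (vprime B +>\<^bsub>Aring B\<^esub> c) \<otimes>\<^bsub>Fv B\<^esub> (vprime B +>\<^bsub>Aring B\<^esub> d)"
    using yd by simp
  interpret P: ideal "vprime B" "Aring B" by (rule vprime_ideal)
  have "vprime B +>\<^bsub>Aring B\<^esub> d \<noteq> \<zero>\<^bsub>Fv B\<^esub>"
  proof
    assume "vprime B +>\<^bsub>Aring B\<^esub> d = \<zero>\<^bsub>Fv B\<^esub>"
    hence "vprime B +>\<^bsub>Aring B\<^esub> d = vprime B" by (simp add: Fv_def FactRing_def)
    thus False using P.a_rcos_self[of d] d by simp
  qed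
  thus "y = vprime B +>\<^bsub>Aring B\<^esub> c" using D.m_rcancel[OF _ h[OF d(1)] _ h[OF c], of y] eq y by simp
qed

end

locale drinfeld_family = function_base B + X: locally_ringed X + L: line_bundle_on X E
  for B :: "'f base" and X :: "('p, 'a) rspace" and E :: "('p, 'a, 'm) lbundle" +
  fixes \<gamma> :: "'f \<Rightarrow> 'a" and \<phi> :: "'f \<Rightarrow> nat \<Rightarrow> 'p set \<Rightarrow> 'm \<Rightarrow> 'm"
  assumes \<gamma>: "\<gamma> \<in> ring_hom (Aloc B) (glob X)" and gen: "gen_drinfeld B X \<gamma> E \<phi>"
begin

lemma gen_conj:
  "(\<forall>a\<in>AA B. (\<forall>i. \<phi> a i \<in> twisted_maps X (qB B ^ i) E E) \<and> locally_finite X E E (\<phi> a)) \<and>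
   (\<forall>U. openin (spc X) U \<longrightarrow> (\<forall>e\<in>carrier (sec E U).
      (\<forall>a\<in>AA B. \<phi> a 0 U e = res X (pts X) U (\<gamma> a) \<odot>\<^bsub>sec E U\<^esub> e) \<and>
      (\<forall>i>0. \<phi> \<one>\<^bsub>Aring B\<^esub> i U e = \<zero>\<^bsub>sec E U\<^esub>) \<and>
      (\<forall>a\<in>AA B. \<forall>b\<in>AA B. \<forall>i.
         \<phi> (a \<oplus>\<^bsub>Aring B\<^esub> b) i U e = \<phi> a i U e \<oplus>\<^bsub>sec E U\<^esub> \<phi> b i U e) \<and>
      (\<forall>a\<in>AA B. \<forall>b\<in>AA B. \<forall>k.
         \<phi> (a \<otimes>\<^bsub>Aring B\<^esub> b) k U e = finsum (sec E U) (\<lambda>i. \<phi> a i U (\<phi> b (k - i) U e)) {..k}))) \<and>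
   (\<forall>x\<in>pts X. \<exists>\<rho>. \<forall>\<psi>\<in>fibres X E \<phi> (residue_point X x).
      drinfeld_module B (residue_field X x) (smap (residue_point X x) (pts X) \<circ> \<gamma>) \<psi> \<and>
      has_rank B (residue_field X x) \<psi> \<rho>)"
  using gen unfolding gen_drinfeld_def by (elim conjE, intro conjI)

lemma
  assumes "a \<in> AA B" "openin (spc X) U"
  shows \<phi>_closed: "s \<in> carrier (sec E U) \<Longrightarrow> \<phi> a i U s \<in> carrier (sec E U)"
    and \<phi>_smult: "c \<in> carrier (shf X U) \<Longrightarrow> s \<in> carrier (sec E U) \<Longrightarrow>
      \<phi> a i U (c \<odot>\<^bsub>sec E U\<^esub> s) = (c [^]\<^bsub>shf X U\<^esub> (qB B ^ i)) \<odot>\<^bsub>sec E U\<^esub> \<phi> a i U s"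
    and \<phi>_mres: "openin (spc X) V \<Longrightarrow> V \<subseteq> U \<Longrightarrow> s \<in> carrier (sec E U) \<Longrightarrow>
      \<phi> a i V (mres E U V s) = mres E U V (\<phi> a i U s)"
proof -
  have t: "\<phi> a i \<in> twisted_maps X (qB B ^ i) E E" using gen_conj[THEN conjunct1] assms by simp
  have "(\<forall>U. openin (spc X) U \<longrightarrow> \<phi> a i U \<in> carrier (sec E U) \<rightarrow> carrier (sec E U) \<and>
        (\<forall>x\<in>carrier (sec E U). \<forall>y\<in>carrier (sec E U).
           \<phi> a i U (x \<oplus>\<^bsub>sec E U\<^esub> y) = \<phi> a i U x \<oplus>\<^bsub>sec E U\<^esub> \<phi> a i U y) \<and>
        (\<forall>c\<in>carrier (shf X U). \<forall>x\<in>carrier (sec E U).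
           \<phi> a i U (c \<odot>\<^bsub>sec E U\<^esub> x) = (c [^]\<^bsub>shf X U\<^esub> (qB B ^ i)) \<odot>\<^bsub>sec E U\<^esub> \<phi> a i U x)) \<and>
     (\<forall>U V. openin (spc X) U \<and> openin (spc X) V \<and> V \<subseteq> U \<longrightarrow>
        (\<forall>x\<in>carrier (sec E U). \<phi> a i V (mres E U V x) = mres E U V (\<phi> a i U x)))"
    using t unfolding twisted_maps_def mem_Collect_eq by (elim conjE, intro conjI)
  note c = this[THEN conjunct1] this[THEN conjunct2]
  show "s \<in> carrier (sec E U) \<Longrightarrow> \<phi> a i U s \<in> carrier (sec E U)" using c(1) assms by (simp add: Pi_def)
  show "c \<in> carrier (shf X U) \<Longrightarrow> s \<in> carrier (sec E U) \<Longrightarrow>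
      \<phi> a i U (c \<odot>\<^bsub>sec E U\<^esub> s) = (c [^]\<^bsub>shf X U\<^esub> (qB B ^ i)) \<odot>\<^bsub>sec E U\<^esub> \<phi> a i U s" using c(1) assms by simp
  show "openin (spc X) V \<Longrightarrow> V \<subseteq> U \<Longrightarrow> s \<in> carrier (sec E U) \<Longrightarrow>
      \<phi> a i V (mres E U V s) = mres E U V (\<phi> a i U s)" using c(2) assms by simp
qed

lemma fibre_rank:
  assumes "x \<in> pts X"
  obtains \<rho> where "\<And>\<psi>. \<psi> \<in> fibres X E \<phi> (residue_point X x) \<Longrightarrow> has_rank B (residue_field X x) \<psi> \<rho>"
  using gen_conj[THEN conjunct2, THEN conjunct2] assms by blast

text \<open>The coefficients of \<open>\<phi>\<^sub>a\<close> in the coordinate given by the generator \<open>m\<close>.\<close>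

definition cf where "cf U m a i = coef X E U m (\<phi> a i U m)"

context
  fixes U m assumes g: "(U, m) \<in> gens X E"
begin

lemmas U = L.gensD(1)[OF g] and m = L.gensD(2)[OF g]

lemma action:
  "a \<in> AA B \<Longrightarrow> \<phi> a 0 U m = res X (pts X) U (\<gamma> a) \<odot>\<^bsub>sec E U\<^esub> m"
  "i > 0 \<Longrightarrow> \<phi> \<one>\<^bsub>ffield B\<^esub> i U m = \<zero>\<^bsub>sec E U\<^esub>"
  "a \<in> AA B \<Longrightarrow> b \<in> AA B \<Longrightarrow> \<phi> (a \<oplus>\<^bsub>ffield B\<^esub> b) i U m = \<phi> a i U m \<oplus>\<^bsub>sec E U\<^esub> \<phi> b i U m"
  "a \<in> AA B \<Longrightarrow> b \<in> AA B \<Longrightarrow>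
     \<phi> (a \<otimes>\<^bsub>ffield B\<^esub> b) k U m = finsum (sec E U) (\<lambda>i. \<phi> a i U (\<phi> b (k - i) U m)) {..k}"
  using gen_conj[THEN conjunct2, THEN conjunct1] U m by simp_all

lemma cf_closed: "a \<in> AA B \<Longrightarrow> cf U m a i \<in> carrier (shf X U)"
  and cf_smult: "a \<in> AA B \<Longrightarrow> cf U m a i \<odot>\<^bsub>sec E U\<^esub> m = \<phi> a i U m"
  unfolding cf_def using L.coef_closed[OF g] L.coef_smult[OF g] \<phi>_closed[OF _ U m] by auto

lemma cf_eqI: "c \<in> carrier (shf X U) \<Longrightarrow> \<phi> a i U m = c \<odot>\<^bsub>sec E U\<^esub> m \<Longrightarrow> cf U m a i = c"
  unfolding cf_def by (rule L.coef_eqI[OF g])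

lemma cf_zero: "a \<in> AA B \<Longrightarrow> cf U m a 0 = res X (pts X) U (\<gamma> a)"
proof (rule cf_eqI)
  assume a: "a \<in> AA B"
  show "res X (pts X) U (\<gamma> a) \<in> carrier (shf X U)"
    using X.res_closed[OF openin_topspace U openin_subset[OF U]] ring_hom_closed[OF \<gamma> AA_Aloc[OF a]] by simp
qed (rule action(1))

lemma cf_one: "cf U m \<one>\<^bsub>ffield B\<^esub> i = (if i = 0 then \<one>\<^bsub>shf X U\<^esub> else \<zero>\<^bsub>shf X U\<^esub>)"
proof -
  interpret M: module "shf X U" "sec E U" by (rule L.sec_module[OF U])
  show ?thesis
  proof (cases "i = 0")
    case True
    thus ?thesis using cf_zero[OF one_AA] ring_hom_one[OF \<gamma>] ring_hom_one[OF X.res_hom[OF openin_topspace U openin_subset[OF U]]]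
      by (simp add: Aloc_simps)
  next
    case False
    thus ?thesis using action(2)[of i] m by (simp add: cf_eqI M.smult_l_null)
  qed
qed

lemma cf_add: "a \<in> AA B \<Longrightarrow> b \<in> AA B \<Longrightarrow> cf U m (a \<oplus>\<^bsub>ffield B\<^esub> b) i = cf U m a i \<oplus>\<^bsub>shf X U\<^esub> cf U m b i"
proof -
  interpret M: module "shf X U" "sec E U" by (rule L.sec_module[OF U])
  assume ab: "a \<in> AA B" "b \<in> AA B"
  show ?thesis
    by (rule cf_eqI) (use action(3)[OF ab] cf_closed cf_smult ab m in \<open>simp_all add: M.smult_l_distr\<close>)
qed

text \<open>Semilinearity moves the coefficient of \<open>b\<close> past \<open>\<tau>\<^sup>i\<close> at the price of a \<open>q\<^sup>i\<close>-th power.\<close>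

lemma cf_mult:
  assumes ab: "a \<in> AA B" "b \<in> AA B"
  shows "cf U m (a \<otimes>\<^bsub>ffield B\<^esub> b) k =
    finsum (shf X U) (\<lambda>i. cf U m a i \<otimes>\<^bsub>shf X U\<^esub> (cf U m b (k - i) [^]\<^bsub>shf X U\<^esub> (qB B ^ i))) {..k}"
proof (rule cf_eqI)
  interpret M: module "shf X U" "sec E U" by (rule L.sec_module[OF U])
  let ?c = "\<lambda>i. cf U m a i \<otimes>\<^bsub>shf X U\<^esub> (cf U m b (k - i) [^]\<^bsub>shf X U\<^esub> (qB B ^ i))"
  have c: "?c \<in> {..k} \<rightarrow> carrier (shf X U)" using cf_closed ab by auto
  show "finsum (shf X U) ?c {..k} \<in> carrier (shf X U)" using c by (rule M.R.finsum_closed)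
  have "\<phi> a i U (\<phi> b (k - i) U m) = ?c i \<odot>\<^bsub>sec E U\<^esub> m" for i
  proof -
    have "\<phi> a i U (\<phi> b (k - i) U m) = \<phi> a i U (cf U m b (k - i) \<odot>\<^bsub>sec E U\<^esub> m)" using cf_smult ab by simp
    also have "\<dots> = (cf U m b (k - i) [^]\<^bsub>shf X U\<^esub> (qB B ^ i)) \<odot>\<^bsub>sec E U\<^esub> (cf U m a i \<odot>\<^bsub>sec E U\<^esub> m)"
      using \<phi>_smult[OF ab(1) U cf_closed[OF ab(2)] m] cf_smult[OF ab(1)] by simp
    also have "\<dots> = ?c i \<odot>\<^bsub>sec E U\<^esub> m" using cf_closed ab m by (simp add: M.smult_assoc1[symmetric] M.R.m_comm)
    finally show ?thesis .
  qed
  hence "\<phi> (a \<otimes>\<^bsub>ffield B\<^esub> b) k U m = finsum (sec E U) (\<lambda>i. ?c i \<odot>\<^bsub>sec E U\<^esub> m) {..k}"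
    using action(4)[OF ab] by simp
  thus "\<phi> (a \<otimes>\<^bsub>ffield B\<^esub> b) k U m = finsum (shf X U) ?c {..k} \<odot>\<^bsub>sec E U\<^esub> m"
    using M.finsum_smult_rdistr[OF _ m c] by simp
qed

context
  fixes R :: "'b ring" and \<chi> :: "'a \<Rightarrow> 'b" and \<delta> :: "'f set \<Rightarrow> 'b"
  assumes R: "cring R" and \<chi>: "\<chi> \<in> ring_hom (shf X U) R" and \<delta>: "\<delta> \<in> ring_hom (Fv B) R"
    and \<chi>\<delta>: "\<And>c. c \<in> AA B \<Longrightarrow> \<chi> (res X (pts X) U (\<gamma> c)) = \<delta> (vprime B +>\<^bsub>Aring B\<^esub> c)"
begin

lemma image_mult:
  assumes ab: "a \<in> AA B" "b \<in> AA B"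
  shows "\<chi> (cf U m (a \<otimes>\<^bsub>ffield B\<^esub> b) k) =
    finsum R (\<lambda>i. \<chi> (cf U m a i) \<otimes>\<^bsub>R\<^esub> (\<chi> (cf U m b (k - i)) [^]\<^bsub>R\<^esub> (qB B ^ i))) {..k}"
proof -
  interpret S: cring "shf X U" by (rule X.shf_cring[OF U])
  interpret R: cring R by (rule R)
  interpret h: ring_hom_cring "shf X U" R \<chi> using \<chi> by unfold_locales
  have pw: "\<chi> (x [^]\<^bsub>shf X U\<^esub> n) = \<chi> x [^]\<^bsub>R\<^esub> n" if "x \<in> carrier (shf X U)" for x and n :: nat
    using that by (induction n) auto
  show ?thesis unfolding cf_mult[OF ab] using cf_closed ab
    by (subst h.hom_finsum) (auto simp: o_def pw intro!: R.finsum_cong')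
qed

text \<open>Every ring homomorphism that kills \<open>\<pp>\<close> carries the coefficients to a family of the kind studied
above. It is applied to restriction to open subsets of the special fibre and to evaluation at its points.\<close>

lemma special_coefficientsI:
  assumes "finite (carrier (Fv B))" "card (carrier (Fv B)) = qB B ^ deg_v B" "deg_v B > 0"
  shows "special_coefficients B R (\<lambda>a i. \<chi> (cf U m a i)) \<delta>"
proof (intro special_coefficients.intro special_coefficients_axioms.intro)
  show "function_base B" by unfold_locales
  show "\<chi> (cf U m c 0) = \<delta> (vprime B +>\<^bsub>Aring B\<^esub> c)" if "c \<in> AA B" for c using cf_zero[OF that] \<chi>\<delta>[OF that] by simp
  show "\<chi> (cf U m c i) \<in> carrier R" if "c \<in> AA B" for c i using ring_hom_closed[OF \<chi> cf_closed[OF that]] .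
qed (fact R \<delta> assms image_mult)+

lemma special_fibreI:
  assumes "field R" "has_rank B R (\<lambda>a i. \<chi> (cf U m a i)) \<rho>"
  shows "special_fibre B R (\<lambda>a i. \<chi> (cf U m a i)) \<rho>"
proof (intro special_fibre.intro special_fibre_axioms.intro)
  interpret S: cring "shf X U" by (rule X.shf_cring[OF U])
  interpret R: cring R by (rule R)
  interpret h: ring_hom_cring "shf X U" R \<chi> using \<chi> by unfold_locales
  show "function_base B" by unfold_locales
  show "\<chi> (cf U m c i) \<in> carrier R" if "c \<in> AA B" for c i using ring_hom_closed[OF \<chi> cf_closed[OF that]] .
  show "\<chi> (cf U m (c \<oplus>\<^bsub>ffield B\<^esub> d) i) = \<chi> (cf U m c i) \<oplus>\<^bsub>R\<^esub> \<chi> (cf U m d i)" if "c \<in> AA B" "d \<in> AA B" for c d i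
    using cf_add[OF that] cf_closed that by simp
  show "\<chi> (cf U m \<one>\<^bsub>ffield B\<^esub> i) = (if i = 0 then \<one>\<^bsub>R\<^esub> else \<zero>\<^bsub>R\<^esub>)" for i unfolding cf_one by simp
  show "\<chi> (cf U m c 0) = \<zero>\<^bsub>R\<^esub>" if c: "c \<in> vprime B" for c
  proof -
    interpret P: ideal "vprime B" "Aring B" by (rule vprime_ideal)
    interpret D: domain "Fv B" unfolding Fv_def by (rule primeideal.quotient_is_domain[OF vprime_primeideal])
    interpret d: ring_hom_cring "Fv B" R \<delta> using \<delta> by unfold_locales
    have "vprime B +>\<^bsub>Aring B\<^esub> c = \<zero>\<^bsub>Fv B\<^esub>" using P.a_rcos_const[OF c] by (simp add: Fv_def FactRing_def)
    thus ?thesis using cf_zero[OF vprime_AA[OF c]] \<chi>\<delta>[OF vprime_AA[OF c]] by simp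
  qed
qed (fact assms image_mult)+

end

end

text \<open>With another generator \<open>m' = u m\<close> the coefficients change by the unit \<open>u\<^sup>Q\<^sup>-\<^sup>1\<close>.\<close>

lemma change_of_generator:
  assumes g: "(U, m) \<in> gens X E" "(U', m') \<in> gens X E" and a: "a \<in> AA B"
  obtains u u' where "u \<in> carrier (shf X (U \<inter> U'))" "u' \<in> carrier (shf X (U \<inter> U'))"
    "u \<otimes>\<^bsub>shf X (U \<inter> U')\<^esub> u' = \<one>\<^bsub>shf X (U \<inter> U')\<^esub>"
    "res X U' (U \<inter> U') (cf U' m' a i) \<otimes>\<^bsub>shf X (U \<inter> U')\<^esub> u =
     u [^]\<^bsub>shf X (U \<inter> U')\<^esub> (qB B ^ i) \<otimes>\<^bsub>shf X (U \<inter> U')\<^esub> res X U (U \<inter> U') (cf U m a i)"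
proof -
  note U = U[OF g(1)] U[OF g(2)] and m = m[OF g(1)] m[OF g(2)]
  define W where "W = U \<inter> U'"
  have W: "openin (spc X) W" "W \<subseteq> U" "W \<subseteq> U'" unfolding W_def using openin_Int[OF U] by auto
  interpret M: module "shf X W" "sec E W" by (rule L.sec_module[OF W(1)])
  define n where "n = mres E U W m"
  define n' where "n' = mres E U' W m'"
  have n: "n \<in> carrier (sec E W)" "n' \<in> carrier (sec E W)"
    unfolding n_def n'_def using L.mres_closed U W m by auto
  have b: "bij_betw (\<lambda>c. c \<odot>\<^bsub>sec E W\<^esub> n) (carrier (shf X W)) (carrier (sec E W))"
    "bij_betw (\<lambda>c. c \<odot>\<^bsub>sec E W\<^esub> n') (carrier (shf X W)) (carrier (sec E W))"
    unfolding n_def n'_def using L.gensD(3)[OF g(1) W(1,2)] L.gensD(3)[OF g(2) W(1,3)] by auto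
  have inj: "c = d" if "c \<in> carrier (shf X W)" "d \<in> carrier (shf X W)" "c \<odot>\<^bsub>sec E W\<^esub> n = d \<odot>\<^bsub>sec E W\<^esub> n" for c d
    using b(1) that unfolding bij_betw_def inj_on_def by simp
  obtain u where u: "u \<in> carrier (shf X W)" "n' = u \<odot>\<^bsub>sec E W\<^esub> n" using b(1) n(2) unfolding bij_betw_def by auto
  obtain u' where u': "u' \<in> carrier (shf X W)" "n = u' \<odot>\<^bsub>sec E W\<^esub> n'" using b(2) n(1) unfolding bij_betw_def by auto
  have "(u' \<otimes>\<^bsub>shf X W\<^esub> u) \<odot>\<^bsub>sec E W\<^esub> n = \<one>\<^bsub>shf X W\<^esub> \<odot>\<^bsub>sec E W\<^esub> n"
    using M.smult_assoc1[OF u'(1) u(1) n(1)] u(2)[symmetric] u'(2)[symmetric] n by simp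
  hence uu: "u \<otimes>\<^bsub>shf X W\<^esub> u' = \<one>\<^bsub>shf X W\<^esub>"
    using inj[OF M.R.m_closed[OF u'(1) u(1)] M.R.one_closed] M.R.m_comm[OF u(1) u'(1)] by simp
  define c where "c = res X U W (cf U m a i)"
  define c' where "c' = res X U' W (cf U' m' a i)"
  have c: "c \<in> carrier (shf X W)" "c' \<in> carrier (shf X W)" unfolding c_def c'_def
    using X.res_closed U W cf_closed[OF g(1) a] cf_closed[OF g(2) a] by auto
  have cn: "c \<odot>\<^bsub>sec E W\<^esub> n = \<phi> a i W n"
    unfolding c_def n_def using L.mres_smult[OF U(1) W(1,2) cf_closed[OF g(1) a] m(1), symmetric]
      cf_smult[OF g(1) a] \<phi>_mres[OF a U(1) W(1,2) m(1)] by simp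
  have cn': "c' \<odot>\<^bsub>sec E W\<^esub> n' = \<phi> a i W n'"
    unfolding c'_def n'_def using L.mres_smult[OF U(2) W(1,3) cf_closed[OF g(2) a] m(2), symmetric]
      cf_smult[OF g(2) a] \<phi>_mres[OF a U(2) W(1,3) m(2)] by simp
  have "(c' \<otimes>\<^bsub>shf X W\<^esub> u) \<odot>\<^bsub>sec E W\<^esub> n = \<phi> a i W (u \<odot>\<^bsub>sec E W\<^esub> n)"
    using M.smult_assoc1[OF c(2) u(1) n(1)] cn' unfolding u(2) by simp
  also have "\<dots> = (u [^]\<^bsub>shf X W\<^esub> (qB B ^ i)) \<odot>\<^bsub>sec E W\<^esub> (c \<odot>\<^bsub>sec E W\<^esub> n)"
    using \<phi>_smult[OF a W(1) u(1) n(1)] cn by simp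
  also have "\<dots> = (u [^]\<^bsub>shf X W\<^esub> (qB B ^ i) \<otimes>\<^bsub>shf X W\<^esub> c) \<odot>\<^bsub>sec E W\<^esub> n"
    using u c n by (simp add: M.smult_assoc1)
  finally have eq: "c' \<otimes>\<^bsub>shf X W\<^esub> u = u [^]\<^bsub>shf X W\<^esub> (qB B ^ i) \<otimes>\<^bsub>shf X W\<^esub> c"
    by (rule inj[rotated 2]) (simp_all add: u(1) c M.R.m_closed)
  show ?thesis
    by (rule that[folded W_def, of u u', folded c_def c'_def]) (fact u(1) u'(1) uu eq)+
qed

end

section \<open>The special fibre of the family\<close>

text \<open>Morphisms are undefined outside the rings of functions, so outside \<open>A\<close> the coordinate form of a fibre
need not agree with the images of the coefficients. This lemma bridges the difference.\<close>

lemma special_fibre_cong: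
  assumes "special_fibre B L \<psi> \<rho>" and eq: "\<And>a i. a \<in> AA B \<Longrightarrow> \<psi>' a i = \<psi> a i"
  shows "special_fibre B L \<psi>' \<rho>"
proof -
  interpret S: special_fibre B L \<psi> \<rho> by fact
  note AA_ring = S.one_AA subringE(6,7)[OF S.AA_subring]
  show ?thesis
  proof (intro special_fibre.intro special_fibre_axioms.intro)
    show "has_rank B L \<psi>' \<rho>" using S.rank eq by (simp add: has_rank_def)
    show "\<psi>' (c \<otimes>\<^bsub>ffield B\<^esub> d) k = finsum L (\<lambda>i. \<psi>' c i \<otimes>\<^bsub>L\<^esub> (\<psi>' d (k - i) [^]\<^bsub>L\<^esub> (qB B ^ i))) {..k}"
      if "c \<in> AA B" "d \<in> AA B" for c d k
      using S.psi_mult[OF that] eq AA_ring that by simp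
    show "\<psi>' (c \<oplus>\<^bsub>ffield B\<^esub> d) i = \<psi>' c i \<oplus>\<^bsub>L\<^esub> \<psi>' d i" if "c \<in> AA B" "d \<in> AA B" for c d i
      using S.psi_add[OF that] eq AA_ring that by simp
    show "\<psi>' c i \<in> carrier L" if "c \<in> AA B" for c i using S.psi_closed[OF that] eq that by simp
    show "\<psi>' \<one>\<^bsub>ffield B\<^esub> i = (if i = 0 then \<one>\<^bsub>L\<^esub> else \<zero>\<^bsub>L\<^esub>)" for i using S.psi_one eq AA_ring by simp
    show "\<psi>' c 0 = \<zero>\<^bsub>L\<^esub>" if "c \<in> vprime B" for c using S.psi_p[OF that] eq S.vprime_AA[OF that] by simp
  qed (unfold_locales)
qed

text \<open>A generalized Drinfeld module over \<open>X\<close>, restricted along a morphism \<open>j : Y \<rightarrow> X\<close> over \<open>A\<close> from a scheme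
over the residue field at \<open>v\<close>.\<close>

locale special_fibre_family = function_base B + D: drinfeld_family B X E \<gamma> \<phi> + f: scheme_mor Y X j
  for B :: "'f base" and X :: "('p, 'a) rspace" and E :: "('p, 'a, 'm) lbundle" and \<gamma> \<phi>
    and Y :: "('p, 'a) rspace" and j +
  fixes g0 :: "'f set \<Rightarrow> 'a"
  assumes g0: "g0 \<in> ring_hom (Fv B) (glob Y)"
    and structure_map: "c \<in> carrier (Aloc B) \<Longrightarrow> smap j (pts X) (\<gamma> c) = g0 (Aloc_residue B c)"
begin

abbreviation cf where "cf \<equiv> D.cf"

text \<open>Functions on an open subset \<open>U\<close> of \<open>X\<close> are pulled back to an open subset \<open>W\<close> of the special fibre that maps into
  \<open>U\<close>, and evaluated at a point \<open>y\<close> of it.\<close>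

definition pull where "pull U W s = res Y (preim Y j U) W (smap j U s)"

definition val where "val y U s = smap (residue_point Y y) (preim Y j U) (smap j U s)"

lemma g0_AA: "c \<in> AA B \<Longrightarrow> g0 (vprime B +>\<^bsub>Aring B\<^esub> c) = smap j (pts X) (\<gamma> c)"
  using structure_map[OF AA_Aloc] Aloc_residue_AA by simp

lemma \<gamma>_closed: "c \<in> AA B \<Longrightarrow> \<gamma> c \<in> carrier (glob X)"
  using ring_hom_closed[OF D.\<gamma> AA_Aloc] .

context
  fixes U m assumes g: "(U, m) \<in> gens X E"
begin

lemmas U = D.U[OF g]
lemmas pU = f.preim_open[OF U]

lemma smap_structure:
  "c \<in> AA B \<Longrightarrow> smap j U (res X (pts X) U (\<gamma> c)) = res Y (pts Y) (preim Y j U) (g0 (vprime B +>\<^bsub>Aring B\<^esub> c))"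
  using f.smap_res[OF openin_topspace U openin_subset[OF U] \<gamma>_closed] by (simp add: g0_AA f.preim_pts)

lemma cf_pull: "c \<in> AA B \<Longrightarrow> smap j U (cf U m c i) \<in> carrier (shf Y (preim Y j U))"
  using ring_hom_closed[OF f.smap_hom[OF U] D.cf_closed[OF g]] .

context
  fixes W assumes W: "openin (spc Y) W" "W \<subseteq> preim Y j U"
begin

lemma pull_hom: "pull U W \<in> ring_hom (shf X U) (shf Y W)"
  using ring_hom_trans[OF f.smap_hom[OF U] f.X.res_hom[OF pU W]] by (simp add: pull_def[abs_def] comp_def)

lemma pull_cf_closed: "c \<in> AA B \<Longrightarrow> pull U W (cf U m c i) \<in> carrier (shf Y W)"
  using ring_hom_closed[OF pull_hom D.cf_closed[OF g]] .

lemma pull_coefficients: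
  assumes "finite (carrier (Fv B))" "card (carrier (Fv B)) = qB B ^ deg_v B" "deg_v B > 0"
  shows "special_coefficients B (shf Y W) (\<lambda>a i. pull U W (cf U m a i)) (res Y (pts Y) W \<circ> g0)"
proof (rule D.special_coefficientsI[OF g f.X.shf_cring[OF W(1)] pull_hom _ _ assms])
  show "res Y (pts Y) W \<circ> g0 \<in> ring_hom (Fv B) (shf Y W)"
    by (rule ring_hom_trans[OF g0 f.X.res_hom[OF openin_topspace W(1) openin_subset[OF W(1)]]])
  show "pull U W (res X (pts X) U (\<gamma> c)) = (res Y (pts Y) W \<circ> g0) (vprime B +>\<^bsub>Aring B\<^esub> c)" if c: "c \<in> AA B" for c
  proof -
    have "g0 (vprime B +>\<^bsub>Aring B\<^esub> c) \<in> carrier (glob Y)"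
      using ring_hom_closed[OF g0] ring_hom_closed[OF coset_hom, of c] c by simp
    thus ?thesis using f.X.res_res[OF openin_topspace pU W(1,2) openin_subset[OF pU]]
      by (simp add: pull_def smap_structure[OF c])
  qed
qed

end

context
  fixes y assumes y: "y \<in> pts Y" "pmap j y \<in> U"
begin

lemma y_preim: "y \<in> preim Y j U" using y by (simp add: preim_def)

lemma val_hom: "val y U \<in> ring_hom (shf X U) (residue_field Y y)"
  using ring_hom_trans[OF f.smap_hom[OF U] f.X.value_hom[OF y(1) pU y_preim]] by (simp add: val_def[abs_def] comp_def)

lemma val_\<delta>:
  "smap (residue_point Y y) (pts Y) \<circ> g0 \<in> ring_hom (Fv B) (residue_field Y y)"
  "c \<in> AA B \<Longrightarrow> val y U (res X (pts X) U (\<gamma> c)) = (smap (residue_point Y y) (pts Y) \<circ> g0) (vprime B +>\<^bsub>Aring B\<^esub> c)"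
proof -
  show "smap (residue_point Y y) (pts Y) \<circ> g0 \<in> ring_hom (Fv B) (residue_field Y y)"
    by (rule ring_hom_trans[OF g0 f.X.value_hom[OF y(1) openin_topspace y(1)]])
  assume c: "c \<in> AA B"
  have "g0 (vprime B +>\<^bsub>Aring B\<^esub> c) \<in> carrier (glob Y)"
    using ring_hom_closed[OF g0] ring_hom_closed[OF coset_hom, of c] c by simp
  thus "val y U (res X (pts X) U (\<gamma> c)) = (smap (residue_point Y y) (pts Y) \<circ> g0) (vprime B +>\<^bsub>Aring B\<^esub> c)"
    using f.X.value_res[OF y(1) openin_topspace pU y_preim openin_subset[OF pU]]
    by (simp add: val_def smap_structure[OF c])
qed

lemma residue_cring: "cring (residue_field Y y)"
  using f.X.residue_field_field[OF y(1)] fieldE(1) by blast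

text \<open>The rank is assumed for the fibre over the residue field of the image point in \<open>X\<close>. It passes to the
larger residue field of \<open>y\<close> because the same coefficients vanish.\<close>

lemma fibre_special: "\<exists>\<rho>. special_fibre B (residue_field Y y) (\<lambda>a i. val y U (cf U m a i)) \<rho>"
proof -
  let ?x = "pmap j y"
  have x: "?x \<in> pts X" by (rule f.pmap_pts[OF y(1)])
  obtain \<rho> where \<rho>: "\<And>\<psi>. \<psi> \<in> fibres X E \<phi> (residue_point X ?x) \<Longrightarrow> has_rank B (residue_field X ?x) \<psi> \<rho>"
    by (rule D.fibre_rank[OF x]) blast
  have "(\<lambda>a i. smap (residue_point X ?x) U (cf U m a i)) \<in> fibres X E \<phi> (residue_point X ?x)"
    unfolding fibres_def D.cf_def mem_Collect_eq
    by (intro exI[of _ U] exI[of _ m] conjI HOL.refl g) (simp add: residue_point_def y)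
  hence "has_rank B (residue_field X ?x) (\<lambda>a i. smap (residue_point X ?x) U (cf U m a i)) \<rho>" by (rule \<rho>)
  moreover have "smap (residue_point X ?x) U (cf U m a i) = \<zero>\<^bsub>residue_field X ?x\<^esub> \<longleftrightarrow> val y U (cf U m a i) = \<zero>\<^bsub>residue_field Y y\<^esub>"
    if "a \<in> AA B" for a i
    unfolding val_def using f.value_pullback_zero_iff[OF y(1) U y(2) D.cf_closed[OF g that]] by simp
  ultimately have "has_rank B (residue_field Y y) (\<lambda>a i. val y U (cf U m a i)) \<rho>" by (simp add: has_rank_def)
  thus ?thesis
    using D.special_fibreI[OF g residue_cring val_hom val_\<delta> f.X.residue_field_field[OF y(1)]] by blast
qed

lemma value_coefficients:
  assumes "finite (carrier (Fv B))" "card (carrier (Fv B)) = qB B ^ deg_v B" "deg_v B > 0"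
  shows "special_coefficients B (residue_field Y y) (\<lambda>a i. val y U (cf U m a i)) (smap (residue_point Y y) (pts Y) \<circ> g0)"
  by (rule D.special_coefficientsI[OF g residue_cring val_hom val_\<delta> assms])

lemma val_pull:
  assumes W: "openin (spc Y) W" "W \<subseteq> preim Y j U" "y \<in> W" and c: "c \<in> carrier (shf X U)"
  shows "smap (residue_point Y y) W (pull U W c) = val y U c"
  unfolding pull_def val_def
  by (rule f.X.value_res[OF y(1) pU W(1,3,2) ring_hom_closed[OF f.smap_hom[OF U] c]])

end

end

text \<open>The generators of the line bundle that occur in the ideal sheaf and in the fibre need not be the
same.\<close>

lemma val_change_of_generator:
  assumes g: "(U, m) \<in> gens X E" "(U', m') \<in> gens X E" and y: "y \<in> pts Y" "pmap j y \<in> U" "pmap j y \<in> U'"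
    and a: "a \<in> AA B" and z: "val y U (cf U m a i) = \<zero>\<^bsub>residue_field Y y\<^esub>"
  shows "val y U' (cf U' m' a i) = \<zero>\<^bsub>residue_field Y y\<^esub>"
proof -
  note O = U[OF g(1)] U[OF g(2)]
  define W where "W = U \<inter> U'"
  have W: "openin (spc X) W" "W \<subseteq> U" "W \<subseteq> U'" "y \<in> preim Y j W"
    unfolding W_def using O y by (auto simp: preim_def)
  note pW = f.preim_open[OF W(1)]
  interpret K: field "residue_field Y y" by (rule f.X.residue_field_field[OF y(1)])
  define v where "v s = smap (residue_point Y y) (preim Y j W) (smap j W s)" for s
  have v: "v \<in> ring_hom (shf X W) (residue_field Y y)"
    using ring_hom_trans[OF f.smap_hom[OF W(1)] f.X.value_hom[OF y(1) pW W(4)]] by (simp add: v_def[abs_def] comp_def)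
  have vr: "v (res X V W s) = val y V s" if V: "openin (spc X) V" "W \<subseteq> V" and s: "s \<in> carrier (shf X V)" for V s
    unfolding v_def val_def f.smap_res[OF V(1) W(1) V(2) s]
    by (rule f.X.value_res[OF y(1) f.preim_open[OF V(1)] pW W(4) f.preim_mono[OF V(2)] ring_hom_closed[OF f.smap_hom[OF V(1)] s]])
  obtain u u' where u: "u \<in> carrier (shf X W)" "u' \<in> carrier (shf X W)" "u \<otimes>\<^bsub>shf X W\<^esub> u' = \<one>\<^bsub>shf X W\<^esub>"
    and eq: "res X U' W (cf U' m' a i) \<otimes>\<^bsub>shf X W\<^esub> u = u [^]\<^bsub>shf X W\<^esub> (qB B ^ i) \<otimes>\<^bsub>shf X W\<^esub> res X U W (cf U m a i)"
    unfolding W_def by (rule D.change_of_generator[OF g a])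
  interpret R: cring "shf X W" by (rule D.X.shf_cring[OF W(1)])
  interpret h: ring_hom_cring "shf X W" "residue_field Y y" v using v by unfold_locales
  have c: "res X U W (cf U m a i) \<in> carrier (shf X W)" "res X U' W (cf U' m' a i) \<in> carrier (shf X W)"
    using D.X.res_closed O W D.cf_closed[OF g(1) a] D.cf_closed[OF g(2) a] by auto
  have "v (u [^]\<^bsub>shf X W\<^esub> (qB B ^ i) \<otimes>\<^bsub>shf X W\<^esub> res X U W (cf U m a i)) = \<zero>\<^bsub>residue_field Y y\<^esub>"
    using u(1) c vr[OF O(1) W(2) D.cf_closed[OF g(1) a]] z by simp
  hence "v (res X U' W (cf U' m' a i)) \<otimes>\<^bsub>residue_field Y y\<^esub> v u = \<zero>\<^bsub>residue_field Y y\<^esub>"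
    using h.hom_mult[OF c(2) u(1)] eq by simp
  moreover have "v u \<noteq> \<zero>\<^bsub>residue_field Y y\<^esub>"
    using h.hom_mult[OF u(1,2)] u by (auto simp: u(3))
  ultimately have "v (res X U' W (cf U' m' a i)) = \<zero>\<^bsub>residue_field Y y\<^esub>"
    using K.integral[of "v (res X U' W (cf U' m' a i))" "v u"] c(2) u(1) by auto
  thus ?thesis using vr[OF O(2) W(3) D.cf_closed[OF g(2) a]] by simp
qed

section \<open>The vanishing locus of the Hasse invariants\<close>

abbreviation hideal where "hideal a h \<equiv> vanishing_ideal Y X j E (hasse B \<phi> a) {1..<h}"

lemma hideal_iff:
  "s \<in> hideal a h W \<longleftrightarrow> s \<in> carrier (shf Y W) \<and> openin (spc Y) W \<and>
     (\<forall>w\<in>W. \<exists>W' U m. openin (spc Y) W' \<and> w \<in> W' \<and> W' \<subseteq> W \<and> (U, m) \<in> gens X E \<and> W' \<subseteq> preim Y j U \<and>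
        res Y W W' s \<in> Idl\<^bsub>shf Y W'\<^esub> ((\<lambda>i. pull U W' (cf U m a (i * deg_v B))) ` {1..<h}))"
  by (simp add: vanishing_ideal_def hasse_def pull_def D.cf_def)

lemma fibre_facts:
  assumes g: "(U, m) \<in> gens X E" and y: "y \<in> pts Y" "pmap j y \<in> U"
    and a: "a \<in> AA B" "has_valuation (ffield B) (vpl B) a 1"
  shows "a \<in> vprime B" "finite (carrier (Fv B))" "card (carrier (Fv B)) = qB B ^ deg_v B" "deg_v B > 0"
    "\<exists>e\<in>AA B. \<one>\<^bsub>ffield B\<^esub> \<ominus>\<^bsub>ffield B\<^esub> e \<in> vprime B \<and> (\<forall>u\<in>vprime B. \<exists>z\<in>AA B. e \<otimes>\<^bsub>ffield B\<^esub> u = a \<otimes>\<^bsub>ffield B\<^esub> z)"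
proof -
  obtain \<rho> where "special_fibre B (residue_field Y y) (\<lambda>a i. val y U (cf U m a i)) \<rho>"
    using fibre_special[OF g y] by blast
  then interpret S: special_fibre B "residue_field Y y" "\<lambda>a i. val y U (cf U m a i)" \<rho> .
  show "a \<in> vprime B" by (rule S.uniformizer_facts(1)[OF a])
  show "finite (carrier (Fv B))" "card (carrier (Fv B)) = qB B ^ deg_v B" "deg_v B > 0"
    "\<exists>e\<in>AA B. \<one>\<^bsub>ffield B\<^esub> \<ominus>\<^bsub>ffield B\<^esub> e \<in> vprime B \<and> (\<forall>u\<in>vprime B. \<exists>z\<in>AA B. e \<otimes>\<^bsub>ffield B\<^esub> u = a \<otimes>\<^bsub>ffield B\<^esub> z)"
    by (rule S.residue_field_facts[OF a])+
qed

text \<open>Every nonempty open set has a point, whose fibre supplies the facts about \<open>A/\<pp>\<close> and the idempotent; the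
ideals are then compared with the generators used for \<open>a'\<close>.\<close>

lemma hideal_subset:
  assumes a: "a \<in> AA B" "has_valuation (ffield B) (vpl B) a 1"
    and a': "a' \<in> AA B" "has_valuation (ffield B) (vpl B) a' 1"
  shows "hideal a' h W \<subseteq> hideal a h W"
proof
  fix s assume s: "s \<in> hideal a' h W"
  have "\<exists>W' U m. openin (spc Y) W' \<and> w \<in> W' \<and> W' \<subseteq> W \<and> (U, m) \<in> gens X E \<and> W' \<subseteq> preim Y j U \<and>
        res Y W W' s \<in> Idl\<^bsub>shf Y W'\<^esub> ((\<lambda>i. pull U W' (cf U m a (i * deg_v B))) ` {1..<h})" if w: "w \<in> W" for w
  proof -
    obtain W' U m where W': "openin (spc Y) W'" "w \<in> W'" "W' \<subseteq> W" and g: "(U, m) \<in> gens X E" and sub: "W' \<subseteq> preim Y j U"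
      and i: "res Y W W' s \<in> Idl\<^bsub>shf Y W'\<^esub> ((\<lambda>i. pull U W' (cf U m a' (i * deg_v B))) ` {1..<h})"
      using s w unfolding hideal_iff by blast
    have y: "w \<in> pts Y" "pmap j w \<in> U" using W'(2) sub by (auto simp: preim_def)
    note F = fibre_facts[OF g y a]
    interpret C: special_coefficients B "shf Y W'" "\<lambda>a i. pull U W' (cf U m a i)" "res Y (pts Y) W' \<circ> g0"
      by (rule pull_coefficients[OF g W'(1) sub F(2,3,4)])
    obtain e where e: "e \<in> AA B" "\<one>\<^bsub>ffield B\<^esub> \<ominus>\<^bsub>ffield B\<^esub> e \<in> vprime B"
      "\<And>u. u \<in> vprime B \<Longrightarrow> \<exists>z\<in>AA B. e \<otimes>\<^bsub>ffield B\<^esub> u = a \<otimes>\<^bsub>ffield B\<^esub> z" using F(5) by blast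
    have "Idl\<^bsub>shf Y W'\<^esub> ((\<lambda>i. pull U W' (cf U m a' (i * deg_v B))) ` {1..<h})
      \<subseteq> Idl\<^bsub>shf Y W'\<^esub> ((\<lambda>i. pull U W' (cf U m a (i * deg_v B))) ` {1..<h})"
      by (rule C.hasse_ideal_le[where E = e]) (fact F(1) fibre_facts(1)[OF g y a'] e)+
    thus ?thesis using W' g sub i by blast
  qed
  thus "s \<in> hideal a h W" using s unfolding hideal_iff by blast
qed

theorem hasse_locus_independent:
  assumes "a \<in> AA B" "has_valuation (ffield B) (vpl B) a 1" "a' \<in> AA B" "has_valuation (ffield B) (vpl B) a' 1"
  shows "hasse_locus B Y X j E \<phi> a h = hasse_locus B Y X j E \<phi> a' h"
proof -
  have "hideal a h = hideal a' h" using hideal_subset assms by (intro ext subset_antisym) blast+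
  thus ?thesis unfolding hasse_locus_def by simp
qed

text \<open>If all sections vanish at \<open>y\<close> then so does everything in the ideal, and \<open>1\<close> is not in the stalk. If one
of them does not vanish at \<open>y\<close>, then it is invertible near \<open>y\<close> and every function lies in the ideal near \<open>y\<close>.\<close>

lemma ideal_stalk_proper_iff:
  assumes g: "(U, m) \<in> gens X E" and y: "y \<in> pts Y" "pmap j y \<in> U" and a: "a \<in> AA B"
  shows "ideal_stalk Y (hideal a h) y \<noteq> carrier (stalk Y y) \<longleftrightarrow>
    (\<forall>i\<in>{1..<h}. val y U (cf U m a (i * deg_v B)) = \<zero>\<^bsub>residue_field Y y\<^esub>)"
proof
  let ?J = "hideal a h"
  let ?k = "residue_field Y y"
  interpret K: field ?k by (rule f.X.residue_field_field[OF y(1)])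
  interpret S: cring "stalk Y y" by (rule f.X.stalk_cring[OF y(1)])
  assume z: "\<forall>i\<in>{1..<h}. val y U (cf U m a (i * deg_v B)) = \<zero>\<^bsub>?k\<^esub>"
  show "ideal_stalk Y ?J y \<noteq> carrier (stalk Y y)"
  proof
    assume "ideal_stalk Y ?J y = carrier (stalk Y y)"
    hence "\<one>\<^bsub>stalk Y y\<^esub> \<in> ideal_stalk Y ?J y" by simp
    then obtain V s where V: "openin (spc Y) V" "y \<in> V" "s \<in> ?J V" "\<one>\<^bsub>stalk Y y\<^esub> = germ Y y V s"
      unfolding ideal_stalk_def by auto
    have s: "s \<in> carrier (shf Y V)" using V(3) unfolding hideal_iff by blast
    obtain W U' m' where W: "openin (spc Y) W" "y \<in> W" "W \<subseteq> V" and g': "(U', m') \<in> gens X E" and sub: "W \<subseteq> preim Y j U'"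
      and i: "res Y V W s \<in> Idl\<^bsub>shf Y W\<^esub> ((\<lambda>i. pull U' W (cf U' m' a (i * deg_v B))) ` {1..<h})"
      using V(2,3) unfolding hideal_iff by blast
    have y': "pmap j y \<in> U'" using W(2) sub by (auto simp: preim_def)
    interpret R: cring "shf Y W" by (rule f.X.shf_cring[OF W(1)])
    let ?v = "smap (residue_point Y y) W"
    interpret h: ring_hom_cring "shf Y W" ?k ?v using f.X.value_hom[OF y(1) W(1,2)] by unfold_locales
    have "(\<lambda>i. pull U' W (cf U' m' a (i * deg_v B))) ` {1..<h} \<subseteq> a_kernel (shf Y W) ?k ?v"
    proof (intro image_subsetI)
      fix i assume i: "i \<in> {1..<h}"
      have "?v (pull U' W (cf U' m' a (i * deg_v B))) = \<zero>\<^bsub>?k\<^esub>"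
        unfolding val_pull[OF g' y(1) y' W(1) sub W(2) D.cf_closed[OF g' a]]
        by (rule val_change_of_generator[OF g g' y y' a]) (rule z[rule_format, OF i])
      thus "pull U' W (cf U' m' a (i * deg_v B)) \<in> a_kernel (shf Y W) ?k ?v"
        unfolding a_kernel_def' mem_Collect_eq by (intro conjI pull_cf_closed[OF g' W(1) sub a])
    qed
    hence "Idl\<^bsub>shf Y W\<^esub> ((\<lambda>i. pull U' W (cf U' m' a (i * deg_v B))) ` {1..<h}) \<subseteq> a_kernel (shf Y W) ?k ?v"
      by (rule R.genideal_minimal[OF h.ring.kernel_is_ideal])
    with i have "res Y V W s \<in> a_kernel (shf Y W) ?k ?v" by (rule rev_subsetD)
    hence "?v (res Y V W s) = \<zero>\<^bsub>?k\<^esub>" unfolding a_kernel_def' mem_Collect_eq by (rule conjunct2)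
    hence "smap (residue_point Y y) V s = \<zero>\<^bsub>?k\<^esub>" using f.X.value_res[OF y(1) V(1) W(1,2,3) s] by simp
    hence "\<one>\<^bsub>stalk Y y\<^esub> \<notin> Units (stalk Y y)" using f.X.value_zero_iff[OF y(1) V(1,2) s] V(4) by simp
    thus False by simp
  qed
next
  let ?J = "hideal a h"
  let ?k = "residue_field Y y"
  assume pr: "ideal_stalk Y ?J y \<noteq> carrier (stalk Y y)"
  show "\<forall>i\<in>{1..<h}. val y U (cf U m a (i * deg_v B)) = \<zero>\<^bsub>?k\<^esub>"
  proof (rule ccontr)
    assume "\<not> ?thesis"
    then obtain i where i: "i \<in> {1..<h}" and nz: "val y U (cf U m a (i * deg_v B)) \<noteq> \<zero>\<^bsub>?k\<^esub>" by blast
    let ?c = "smap j U (cf U m a (i * deg_v B))"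
    note O = pU[OF g]
    have yU: "y \<in> preim Y j U" using y by (simp add: preim_def)
    have c: "?c \<in> carrier (shf Y (preim Y j U))" by (rule cf_pull[OF g a])
    have "germ Y y (preim Y j U) ?c \<in> Units (stalk Y y)"
      using nz f.X.value_zero_iff[OF y(1) O yU c] unfolding val_def by blast
    then obtain W z where W: "openin (spc Y) W" "y \<in> W" "W \<subseteq> preim Y j U" and z: "z \<in> carrier (shf Y W)"
      "res Y (preim Y j U) W ?c \<otimes>\<^bsub>shf Y W\<^esub> z = \<one>\<^bsub>shf Y W\<^esub>" by (rule f.X.invertible_near[OF y(1) O yU c])
    have "carrier (stalk Y y) \<subseteq> ideal_stalk Y ?J y"
    proof
      fix e assume "e \<in> carrier (stalk Y y)"
      then obtain V t where V: "openin (spc Y) V" "y \<in> V" and t: "t \<in> carrier (shf Y V)" and e: "e = germ Y y V t"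
        by (auto simp: stalk_def)
      define T where "T = W \<inter> V"
      have T: "openin (spc Y) T" "y \<in> T" "T \<subseteq> W" "T \<subseteq> V" "T \<subseteq> preim Y j U"
        unfolding T_def using openin_Int[OF W(1) V(1)] W V by auto
      interpret R: cring "shf Y T" by (rule f.X.shf_cring[OF T(1)])
      define tT where "tT = res Y V T t"
      have tT: "tT \<in> carrier (shf Y T)" unfolding tT_def by (rule f.X.res_closed[OF V(1) T(1,4) t])
      let ?p = "pull U T (cf U m a (i * deg_v B))"
      let ?G = "(\<lambda>i. pull U T (cf U m a (i * deg_v B))) ` {1..<h}"
      have G: "?G \<subseteq> carrier (shf Y T)" using pull_cf_closed[OF g T(1,5) a] by auto
      interpret I: ideal "Idl\<^bsub>shf Y T\<^esub> ?G" "shf Y T" by (rule R.genideal_ideal[OF G])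
      define zT where "zT = res Y W T z"
      have zT: "zT \<in> carrier (shf Y T)" unfolding zT_def by (rule f.X.res_closed[OF W(1) T(1,3) z(1)])
      have rh: "res Y W T \<in> ring_hom (shf Y W) (shf Y T)" by (rule f.X.res_hom[OF W(1) T(1,3)])
      have "?p \<otimes>\<^bsub>shf Y T\<^esub> zT = res Y W T (res Y (preim Y j U) W ?c \<otimes>\<^bsub>shf Y W\<^esub> z)"
        unfolding ring_hom_mult[OF rh f.X.res_closed[OF O W(1,3) c] z(1)] zT_def pull_def
        using f.X.res_res[OF O W(1) T(1,3) W(3) c] by simp
      hence one: "?p \<otimes>\<^bsub>shf Y T\<^esub> zT = \<one>\<^bsub>shf Y T\<^esub>" using ring_hom_one[OF rh] z(2) by simp
      have "?p \<in> Idl\<^bsub>shf Y T\<^esub> ?G" using R.genideal_self[OF G] i by blast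
      hence "\<one>\<^bsub>shf Y T\<^esub> \<in> Idl\<^bsub>shf Y T\<^esub> ?G" using I.I_r_closed[OF _ zT] one by metis
      hence "tT \<in> Idl\<^bsub>shf Y T\<^esub> ?G" using I.one_imp_carrier tT by simp
      hence "tT \<in> ?J T" unfolding hideal_iff
        using tT T g f.X.res_self[OF T(1) tT] by (intro conjI ballI exI[of _ T] exI[of _ U] exI[of _ m]) auto
      moreover have "e = germ Y y T tT" unfolding e tT_def by (rule f.X.germ_res[OF V(1) T(1,2,4) t, symmetric])
      ultimately show "e \<in> ideal_stalk Y ?J y" unfolding ideal_stalk_def using T(1,2) by blast
    qed
    moreover have "ideal_stalk Y ?J y \<subseteq> carrier (stalk Y y)"
    proof
      fix e assume "e \<in> ideal_stalk Y ?J y"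
      then obtain V s where "e = germ Y y V s" "openin (spc Y) V" "y \<in> V" "s \<in> ?J V" unfolding ideal_stalk_def by blast
      thus "e \<in> carrier (stalk Y y)" using ring_hom_closed[OF f.X.germ_hom] unfolding hideal_iff by blast
    qed
    ultimately show False using pr by blast
  qed
qed

theorem height_ge_iff_hasse_locus:
  assumes a: "a \<in> AA B" "has_valuation (ffield B) (vpl B) a 1" and y: "y \<in> pts Y"
    and \<psi>: "\<psi> \<in> fibres X E \<phi> (comp_mor (field_spec (residue_field Y y)) Y X j (residue_point Y y))"
  shows "int h \<le> height B (residue_field Y y) \<psi> \<longleftrightarrow> y \<in> pts (hasse_locus B Y X j E \<phi> a h)"
proof -
  let ?p = "comp_mor (field_spec (residue_field Y y)) Y X j (residue_point Y y)"
  let ?k = "residue_field Y y"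
  obtain U m where g: "(U, m) \<in> gens X E" and pU': "pmap ?p () \<in> U"
    and \<psi>_eq: "\<psi> = (\<lambda>a i. smap ?p U (coef X E U m (\<phi> a i U m)))"
    using \<psi> unfolding fibres_def by blast
  have yU: "pmap j y \<in> U" using pU' by (simp add: comp_mor_def field_spec_def residue_point_def)
  note F = fibre_facts[OF g y yU a]
  have \<psi>_val: "\<psi> a i = val y U (cf U m a i)" if "a \<in> AA B" for a i
    unfolding \<psi>_eq D.cf_def[symmetric] using U[OF g] D.cf_closed[OF g that, of i] by (simp add: comp_mor_def val_def)
  obtain \<rho> where "special_fibre B ?k (\<lambda>a i. val y U (cf U m a i)) \<rho>" using fibre_special[OF g y yU] by blast
  hence "special_fibre B ?k \<psi> \<rho>" by (rule special_fibre_cong) (use \<psi>_val in auto)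
  hence "int h \<le> height B ?k \<psi> \<longleftrightarrow> (\<forall>i<h * deg_v B. \<psi> a i = \<zero>\<^bsub>?k\<^esub>)"
    by (rule special_fibre.height_ge_iff[OF _ a])
  also have "\<dots> \<longleftrightarrow> (\<forall>i<h * deg_v B. val y U (cf U m a i) = \<zero>\<^bsub>?k\<^esub>)" using \<psi>_val[OF a(1)] by simp
  also have "\<dots> \<longleftrightarrow> (\<forall>i\<in>{1..<h}. val y U (cf U m a (i * deg_v B)) = \<zero>\<^bsub>?k\<^esub>)"
  proof
    assume z: "\<forall>i\<in>{1..<h}. val y U (cf U m a (i * deg_v B)) = \<zero>\<^bsub>?k\<^esub>"
    interpret C: special_coefficients B ?k "\<lambda>a i. val y U (cf U m a i)" "smap (residue_point Y y) (pts Y) \<circ> g0"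
      by (rule value_coefficients[OF g y yU F(2,3,4)])
    have "val y U (cf U m a k) \<in> {\<zero>\<^bsub>?k\<^esub>}" if "k < h * deg_v B" for k
      by (rule C.low_coefficients_in_ideal[OF C.R.zeroideal F(1) _ that]) (use z in auto)
    thus "\<forall>i<h * deg_v B. val y U (cf U m a i) = \<zero>\<^bsub>?k\<^esub>" by simp
  qed (use F(4) in simp)
  also have "\<dots> \<longleftrightarrow> ideal_stalk Y (hideal a h) y \<noteq> carrier (stalk Y y)"
    using ideal_stalk_proper_iff[OF g y yU a(1)] by simp
  also have "\<dots> \<longleftrightarrow> y \<in> pts (hasse_locus B Y X j E \<phi> a h)"
    using y by (simp add: hasse_locus_def closed_subscheme_def Let_def)
  finally show ?thesis .
qed

end

theorem lemma6p4:
  fixes B :: "'f base" and r :: nat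
    and K Kv :: "('f set \<Rightarrow> 'f set) mat set"
    and M Mbar M0 :: "('p, 'a) rspace"
    and g gbar :: "'f \<Rightarrow> 'a" and g0 :: "'f set \<Rightarrow> 'a"
    and EK Ebar :: "('p, 'a, 'm) lbundle"
    and \<phi>K \<phi>bar :: "'f \<Rightarrow> nat \<Rightarrow> 'p set \<Rightarrow> 'm \<Rightarrow> 'm"
    and \<iota> j :: "('p, 'a, 'p, 'a) rmor"
  assumes "is_base B" and "r \<ge> 1"
    and "fine B r K" and "hyperspecial_decomp B r K Kv"
    and "moduli_scheme B r Kv M g EK \<phi>K"
    and "satake_compactification B r M g EK \<phi>K Mbar gbar \<iota> Ebar \<phi>bar"
    and "base_change (Aloc B) (Fv B) (Aloc_residue B) Mbar gbar M0 g0 j"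
  shows "(\<forall>h a a'. 1 \<le> h \<and> h \<le> r \<and>
        a \<in> AA B \<and> has_valuation (ffield B) (vpl B) a 1 \<and>
        a' \<in> AA B \<and> has_valuation (ffield B) (vpl B) a' 1 \<longrightarrow>
        hasse_locus B M0 Mbar j Ebar \<phi>bar a h = hasse_locus B M0 Mbar j Ebar \<phi>bar a' h) \<and>
     (\<forall>h a x. 1 \<le> h \<and> h \<le> r \<and>
        a \<in> AA B \<and> has_valuation (ffield B) (vpl B) a 1 \<and> x \<in> pts M0 \<longrightarrow>
        (\<forall>\<psi>\<in>fibres Mbar Ebar \<phi>bar
            (comp_mor (field_spec (residue_field M0 x)) M0 Mbar j (residue_point M0 x)).
          int h \<le> height B (residue_field M0 x) \<psi> \<longleftrightarrow>
          x \<in> pts (hasse_locus B M0 Mbar j Ebar \<phi>bar a h)))"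
proof -
  have "scheme_over (Aloc B) Mbar gbar \<and> gen_drinfeld B Mbar gbar Ebar \<phi>bar"
    using assms(6) unfolding satake_compactification_def by (elim conjE, intro conjI)
  note sat = this[THEN conjunct1] this[THEN conjunct2]
  have "scheme_over (Fv B) M0 g0 \<and> j \<in> mor_over (Aloc B) M0 (g0 \<circ> Aloc_residue B) Mbar gbar"
    using assms(7) unfolding base_change_def by (elim conjE, intro conjI)
  note bc = this[THEN conjunct1] this[THEN conjunct2]
  have line: "line_bundle Mbar Ebar" using sat(2) unfolding gen_drinfeld_def by (elim conjE)
  interpret X: locally_ringed Mbar using sat(1) by (intro locally_ringedI) (simp add: scheme_over_def)
  interpret Y: locally_ringed M0 using bc(1) by (intro locally_ringedI) (simp add: scheme_over_def)
  interpret S: special_fibre_family B Mbar Ebar gbar \<phi>bar M0 j g0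
    by unfold_locales (use assms(1) sat bc line in \<open>simp_all add: scheme_over_def mor_over_def\<close>)
  show ?thesis using S.hasse_locus_independent S.height_ge_iff_hasse_locus by blast
qed

end
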